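(* Let $p\in\{3,4,6\}$ and $N=\lfloor p/2\rfloor\in\{1,2,3\}$. With the notation of the context, the identification $s(\tau)\leftrightarrow\omega_0^{-k}s(\omega_1/\omega_0)$ (for modular forms $s$ of weight $k$) induces an isomorphism of graded rings $$\mathbb C[\text{Eisenstein series of type } p]\ \simeq\ M_*(\Gamma_1(N))$$ between the $\mathbb C$-algebra generated by all Eisenstein series of type $p$ and the ring of holomorphic modular forms of $\Gamma_1(N)$. The correspondence of generators is as follows (with $\tau=\omega_1/\omega_0$). Type $\mathrm A_2$ ($p=3$): $\ g_s=\frac1{2^2\cdot3}\pi^4e_4(\tau)\,\omega_0^{-4}$, $\ g_l=\frac1{2^3\cdot3^3}\pi^6e_6(\tau)\,\omega_0^{-6}$. Type $\mathrm B_2$ ($p=4$): $\ g_s=\pi^2\alpha_2(\tau)\,\omega_0^{-2}$, $\ g_l=2^4\pi^4\beta_4(\tau)\,\omega_0^{-4}-\frac1{2^3}\pi^4\big(\alpha_2(\tau)\,\omega_0^{-2}\big)^2$. Type $\mathrm G_2$ ($p=6$): $\ g_s=\frac1{\sqrt3}\pi\,\alpha_1(\tau)\,\omega_0^{-1}$, $\ g_l=-\frac2{3\sqrt3}\pi^3\beta_3(\tau)\,\omega_0^{-3}$.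
   Context: $\Gamma_1(N)=\{\begin{pmatrix}a&b\\c&d\end{pmatrix}\in \mathrm{SL}_2(\mathbb Z): a\equiv d\equiv1,\ c\equiv0 \bmod N\}$. $\widetilde{\mathbb H}=\{(\omega_0,\omega_1)\in\mathbb C^2:\mathrm{Im}(\omega_1/\omega_0)>0\}$. $M_*(\Gamma_1(N))=\bigoplus_kM_k(\Gamma_1(N))$ is the graded ring of holomorphic modular forms (holomorphic on the upper half plane and at all cusps). Eisenstein series. For $(\omega_0,\omega_1)\in\widetilde{\mathbb H}$ let $\Omega=\mathbb Z\omega_0+\mathbb Z\omega_1$, $\mathfrak p(z)=z^{-2}+\sum_{0\ne\omega\in\Omega}((z-\omega)^{-2}-\omega^{-2})$, $\zeta(z)=z^{-1}+\sum_{0\neq\omega\in\Omega}((z-\omega)^{-1}+\omega^{-1}+z\omega^{-2})$. For $m\ge3$ put $G_m(0)=\sum_{0\ne\omega\in\Omega}\omega^{-m}$ and $G_m(a)=\sum_{\omega\in\Omega}(\omega+a)^{-m}$ for $a\in(\mathbb R\omega_0+\mathbb R\omega_1)\setminus\Omega$. Define meromorphic functions of $z$: - $p=3$: $X=\frac14\mathfrak p(z)$, $Y=\frac18\mathfrak p'(z)$; - $p=4$: $X=-\frac12\zeta(\frac12\omega_0)+\frac12\zeta(z)-\frac12\zeta(z-\frac12\omega_0)$, $Y=-\frac14\mathfrak p(z)+\frac14\mathfrak p(z-\frac12\omega_0)$; - $p=6$: $X=-\frac16\zeta(\frac13\omega_0)-\frac16\zeta(\frac23\omega_0)+\frac12\zeta(z)-\frac12\zeta(z-\frac13\omega_0)$,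 $Y=\frac12\zeta(\frac13\omega_0)+\frac12\zeta(\frac23\omega_0)-\frac12\zeta(z)-\frac12\zeta(z-\frac13\omega_0)+\zeta(z-\frac23\omega_0)$. The Eisenstein series of type $p$ are the coefficients of the Laurent expansions of $X$ and $Y$ at $z=0$, as holomorphic functions on $\widetilde{\mathbb H}$. Their algebra is generated by the two functions $g_s,g_l$ on $\widetilde{\mathbb H}$ given by: - $p=3$: $g_s=\frac{15}4G_4(0)$, $g_l=\frac{35}{16}G_6(0)$; - $p=4$: $g_s=\frac32\mathfrak p(\frac12\omega_0)$, $g_l=\frac5{32}\mathfrak p(\frac12\omega_0)^2+\frac58G_4(0)-\frac58G_4(\frac12\omega_0)$; - $p=6$: $g_s=\zeta(\frac13\omega_0)-\frac23\zeta(\frac12\omega_0)$, $g_l=2g_s^3-G_3(\frac13\omega_0)$. Generators of the rings of modular forms (Aoki–Ibukiyama): $M_*(\Gamma_1(1))=\mathbb C[e_4,e_6]$, $M_*(\Gamma_1(2))=\mathbb C[\alpha_2,\beta_4]$, $M_*(\Gamma_1(3))=\mathbb C[\alpha_1,\beta_3]$, subscripts being the weights. They are determined by their values at cusps, where the value of $s\in M_k$ at $\sqrt{-1}\infty$ is $\lim_{\mathrm{Im}\,\tau\to\infty}s(\tau)$ and its value at the cusp $0$ is $\lim_{\mathrm{Im}\,\tau\to\infty}\tau^{-k}s(-1/\tau)$: $e_4,e_6$ have value $1$ at $\sqrt{-1}\infty$; $\alpha_2$ has values $1$ at $\sqrt{-1}\infty$ and $-\frac12$ at $0$; $\beta_4$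 has values $0$ at $\sqrt{-1}\infty$ and $\frac1{256}$ at $0$; $\alpha_1$ has values $1$ at $\sqrt{-1}\infty$ and $-\sqrt{-1}/\sqrt3$ at $0$; $\beta_3$ has values $1$ at $\sqrt{-1}\infty$ and $-\sqrt{-1}/(3\sqrt3)$ at $0$. *)

theory Defs
  imports
    "HOL-Complex_Analysis.Complex_Analysis"
    "HOL-Number_Theory.Cong"
    "HOL-Algebra.QuotRing"
begin

text \<open>
  Functions on the upper half plane, and functions on the space of oriented bases of lattices,
  are represented by total functions that vanish outside of that domain.
\<close>

definition upper_half_plane :: "complex set" where
  "upper_half_plane = {\<tau>. Im \<tau> > 0}"

definition oriented_bases :: "(complex \<times> complex) set" where
  "oriented_bases = {(\<omega>0, \<omega>1). Im (\<omega>1 / \<omega>0) > 0}"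


subsection \<open>Modular forms\<close>

definition SL2Z :: "(int ^ 2 ^ 2) set" where
  "SL2Z = {A. det A = 1}"

definition Gamma1 :: "nat \<Rightarrow> (int ^ 2 ^ 2) set" where
  "Gamma1 N = {A \<in> SL2Z. [A $ 1 $ 1 = 1] (mod int N) \<and> [A $ 2 $ 2 = 1] (mod int N) \<and>
                          [A $ 2 $ 1 = 0] (mod int N)}"

definition slash :: "int \<Rightarrow> (complex \<Rightarrow> complex) \<Rightarrow> int ^ 2 ^ 2 \<Rightarrow> complex \<Rightarrow> complex" where
  "slash k f A \<tau> =
     (of_int (A $ 2 $ 1) * \<tau> + of_int (A $ 2 $ 2)) powi (-k) *
     f ((of_int (A $ 1 $ 1) * \<tau> + of_int (A $ 1 $ 2)) /
        (of_int (A $ 2 $ 1) * \<tau> + of_int (A $ 2 $ 2)))"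

text \<open>
  A function of period \<open>N\<close> on the upper half plane is a function of \<open>q = exp (2 \<pi> \<i> \<tau> / N)\<close> on
  the punctured unit disc; it is holomorphic at infinity if the latter function extends
  holomorphically to \<open>q = 0\<close>.
\<close>
definition holomorphic_at_infinity :: "nat \<Rightarrow> (complex \<Rightarrow> complex) \<Rightarrow> bool" where
  "holomorphic_at_infinity N f \<longleftrightarrow>
     (\<exists>h. h holomorphic_on ball 0 1 \<and>
          (\<forall>\<tau>\<in>upper_half_plane. f \<tau> = h (exp (2 * of_real pi * \<i> * \<tau> / of_nat N))))"

text \<open>
  Every cusp is \<open>A \<infinity>\<close> for some \<open>A\<close> in the full modular group. As the principal congruence
  subgroup of level \<open>N\<close> is normal and contained in \<open>Gamma1 N\<close>, the function \<open>slash k f A\<close> has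
  period \<open>N\<close> even if the width of that cusp is a proper divisor of \<open>N\<close>.
\<close>
definition modular_forms :: "nat \<Rightarrow> int \<Rightarrow> (complex \<Rightarrow> complex) set" where
  "modular_forms N k =
     {f. f holomorphic_on upper_half_plane \<and>
         (\<forall>A\<in>Gamma1 N. \<forall>\<tau>\<in>upper_half_plane. slash k f A \<tau> = f \<tau>) \<and>
         (\<forall>A\<in>SL2Z. holomorphic_at_infinity N (slash k f A)) \<and>
         (\<forall>\<tau>. \<tau> \<notin> upper_half_plane \<longrightarrow> f \<tau> = 0)}"

text \<open>
  The external direct sum of the spaces of modular forms of all integral weights: finitely
  supported families \<open>s\<close>, with \<open>s k\<close> of weight \<open>k\<close>, and convolution as multiplication.
\<close>
definition modular_forms_ring :: "nat \<Rightarrow> (int \<Rightarrow> complex \<Rightarrow> complex) ring" where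
  "modular_forms_ring N =
     \<lparr>carrier = {s. (\<forall>k. s k \<in> modular_forms N k) \<and> finite {k. s k \<noteq> (\<lambda>_. 0)}},
      monoid.mult = (\<lambda>s t k \<tau>. \<Sum>i | s i \<noteq> (\<lambda>_. 0). s i \<tau> * t (k - i) \<tau>),
      one = (\<lambda>k \<tau>. if k = 0 \<and> \<tau> \<in> upper_half_plane then 1 else 0),
      zero = (\<lambda>_ _. 0),
      add = (\<lambda>s t k \<tau>. s k \<tau> + t k \<tau>)\<rparr>"

definition modular_forms_part :: "nat \<Rightarrow> int \<Rightarrow> (int \<Rightarrow> complex \<Rightarrow> complex) set" where
  "modular_forms_part N k = {s \<in> carrier (modular_forms_ring N). \<forall>i. i \<noteq> k \<longrightarrow> s i = (\<lambda>_. 0)}"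

definition value_at_infinity :: "(complex \<Rightarrow> complex) \<Rightarrow> complex \<Rightarrow> bool" where
  "value_at_infinity f c \<longleftrightarrow> (f \<longlongrightarrow> c) (filtercomap Im at_top)"

definition value_at_zero :: "int \<Rightarrow> (complex \<Rightarrow> complex) \<Rightarrow> complex \<Rightarrow> bool" where
  "value_at_zero k f c \<longleftrightarrow> ((\<lambda>\<tau>. \<tau> powi (-k) * f (- 1 / \<tau>)) \<longlongrightarrow> c) (filtercomap Im at_top)"

definition e4 :: "complex \<Rightarrow> complex" where
  "e4 = (THE f. f \<in> modular_forms 1 4 \<and> value_at_infinity f 1)"

definition e6 :: "complex \<Rightarrow> complex" where
  "e6 = (THE f. f \<in> modular_forms 1 6 \<and> value_at_infinity f 1)"

definition alpha2 :: "complex \<Rightarrow> complex" where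
  "alpha2 = (THE f. f \<in> modular_forms 2 2 \<and> value_at_infinity f 1 \<and> value_at_zero 2 f (- 1 / 2))"

definition beta4 :: "complex \<Rightarrow> complex" where
  "beta4 = (THE f. f \<in> modular_forms 2 4 \<and> value_at_infinity f 0 \<and> value_at_zero 4 f (1 / 256))"

definition alpha1 :: "complex \<Rightarrow> complex" where
  "alpha1 = (THE f. f \<in> modular_forms 3 1 \<and> value_at_infinity f 1 \<and>
               value_at_zero 1 f (- \<i> / of_real (sqrt 3)))"

definition beta3 :: "complex \<Rightarrow> complex" where
  "beta3 = (THE f. f \<in> modular_forms 3 3 \<and> value_at_infinity f 1 \<and>
              value_at_zero 3 f (- \<i> / (3 * of_real (sqrt 3))))"


subsection \<open>Eisenstein series of type \<open>p\<close>\<close>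

definition period_lattice :: "complex \<times> complex \<Rightarrow> complex set" where
  "period_lattice w = {of_int m * fst w + of_int n * snd w | m n. True}"

definition weierstrass_p :: "complex \<times> complex \<Rightarrow> complex \<Rightarrow> complex" where
  "weierstrass_p w z =
     1 / z ^ 2 + (\<Sum>\<^sub>\<infinity>\<omega>\<in>period_lattice w - {0}. 1 / (z - \<omega>) ^ 2 - 1 / \<omega> ^ 2)"

definition weierstrass_zeta :: "complex \<times> complex \<Rightarrow> complex \<Rightarrow> complex" where
  "weierstrass_zeta w z =
     1 / z + (\<Sum>\<^sub>\<infinity>\<omega>\<in>period_lattice w - {0}. 1 / (z - \<omega>) + 1 / \<omega> + z / \<omega> ^ 2)"

definition lattice_sum :: "nat \<Rightarrow> complex \<times> complex \<Rightarrow> complex \<Rightarrow> complex" where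
  "lattice_sum m w a =
     (if a = 0 then (\<Sum>\<^sub>\<infinity>\<omega>\<in>period_lattice w - {0}. 1 / \<omega> ^ m)
      else (\<Sum>\<^sub>\<infinity>\<omega>\<in>period_lattice w. 1 / (\<omega> + a) ^ m))"

definition eis_X :: "nat \<Rightarrow> complex \<times> complex \<Rightarrow> complex \<Rightarrow> complex" where
  "eis_X p w z =
     (let \<omega>0 = fst w; \<zeta> = weierstrass_zeta w in
      if p = 3 then 1 / 4 * weierstrass_p w z
      else if p = 4 then - 1 / 2 * \<zeta> (\<omega>0 / 2) + 1 / 2 * \<zeta> z - 1 / 2 * \<zeta> (z - \<omega>0 / 2)
      else if p = 6 then - 1 / 6 * \<zeta> (\<omega>0 / 3) - 1 / 6 * \<zeta> (2 * \<omega>0 / 3)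
                         + 1 / 2 * \<zeta> z - 1 / 2 * \<zeta> (z - \<omega>0 / 3)
      else 0)"

definition eis_Y :: "nat \<Rightarrow> complex \<times> complex \<Rightarrow> complex \<Rightarrow> complex" where
  "eis_Y p w z =
     (let \<omega>0 = fst w; \<zeta> = weierstrass_zeta w in
      if p = 3 then 1 / 8 * deriv (weierstrass_p w) z
      else if p = 4 then - 1 / 4 * weierstrass_p w z + 1 / 4 * weierstrass_p w (z - \<omega>0 / 2)
      else if p = 6 then 1 / 2 * \<zeta> (\<omega>0 / 3) + 1 / 2 * \<zeta> (2 * \<omega>0 / 3)
                         - 1 / 2 * \<zeta> z - 1 / 2 * \<zeta> (z - \<omega>0 / 3) + \<zeta> (z - 2 * \<omega>0 / 3)
      else 0)"

definition on_oriented_bases ::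
    "(complex \<times> complex \<Rightarrow> complex) \<Rightarrow> complex \<times> complex \<Rightarrow> complex" where
  "on_oriented_bases F w = (if w \<in> oriented_bases then F w else 0)"

definition eisenstein_series :: "nat \<Rightarrow> (complex \<times> complex \<Rightarrow> complex) set" where
  "eisenstein_series p =
     (\<Union>n. {on_oriented_bases (\<lambda>w. fls_nth (laurent_expansion (eis_X p w) 0) n),
           on_oriented_bases (\<lambda>w. fls_nth (laurent_expansion (eis_Y p w) 0) n)})"

inductive_set generated_algebra ::
    "(complex \<times> complex \<Rightarrow> complex) set \<Rightarrow> (complex \<times> complex \<Rightarrow> complex) set"
  for S :: "(complex \<times> complex \<Rightarrow> complex) set" where
  gen: "F \<in> S \<Longrightarrow> F \<in> generated_algebra S"
| const: "on_oriented_bases (\<lambda>_. c) \<in> generated_algebra S"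
| add: "F \<in> generated_algebra S \<Longrightarrow> G \<in> generated_algebra S \<Longrightarrow>
          (\<lambda>w. F w + G w) \<in> generated_algebra S"
| mult: "F \<in> generated_algebra S \<Longrightarrow> G \<in> generated_algebra S \<Longrightarrow>
          (\<lambda>w. F w * G w) \<in> generated_algebra S"

definition eisenstein_ring :: "nat \<Rightarrow> (complex \<times> complex \<Rightarrow> complex) ring" where
  "eisenstein_ring p =
     \<lparr>carrier = generated_algebra (eisenstein_series p),
      monoid.mult = (\<lambda>F G w. F w * G w),
      one = on_oriented_bases (\<lambda>_. 1),
      zero = (\<lambda>_. 0),
      add = (\<lambda>F G w. F w + G w)\<rparr>"

text \<open>The part of degree \<open>k\<close> consists of the functions that are homogeneous of degree \<open>-k\<close>.\<close>
definition eisenstein_part :: "nat \<Rightarrow> int \<Rightarrow> (complex \<times> complex \<Rightarrow> complex) set" where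
  "eisenstein_part p k =
     {F \<in> carrier (eisenstein_ring p).
        \<forall>c \<omega>0 \<omega>1. c \<noteq> 0 \<longrightarrow> (\<omega>0, \<omega>1) \<in> oriented_bases \<longrightarrow>
          F (c * \<omega>0, c * \<omega>1) = c powi (-k) * F (\<omega>0, \<omega>1)}"

definition g_s :: "nat \<Rightarrow> complex \<times> complex \<Rightarrow> complex" where
  "g_s p = on_oriented_bases (\<lambda>w. let \<omega>0 = fst w in
     if p = 3 then 15 / 4 * lattice_sum 4 w 0
     else if p = 4 then 3 / 2 * weierstrass_p w (\<omega>0 / 2)
     else if p = 6 then weierstrass_zeta w (\<omega>0 / 3) - 2 / 3 * weierstrass_zeta w (\<omega>0 / 2)
     else 0)"

definition g_l :: "nat \<Rightarrow> complex \<times> complex \<Rightarrow> complex" where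
  "g_l p = on_oriented_bases (\<lambda>w. let \<omega>0 = fst w in
     if p = 3 then 35 / 16 * lattice_sum 6 w 0
     else if p = 4 then 5 / 32 * weierstrass_p w (\<omega>0 / 2) ^ 2
                        + 5 / 8 * lattice_sum 4 w 0 - 5 / 8 * lattice_sum 4 w (\<omega>0 / 2)
     else if p = 6 then 2 * g_s p w ^ 3 - lattice_sum 3 w (\<omega>0 / 3)
     else 0)"


subsection \<open>The identification\<close>

definition modular_to_lattice ::
    "(int \<Rightarrow> complex \<Rightarrow> complex) \<Rightarrow> complex \<times> complex \<Rightarrow> complex" where
  "modular_to_lattice s =
     on_oriented_bases (\<lambda>(\<omega>0, \<omega>1). \<Sum>k | s k \<noteq> (\<lambda>_. 0). \<omega>0 powi (-k) * s k (\<omega>1 / \<omega>0))"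

definition graded_ring_iso ::
    "('a, 'm) ring_scheme \<Rightarrow> (int \<Rightarrow> 'a set) \<Rightarrow> ('b, 'n) ring_scheme \<Rightarrow> (int \<Rightarrow> 'b set) \<Rightarrow>
     ('a \<Rightarrow> 'b) \<Rightarrow> bool" where
  "graded_ring_iso R grR S grS h \<longleftrightarrow> h \<in> ring_iso R S \<and> (\<forall>k. h ` grR k = grS k)"

end

theory Submission
  imports Defs "HOL-Real_Asymp.Real_Asymp"
begin

text \<open>
  The Laurent coefficients of \<open>X\<close> and \<open>Y\<close> are linear combinations of lattice sums, of their
  translates by a torsion point, of \<open>\<wp>(\<omega>0 / N)\<close> and, for \<open>p = 6\<close>, of
  \<open>s = (2 \<zeta>(\<omega>0 / 3) - \<zeta>(2 \<omega>0 / 3)) / 3\<close>. Each of them is homogeneous, invariant under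
  \<open>\<Gamma>\<^sub>1(N)\<close> and bounded at the cusps \<open>\<infinity>\<close> and \<open>0\<close>, hence a modular form.

  Conversely, there is a form \<open>D\<close> in the algebra of the generators, of weight 12, 4 or 3, without
  zeros in the upper half plane and at the cusp \<open>0\<close> (if \<open>N > 1\<close>), with a simple zero at \<open>\<infinity>\<close>:
  the discriminant for \<open>N = 1\<close>, \<open>(e2 - e3)\<^sup>2 = 60 G4 - 3 \<wp>(\<omega>0 / 2)\<^sup>2\<close> for \<open>N = 2\<close> and
  \<open>8 s\<^sup>3 - 2 G3(\<omega>0 / 3)\<close>, which divides the discriminant, for \<open>N = 3\<close>. A form of weight \<open>k\<close>
  is a multiple of a monomial in the generators that does not vanish at \<open>\<infinity>\<close>, plus \<open>D\<close> times a
  form of smaller weight. Forms of weight 0 are constant by the maximum principle, and forms of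
  negative weight vanish; so induction on \<open>k\<close> shows that \<open>g_s\<close> and \<open>g_l\<close> generate. The same
  division by \<open>D\<close> proves that the cusp values determine \<open>e4, \<dots>, beta3\<close>, and it remains to compute
  the values of \<open>g_s\<close> and \<open>g_l\<close> at the cusps. They follow from the trigamma reflection formula for
  \<open>\<wp>(\<omega>0 / 2)\<close> and from algebraic relations between division values and the invariants.
\<close>

text \<open>Zeros are never counted: the valence formula is replaced by the maximum principle in
  weight 0 and by division by \<open>D\<close>. Division needs \<open>D\<close> to vanish nowhere in
  the upper half plane, which goes back to the three half-period values e1, e2, e3 being distinct, a
  consequence of Liouville's theorem. The only quantitative input on orders of vanishing is that e2
  - e3 behaves like -16 \<pi>^2 exp(\<pi> \<i> \<tau>); the simple zeros for all three levels follow
  from it. The restriction N \<le> 3 enters through the cusps: N is 1 or a prime for which all units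
  are 1 or -1, so that up to sign and translation a form has just two expansions, at infinity and at
  0, and boundedness of these is all that must be checked. At the cusp 0 the series for \<wp>
  escapes the common majorant; there \<wp> is bounded as a root of a cubic with bounded
  coefficients. No recursion for Laurent coefficients is used: each coefficient is modular, and each
  modular form is a polynomial in \<open>g_s\<close> and \<open>g_l\<close>, so that the statement
  on the algebra is a corollary of the structure of the ring of forms.\<close>

lemma has_field_derivative_infsum:
  fixes f :: "'i \<Rightarrow> complex \<Rightarrow> complex"
  assumes "\<And>i x. i \<in> I \<Longrightarrow> x \<in> cball z r \<Longrightarrow> (f i has_field_derivative f' i x) (at x)"
    and "\<And>i x. i \<in> I \<Longrightarrow> x \<in> cball z r \<Longrightarrow> norm (f i x) \<le> M i"
    and "M summable_on I" and "w \<in> ball z r"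
  shows "((\<lambda>x. \<Sum>\<^sub>\<infinity>i\<in>I. f i x) has_field_derivative (\<Sum>\<^sub>\<infinity>i\<in>I. f' i w)) (at w)"
proof -
  have r: "0 < r" using assms(4) by (metis ball_eq_empty empty_iff not_le)
  have "eventually (\<lambda>X. continuous_on (cball z r) (\<lambda>x. \<Sum>i\<in>X. f i x) \<and>
      (\<forall>w\<in>ball z r. ((\<lambda>x. \<Sum>i\<in>X. f i x) has_field_derivative (\<Sum>i\<in>X. f' i w)) (at w)))
    (finite_subsets_at_top I)"
  proof (rule eventually_finite_subsets_at_top_weakI)
    fix X assume X: "finite X" "X \<subseteq> I"
    have d: "((\<lambda>x. \<Sum>i\<in>X. f i x) has_field_derivative (\<Sum>i\<in>X. f' i w)) (at w)" if "w \<in> cball z r" for w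
      using X that by (intro DERIV_sum assms(1)) auto
    then have "continuous_on (cball z r) (\<lambda>x. \<Sum>i\<in>X. f i x)"
      by (meson DERIV_isCont continuous_at_imp_continuous_on)
    with d show "continuous_on (cball z r) (\<lambda>x. \<Sum>i\<in>X. f i x) \<and>
      (\<forall>w\<in>ball z r. ((\<lambda>x. \<Sum>i\<in>X. f i x) has_field_derivative (\<Sum>i\<in>X. f' i w)) (at w))" by auto
  qed
  \<comment> \<open>Only the summands are dominated, not their derivatives: a uniform limit of
    holomorphic functions may be differentiated termwise, and the same theorem yields convergence of
    the derivative sums.\<close>
  moreover have "uniform_limit (cball z r) (\<lambda>X x. \<Sum>i\<in>X. f i x) (\<lambda>x. \<Sum>\<^sub>\<infinity>i\<in>I. f i x) (finite_subsets_at_top I)"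
    by (rule Weierstrass_m_test_general[OF assms(2,3)]) auto
  ultimately obtain g' where g': "\<And>w. w \<in> ball z r \<Longrightarrow>
     ((\<lambda>x. \<Sum>\<^sub>\<infinity>i\<in>I. f i x) has_field_derivative (g' w)) (at w) \<and>
     ((\<lambda>X. \<Sum>i\<in>X. f' i w) \<longlongrightarrow> g' w) (finite_subsets_at_top I)"
    by (rule has_complex_derivative_uniform_limit) (use r in auto)
  from g'[OF assms(4)] have "((\<lambda>i. f' i w) has_sum g' w) I"
    by (simp add: has_sum_def)
  with g'[OF assms(4)] show ?thesis by (simp add: infsumI)
qed

lemma abs_summable_comparison:
  fixes f :: "'i \<Rightarrow> complex"
  assumes "M summable_on I" "\<And>i. i \<in> I \<Longrightarrow> norm (f i) \<le> C * M i"
  shows "f summable_on I"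
proof -
  have "(\<lambda>i. C * M i) summable_on I" using assms(1) by (rule summable_on_cmult_right)
  then have "(\<lambda>i. norm (f i)) summable_on I"
    by (rule summable_on_comparison_test) (use assms(2) in auto)
  then show ?thesis by (rule abs_summable_summable)
qed

text \<open>Dominated convergence for unordered sums along an arbitrary filter, as needed for limits
  at the cusps.\<close>

lemma tendsto_infsum_dominated:
  fixes f :: "'i \<Rightarrow> 'b \<Rightarrow> complex"
  assumes lim: "\<And>i. i \<in> I \<Longrightarrow> (f i \<longlongrightarrow> g i) F"
    and bound: "\<forall>\<^sub>F x in F. \<forall>i\<in>I. norm (f i x) \<le> M i"
    and M: "M summable_on I"
  shows "((\<lambda>x. \<Sum>\<^sub>\<infinity>i\<in>I. f i x) \<longlongrightarrow> (\<Sum>\<^sub>\<infinity>i\<in>I. g i)) F"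
proof (cases "F = bot")
  case False
  have gM: "norm (g i) \<le> M i" if "i \<in> I" for i
    by (rule tendsto_le[OF False tendsto_const tendsto_norm[OF lim[OF that]]])
       (use bound that in \<open>auto elim: eventually_mono\<close>)
  \<comment> \<open>The limit and the functions at the points where the bound holds form one family,
    with \<open>None\<close> for the limit. A single M-test on \<open>Y\<close> then gives a finite
    set \<open>X\<close> whose tails are small for all of them at once.\<close>
  define Y where "Y = insert None (Some ` {x. \<forall>i\<in>I. norm (f i x) \<le> M i})"
  define h where "h i y = (case y of None \<Rightarrow> g i | Some x \<Rightarrow> f i x)" for i y
  have ul: "uniform_limit Y (\<lambda>X y. \<Sum>i\<in>X. h i y) (\<lambda>y. \<Sum>\<^sub>\<infinity>i\<in>I. h i y) (finite_subsets_at_top I)"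
    by (rule Weierstrass_m_test_general[OF _ M]) (auto simp: Y_def h_def gM)
  show ?thesis
  proof (rule tendstoI)
    fix e :: real assume e: "e > 0"
    have "\<forall>\<^sub>F X in finite_subsets_at_top I. finite X \<and> X \<subseteq> I \<and>
        (\<forall>y\<in>Y. dist (\<Sum>i\<in>X. h i y) (\<Sum>\<^sub>\<infinity>i\<in>I. h i y) < e / 3)"
      using uniform_limitD[OF ul, of "e / 3"] e eventually_finite_subsets_at_top_weakI[of I "\<lambda>X. finite X \<and> X \<subseteq> I"]
      by (simp add: eventually_conj_iff)
    from eventually_happens'[OF finite_subsets_at_top_neq_bot this]
    obtain X where X: "finite X" "X \<subseteq> I"
      "\<forall>y\<in>Y. dist (\<Sum>i\<in>X. h i y) (\<Sum>\<^sub>\<infinity>i\<in>I. h i y) < e / 3" by (elim exE conjE)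
    have "((\<lambda>x. \<Sum>i\<in>X. f i x) \<longlongrightarrow> (\<Sum>i\<in>X. g i)) F"
      using X by (intro tendsto_sum lim) auto
    then have "\<forall>\<^sub>F x in F. dist (\<Sum>i\<in>X. f i x) (\<Sum>i\<in>X. g i) < e / 3"
      using e by (intro tendstoD) auto
    with bound show "\<forall>\<^sub>F x in F. dist (\<Sum>\<^sub>\<infinity>i\<in>I. f i x) (\<Sum>\<^sub>\<infinity>i\<in>I. g i) < e"
    proof eventually_elim
      case (elim x)
      have "dist (\<Sum>i\<in>X. f i x) (\<Sum>\<^sub>\<infinity>i\<in>I. f i x) < e / 3"
        using bspec[OF X(3), of "Some x"] elim by (simp add: Y_def h_def)
      moreover have "dist (\<Sum>i\<in>X. g i) (\<Sum>\<^sub>\<infinity>i\<in>I. g i) < e / 3"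
        using bspec[OF X(3), of None] by (simp add: Y_def h_def)
      ultimately show ?case using elim(2)
        by (metis dist_commute dist_triangle_third)
    qed
  qed
qed auto

subsection \<open>Sums over lattices\<close>

lemma summable_on_int_nonneg_even:
  fixes f :: "int \<Rightarrow> real"
  assumes "\<And>n. f n \<ge> 0" "summable (\<lambda>n. f (int n))" "summable (\<lambda>n. f (- int n))"
  shows "f summable_on UNIV"
proof -
  have "f summable_on range int"
    by (subst summable_on_reindex) (use assms in \<open>auto simp: inj_def o_def intro!: summable_nonneg_imp_summable_on\<close>)
  moreover have "f summable_on range (\<lambda>n. - int n)"
    by (subst summable_on_reindex) (use assms in \<open>auto simp: inj_def o_def intro!: summable_nonneg_imp_summable_on\<close>)
  ultimately have "f summable_on (range int \<union> range (\<lambda>n. - int n))"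
    by (rule summable_on_union)
  moreover have "range int \<union> range (\<lambda>n. - int n) = UNIV"
    by (auto simp: image_iff) (metis int_cases2)
  ultimately show ?thesis by simp
qed

text \<open>Common majorant of the lattice sums: the exponent 3 exceeds the rank 2, and the summand
  1 keeps the denominator positive at (0, 0), so that translated sums over all pairs are covered
  too.\<close>

definition cube_weight :: "int \<times> int \<Rightarrow> real" where
  "cube_weight = (\<lambda>(m, n). 1 / (1 + \<bar>of_int m\<bar> + \<bar>of_int n\<bar>) ^ 3)"

text \<open>As 1 + |m| + |n| dominates both 1 + |m| and 1 + |n|, its cube dominates the product of
  their powers 3/2; the double sum is then bounded by the square of a convergent single sum.\<close>

lemma summable_cube_weight: "cube_weight summable_on UNIV"
proof -
  define h :: "int \<Rightarrow> real" where "h = (\<lambda>m. (1 + \<bar>of_int m\<bar>) powr (-3/2))"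
  have "summable (\<lambda>n. real (Suc n) powr (-3/2))"
    by (subst summable_Suc_iff) (simp add: summable_real_powr_iff)
  then have hn: "summable (\<lambda>n. (1 + real n) powr (-3/2))" by (simp add: add.commute)
  have h: "h summable_on UNIV"
    by (rule summable_on_int_nonneg_even) (use hn in \<open>auto simp: h_def\<close>)
  have h0: "h m \<ge> 0" for m by (simp add: h_def)
  have inner: "(\<Sum>\<^sub>\<infinity>n. norm (h m * h n)) = h m * infsum h UNIV" for m
    using h0 by (simp add: infsum_cmult_right')
  have "(\<lambda>p. norm (h (fst p) * h (snd p))) summable_on (UNIV \<times> UNIV)"
  proof (subst Infinite_Sum.abs_summable_on_Sigma_iff, intro conjI ballI)
    show "(\<lambda>n. norm (h (fst (m, n)) * h (snd (m, n)))) summable_on UNIV" for m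
      using summable_on_cmult_right[OF h, of "h m"] h0 by simp
    show "(\<lambda>m. norm (\<Sum>\<^sub>\<infinity>n. norm (h (fst (m, n)) * h (snd (m, n))))) summable_on UNIV"
      using summable_on_cmult_left[OF h, of "infsum h UNIV"] h0 infsum_nonneg[of UNIV h]
      by (simp only: fst_conv snd_conv inner) simp
  qed
  then have "(\<lambda>p. h (fst p) * h (snd p)) summable_on (UNIV \<times> UNIV)"
    by (rule abs_summable_summable)
  then have "(\<lambda>p. h (fst p) * h (snd p)) summable_on UNIV" by simp
  then show ?thesis
  proof (rule summable_on_comparison_test)
    fix p :: "int \<times> int"
    obtain m n where p: "p = (m, n)" by (cases p)
    define u v where "u = 1 + \<bar>real_of_int m\<bar>" and "v = 1 + \<bar>real_of_int n\<bar>"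
    define t where "t = 1 + \<bar>real_of_int m\<bar> + \<bar>real_of_int n\<bar>"
    have uv: "u > 0" "v > 0" "u \<le> t" "v \<le> t" "t > 0" by (auto simp: u_def v_def t_def)
    have "u powr (3/2) * v powr (3/2) \<le> t powr (3/2) * t powr (3/2)"
      using uv by (intro mult_mono powr_mono2) auto
    also have "\<dots> = t powr 3" by (simp flip: powr_add)
    also have "\<dots> = t ^ 3" using uv by (simp add: powr_numeral)
    finally have "1 / t ^ 3 \<le> 1 / (u powr (3/2) * v powr (3/2))"
      using uv by (intro divide_left_mono) auto
    also have "\<dots> = h m * h n" by (simp add: h_def u_def v_def powr_minus field_simps)
    finally show "cube_weight p \<le> h (fst p) * h (snd p)" by (simp add: p cube_weight_def t_def)
  qed (auto simp: cube_weight_def)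
qed

text \<open>The imaginary part of u + v t bounds v because Im t > 0, and then the real part bounds
  u. Uniqueness of lattice coordinates, discreteness and summability all rest on this bound.\<close>

lemma oriented_basis_norm_bound:
  assumes "w \<in> oriented_bases"
  obtains c where "c > 0"
    "\<And>u v :: real. c * (\<bar>u\<bar> + \<bar>v\<bar>) \<le> norm (of_real u * fst w + of_real v * snd w)"
proof -
  define t where "t = snd w / fst w"
  have im: "Im t > 0" and w0: "fst w \<noteq> 0"
    using assms by (auto simp: oriented_bases_def t_def case_prod_beta)
  define C where "C = 1 + (\<bar>Re t\<bar> + 1) / Im t"
  have C: "C > 0" unfolding C_def using im by (intro add_pos_nonneg) auto
  show ?thesis
  proof
    show "norm (fst w) / C > 0" using w0 C by simp
  next
    fix u v :: real
    have 1: "\<bar>v\<bar> * Im t \<le> norm (of_real u + of_real v * t)"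
      using abs_Im_le_cmod[of "of_real u + of_real v * t"] im by (simp add: abs_mult)
    have 2: "\<bar>u + v * Re t\<bar> \<le> norm (of_real u + of_real v * t)"
      using abs_Re_le_cmod[of "of_real u + of_real v * t"] by simp
    have "\<bar>u\<bar> \<le> \<bar>u + v * Re t\<bar> + \<bar>v\<bar> * \<bar>Re t\<bar>"
      by (simp flip: abs_mult)
    with 2 have "\<bar>u\<bar> + \<bar>v\<bar> \<le> norm (of_real u + of_real v * t) + \<bar>v\<bar> * (\<bar>Re t\<bar> + 1)"
      by (simp add: algebra_simps)
    also have "\<bar>v\<bar> * (\<bar>Re t\<bar> + 1) \<le> (norm (of_real u + of_real v * t) / Im t) * (\<bar>Re t\<bar> + 1)"
      using 1 im by (intro mult_right_mono) (auto simp: field_simps)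
    finally have "\<bar>u\<bar> + \<bar>v\<bar> \<le> C * norm (of_real u + of_real v * t)"
      by (simp add: C_def algebra_simps)
    moreover have "of_real u * fst w + of_real v * snd w = fst w * (of_real u + of_real v * t)"
      using w0 by (simp add: t_def field_simps)
    hence "norm (of_real u * fst w + of_real v * snd w) = norm (fst w) * norm (of_real u + of_real v * t)"
      by (simp only: norm_mult)
    ultimately show "norm (fst w) / C * (\<bar>u\<bar> + \<bar>v\<bar>) \<le> norm (of_real u * fst w + of_real v * snd w)"
      using mult_left_mono[of "\<bar>u\<bar> + \<bar>v\<bar>" "C * norm (of_real u + of_real v * t)" "norm (fst w)"] C
      by (simp add: field_simps)
  qed
qed

definition lattice_point :: "complex \<times> complex \<Rightarrow> int \<times> int \<Rightarrow> complex" where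
  "lattice_point w p = of_int (fst p) * fst w + of_int (snd p) * snd w"

lemma zero_in_lattice [simp]: "0 \<in> period_lattice w"
  unfolding period_lattice_def by (rule CollectI, rule exI[of _ 0], rule exI[of _ 0]) auto

lemma lattice_point_bij:
  assumes "w \<in> oriented_bases"
  shows "bij_betw (lattice_point w) UNIV (period_lattice w)"
    and "bij_betw (lattice_point w) (UNIV - {(0, 0)}) (period_lattice w - {0})"
proof -
  obtain c where c: "c > 0"
    "\<And>u v :: real. c * (\<bar>u\<bar> + \<bar>v\<bar>) \<le> norm (of_real u * fst w + of_real v * snd w)"
    using oriented_basis_norm_bound[OF assms] by blast
  have inj: "inj (lattice_point w)"
  proof (rule injI)
    fix p q assume "lattice_point w p = lattice_point w q"
    then have "of_real (of_int (fst p - fst q)) * fst w + of_real (of_int (snd p - snd q)) * snd w = 0"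
      by (simp add: lattice_point_def algebra_simps)
    with c(2)[of "of_int (fst p - fst q)" "of_int (snd p - snd q)"]
    have "c * (\<bar>of_int (fst p - fst q)\<bar> + \<bar>of_int (snd p - snd q)\<bar>) \<le> 0" by simp
    with c(1) have "\<bar>real_of_int (fst p - fst q)\<bar> + \<bar>real_of_int (snd p - snd q)\<bar> \<le> 0"
      by (simp add: mult_le_0_iff)
    then have "real_of_int (fst p - fst q) = 0 \<and> real_of_int (snd p - snd q) = 0" by linarith
    then show "p = q" by (simp add: prod_eq_iff)
  qed
  then show 1: "bij_betw (lattice_point w) UNIV (period_lattice w)"
    by (force simp: bij_betw_def lattice_point_def period_lattice_def image_iff)
  show "bij_betw (lattice_point w) (UNIV - {(0, 0)}) (period_lattice w - {0})"
    using bij_betw_DiffI[OF 1, of "{(0,0)}" "{0}"] by (simp add: lattice_point_def bij_betw_def)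
qed

lemma lattice_add [intro]: "a \<in> period_lattice w \<Longrightarrow> b \<in> period_lattice w \<Longrightarrow> a + b \<in> period_lattice w"
proof -
  assume "a \<in> period_lattice w" "b \<in> period_lattice w"
  then obtain m n m' n' :: int where "a = of_int m * fst w + of_int n * snd w" "b = of_int m' * fst w + of_int n' * snd w"
    by (auto simp: period_lattice_def)
  then have "a + b = of_int (m + m') * fst w + of_int (n + n') * snd w" by (simp add: algebra_simps)
  then show ?thesis unfolding period_lattice_def by blast
qed

lemma lattice_minus [simp]: "- a \<in> period_lattice w \<longleftrightarrow> a \<in> period_lattice w"
proof -
  have "- a \<in> period_lattice w" if "a \<in> period_lattice w" for a :: complex
  proof -
    obtain m n :: int where mn: "a = of_int m * fst w + of_int n * snd w"
      using \<open>a \<in> _\<close> unfolding period_lattice_def mem_Collect_eq by metis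
    then have "- a = of_int (- m) * fst w + of_int (- n) * snd w" by (simp add: algebra_simps)
    then show ?thesis unfolding period_lattice_def by blast
  qed
  from this[of a] this[of "- a"] show ?thesis by auto
qed

lemma lattice_diff [intro]: "a \<in> period_lattice w \<Longrightarrow> b \<in> period_lattice w \<Longrightarrow> a - b \<in> period_lattice w"
  using lattice_add[of a w "- b"] by simp

lemma lattice_add_iff [simp]:
  "b \<in> period_lattice w \<Longrightarrow> a + b \<in> period_lattice w \<longleftrightarrow> a \<in> period_lattice w"
  "b \<in> period_lattice w \<Longrightarrow> b + a \<in> period_lattice w \<longleftrightarrow> a \<in> period_lattice w"
  "b \<in> period_lattice w \<Longrightarrow> a - b \<in> period_lattice w \<longleftrightarrow> a \<in> period_lattice w"
  "b \<in> period_lattice w \<Longrightarrow> b - a \<in> period_lattice w \<longleftrightarrow> a \<in> period_lattice w"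
proof -
  assume b: "b \<in> period_lattice w"
  show 1: "a + b \<in> period_lattice w \<longleftrightarrow> a \<in> period_lattice w"
    using lattice_add[of a w b] lattice_diff[of "a + b" w b] b by auto
  then show "b + a \<in> period_lattice w \<longleftrightarrow> a \<in> period_lattice w" by (simp add: add.commute)
  show "a - b \<in> period_lattice w \<longleftrightarrow> a \<in> period_lattice w"
    using lattice_diff[of a w b] lattice_add[of "a - b" w b] b by auto
  then show "b - a \<in> period_lattice w \<longleftrightarrow> a \<in> period_lattice w"
    using lattice_minus[of "a - b"] by simp
qed

lemma lattice_basis [simp]: "fst w \<in> period_lattice w" "snd w \<in> period_lattice w"
proof -
  show "fst w \<in> period_lattice w"
    unfolding period_lattice_def by (rule CollectI, rule exI[of _ 1], rule exI[of _ 0]) auto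
  show "snd w \<in> period_lattice w"
    unfolding period_lattice_def by (rule CollectI, rule exI[of _ 0], rule exI[of _ 1]) auto
qed

lemma lattice_multiple: "b \<in> period_lattice w \<Longrightarrow> of_int k * b \<in> period_lattice w"
proof -
  assume "b \<in> period_lattice w"
  then obtain m n :: int where "b = of_int m * fst w + of_int n * snd w"
    unfolding period_lattice_def mem_Collect_eq by metis
  then have "of_int k * b = of_int (k * m) * fst w + of_int (k * n) * snd w" by (simp add: algebra_simps)
  then show ?thesis unfolding period_lattice_def by blast
qed

lemma countable_lattice [simp]: "countable (period_lattice w)"
proof -
  have "period_lattice w = range (lattice_point w)"
    by (force simp: period_lattice_def lattice_point_def image_iff)
  then show ?thesis by simp
qed

text \<open>Lattice coordinates are unique. The cases d = 2 and d = 3 provide the torsion points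
  used later.\<close>

lemma lattice_coset_not_half:
  assumes w: "w \<in> oriented_bases" and "d > 1" and "\<not> int d dvd m \<or> \<not> int d dvd n"
  shows "(of_int m * fst w + of_int n * snd w) / of_nat d \<notin> period_lattice w"
proof
  assume "(of_int m * fst w + of_int n * snd w) / of_nat d \<in> period_lattice w"
  then obtain m' n' :: int where "(of_int m * fst w + of_int n * snd w) / of_nat d = of_int m' * fst w + of_int n' * snd w"
    by (auto simp: period_lattice_def)
  then have "lattice_point w (m, n) = lattice_point w (int d * m', int d * n')"
    using \<open>d > 1\<close> by (simp add: lattice_point_def field_simps)
  then have "(m, n) = (int d * m', int d * n')"
    using lattice_point_bij(1)[OF w] by (simp add: bij_betw_def inj_def)
  with assms(3) show False by auto
qed

context
  fixes w :: "complex \<times> complex"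
  assumes w: "w \<in> oriented_bases"
begin

lemma lattice_min_norm: obtains d where "d > 0" "\<And>\<omega>. \<omega> \<in> period_lattice w - {0} \<Longrightarrow> d \<le> norm \<omega>"
proof -
  obtain c where c: "c > 0"
    "\<And>u v :: real. c * (\<bar>u\<bar> + \<bar>v\<bar>) \<le> norm (of_real u * fst w + of_real v * snd w)"
    using oriented_basis_norm_bound[OF w] by blast
  show ?thesis
  proof
    fix \<omega> assume "\<omega> \<in> period_lattice w - {0}"
    then obtain m n :: int where \<omega>: "\<omega> = of_int m * fst w + of_int n * snd w" "m \<noteq> 0 \<or> n \<noteq> 0"
      unfolding period_lattice_def by force
    then have "1 \<le> \<bar>real_of_int m\<bar> + \<bar>real_of_int n\<bar>" by linarith
    then have "c * 1 \<le> c * (\<bar>of_int m\<bar> + \<bar>of_int n\<bar>)" using c(1) by (intro mult_left_mono) auto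
    with c(2)[of "of_int m" "of_int n"] \<omega>(1) show "c \<le> norm \<omega>" by simp
  qed (rule c(1))
qed

lemma closed_lattice_subset: "S \<subseteq> period_lattice w \<Longrightarrow> closed S"
proof -
  assume S: "S \<subseteq> period_lattice w"
  obtain d where d: "d > 0" "\<And>\<omega>. \<omega> \<in> period_lattice w - {0} \<Longrightarrow> d \<le> norm \<omega>"
    using lattice_min_norm by blast
  show ?thesis
  proof (rule discrete_imp_closed[OF d(1)], intro ballI impI)
    fix x y assume xy: "x \<in> S" "y \<in> S" "dist y x < d"
    then have "y - x \<in> period_lattice w" using S by (blast intro: lattice_diff)
    with d(2)[of "y - x"] xy(3) show "y = x" by (force simp: dist_norm)
  qed
qed

text \<open>Reduces the local dominations below to the summability of |\<omega>|^(-3). The point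
  \<open>z\<close> may be 0, since expansions at the origin are needed.\<close>

lemma away_from_lattice:
  assumes "z \<notin> period_lattice w - {0}"
  obtains r c where "r > 0" "c > 0" "cball z r \<inter> (period_lattice w - {0}) = {}"
    "\<And>x \<omega>. x \<in> cball z r \<Longrightarrow> \<omega> \<in> period_lattice w - {0} \<Longrightarrow> c * norm \<omega> \<le> norm (x - \<omega>)"
proof -
  have "open (- (period_lattice w - {0}))" using closed_lattice_subset[of "period_lattice w - {0}"] by blast
  then obtain e where e: "e > 0" "ball z e \<subseteq> - (period_lattice w - {0})"
    using assms by (meson ComplI openE)
  define r where "r = e / 2"
  have r: "r > 0" using e by (simp add: r_def)
  \<comment> \<open>From |x - \<omega>| \<ge> r and |\<omega>| \<le> |x - \<omega>| + |z| + r one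
    gets r |\<omega>| \<le> (2 r + |z|) |x - \<omega>|.\<close>
  define c where "c = r / (2 * r + norm z)"
  have pos: "2 * r + norm z > 0" using r by (intro add_pos_nonneg) auto
  show ?thesis
  proof
    show "r > 0" "c > 0" using r pos by (auto simp: c_def)
    show "cball z r \<inter> (period_lattice w - {0}) = {}"
      using e by (force simp: r_def)
    fix x \<omega> assume x: "x \<in> cball z r" and om: "\<omega> \<in> period_lattice w - {0}"
    have "dist z \<omega> \<ge> e" using e(2) om by force
    then have "norm (z - \<omega>) \<ge> 2 * r" by (simp add: r_def dist_norm)
    moreover have "norm (z - x) \<le> r" using x by (simp add: dist_norm)
    ultimately have 1: "norm (x - \<omega>) \<ge> r"
      using norm_triangle_ineq[of "z - x" "x - \<omega>"] by simp
    have "norm \<omega> \<le> norm (x - \<omega>) + norm x" by (metis norm_minus_commute norm_triangle_sub add.commute)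
    also have "norm x \<le> norm z + r" using \<open>norm (z - x) \<le> r\<close> norm_triangle_ineq3[of x z]
      by (simp add: norm_minus_commute abs_le_iff)
    finally have "norm \<omega> \<le> norm (x - \<omega>) + (norm z + r)" by simp
    then have "r * norm \<omega> \<le> r * (norm (x - \<omega>) + (norm z + r))"
      using r by (intro mult_left_mono) auto
    then have "r * norm \<omega> \<le> r * norm (x - \<omega>) + r * (norm z + r)"
      by (simp only: distrib_left)
    also have "r * (norm z + r) \<le> norm (x - \<omega>) * (norm z + r)"
      using 1 r by (intro mult_right_mono add_nonneg_nonneg) auto
    finally have "r * norm \<omega> \<le> norm (x - \<omega>) * (2 * r + norm z)" by (simp add: algebra_simps)
    then show "c * norm \<omega> \<le> norm (x - \<omega>)" using pos by (simp add: c_def field_simps)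
  qed
qed

lemma summable_lattice_cube: "(\<lambda>\<omega>. 1 / norm \<omega> ^ 3) summable_on (period_lattice w - {0})"
proof -
  obtain c where c: "c > 0"
    "\<And>u v :: real. c * (\<bar>u\<bar> + \<bar>v\<bar>) \<le> norm (of_real u * fst w + of_real v * snd w)"
    using oriented_basis_norm_bound[OF w] by blast
  have "(\<lambda>p. (2 / c) ^ 3 * cube_weight p) summable_on (UNIV - {(0,0)})"
    by (intro summable_on_cmult_right summable_on_subset_banach[OF summable_cube_weight]) auto
  then have "(\<lambda>p. 1 / norm (lattice_point w p) ^ 3) summable_on (UNIV - {(0,0)})"
  proof (rule summable_on_comparison_test)
    fix p :: "int \<times> int" assume p: "p \<in> UNIV - {(0,0)}"
    obtain m n where mn: "p = (m, n)" by (cases p)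
    define t where "t = \<bar>real_of_int m\<bar> + \<bar>real_of_int n\<bar>"
    have "1 \<le> \<bar>m\<bar> + \<bar>n\<bar>" using p mn by auto
    then have "1 \<le> real_of_int (\<bar>m\<bar> + \<bar>n\<bar>)" by linarith
    then have t: "t \<ge> 1" by (simp add: t_def)
    have "c * (1 + t) / 2 \<le> norm (lattice_point w p)"
    proof -
      have "c * (1 + t) \<le> c * (2 * t)" using c(1) t by (intro mult_left_mono) auto
      also have "\<dots> = 2 * (c * t)" by simp
      also have "c * t \<le> norm (lattice_point w p)"
        using c(2)[of "of_int m" "of_int n"] by (simp add: mn lattice_point_def t_def)
      finally show ?thesis by simp
    qed
    then have "(c * (1 + t) / 2) ^ 3 \<le> norm (lattice_point w p) ^ 3"
      using c(1) t by (intro power_mono) auto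
    moreover have "0 < c * (1 + t) / 2" using c(1) t by simp
    ultimately have "1 / norm (lattice_point w p) ^ 3 \<le> 1 / (c * (1 + t) / 2) ^ 3"
      by (intro divide_left_mono) (auto intro!: mult_pos_pos zero_less_power elim: less_le_trans[rotated])
    also have "\<dots> = (2 / c) ^ 3 * cube_weight p"
      by (simp add: mn cube_weight_def t_def power_divide power_mult_distrib add.assoc)
    finally show "1 / norm (lattice_point w p) ^ 3 \<le> (2 / c) ^ 3 * cube_weight p" .
  qed auto
  then show ?thesis
    using summable_on_reindex_bij_betw[OF lattice_point_bij(2)[OF w], of "\<lambda>\<omega>. 1 / norm \<omega> ^ 3"] by simp
qed

text \<open>Nonzero lattice points have norm at least some d > 0, so higher powers are dominated by
  a multiple of the cube.\<close>

lemma summable_lattice_power: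
  assumes "k \<ge> 3"
  shows "(\<lambda>\<omega>. 1 / norm \<omega> ^ k) summable_on (period_lattice w - {0})"
proof -
  obtain d where d: "d > 0" "\<And>\<omega>. \<omega> \<in> period_lattice w - {0} \<Longrightarrow> d \<le> norm \<omega>"
    using lattice_min_norm by blast
  have "(\<lambda>\<omega>. 1 / d ^ (k - 3) * (1 / norm \<omega> ^ 3)) summable_on (period_lattice w - {0})"
    by (intro summable_on_cmult_right summable_lattice_cube)
  then show ?thesis
  proof (rule summable_on_comparison_test)
    fix \<omega> assume om: "\<omega> \<in> period_lattice w - {0}"
    have "norm \<omega> ^ k = norm \<omega> ^ (k - 3) * norm \<omega> ^ 3" using assms by (simp flip: power_add)
    moreover have "d ^ (k - 3) \<le> norm \<omega> ^ (k - 3)" using d om by (intro power_mono) auto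
    moreover have "norm \<omega> > 0" using om by auto
    ultimately show "1 / norm \<omega> ^ k \<le> 1 / d ^ (k - 3) * (1 / norm \<omega> ^ 3)"
      using d(1) by (simp add: frac_le)
  qed auto
qed

end

subsection \<open>Weierstrass functions\<close>

lemma has_field_derivative_inverse_power_shift:
  fixes x :: complex
  assumes "x \<noteq> \<omega>"
  shows "((\<lambda>x. 1 / (x - \<omega>) ^ k) has_field_derivative - of_nat k * (1 / (x - \<omega>) ^ Suc k)) (at x)"
proof (cases k)
  case (Suc j)
  have "((\<lambda>x. 1 / (x - \<omega>) ^ Suc j) has_field_derivative
      (0 * (x - \<omega>) ^ Suc j - 1 * (of_nat (Suc j) * ((1 - 0) * (x - \<omega>) ^ j))) / ((x - \<omega>) ^ Suc j * (x - \<omega>) ^ Suc j)) (at x)"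
    by (rule derivative_eq_intros refl | use assms in simp)+
  then show ?thesis unfolding Suc
    by (rule DERIV_cong) (use assms in \<open>simp add: divide_simps\<close>)
qed simp

text \<open>Dropping the polar term at 0 leaves a function that is holomorphic at the origin; limits
  and Laurent coefficients at 0 are read off from such regular parts.\<close>

definition zeta_reg :: "complex \<times> complex \<Rightarrow> complex \<Rightarrow> complex" where
  "zeta_reg w z = (\<Sum>\<^sub>\<infinity>\<omega>\<in>period_lattice w - {0}. 1 / (z - \<omega>) + 1 / \<omega> + z / \<omega> ^ 2)"

definition wp_reg :: "complex \<times> complex \<Rightarrow> complex \<Rightarrow> complex" where
  "wp_reg w z = (\<Sum>\<^sub>\<infinity>\<omega>\<in>period_lattice w - {0}. 1 / (z - \<omega>) ^ 2 - 1 / \<omega> ^ 2)"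

definition eis_reg :: "nat \<Rightarrow> complex \<times> complex \<Rightarrow> complex \<Rightarrow> complex" where
  "eis_reg k w z = (\<Sum>\<^sub>\<infinity>\<omega>\<in>period_lattice w - {0}. 1 / (z - \<omega>) ^ k)"

text \<open>For k \<ge> 3 this is the sum E_k of (z - \<omega>)^(-k) over the whole lattice, up to a
  factor a derivative of \<wp>: \<wp>' = -2 E_3 and \<wp>'' = 6 E_4.\<close>

definition eis_full :: "nat \<Rightarrow> complex \<times> complex \<Rightarrow> complex \<Rightarrow> complex" where
  "eis_full k w z = 1 / z ^ k + eis_reg k w z"

lemma weierstrass_zeta_eq: "weierstrass_zeta w z = 1 / z + zeta_reg w z"
  by (simp add: weierstrass_zeta_def zeta_reg_def)

lemma weierstrass_p_eq: "weierstrass_p w z = 1 / z ^ 2 + wp_reg w z"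
  by (simp add: weierstrass_p_def wp_reg_def)

lemma infsum_lattice_reflect:
  "(\<Sum>\<^sub>\<infinity>\<omega>\<in>period_lattice w. f (- \<omega>)) = (\<Sum>\<^sub>\<infinity>\<omega>\<in>period_lattice w. f \<omega>)"
  "(\<Sum>\<^sub>\<infinity>\<omega>\<in>period_lattice w - {0}. f (- \<omega>)) = (\<Sum>\<^sub>\<infinity>\<omega>\<in>period_lattice w - {0}. f \<omega>)"
  by (rule infsum_reindex_bij_witness[of _ uminus uminus]; simp)+

lemma zeta_reg_0 [simp]: "zeta_reg w 0 = 0"
  unfolding zeta_reg_def by (rule infsum_0) auto

lemma wp_reg_0 [simp]: "wp_reg w 0 = 0"
  unfolding wp_reg_def by (rule infsum_0) auto

lemma weierstrass_p_minus: "weierstrass_p w (- z) = weierstrass_p w z"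
proof -
  have "wp_reg w (- z) = (\<Sum>\<^sub>\<infinity>\<omega>\<in>period_lattice w - {0}. 1 / (z - (- \<omega>)) ^ 2 - 1 / (- \<omega>) ^ 2)"
    unfolding wp_reg_def by (rule infsum_cong) (simp add: power2_eq_square algebra_simps)
  then show ?thesis
    unfolding weierstrass_p_eq wp_reg_def by (subst (asm) infsum_lattice_reflect) simp
qed

lemma eis_reg_minus: "eis_reg k w (- z) = (- 1) ^ k * eis_reg k w z"
proof -
  have "eis_reg k w (- z) = (\<Sum>\<^sub>\<infinity>\<omega>\<in>period_lattice w - {0}. (- 1) ^ k * (1 / (z - (- \<omega>)) ^ k))"
    unfolding eis_reg_def
  proof (rule infsum_cong)
    fix \<omega>
    have "(- z - \<omega>) ^ k = (- 1) ^ k * (z - (- \<omega>)) ^ k"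
      by (simp flip: power_mult_distrib)
    then show "1 / (- z - \<omega>) ^ k = (- 1) ^ k * (1 / (z - (- \<omega>)) ^ k)"
      by (simp add: divide_simps minus_one_power_iff)
  qed
  also have "\<dots> = (- 1) ^ k * (\<Sum>\<^sub>\<infinity>\<omega>\<in>period_lattice w - {0}. 1 / (z - (- \<omega>)) ^ k)"
    by (rule infsum_cmult_right')
  also have "\<dots> = (- 1) ^ k * eis_reg k w z"
    unfolding eis_reg_def by (subst infsum_lattice_reflect) simp
  finally show ?thesis .
qed

lemma eis_full_minus: "eis_full k w (- z) = (- 1) ^ k * eis_full k w z"
  by (simp add: eis_full_def eis_reg_minus power_minus[of z] divide_simps minus_one_power_iff)

lemma weierstrass_zeta_minus: "weierstrass_zeta w (- z) = - weierstrass_zeta w z"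
proof -
  have "zeta_reg w (- z) = (\<Sum>\<^sub>\<infinity>\<omega>\<in>period_lattice w - {0}. - (1 / (z - (- \<omega>)) + 1 / (- \<omega>) + z / (- \<omega>) ^ 2))"
    unfolding zeta_reg_def
  proof (rule infsum_cong)
    fix \<omega>
    have "1 / (- z - \<omega>) = - (1 / (z + \<omega>))"
      by (metis add.commute minus_add_distrib minus_divide_right uminus_add_conv_diff)
    then show "1 / (- z - \<omega>) + 1 / \<omega> + - z / \<omega> ^ 2 = - (1 / (z - (- \<omega>)) + 1 / (- \<omega>) + z / (- \<omega>) ^ 2)"
      by simp
  qed
  also have "\<dots> = - (\<Sum>\<^sub>\<infinity>\<omega>\<in>period_lattice w - {0}. 1 / (z - (- \<omega>)) + 1 / (- \<omega>) + z / (- \<omega>) ^ 2)"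
    by (rule infsum_uminus)
  also have "\<dots> = - zeta_reg w z"
    unfolding zeta_reg_def by (subst infsum_lattice_reflect) simp
  finally show ?thesis by (simp add: weierstrass_zeta_eq)
qed

lemma eis_reg_0: "eis_reg k w 0 = lattice_sum k w 0"
  using infsum_lattice_reflect(2)[of "\<lambda>\<omega>. 1 / \<omega> ^ k" w] by (simp add: eis_reg_def lattice_sum_def)

lemma lattice_sum_odd: "odd k \<Longrightarrow> lattice_sum k w 0 = 0"
  using eis_reg_minus[of k w 0] by (simp add: eis_reg_0)

context
  fixes w :: "complex \<times> complex"
  assumes w: "w \<in> oriented_bases"
begin

lemma zeta_reg_deriv:
  assumes "z \<notin> period_lattice w - {0}"
  shows "(zeta_reg w has_field_derivative - wp_reg w z) (at z)"
proof -
  obtain r c where rc: "r > 0" "c > 0" "cball z r \<inter> (period_lattice w - {0}) = {}"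
    "\<And>x \<omega>. x \<in> cball z r \<Longrightarrow> \<omega> \<in> period_lattice w - {0} \<Longrightarrow> c * norm \<omega> \<le> norm (x - \<omega>)"
    using away_from_lattice[OF w assms] by metis
  define R where "R = norm z + r"
  have "((\<lambda>x. \<Sum>\<^sub>\<infinity>\<omega>\<in>period_lattice w - {0}. 1 / (x - \<omega>) + 1 / \<omega> + x / \<omega> ^ 2) has_field_derivative
      (\<Sum>\<^sub>\<infinity>\<omega>\<in>period_lattice w - {0}. - (1 / (z - \<omega>) ^ 2 - 1 / \<omega> ^ 2))) (at z)"
  proof (rule has_field_derivative_infsum)
    fix \<omega> x assume om: "\<omega> \<in> period_lattice w - {0}" and x: "x \<in> cball z r"
    have ne: "\<omega> \<noteq> 0" "x \<noteq> \<omega>" using om x rc(3) by auto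
    show "((\<lambda>x. 1 / (x - \<omega>) + 1 / \<omega> + x / \<omega> ^ 2) has_field_derivative - (1 / (x - \<omega>) ^ 2 - 1 / \<omega> ^ 2)) (at x)"
      by (auto intro!: derivative_eq_intros simp: ne power2_eq_square)
    have x': "norm x \<le> R" using x norm_triangle_ineq2[of x z] by (simp add: dist_norm R_def norm_minus_commute)
    \<comment> \<open>The two correction terms cancel the orders 1/\<omega> and 1/\<omega>^2, so the
      summand decays like |\<omega>|^(-3).\<close>
    have "1 / (x - \<omega>) + 1 / \<omega> + x / \<omega> ^ 2 = x ^ 2 / (\<omega> ^ 2 * (x - \<omega>))"
      using ne by (simp add: field_simps power2_eq_square)
    then have "norm (1 / (x - \<omega>) + 1 / \<omega> + x / \<omega> ^ 2) = norm x ^ 2 / (norm \<omega> ^ 2 * norm (x - \<omega>))"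
      by (simp add: norm_mult norm_divide norm_power)
    also have "\<dots> \<le> R ^ 2 / (norm \<omega> ^ 2 * (c * norm \<omega>))"
      using ne rc(2) rc(4)[OF x om] x' by (intro frac_le mult_mono power_mono) auto
    also have "\<dots> = R ^ 2 / c * (1 / norm \<omega> ^ 3)"
      by (simp add: power2_eq_square power3_eq_cube)
    finally show "norm (1 / (x - \<omega>) + 1 / \<omega> + x / \<omega> ^ 2) \<le> R ^ 2 / c * (1 / norm \<omega> ^ 3)" .
  next
    show "(\<lambda>\<omega>. R ^ 2 / c * (1 / norm \<omega> ^ 3)) summable_on (period_lattice w - {0})"
      by (intro summable_on_cmult_right summable_lattice_cube w)
  qed (use rc in auto)
  then show ?thesis
    unfolding zeta_reg_def wp_reg_def infsum_uminus .
qed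

lemma wp_reg_deriv:
  assumes "z \<notin> period_lattice w - {0}"
  shows "(wp_reg w has_field_derivative - 2 * eis_reg 3 w z) (at z)"
    and wp_summable: "(\<lambda>\<omega>. 1 / (z - \<omega>) ^ 2 - 1 / \<omega> ^ 2) summable_on (period_lattice w - {0})"
proof -
  obtain r c where rc: "r > 0" "c > 0" "cball z r \<inter> (period_lattice w - {0}) = {}"
    "\<And>x \<omega>. x \<in> cball z r \<Longrightarrow> \<omega> \<in> period_lattice w - {0} \<Longrightarrow> c * norm \<omega> \<le> norm (x - \<omega>)"
    using away_from_lattice[OF w assms] by metis
  define R where "R = norm z + r"
  have R: "R > 0" using rc by (simp add: R_def add_nonneg_pos)
  have bound: "norm (1 / (x - \<omega>) ^ 2 - 1 / \<omega> ^ 2) \<le> (R / c ^ 2 + R / c) * (1 / norm \<omega> ^ 3)"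
    if om: "\<omega> \<in> period_lattice w - {0}" and x: "x \<in> cball z r" for x \<omega>
  proof -
    have ne: "\<omega> \<noteq> 0" "x \<noteq> \<omega>" using om x rc(3) by auto
    have x': "norm x \<le> R" using x norm_triangle_ineq2[of x z] by (simp add: dist_norm R_def norm_minus_commute)
    \<comment> \<open>Each of the two fractions decays like |\<omega>|^(-3), although neither 1/(x -
      \<omega>)^2 nor 1/\<omega>^2 is summable.\<close>
    have "1 / (x - \<omega>) ^ 2 - 1 / \<omega> ^ 2 = x / (\<omega> * (x - \<omega>) ^ 2) - x / (\<omega> ^ 2 * (x - \<omega>))"
      using ne by (simp add: divide_simps) (simp add: power2_eq_square algebra_simps)
    then have "norm (1 / (x - \<omega>) ^ 2 - 1 / \<omega> ^ 2) \<le>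
        norm x / (norm \<omega> * norm (x - \<omega>) ^ 2) + norm x / (norm \<omega> ^ 2 * norm (x - \<omega>))"
      using norm_triangle_ineq4[of "x / (\<omega> * (x - \<omega>) ^ 2)" "x / (\<omega> ^ 2 * (x - \<omega>))"]
      by (simp add: norm_mult norm_divide norm_power)
    also have "\<dots> \<le> R / (norm \<omega> * (c * norm \<omega>) ^ 2) + R / (norm \<omega> ^ 2 * (c * norm \<omega>))"
      using ne rc(2) rc(4)[OF x om] x' R by (intro add_mono frac_le mult_mono power_mono) auto
    also have "\<dots> = (R / c ^ 2 + R / c) * (1 / norm \<omega> ^ 3)"
      by (simp add: power2_eq_square power3_eq_cube add_divide_distrib mult_ac)
    finally show ?thesis .
  qed
  have M: "(\<lambda>\<omega>. (R / c ^ 2 + R / c) * (1 / norm \<omega> ^ 3)) summable_on (period_lattice w - {0})"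
    by (intro summable_on_cmult_right summable_lattice_cube w)
  have "((\<lambda>x. \<Sum>\<^sub>\<infinity>\<omega>\<in>period_lattice w - {0}. 1 / (x - \<omega>) ^ 2 - 1 / \<omega> ^ 2) has_field_derivative
      (\<Sum>\<^sub>\<infinity>\<omega>\<in>period_lattice w - {0}. - 2 * (1 / (z - \<omega>) ^ 3))) (at z)"
  proof (rule has_field_derivative_infsum)
    fix \<omega> x assume om: "\<omega> \<in> period_lattice w - {0}" and x: "x \<in> cball z r"
    then have "x \<noteq> \<omega>" using rc(3) by auto
    from DERIV_diff[OF has_field_derivative_inverse_power_shift[OF this, of 2] DERIV_const[of "1 / \<omega> ^ 2"]]
    show "((\<lambda>x. 1 / (x - \<omega>) ^ 2 - 1 / \<omega> ^ 2) has_field_derivative - 2 * (1 / (x - \<omega>) ^ 3)) (at x)"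
      by (simp add: eval_nat_numeral)
  qed (use rc bound M in auto)
  then show "(wp_reg w has_field_derivative - 2 * eis_reg 3 w z) (at z)"
    unfolding wp_reg_def eis_reg_def infsum_cmult_right' .
  show "(\<lambda>\<omega>. 1 / (z - \<omega>) ^ 2 - 1 / \<omega> ^ 2) summable_on (period_lattice w - {0})"
    by (rule abs_summable_comparison[OF M, of _ 1]) (use bound rc(1) in auto)
qed

lemma eis_reg_deriv:
  assumes "z \<notin> period_lattice w - {0}" and k: "k \<ge> 3"
  shows "(eis_reg k w has_field_derivative - of_nat k * eis_reg (Suc k) w z) (at z)"
    and eis_summable: "(\<lambda>\<omega>. 1 / (z - \<omega>) ^ k) summable_on (period_lattice w - {0})"
proof -
  obtain r c where rc: "r > 0" "c > 0" "cball z r \<inter> (period_lattice w - {0}) = {}"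
    "\<And>x \<omega>. x \<in> cball z r \<Longrightarrow> \<omega> \<in> period_lattice w - {0} \<Longrightarrow> c * norm \<omega> \<le> norm (x - \<omega>)"
    using away_from_lattice[OF w assms(1)] by metis
  have bound: "norm (1 / (x - \<omega>) ^ k) \<le> 1 / c ^ k * (1 / norm \<omega> ^ k)"
    if "\<omega> \<in> period_lattice w - {0}" "x \<in> cball z r" for x \<omega>
  proof -
    have "(c * norm \<omega>) ^ k \<le> norm (x - \<omega>) ^ k"
      using rc that by (intro power_mono) auto
    moreover have "0 < (c * norm \<omega>) ^ k" using that rc(2) by simp
    ultimately show ?thesis
      by (simp add: norm_divide norm_power power_mult_distrib frac_le)
  qed
  have M: "(\<lambda>\<omega>. 1 / c ^ k * (1 / norm \<omega> ^ k)) summable_on (period_lattice w - {0})"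
    using summable_on_cmult_right[OF summable_lattice_power[OF w k]] by blast
  have "((\<lambda>x. \<Sum>\<^sub>\<infinity>\<omega>\<in>period_lattice w - {0}. 1 / (x - \<omega>) ^ k) has_field_derivative
      (\<Sum>\<^sub>\<infinity>\<omega>\<in>period_lattice w - {0}. - of_nat k * (1 / (z - \<omega>) ^ Suc k))) (at z)"
  proof (rule has_field_derivative_infsum)
    fix \<omega> x assume om: "\<omega> \<in> period_lattice w - {0}" and x: "x \<in> cball z r"
    have ne: "\<omega> \<noteq> 0" "x \<noteq> \<omega>" using om x rc(3) by auto
    show "((\<lambda>x. 1 / (x - \<omega>) ^ k) has_field_derivative - of_nat k * (1 / (x - \<omega>) ^ Suc k)) (at x)"
      by (rule has_field_derivative_inverse_power_shift[OF ne(2)])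
  qed (use rc bound M in auto)
  then show "(eis_reg k w has_field_derivative - of_nat k * eis_reg (Suc k) w z) (at z)"
    unfolding eis_reg_def infsum_cmult_right' .
  show "(\<lambda>\<omega>. 1 / (z - \<omega>) ^ k) summable_on (period_lattice w - {0})"
    by (rule abs_summable_comparison[OF M, of _ 1]) (use bound rc(1) in auto)
qed

lemma eis_full_infsum:
  assumes "z \<notin> period_lattice w - {0}" "k \<ge> 3"
  shows "eis_full k w z = (\<Sum>\<^sub>\<infinity>\<omega>\<in>period_lattice w. 1 / (z - \<omega>) ^ k)"
proof -
  have "(\<Sum>\<^sub>\<infinity>\<omega>\<in>insert 0 (period_lattice w - {0}). 1 / (z - \<omega>) ^ k) = 1 / (z - 0) ^ k + eis_reg k w z"
    unfolding eis_reg_def by (rule infsum_insert[OF eis_summable[OF assms]]) simp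
  then show ?thesis by (simp add: eis_full_def insert_absorb)
qed

lemma lattice_sum_eq_eis_full:
  assumes "a \<notin> period_lattice w" "k \<ge> 3"
  shows "lattice_sum k w a = eis_full k w a"
proof -
  have "a \<noteq> 0" using assms by auto
  then show ?thesis
    using infsum_lattice_reflect(1)[of "\<lambda>\<omega>. 1 / (\<omega> + a) ^ k" w] assms
    by (simp add: lattice_sum_def eis_full_infsum)
qed

lemma eis_full_period:
  assumes "z \<notin> period_lattice w" "\<mu> \<in> period_lattice w" "k \<ge> 3"
  shows "eis_full k w (z + \<mu>) = eis_full k w z"
proof -
  have "(\<Sum>\<^sub>\<infinity>\<omega>\<in>period_lattice w. 1 / (z - \<omega>) ^ k) = (\<Sum>\<^sub>\<infinity>\<omega>\<in>period_lattice w. 1 / (z + \<mu> - \<omega>) ^ k)"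
    by (rule infsum_reindex_bij_witness[of _ "\<lambda>\<omega>. \<omega> - \<mu>" "\<lambda>\<omega>. \<omega> + \<mu>"]) (use assms in \<open>auto simp: algebra_simps\<close>)
  then show ?thesis using assms by (simp add: eis_full_infsum)
qed

lemma weierstrass_zeta_deriv:
  assumes "z \<notin> period_lattice w"
  shows "(weierstrass_zeta w has_field_derivative - weierstrass_p w z) (at z)"
proof -
  have "z \<noteq> 0" using assms by auto
  have "((\<lambda>z. 1 / z + zeta_reg w z) has_field_derivative - weierstrass_p w z) (at z)"
    by (rule derivative_eq_intros zeta_reg_deriv refl | use assms \<open>z \<noteq> 0\<close> in \<open>force simp: weierstrass_p_eq power2_eq_square\<close>)+
  then show ?thesis by (simp add: weierstrass_zeta_eq[abs_def])
qed

lemma weierstrass_p_deriv: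
  assumes "z \<notin> period_lattice w"
  shows "(weierstrass_p w has_field_derivative - 2 * eis_full 3 w z) (at z)"
proof -
  have "z \<noteq> 0" using assms by auto
  have "((\<lambda>z. 1 / z ^ 2) has_field_derivative - 2 / z ^ 3) (at z)"
    using has_field_derivative_inverse_power_shift[OF \<open>z \<noteq> 0\<close>, of 2] by (simp add: eval_nat_numeral)
  from DERIV_add[OF this wp_reg_deriv(1)[of z]] show ?thesis
    using assms by (simp add: weierstrass_p_eq[abs_def] eis_full_def algebra_simps)
qed

lemma eis_full_deriv:
  assumes "z \<notin> period_lattice w" "k \<ge> 3"
  shows "(eis_full k w has_field_derivative - of_nat k * eis_full (Suc k) w z) (at z)"
proof -
  have "z \<noteq> 0" using assms by auto
  have "((\<lambda>z. 1 / z ^ k) has_field_derivative - of_nat k / z ^ Suc k) (at z)"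
    using has_field_derivative_inverse_power_shift[OF \<open>z \<noteq> 0\<close>, of k] by simp
  from DERIV_add[OF this eis_reg_deriv(1)[of z k]] show ?thesis
    using assms by (simp add: eis_full_def[abs_def] algebra_simps)
qed

lemma open_compl_lattice: "open (- (period_lattice w))" "open (- (period_lattice w - {0}))"
  using closed_lattice_subset[OF w] by blast+

lemma connected_compl_lattice: "connected (- (period_lattice w))"
  using connected_open_diff_countable[of "UNIV :: complex set" "period_lattice w"]
  by (simp add: Compl_eq_Diff_UNIV connected_UNIV)

text \<open>The difference F(z + \<mu>) - F(z) has derivative 0, and the complement of a countable
  set is connected. For \<wp> the constant turns out to be 0; for \<zeta> it is the
  quasi-period.\<close>

lemma quasi_period:
  assumes F: "\<And>z. z \<notin> period_lattice w \<Longrightarrow> (F has_field_derivative f z) (at z)"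
    and f: "\<And>z. z \<notin> period_lattice w \<Longrightarrow> f (z + \<mu>) = f z"
    and \<mu>: "\<mu> \<in> period_lattice w"
  obtains c where "\<And>z. z \<notin> period_lattice w \<Longrightarrow> F (z + \<mu>) = F z + c"
proof -
  have "(\<lambda>z. F (z + \<mu>) - F z) constant_on (- period_lattice w)"
  proof (rule has_field_derivative_0_imp_constant_on)
    fix z assume z: "z \<in> - period_lattice w"
    have "((\<lambda>z. F (z + \<mu>)) has_field_derivative f (z + \<mu>)) (at z)"
      using DERIV_shift[of F "f (z + \<mu>)" z \<mu>] F[of "z + \<mu>"] z \<mu> by simp
    from DERIV_diff[OF this F[of z]] show "((\<lambda>z. F (z + \<mu>) - F z) has_field_derivative 0) (at z)"
      using z f by simp
  qed (use open_compl_lattice connected_compl_lattice in auto)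
  then obtain c where "\<And>z. z \<in> - period_lattice w \<Longrightarrow> F (z + \<mu>) - F z = c"
    by (auto simp: constant_on_def)
  then show ?thesis by (intro that[of c]) (simp add: algebra_simps)
qed

text \<open>This detour over the basis vectors is taken because the argument for \<wp> applies to a
  period only if half of it lies off the lattice.\<close>

lemma lattice_period_induct:
  assumes "\<And>z. z \<notin> period_lattice w \<Longrightarrow> f (z + fst w) = f z"
    and "\<And>z. z \<notin> period_lattice w \<Longrightarrow> f (z + snd w) = f z"
    and z: "z \<notin> period_lattice w" and "\<mu> \<in> period_lattice w"
  shows "f (z + \<mu>) = (f z :: complex)"
proof -
  have mult: "f (z + of_int m * b) = f z"
    if b: "b \<in> period_lattice w" and per: "\<And>z. z \<notin> period_lattice w \<Longrightarrow> f (z + b) = f z"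
      and z: "z \<notin> period_lattice w" for b z and m :: int
  proof (induction m rule: int_induct[of _ 0])
    case (step1 i)
    have "of_int i * b \<in> period_lattice w"
      using b by (intro lattice_multiple) 
    then show ?case using per[of "z + of_int i * b"] step1 z by (simp add: algebra_simps)
  next
    case (step2 i)
    have "of_int (i - 1) * b \<in> period_lattice w"
      using b by (intro lattice_multiple)
    then have "z + of_int (i - 1) * b \<notin> period_lattice w" using z by (simp only: lattice_add_iff not_False_eq_True)
    from per[OF this] show ?case using step2 by (simp add: algebra_simps)
  qed simp
  obtain m n :: int where mn: "\<mu> = of_int m * fst w + of_int n * snd w"
    using assms(4) unfolding period_lattice_def mem_Collect_eq by metis
  have "of_int m * fst w \<in> period_lattice w" by (intro lattice_multiple) simp
  then have "f (z + of_int m * fst w + of_int n * snd w) = f (z + of_int m * fst w)"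
    using z by (intro mult assms(2)) auto
  also have "\<dots> = f z" using z by (intro mult assms(1)) auto
  finally show ?thesis by (simp add: mn add.assoc)
qed

lemma half_basis_notin: "fst w / 2 \<notin> period_lattice w" "snd w / 2 \<notin> period_lattice w"
  "(fst w + snd w) / 2 \<notin> period_lattice w"
  using lattice_coset_not_half[OF w, of 2 1 0] lattice_coset_not_half[OF w, of 2 0 1]
    lattice_coset_not_half[OF w, of 2 1 1] by auto

text \<open>The derivative of \<wp> is a periodic sum, so only a constant is in doubt; evaluation at
  -b/2, where evenness gives equal values, shows that it is 0.\<close>

lemma weierstrass_p_period:
  assumes "z \<notin> period_lattice w" "\<mu> \<in> period_lattice w"
  shows "weierstrass_p w (z + \<mu>) = weierstrass_p w z"
proof -
  have per: "weierstrass_p w (z + b) = weierstrass_p w z"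
    if b: "b \<in> period_lattice w" "b / 2 \<notin> period_lattice w" "z \<notin> period_lattice w" for b z
  proof -
    obtain c where c: "\<And>z. z \<notin> period_lattice w \<Longrightarrow> weierstrass_p w (z + b) = weierstrass_p w z + c"
      by (rule quasi_period[of "weierstrass_p w" "\<lambda>z. - 2 * eis_full 3 w z" b])
         (use weierstrass_p_deriv eis_full_period[of _ b 3] b(1) in auto)
    have "weierstrass_p w (- (b / 2) + b) = weierstrass_p w (- (b / 2)) + c"
      using b by (intro c) (simp only: lattice_minus not_False_eq_True)
    then have "c = 0" using weierstrass_p_minus[of w "b / 2"] by simp
    with c b show ?thesis by simp
  qed
  show ?thesis
    by (rule lattice_period_induct[OF per per assms]) (use half_basis_notin in auto)
qed

lemma weierstrass_zeta_period:
  assumes "\<mu> \<in> period_lattice w"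
  obtains c where "\<And>z. z \<notin> period_lattice w \<Longrightarrow> weierstrass_zeta w (z + \<mu>) = weierstrass_zeta w z + c"
  using quasi_period[of "weierstrass_zeta w" "\<lambda>z. - weierstrass_p w z" \<mu>] weierstrass_zeta_deriv weierstrass_p_period assms
  by auto

end

subsection \<open>Elliptic functions\<close>

lemma higher_deriv_tower:
  fixes F :: "nat \<Rightarrow> complex \<Rightarrow> complex"
  assumes "open S" and F: "\<And>k z. z \<in> S \<Longrightarrow> (F k has_field_derivative F (Suc k) z) (at z)" and "z \<in> S"
  shows "(deriv ^^ k) (F 0) z = F k z"
  using \<open>z \<in> S\<close>
proof (induction k arbitrary: z)
  case (Suc k)
  have "deriv ((deriv ^^ k) (F 0)) z = deriv (F k) z"
    using eventually_nhds_in_open[OF \<open>open S\<close> Suc.prems] Suc.IH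
    by (intro deriv_cong_ev) (auto elim: eventually_mono)
  then show ?case using F[OF Suc.prems] by (simp add: DERIV_imp_deriv)
qed simp

text \<open>The quotient \<open>s\<close> is the sum of the shifted power series, hence holomorphic
  at 0 as well. It allows poles to be cancelled explicitly before passing to a limit.\<close>

lemma taylor_remainder_holomorphic:
  fixes f :: "complex \<Rightarrow> complex"
  assumes f: "f holomorphic_on ball 0 r"
  obtains s where "s holomorphic_on ball 0 r"
    "\<And>z. z \<in> ball 0 r \<Longrightarrow> f z = (\<Sum>k<n. (deriv ^^ k) f 0 / fact k * z ^ k) + z ^ n * s z"
proof -
  define a where "a k = (deriv ^^ k) f 0 / fact k" for k
  define s where "s z = (if z = 0 then a n else (f z - (\<Sum>k<n. a k * z ^ k)) / z ^ n)" for z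
  have eq: "f z = (\<Sum>k<n. a k * z ^ k) + z ^ n * s z" if "z \<in> ball 0 r" for z
  proof (cases "z = 0")
    case True
    have "f 0 = a 0" by (simp add: a_def)
    then show ?thesis using True
      by (cases n) (simp_all add: s_def sum.lessThan_Suc_shift del: sum.lessThan_Suc)
  qed (simp add: s_def)
  have sums: "(\<lambda>k. a (k + n) * (z - 0) ^ k) sums s z" if "z \<in> ball 0 r" for z
  proof (cases "z = 0")
    case True
    then show ?thesis using powser_sums_zero[of "\<lambda>k. a (k + n)"] by (simp add: s_def)
  next
    case False
    have "(\<lambda>k. a k * z ^ k) sums f z"
      using holomorphic_power_series[OF f that] by (simp add: a_def)
    then have "(\<lambda>k. a (k + n) * z ^ (k + n)) sums (f z - (\<Sum>k<n. a k * z ^ k))"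
      by (rule sums_split_initial_segment)
    from sums_mult[OF this, of "1 / z ^ n"] show ?thesis
      using False by (simp add: s_def power_add)
  qed
  have "s holomorphic_on ball 0 r" by (rule power_series_holomorphic[OF sums])
  with eq show ?thesis by (intro that[of s]) (simp_all add: a_def)
qed

context
  fixes w :: "complex \<times> complex"
  assumes w: "w \<in> oriented_bases"
begin

lemma fundamental_parallelogram:
  obtains K where "compact K" "\<And>z. \<exists>\<mu>\<in>period_lattice w. z + \<mu> \<in> K"
proof -
  define t where "t = snd w / fst w"
  have im: "Im t > 0" and w0: "fst w \<noteq> 0"
    using w by (auto simp: oriented_bases_def t_def case_prod_beta)
  define K where "K = (\<lambda>p. of_real (fst p) * fst w + of_real (snd p) * snd w) ` ({0..1::real} \<times> {0..1::real})"
  have "compact K" unfolding K_def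
    by (intro compact_continuous_image continuous_intros compact_Times) auto
  moreover have "\<exists>\<mu>\<in>period_lattice w. z + \<mu> \<in> K" for z
  proof -
    define v where "v = Im (z / fst w) / Im t"
    define u where "u = Re (z / fst w) - v * Re t"
    have "z / fst w = of_real u + of_real v * t"
      using im by (simp add: complex_eq_iff u_def v_def)
    then have z: "z = of_real u * fst w + of_real v * snd w"
      using w0 by (simp add: t_def field_simps)
    define \<mu> where "\<mu> = of_int (- \<lfloor>u\<rfloor>) * fst w + of_int (- \<lfloor>v\<rfloor>) * snd w"
    have "\<mu> \<in> period_lattice w" unfolding \<mu>_def period_lattice_def by blast
    moreover have "z + \<mu> = of_real (frac u) * fst w + of_real (frac v) * snd w"
      by (simp add: z \<mu>_def frac_def algebra_simps)
    then have "z + \<mu> \<in> K" unfolding K_def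
      by (intro image_eqI[of _ _ "(frac u, frac v)"]) (auto simp: frac_lt_1 less_imp_le)
    ultimately show ?thesis by blast
  qed
  ultimately show ?thesis by (rule that)
qed

text \<open>Liouville's theorem: finite limits at 0 and \<open>a\<close> make all singularities
  removable, since the others are translates of these, and the entire extension takes all its values
  on a compact parallelogram. The second point \<open>a\<close> serves functions built from z and z
  - a; a = 0 is allowed.\<close>

lemma elliptic_constant:
  fixes f :: "complex \<Rightarrow> complex" and a :: complex
  defines S_def: "S \<equiv> period_lattice w \<union> {z. z - a \<in> period_lattice w}"
  assumes hol: "f holomorphic_on - S"
    and per: "\<And>z \<mu>. z \<notin> S \<Longrightarrow> \<mu> \<in> period_lattice w \<Longrightarrow> f (z + \<mu>) = f z"
    and l0: "(f \<longlongrightarrow> l0) (at 0)" and la: "(f \<longlongrightarrow> la) (at a)"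
    and z: "z \<notin> S"
  shows "f z = l0"
proof -
  define F where "F z = (if z \<in> period_lattice w then l0 else if z - a \<in> period_lattice w then la else f z)" for z
  have S_period: "z + \<mu> \<in> S \<longleftrightarrow> z \<in> S" if "\<mu> \<in> period_lattice w" for z \<mu>
  proof -
    have "z + \<mu> - a = (z - a) + \<mu>" by simp
    then have "z + \<mu> - a \<in> period_lattice w \<longleftrightarrow> z - a \<in> period_lattice w"
      using lattice_add_iff(1)[OF that, of "z - a"] by (simp only:)
    then show ?thesis using that by (simp add: S_def)
  qed
  have F_period: "F (z + \<mu>) = F z" if "\<mu> \<in> period_lattice w" for z \<mu>
  proof -
    have "z + \<mu> - a = (z - a) + \<mu>" by simp
    then have "z + \<mu> - a \<in> period_lattice w \<longleftrightarrow> z - a \<in> period_lattice w"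
      using lattice_add_iff(1)[OF that, of "z - a"] by (simp only:)
    then show ?thesis using that per[of z \<mu>] by (simp add: F_def S_def)
  qed
  have closed: "closed T" if T: "T \<subseteq> S" for T
  proof -
    have "closed (T \<inter> period_lattice w)" by (rule closed_lattice_subset[OF w]) auto
    moreover have "closed ((\<lambda>z. a + z) ` {z. a + z \<in> T \<and> z \<in> period_lattice w})"
      by (intro closed_translation closed_lattice_subset[OF w]) auto
    moreover have "T = (T \<inter> period_lattice w) \<union> ((\<lambda>z. a + z) ` {z. a + z \<in> T \<and> z \<in> period_lattice w})"
    proof -
      have "z \<in> (\<lambda>z. a + z) ` {z. a + z \<in> T \<and> z \<in> period_lattice w}" if "z \<in> T" "z - a \<in> period_lattice w" for z
        using that by (intro image_eqI[of _ _ "z - a"]) auto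
      then show ?thesis using T unfolding S_def by auto
    qed
    ultimately show ?thesis by (metis closed_Un)
  qed
  \<comment> \<open>Periodicity carries the limit at a base point \<open>b\<close>, which will be 0
    or \<open>a\<close>, to every translate \<open>p\<close>.\<close>
  have transfer: "(F \<longlongrightarrow> F p) (at p)"
    if "(f \<longlongrightarrow> F b) (at b)" "p - b \<in> period_lattice w" "b \<in> S" for p b
  proof -
    have "F p = F b" using F_period[OF that(2), of b] by simp
    have "open (- (S - {p}))" using closed[of "S - {p}"] by blast
    then have "\<forall>\<^sub>F z in at p. z \<in> - (S - {p}) - {p}"
      by (intro eventually_at_in_open) auto
    then have ev: "\<forall>\<^sub>F z in at p. f (z - (p - b)) = F z"
    proof eventually_elim
      case (elim z)
      then have "z \<notin> S" by auto
      then have "z - (p - b) \<notin> S" using S_period[OF that(2), of "z - (p - b)"] by simp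
      then have "F (z - (p - b)) = f (z - (p - b))" by (auto simp: F_def S_def)
      moreover have "F (z - (p - b)) = F z" using F_period[OF that(2), of "z - (p - b)"] by simp
      ultimately show ?case by simp
    qed
    have "((\<lambda>z. f (z - (p - b))) \<longlongrightarrow> F b) (at p)"
      using LIM_offset[OF that(1), of "- (p - b)"] by (simp add: algebra_simps)
    then show ?thesis using ev \<open>F p = F b\<close> by (auto elim: Lim_transform_eventually)
  qed
  have lim: "(F \<longlongrightarrow> F p) (at p)" if "p \<in> S" for p
  proof (cases "p \<in> period_lattice w")
    case True
    then show ?thesis using transfer[of 0 p] l0 by (simp add: F_def S_def)
  next
    case False
    then have pa: "p - a \<in> period_lattice w" using that by (auto simp: S_def)
    then have "a \<notin> period_lattice w" using False by (metis lattice_add_iff(1) diff_add_cancel)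
    then show ?thesis using transfer[of a p] la pa by (simp add: F_def S_def)
  qed
  have "F field_differentiable at p" for p
  proof -
    have op: "open (- (S - {p}))" using closed[of "S - {p}"] by blast
    have "F holomorphic_on (- (S - {p}))"
    proof (rule no_isolated_singularity'[OF _ _ op, of "{p} \<inter> S"])
      show "(F \<longlongrightarrow> F z) (at z within - (S - {p}))" if "z \<in> {p} \<inter> S" for z
        using lim[of z] that by (auto intro: tendsto_within_subset)
      have "F holomorphic_on - S"
        by (rule holomorphic_transform[OF hol]) (auto simp: F_def S_def)
      moreover have "- (S - {p}) - {p} \<inter> S = - S" by auto
      ultimately show "F holomorphic_on - (S - {p}) - {p} \<inter> S" by simp
    qed auto
    then show ?thesis using op by (auto simp: holomorphic_on_open field_differentiable_def)
  qed
  then have holF: "F holomorphic_on UNIV" by (simp add: holomorphic_on_def)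
  obtain K where K: "compact K" "\<And>z. \<exists>\<mu>\<in>period_lattice w. z + \<mu> \<in> K"
    using fundamental_parallelogram by blast
  have "range F \<subseteq> F ` K"
  proof
    fix y assume "y \<in> range F"
    then obtain z where "y = F z" by auto
    moreover obtain \<mu> where "\<mu> \<in> period_lattice w" "z + \<mu> \<in> K" using K(2) by blast
    ultimately show "y \<in> F ` K" using F_period[of \<mu> z] by (intro image_eqI[of _ _ "z + \<mu>"]) auto
  qed
  moreover have "compact (F ` K)"
    using holF K(1) by (intro compact_continuous_image) (auto intro: continuous_on_subset holomorphic_on_imp_continuous_on)
  ultimately have "bounded (range F)" using compact_imp_bounded bounded_subset by blast
  then have "F constant_on UNIV" using Liouville_theorem[OF holF] by blast
  then have "F z = F 0" by (auto simp: constant_on_def)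
  then show ?thesis using z by (simp add: F_def S_def)
qed

lemma holomorphic_off_lattice:
  assumes "A \<inter> period_lattice w = {}"
  shows "weierstrass_p w holomorphic_on A" "weierstrass_zeta w holomorphic_on A"
    "k \<ge> 3 \<Longrightarrow> eis_full k w holomorphic_on A"
proof -
  have "A \<subseteq> - period_lattice w" using assms by auto
  moreover have "weierstrass_p w holomorphic_on - period_lattice w" "weierstrass_zeta w holomorphic_on - period_lattice w"
    "k \<ge> 3 \<Longrightarrow> eis_full k w holomorphic_on - period_lattice w"
    using open_compl_lattice(1)[OF w] weierstrass_p_deriv[OF w] weierstrass_zeta_deriv[OF w] eis_full_deriv[OF w, of _ k]
    unfolding holomorphic_on_open[OF open_compl_lattice(1)[OF w]] by blast+
  ultimately show "weierstrass_p w holomorphic_on A" "weierstrass_zeta w holomorphic_on A"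
    "k \<ge> 3 \<Longrightarrow> eis_full k w holomorphic_on A"
    by (auto intro: holomorphic_on_subset)
qed

text \<open>The index 0 is excluded because \<open>wp_reg\<close> itself carries the subtracted
  terms 1/\<omega>^2; its derivatives are plain sums.\<close>

lemma wp_reg_higher_deriv:
  assumes "z \<notin> period_lattice w - {0}" "k > 0"
  shows "(deriv ^^ k) (wp_reg w) z = (- 1) ^ k * fact (Suc k) * eis_reg (k + 2) w z"
proof -
  define F where "F k = (if k = 0 then wp_reg w else (\<lambda>z. (- 1) ^ k * fact (Suc k) * eis_reg (k + 2) w z))" for k
  have "(deriv ^^ k) (F 0) z = F k z"
  proof (rule higher_deriv_tower[OF open_compl_lattice(2)[OF w]])
    fix k z assume "z \<in> - (period_lattice w - {0})"
    then have z: "z \<notin> period_lattice w - {0}" by blast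
    show "(F k has_field_derivative F (Suc k) z) (at z)"
    proof (cases "k = 0")
      case True
      then show ?thesis using wp_reg_deriv(1)[OF w z] by (simp add: F_def numeral_3_eq_3)
    next
      case False
      then have "3 \<le> k + 2" by simp
      from DERIV_cmult[OF eis_reg_deriv(1)[OF w z this], of "(- 1) ^ k * fact (Suc k)"]
      show ?thesis using False by (simp add: F_def algebra_simps)
    qed
  qed (use assms in blast)
  then show ?thesis using assms(2) by (simp add: F_def)
qed

text \<open>The odd lattice sums vanish under \<omega> -> -\<omega>. The remainder has order 5
  because the cubic relation multiplies it by z^(-4) and must still show its constant term.\<close>

lemma wp_reg_expansion:
  obtains r s where "r > 0" "s holomorphic_on ball 0 r" "ball 0 r \<inter> (period_lattice w - {0}) = {}"
    "\<And>z. z \<in> ball 0 r \<Longrightarrow>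
      wp_reg w z = 3 * lattice_sum 4 w 0 * z ^ 2 + 5 * lattice_sum 6 w 0 * z ^ 4 + z ^ 5 * s z"
proof -
  obtain r where "r > 0" "cball 0 r \<inter> (period_lattice w - {0}) = {}"
    by (rule away_from_lattice[OF w, of 0]) auto
  then have r: "r > 0" "ball 0 r \<inter> (period_lattice w - {0}) = {}"
    using ball_subset_cball[of 0 r] by blast+
  have hol: "wp_reg w holomorphic_on ball 0 r"
  proof (subst holomorphic_on_open, simp, intro ballI)
    fix z :: complex assume "z \<in> ball 0 r"
    then have "z \<notin> period_lattice w - {0}" using r(2) by blast
    from wp_reg_deriv(1)[OF w this] show "\<exists>f'. (wp_reg w has_field_derivative f') (at z)" by blast
  qed
  define c where "c k = (deriv ^^ k) (wp_reg w) 0 / fact k" for k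
  obtain s where s: "s holomorphic_on ball 0 r"
    "\<And>z. z \<in> ball 0 r \<Longrightarrow> wp_reg w z = (\<Sum>k<5. c k * z ^ k) + z ^ 5 * s z"
    using taylor_remainder_holomorphic[OF hol, of 5] unfolding c_def by blast
  have c: "c k = (- 1) ^ k * of_nat (Suc k) * lattice_sum (k + 2) w 0" if "k > 0" for k
    using wp_reg_higher_deriv[of 0 k] that by (simp add: c_def eis_reg_0)
  have c0: "c 0 = 0" by (simp add: c_def)
  have "c 1 = 0" "c 2 = 3 * lattice_sum 4 w 0" "c 3 = 0" "c 4 = 5 * lattice_sum 6 w 0"
    by (subst c; simp add: lattice_sum_odd)+
  moreover have "(\<Sum>k<5. c k * z ^ k) = c 0 + c 1 * z + c 2 * z ^ 2 + c 3 * z ^ 3 + c 4 * z ^ 4" for z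
    by (simp add: lessThan_nat_numeral)
  ultimately have "(\<Sum>k<5. c k * z ^ k) = 3 * lattice_sum 4 w 0 * z ^ 2 + 5 * lattice_sum 6 w 0 * z ^ 4" for z
    using c0 by simp
  with s r show ?thesis by (intro that[of r s]) auto
qed

text \<open>As \<wp>'' = 6 E_4, this is the classical \<wp>'' = 6 \<wp>^2 - 30 G_4. The poles
  cancel, and the difference tends to G_4 - 6 G_4 at 0.\<close>

theorem weierstrass_p_second_order:
  assumes "z \<notin> period_lattice w"
  shows "eis_full 4 w z = weierstrass_p w z ^ 2 - 5 * lattice_sum 4 w 0"
proof -
  obtain r s where rs: "r > 0" "s holomorphic_on ball 0 r" "ball 0 r \<inter> (period_lattice w - {0}) = {}"
    "\<And>z. z \<in> ball 0 r \<Longrightarrow>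
      wp_reg w z = 3 * lattice_sum 4 w 0 * z ^ 2 + 5 * lattice_sum 6 w 0 * z ^ 4 + z ^ 5 * s z"
    using wp_reg_expansion by blast
  define A B where "A = 3 * lattice_sum 4 w 0" and "B = 5 * lattice_sum 6 w 0"
  have s: "(s \<longlongrightarrow> s 0) (at 0)"
    using continuous_on_eq_continuous_at[of "ball 0 r" s] holomorphic_on_imp_continuous_on[OF rs(2)] rs(1)
    by (simp add: isCont_def)
  have e: "(eis_reg 4 w \<longlongrightarrow> eis_reg 4 w 0) (at 0)"
    using DERIV_isCont[OF eis_reg_deriv(1)[OF w, of 0 4]] by (simp add: isCont_def)
  define f where "f z = eis_full 4 w z - weierstrass_p w z ^ 2" for z
  define g where "g z = eis_reg 4 w z - 2 * (A + B * z ^ 2 + z ^ 3 * s z) - (A * z ^ 2 + B * z ^ 4 + z ^ 5 * s z) ^ 2" for z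
  have "(g \<longlongrightarrow> - 5 * lattice_sum 4 w 0) (at 0)"
    unfolding g_def by (rule tendsto_eq_intros s e refl)+ (simp add: eis_reg_0 A_def)
  moreover have "\<forall>\<^sub>F z in at 0. g z = f z"
  proof -
    have "\<forall>\<^sub>F z in at 0. z \<in> ball 0 r - {0}"
      using rs(1) by (intro eventually_at_in_open) auto
    then show ?thesis
    proof eventually_elim
      case (elim z)
      then have "z \<noteq> 0" "wp_reg w z = A * z ^ 2 + B * z ^ 4 + z ^ 5 * s z" using rs(4) by (auto simp: A_def B_def)
      then show ?case
        by (simp add: f_def g_def eis_full_def weierstrass_p_eq field_simps) (simp add: eval_nat_numeral algebra_simps)
    qed
  qed
  ultimately have lim: "(f \<longlongrightarrow> - 5 * lattice_sum 4 w 0) (at 0)" by (rule Lim_transform_eventually)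
  have "f z = - 5 * lattice_sum 4 w 0"
  proof (rule elliptic_constant[of f 0, OF _ _ lim lim])
    show "f holomorphic_on - (period_lattice w \<union> {z. z - 0 \<in> period_lattice w})"
      unfolding f_def by (intro holomorphic_intros holomorphic_off_lattice) auto
  qed (use assms weierstrass_p_period[OF w] eis_full_period[OF w] in \<open>auto simp: f_def\<close>)
  then show ?thesis by (simp add: f_def algebra_simps)
qed

text \<open>As \<wp>' = -2 E_3, this is the differential equation of \<wp>; all poles of the
  combination \<open>f\<close> cancel, so it equals its limit at 0.\<close>

theorem weierstrass_p_cubic:
  assumes "z \<notin> period_lattice w"
  shows "4 * eis_full 3 w z ^ 2 =
    4 * weierstrass_p w z ^ 3 - 60 * lattice_sum 4 w 0 * weierstrass_p w z - 140 * lattice_sum 6 w 0"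
proof -
  obtain r s where rs: "r > 0" "s holomorphic_on ball 0 r" "ball 0 r \<inter> (period_lattice w - {0}) = {}"
    "\<And>z. z \<in> ball 0 r \<Longrightarrow>
      wp_reg w z = 3 * lattice_sum 4 w 0 * z ^ 2 + 5 * lattice_sum 6 w 0 * z ^ 4 + z ^ 5 * s z"
    using wp_reg_expansion by blast
  define A B where "A = 3 * lattice_sum 4 w 0" and "B = 5 * lattice_sum 6 w 0"
  define s' where "s' = deriv s"
  have cont: "(g \<longlongrightarrow> g 0) (at 0)" if "g holomorphic_on ball 0 r" for g
    using continuous_on_eq_continuous_at[of "ball 0 r" g] holomorphic_on_imp_continuous_on[OF that] rs(1)
    by (simp add: isCont_def)
  have s: "(s \<longlongrightarrow> s 0) (at 0)" "(s' \<longlongrightarrow> s' 0) (at 0)"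
    unfolding s'_def using rs by (auto intro!: cont holomorphic_deriv)
  define R where "R z = A * z ^ 2 + B * z ^ 4 + z ^ 5 * s z" for z
  define e where "e z = - (2 * A * z + 4 * B * z ^ 3 + 5 * z ^ 4 * s z + z ^ 5 * s' z) / 2" for z
  \<comment> \<open>The expansion of E_3 is obtained by differentiating that of \<wp>, by uniqueness
    of the derivative.\<close>
  have e: "eis_reg 3 w z = e z" if "z \<in> ball 0 r" for z
  proof -
    have "(s has_field_derivative s' z) (at z)"
      using rs(2) that unfolding s'_def by (intro holomorphic_derivI) auto
    then have "(R has_field_derivative - 2 * e z) (at z)"
      unfolding R_def e_def by (auto intro!: derivative_eq_intros simp: algebra_simps)
    then have "(wp_reg w has_field_derivative - 2 * e z) (at z)"
      by (rule has_field_derivative_transform_within_open[of _ _ _ "ball 0 r"]) (use rs(4) that in \<open>auto simp: R_def A_def B_def\<close>)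
    moreover have "(wp_reg w has_field_derivative - 2 * eis_reg 3 w z) (at z)"
      using rs(3) that by (intro wp_reg_deriv(1)[OF w]) auto
    ultimately show ?thesis using DERIV_unique by fastforce
  qed
  define f where "f z = 4 * eis_full 3 w z ^ 2 - 4 * weierstrass_p w z ^ 3 + 60 * lattice_sum 4 w 0 * weierstrass_p w z" for z
  \<comment> \<open>This is \<open>f\<close> with the poles removed: in order z^(-2) the terms -8 A,
    -12 A and 20 A = 60 G_4 cancel, and the constant term is -16 B - 12 B = -28 B = -140
    G_6.\<close>
  define g where "g z = - 28 * B - 32 * z * s z - 4 * z ^ 2 * s' z + 4 * e z ^ 2
      - 12 * z ^ 2 * (A + B * z ^ 2 + z ^ 3 * s z) ^ 2 - 4 * R z ^ 3 + 20 * A * R z" for z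
  have "(g \<longlongrightarrow> - 140 * lattice_sum 6 w 0) (at 0)"
    unfolding g_def R_def e_def by (auto intro!: tendsto_eq_intros s simp: B_def)
  moreover have "\<forall>\<^sub>F z in at 0. g z = f z"
  proof -
    have "\<forall>\<^sub>F z in at 0. z \<in> ball 0 r - {0}"
      using rs(1) by (intro eventually_at_in_open) auto
    then show ?thesis
    proof eventually_elim
      case (elim z)
      then have z: "z \<noteq> 0" and R: "wp_reg w z = R z" and e: "eis_reg 3 w z = e z"
        using rs(4) e by (auto simp: A_def B_def R_def)
      have E: "eis_full 3 w z = 1 / z ^ 3 + e z" and P: "weierstrass_p w z = 1 / z ^ 2 + R z"
        by (simp_all add: eis_full_def weierstrass_p_eq R e)
      have 1: "8 * e z / z ^ 3 = - 8 * A / z ^ 2 - 16 * B - 20 * z * s z - 4 * z ^ 2 * s' z"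
        using z by (simp add: e_def field_simps) (simp add: eval_nat_numeral algebra_simps)
      have 2: "12 * R z / z ^ 4 = 12 * A / z ^ 2 + 12 * B + 12 * z * s z"
        using z by (simp add: R_def field_simps) (simp add: eval_nat_numeral algebra_simps)
      have 3: "12 * R z ^ 2 / z ^ 2 = 12 * z ^ 2 * (A + B * z ^ 2 + z ^ 3 * s z) ^ 2"
        using z by (simp add: R_def field_simps) (simp add: eval_nat_numeral algebra_simps)
      have "f z = (8 * e z / z ^ 3 + 4 * e z ^ 2) - (12 * R z / z ^ 4 + 12 * R z ^ 2 / z ^ 2 + 4 * R z ^ 3) + 20 * A * (1 / z ^ 2 + R z)"
        unfolding f_def E P using z by (simp add: A_def field_simps) (simp add: eval_nat_numeral algebra_simps)
      also have "\<dots> = g z"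
        unfolding 1 2 3 g_def by (simp add: algebra_simps)
      finally show ?case by simp
    qed
  qed
  ultimately have lim: "(f \<longlongrightarrow> - 140 * lattice_sum 6 w 0) (at 0)" by (rule Lim_transform_eventually)
  have "f z = - 140 * lattice_sum 6 w 0"
  proof (rule elliptic_constant[of f 0, OF _ _ lim lim])
    show "f holomorphic_on - (period_lattice w \<union> {z. z - 0 \<in> period_lattice w})"
      unfolding f_def by (intro holomorphic_intros holomorphic_off_lattice) auto
  qed (use assms weierstrass_p_period[OF w] eis_full_period[OF w] in \<open>auto simp: f_def\<close>)
  then show ?thesis by (simp add: f_def algebra_simps)
qed

text \<open>The classical formula (\<zeta>(x) + \<zeta>(y) + \<zeta>(t))^2 = \<wp>(x) + \<wp>(y) +
  \<wp>(t) for x + y + t = 0, at x = z, y = a - z, t = -a. Quasi-periods cancel in \<zeta>(z) -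
  \<zeta>(z - a), and the double poles cancel against \<wp>; the simple pole at 0 disappears since
  the regular part \<open>v\<close> vanishes there.\<close>

lemma weierstrass_zeta_square:
  assumes a: "a \<notin> period_lattice w" and z: "z \<notin> period_lattice w" "z - a \<notin> period_lattice w"
  shows "(weierstrass_zeta w z - weierstrass_zeta w (z - a) - weierstrass_zeta w a) ^ 2 =
    weierstrass_p w z + weierstrass_p w (z - a) + weierstrass_p w a"
proof -
  define u where "u z = weierstrass_zeta w z - weierstrass_zeta w (z - a) - weierstrass_zeta w a" for z
  define f where "f z = u z ^ 2 - weierstrass_p w z - weierstrass_p w (z - a)" for z
  define v where "v z = zeta_reg w z - weierstrass_zeta w (z - a) - weierstrass_zeta w a" for z
  have ma: "- a \<notin> period_lattice w" using a by simp
  have dv: "(v has_field_derivative weierstrass_p w a) (at 0)"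
  proof -
    have "((\<lambda>z. weierstrass_zeta w (z - a)) has_field_derivative - weierstrass_p w (- a)) (at 0)"
      using DERIV_shift[of "weierstrass_zeta w" "- weierstrass_p w (- a)" 0 "- a"] weierstrass_zeta_deriv[OF w ma] by simp
    then have "(v has_field_derivative - wp_reg w 0 - (- weierstrass_p w (- a)) - 0) (at 0)"
      unfolding v_def by (intro DERIV_diff zeta_reg_deriv[OF w] DERIV_const) auto
    then show ?thesis by (simp add: weierstrass_p_minus)
  qed
  have v0: "v 0 = 0" by (simp add: v_def weierstrass_zeta_minus)
  have lim_v: "((\<lambda>z. v z / z) \<longlongrightarrow> weierstrass_p w a) (at 0)"
    using dv v0 by (simp add: has_field_derivative_iff)
  have cv: "(v \<longlongrightarrow> 0) (at 0)" using DERIV_isCont[OF dv] v0 by (simp add: isCont_def)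
  have cp: "((\<lambda>z. weierstrass_p w (z - a)) \<longlongrightarrow> weierstrass_p w a) (at 0)"
  proof -
    have "isCont (weierstrass_p w) (0 - a)" using DERIV_isCont[OF weierstrass_p_deriv[OF w ma]] by simp
    then have "isCont (\<lambda>z. weierstrass_p w (z - a)) 0" by (rule isCont_o2[rotated]) (intro continuous_intros)
    then show ?thesis by (simp add: isCont_def weierstrass_p_minus)
  qed
  have cr: "(wp_reg w \<longlongrightarrow> 0) (at 0)" using DERIV_isCont[OF wp_reg_deriv(1)[OF w, of 0]] by (simp add: isCont_def)
  \<comment> \<open>As v(z)/z and \<wp>(z - a) both tend to \<wp>(a), the limit is 2 \<wp>(a) -
    \<wp>(a).\<close>
  have "((\<lambda>z. 2 * (v z / z) + v z ^ 2 - wp_reg w z - weierstrass_p w (z - a)) \<longlongrightarrow>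
      2 * weierstrass_p w a + 0 ^ 2 - 0 - weierstrass_p w a) (at 0)"
    by (intro tendsto_diff tendsto_add tendsto_mult tendsto_power tendsto_const lim_v cv cp cr)
  moreover have "\<forall>\<^sub>F z in at 0. 2 * (v z / z) + v z ^ 2 - wp_reg w z - weierstrass_p w (z - a) = f z"
  proof (rule eventually_mono[OF eventually_neq_at_within[of 0]])
    fix z :: complex assume "z \<noteq> 0"
    then show "2 * (v z / z) + v z ^ 2 - wp_reg w z - weierstrass_p w (z - a) = f z"
      by (simp add: f_def u_def v_def weierstrass_zeta_eq[of w z] weierstrass_p_eq[of w z] field_simps power2_eq_square)
  qed
  ultimately have lim: "(f \<longlongrightarrow> weierstrass_p w a) (at 0)"
    by (auto dest: Lim_transform_eventually)
  \<comment> \<open>The reflection z -> a - z exchanges the two singular points and so yields the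
    limit at \<open>a\<close>.\<close>
  have sym: "f (a - z) = f z" for z
    using weierstrass_zeta_minus[of w z] weierstrass_zeta_minus[of w "z - a"] weierstrass_p_minus[of w z] weierstrass_p_minus[of w "z - a"]
    by (simp add: f_def u_def)
  have "((\<lambda>z. f (a - z)) \<longlongrightarrow> weierstrass_p w a) (at a)"
  proof (rule filterlim_compose[OF lim])
    have "((\<lambda>z. a - z) \<longlongrightarrow> a - a) (at a)" by (intro tendsto_intros)
    moreover have "\<forall>\<^sub>F z in at a. a - z \<noteq> 0"
      using eventually_neq_at_within[of a] by (rule eventually_mono) auto
    ultimately show "filterlim (\<lambda>z. a - z) (at 0) (at a)" by (simp add: filterlim_at)
  qed
  then have lim_a: "(f \<longlongrightarrow> weierstrass_p w a) (at a)" by (simp add: sym)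
  have "f z = weierstrass_p w a"
  proof (rule elliptic_constant[of f a, OF _ _ lim lim_a])
    define S where "S = period_lattice w \<union> {z. z - a \<in> period_lattice w}"
    have "(\<lambda>z. g (z - a)) holomorphic_on - S" if "g holomorphic_on - period_lattice w" for g
      by (rule holomorphic_on_compose_gen[of "\<lambda>z. z - a" _ g, unfolded o_def, OF _ that])
         (auto intro!: holomorphic_intros simp: S_def)
    then show "f holomorphic_on - (period_lattice w \<union> {z. z - a \<in> period_lattice w})"
      unfolding f_def u_def S_def[symmetric]
      by (intro holomorphic_intros holomorphic_off_lattice) (auto simp: S_def intro: holomorphic_off_lattice)
  next
    fix z \<mu> assume z: "z \<notin> period_lattice w \<union> {z. z - a \<in> period_lattice w}" and \<mu>: "\<mu> \<in> period_lattice w"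
    obtain c where c: "\<And>z. z \<notin> period_lattice w \<Longrightarrow> weierstrass_zeta w (z + \<mu>) = weierstrass_zeta w z + c"
      using weierstrass_zeta_period[OF w \<mu>] by blast
    have "z + \<mu> - a = (z - a) + \<mu>" by simp
    then have "weierstrass_p w (z + \<mu> - a) = weierstrass_p w ((z - a) + \<mu>)"
      "weierstrass_zeta w (z + \<mu> - a) = weierstrass_zeta w ((z - a) + \<mu>)" by (simp_all only:)
    then show "f (z + \<mu>) = f z"
      using z c[of z] c[of "z - a"] weierstrass_p_period[OF w _ \<mu>, of z] weierstrass_p_period[OF w _ \<mu>, of "z - a"]
      by (simp add: f_def u_def)
  qed (use z in auto)
  then show ?thesis by (simp add: f_def u_def algebra_simps)
qed

text \<open>Replaces the count of zeros of an elliptic function. The product (\<wp>(z) - e)(\<wp>(z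
  - h) - e) has no poles, because at a half period \<wp> - e has a zero of order at least 2, which
  absorbs the double pole of the other factor; so the product is constant. A further zero
  \<open>b\<close> would make the constant 0 and force \<wp> = e on an open set.\<close>

lemma weierstrass_p_half_period_inj:
  assumes h: "h \<notin> period_lattice w" "2 * h \<in> period_lattice w" and b: "b \<notin> period_lattice w"
    and eq: "weierstrass_p w b = weierstrass_p w h"
  shows "b - h \<in> period_lattice w"
proof (rule ccontr)
  assume bh: "b - h \<notin> period_lattice w"
  define e where "e = weierstrass_p w h"
  have E0: "eis_full 3 w (- h) = 0"
  proof -
    have "eis_full 3 w (- h + 2 * h) = eis_full 3 w (- h)" using h by (intro eis_full_period[OF w]) auto
    then show ?thesis using eis_full_minus[of 3 w h] by simp
  qed
  have op: "open ((\<lambda>z. z - h) -` (- period_lattice w))"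
    by (intro open_vimage open_compl_lattice(1)[OF w] continuous_intros)
  obtain r where r: "r > 0" "ball 0 r \<subseteq> (\<lambda>z. z - h) -` (- period_lattice w)"
    using openE[OF op, of 0] h(1) by auto
  define g where "g z = weierstrass_p w (z - h) - e" for z
  have dg: "(g has_field_derivative - 2 * eis_full 3 w (z - h)) (at z)" if "z \<in> ball 0 r" for z
    using DERIV_shift[of "weierstrass_p w" "- 2 * eis_full 3 w (z - h)" z "- h"] weierstrass_p_deriv[OF w, of "z - h"] r(2) that
    unfolding g_def by (auto intro!: derivative_eq_intros)
  have gh: "g holomorphic_on ball 0 r" using dg unfolding holomorphic_on_open[OF open_ball] by blast
  obtain s where s: "s holomorphic_on ball 0 r"
    "\<And>z. z \<in> ball 0 r \<Longrightarrow> g z = (\<Sum>k<2. (deriv ^^ k) g 0 / fact k * z ^ k) + z ^ 2 * s z"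
    using taylor_remainder_holomorphic[OF gh, of 2] by blast
  have g0: "g 0 = 0" "deriv g 0 = 0"
    using dg[of 0] r(1) E0 by (auto simp: g_def e_def weierstrass_p_minus intro!: DERIV_imp_deriv)
  then have gs: "g z = z ^ 2 * s z" if "z \<in> ball 0 r" for z
    using s(2)[OF that] by (simp add: lessThan_nat_numeral)
  have cs: "(s \<longlongrightarrow> s 0) (at 0)"
    using continuous_on_eq_continuous_at[of "ball 0 r" s] holomorphic_on_imp_continuous_on[OF s(1)] r(1)
    by (simp add: isCont_def)
  have cr: "(wp_reg w \<longlongrightarrow> 0) (at 0)" using DERIV_isCont[OF wp_reg_deriv(1)[OF w, of 0]] by (simp add: isCont_def)
  define f where "f z = (weierstrass_p w z - e) * (weierstrass_p w (z - h) - e)" for z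
  have "((\<lambda>z. (1 + z ^ 2 * (wp_reg w z - e)) * s z) \<longlongrightarrow> s 0) (at 0)"
    by (auto intro!: tendsto_eq_intros cs cr)
  moreover have "\<forall>\<^sub>F z in at 0. (1 + z ^ 2 * (wp_reg w z - e)) * s z = f z"
  proof -
    have "\<forall>\<^sub>F z in at 0. z \<in> ball 0 r - {0}" using r(1) by (intro eventually_at_in_open) auto
    then show ?thesis
    proof eventually_elim
      case (elim z)
      then have "f z = (1 / z ^ 2 + wp_reg w z - e) * (z ^ 2 * s z)"
        using gs[of z] by (simp add: f_def g_def weierstrass_p_eq[of w z])
      then show ?case using elim by (simp add: field_simps)
    qed
  qed
  ultimately have lim: "(f \<longlongrightarrow> s 0) (at 0)" by (rule Lim_transform_eventually)
  define S where "S = period_lattice w \<union> {z. z - h \<in> period_lattice w}"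
  have hp: "- h \<notin> period_lattice w" using h(1) by simp
  have "\<forall>\<^sub>F t in at 0. f t = f (h + t)"
  proof -
    have "\<forall>\<^sub>F t in at 0. t \<in> ball 0 r" using r(1) by (intro eventually_at_in_open') auto
    then show ?thesis
    proof eventually_elim
      case (elim t)
      then have "t - h \<notin> period_lattice w" using r(2) by auto
      from weierstrass_p_period[OF w this h(2)] show ?case by (simp add: f_def algebra_simps)
    qed
  qed
  with lim have "((\<lambda>t. f (h + t)) \<longlongrightarrow> s 0) (at 0)" by (rule Lim_transform_eventually)
  then have lim_h: "(f \<longlongrightarrow> s 0) (at h)" by (rule LIM_offset_zero_cancel)
  have const: "f z = s 0" if "z \<notin> S" for z
  proof (rule elliptic_constant[of f h, OF _ _ lim lim_h])
    have "(\<lambda>z. weierstrass_p w (z - h)) holomorphic_on - S"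
      by (rule holomorphic_on_compose_gen[of "\<lambda>z. z - h" _ "weierstrass_p w", unfolded o_def, OF _ holomorphic_off_lattice(1)[of "- period_lattice w"]])
         (auto intro!: holomorphic_intros simp: S_def)
    then show "f holomorphic_on - (period_lattice w \<union> {z. z - h \<in> period_lattice w})"
      unfolding f_def S_def[symmetric]
      by (intro holomorphic_intros holomorphic_off_lattice) (auto simp: S_def)
  next
    fix z \<mu> assume z: "z \<notin> period_lattice w \<union> {z. z - h \<in> period_lattice w}" and \<mu>: "\<mu> \<in> period_lattice w"
    have "weierstrass_p w (z + \<mu> - h) = weierstrass_p w ((z - h) + \<mu>)" by (simp add: algebra_simps)
    then show "f (z + \<mu>) = f z"
      using z weierstrass_p_period[OF w _ \<mu>, of z] weierstrass_p_period[OF w _ \<mu>, of "z - h"]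
      by (simp add: f_def)
  qed (use that in \<open>auto simp: S_def\<close>)
  have "f b = s 0" using b bh by (intro const) (auto simp: S_def)
  then have "s 0 = 0" using eq by (simp add: f_def e_def)
  then have zero: "f z = 0" if "z \<notin> S" for z using const[OF that] by simp
  have "((\<lambda>z. 1 + z ^ 2 * (wp_reg w z - e)) \<longlongrightarrow> 1) (at 0)"
    by (auto intro!: tendsto_eq_intros cr)
  then have "\<forall>\<^sub>F z in at 0. 1 + z ^ 2 * (wp_reg w z - e) \<noteq> 0"
    by (rule tendsto_imp_eventually_ne) simp
  moreover have "\<forall>\<^sub>F z in at 0. z \<in> - (period_lattice w - {0}) - {0}"
    by (intro eventually_at_in_open open_compl_lattice(2)[OF w]) auto
  ultimately have "\<forall>\<^sub>F z in at 0. z \<noteq> 0 \<and> z \<notin> period_lattice w \<and> weierstrass_p w z \<noteq> e"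
  proof eventually_elim
    case (elim z)
    then have "z \<noteq> 0" by auto
    then have "1 + z ^ 2 * (wp_reg w z - e) = z ^ 2 * (weierstrass_p w z - e)"
      by (simp add: weierstrass_p_eq field_simps)
    with elim show ?case by auto
  qed
  then obtain d where d: "d > 0" "\<And>z. z \<noteq> 0 \<Longrightarrow> dist z 0 < d \<Longrightarrow> z \<notin> period_lattice w \<and> weierstrass_p w z \<noteq> e"
    by (auto simp: eventually_at)
  define d' where "d' = min d r"
  have d': "d' > 0" "d' \<le> d" "d' \<le> r" using d(1) r(1) by (auto simp: d'_def)
  \<comment> \<open>Near 0 the factor \<wp>(z) - e does not vanish, so the other factor does: \<wp>
    = e on the punctured disc \<open>T\<close> about -h. Continuation to a point near 0 contradicts
    the choice of \<open>d\<close>.\<close>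
  define T where "T = {x. x + h \<in> ball 0 d' - {0}}"
  have "T = (\<lambda>x. x + h) -` (ball 0 d' - {0})" by (auto simp: T_def)
  moreover have "open ((\<lambda>x. x + h) -` (ball 0 d' - {0}))"
    by (intro open_vimage continuous_intros open_Diff) auto
  ultimately have "open T" by simp
  have Tsub: "T \<subseteq> - period_lattice w"
  proof
    fix x assume "x \<in> T"
    then have "x + h \<in> ball 0 r" using d' by (auto simp: T_def)
    then show "x \<in> - period_lattice w" using r(2) by force
  qed
  have Te: "weierstrass_p w x = e" if "x \<in> T" for x
  proof -
    have x: "x + h \<noteq> 0" "dist (x + h) 0 < d" using that d' by (auto simp: T_def)
    then have "x + h \<notin> S" using d(2)[OF x] Tsub that by (auto simp: S_def)
    from zero[OF this] show ?thesis using d(2)[OF x] by (simp add: f_def)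
  qed
  have half: "of_real (d' / 2) \<noteq> (0::complex)" "dist (of_real (d' / 2)) (0::complex) < d"
    using d' by (auto simp: dist_norm)
  have "weierstrass_p w (of_real (d' / 2)) = e"
  proof (rule analytic_continuation_open[of T "- period_lattice w" "weierstrass_p w" "\<lambda>_. e"])
    have "of_real (d' / 2) - h \<in> T" using d' by (simp add: T_def dist_norm)
    then show "T \<noteq> {}" by blast
  qed (use \<open>open T\<close> Tsub Te open_compl_lattice(1)[OF w] connected_compl_lattice[OF w] holomorphic_off_lattice(1)[of "- period_lattice w"]
       d(2)[OF half] in auto)
  then show False using d(2)[OF half] by simp
qed

lemma eis_full_half_period:
  assumes "h \<notin> period_lattice w" "2 * h \<in> period_lattice w"
  shows "eis_full 3 w h = 0"
proof -
  have "eis_full 3 w (- h + 2 * h) = eis_full 3 w (- h)" using assms by (intro eis_full_period[OF w]) auto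
  then show ?thesis using eis_full_minus[of 3 w h] by simp
qed

end

section \<open>Half-period values and the discriminant\<close>

definition half_value_1 :: "complex \<times> complex \<Rightarrow> complex" where
  "half_value_1 w = weierstrass_p w (fst w / 2)"

definition half_value_2 :: "complex \<times> complex \<Rightarrow> complex" where
  "half_value_2 w = weierstrass_p w (snd w / 2)"

definition half_value_3 :: "complex \<times> complex \<Rightarrow> complex" where
  "half_value_3 w = weierstrass_p w ((fst w + snd w) / 2)"

text \<open>The classical g_2^3 - 27 g_3^2, with g_2 = 60 G_4 and g_3 = 140 G_6.\<close>

definition discriminant :: "complex \<times> complex \<Rightarrow> complex" where
  "discriminant w = (60 * lattice_sum 4 w 0) ^ 3 - 27 * (140 * lattice_sum 6 w 0) ^ 2"

context
  fixes w :: "complex \<times> complex"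
  assumes w: "w \<in> oriented_bases"
begin

lemma half_values_distinct:
  "half_value_1 w \<noteq> half_value_2 w" "half_value_1 w \<noteq> half_value_3 w" "half_value_2 w \<noteq> half_value_3 w"
proof -
  note h = half_basis_notin[OF w]
  have h2: "2 * (fst w / 2) \<in> period_lattice w" "2 * (snd w / 2) \<in> period_lattice w" by simp_all
  have d: "fst w / 2 - snd w / 2 \<notin> period_lattice w"
    using lattice_coset_not_half[OF w, of 2 1 "-1"] by (simp add: diff_divide_distrib)
  have d': "(fst w + snd w) / 2 - fst w / 2 \<notin> period_lattice w" "(fst w + snd w) / 2 - snd w / 2 \<notin> period_lattice w"
    using h by (simp_all add: add_divide_distrib)
  show "half_value_1 w \<noteq> half_value_2 w" "half_value_1 w \<noteq> half_value_3 w" "half_value_2 w \<noteq> half_value_3 w"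
    unfolding half_value_1_def half_value_2_def half_value_3_def
    using weierstrass_p_half_period_inj[OF w h(1) h2(1)] weierstrass_p_half_period_inj[OF w h(2) h2(2)] h d d'
    by (metis, metis, metis)
qed

lemma half_value_cubic:
  "4 * half_value_1 w ^ 3 - 60 * lattice_sum 4 w 0 * half_value_1 w - 140 * lattice_sum 6 w 0 = 0"
  "4 * half_value_2 w ^ 3 - 60 * lattice_sum 4 w 0 * half_value_2 w - 140 * lattice_sum 6 w 0 = 0"
  "4 * half_value_3 w ^ 3 - 60 * lattice_sum 4 w 0 * half_value_3 w - 140 * lattice_sum 6 w 0 = 0"
proof -
  note h = half_basis_notin[OF w]
  have h2: "2 * (fst w / 2) \<in> period_lattice w" "2 * (snd w / 2) \<in> period_lattice w" "2 * ((fst w + snd w) / 2) \<in> period_lattice w"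
    using lattice_add[of "fst w" w "snd w"] by (simp_all del: distrib_left_numeral)
  show "4 * half_value_1 w ^ 3 - 60 * lattice_sum 4 w 0 * half_value_1 w - 140 * lattice_sum 6 w 0 = 0"
    "4 * half_value_2 w ^ 3 - 60 * lattice_sum 4 w 0 * half_value_2 w - 140 * lattice_sum 6 w 0 = 0"
    "4 * half_value_3 w ^ 3 - 60 * lattice_sum 4 w 0 * half_value_3 w - 140 * lattice_sum 6 w 0 = 0"
    using weierstrass_p_cubic[OF w h(1)] weierstrass_p_cubic[OF w h(2)] weierstrass_p_cubic[OF w h(3)]
      eis_full_half_period[OF w h(1) h2(1)] eis_full_half_period[OF w h(2) h2(2)] eis_full_half_period[OF w h(3) h2(3)]
    by (simp_all add: half_value_1_def half_value_2_def half_value_3_def)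
qed

text \<open>Subtracting the cubic equations of two roots x, y and cancelling x - y gives p = 4 (x^2
  + x y + y^2). Comparing two such equations yields the vanishing sum, and the rest follows by
  elimination.\<close>

lemma half_value_vieta:
  "half_value_1 w + half_value_2 w + half_value_3 w = 0"
  "60 * lattice_sum 4 w 0 = - 4 * (half_value_1 w * half_value_2 w + half_value_1 w * half_value_3 w + half_value_2 w * half_value_3 w)"
  "140 * lattice_sum 6 w 0 = 4 * half_value_1 w * half_value_2 w * half_value_3 w"
proof -
  define a b c p q where "a = half_value_1 w" "b = half_value_2 w" "c = half_value_3 w"
    "p = 60 * lattice_sum 4 w 0" "q = 140 * lattice_sum 6 w 0"
  note defs = this
  have ne: "a \<noteq> b" "a \<noteq> c" "b \<noteq> c" using half_values_distinct by (simp_all add: defs)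
  have cub: "4 * a ^ 3 - p * a - q = 0" "4 * b ^ 3 - p * b - q = 0" "4 * c ^ 3 - p * c - q = 0"
    using half_value_cubic by (simp_all add: defs)
  have quot: "x = y \<or> p = 4 * (x ^ 2 + x * y + y ^ 2)"
    if "4 * x ^ 3 - p * x - q = 0" "4 * y ^ 3 - p * y - q = 0" for x y
  proof -
    have "(x - y) * (4 * (x ^ 2 + x * y + y ^ 2) - p) = (4 * x ^ 3 - p * x - q) - (4 * y ^ 3 - p * y - q)"
      by (simp add: algebra_simps power2_eq_square power3_eq_cube)
    then have "(x - y) * (4 * (x ^ 2 + x * y + y ^ 2) - p) = 0" unfolding that by simp
    then show ?thesis by auto
  qed
  have p: "p = 4 * (a ^ 2 + a * b + b ^ 2)" "p = 4 * (a ^ 2 + a * c + c ^ 2)"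
    using quot[OF cub(1,2)] quot[OF cub(1,3)] ne by auto
  have "4 * ((b - c) * (a + b + c)) = 4 * (a ^ 2 + a * b + b ^ 2) - 4 * (a ^ 2 + a * c + c ^ 2)"
    by (simp add: algebra_simps power2_eq_square)
  also have "\<dots> = 0" unfolding p[symmetric] by simp
  finally have s: "a + b + c = 0" using ne by simp
  then have c: "c = - a - b" by (metis add.commute add_eq_0_iff diff_conv_add_uminus minus_add_distrib)
  have p': "p = - 4 * (a * b + a * c + b * c)" unfolding p(1) c by (simp add: algebra_simps power2_eq_square)
  have "q = 4 * a ^ 3 - p * a" using cub(1) by (simp add: algebra_simps)
  then have q: "q = 4 * a * b * c" unfolding p(1) c by (simp add: algebra_simps power2_eq_square power3_eq_cube)
  show "half_value_1 w + half_value_2 w + half_value_3 w = 0"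
    "60 * lattice_sum 4 w 0 = - 4 * (half_value_1 w * half_value_2 w + half_value_1 w * half_value_3 w + half_value_2 w * half_value_3 w)"
    "140 * lattice_sum 6 w 0 = 4 * half_value_1 w * half_value_2 w * half_value_3 w"
    using s p' q by (simp_all add: defs)
qed

text \<open>A change of basis of level 2 may exchange e2 and e3, but the square of their difference
  is a polynomial in G_4 and e1, hence itself a form of level 2.\<close>

lemma half_value_square_diff:
  "(half_value_2 w - half_value_3 w) ^ 2 = 60 * lattice_sum 4 w 0 - 3 * half_value_1 w ^ 2"
proof -
  have "half_value_1 w = - half_value_2 w - half_value_3 w"
    using half_value_vieta(1) by (metis add.assoc add_eq_0_iff minus_add_distrib minus_minus uminus_add_conv_diff add.commute)
  then show ?thesis unfolding half_value_vieta(2) by (simp only:) (simp add: algebra_simps power2_eq_square)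
qed

lemma discriminant_eq:
  "discriminant w = 16 * ((half_value_1 w - half_value_2 w) * (half_value_1 w - half_value_3 w) * (half_value_2 w - half_value_3 w)) ^ 2"
proof -
  have ring: "(- 4 * (x * y + x * (- x - y) + y * (- x - y))) ^ 3 - 27 * (4 * x * y * (- x - y)) ^ 2 =
      16 * ((x - y) * (x - (- x - y)) * (y - (- x - y))) ^ 2" for x y :: complex
    by (simp add: algebra_simps power2_eq_square power3_eq_cube)
  have "half_value_3 w = - half_value_1 w - half_value_2 w"
    using half_value_vieta(1) by (metis add_eq_0_iff minus_add_distrib uminus_add_conv_diff add.commute)
  then show ?thesis unfolding discriminant_def half_value_vieta(2,3)
    by (simp only: ring)
qed

lemma discriminant_nonzero: "discriminant w \<noteq> 0"
  using half_values_distinct by (simp add: discriminant_eq)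

end

subsection \<open>Points of order three\<close>

text \<open>As \<open>\<zeta>(2a) - 2\<zeta>(a) = \<wp>''(a) / (2\<wp>'(a))\<close>, this is \<open>- 1 / 6\<close> times the slope of the tangent
  to the cubic at the point of parameter \<open>a\<close>, which is a flex if \<open>a\<close> has order three.\<close>

definition flex_slope :: "complex \<times> complex \<Rightarrow> complex \<Rightarrow> complex" where
  "flex_slope w a = (2 * weierstrass_zeta w a - weierstrass_zeta w (2 * a)) / 3"

context
  fixes w :: "complex \<times> complex" and a :: complex
  assumes w: "w \<in> oriented_bases" and a: "a \<notin> period_lattice w" "3 * a \<in> period_lattice w"
begin

lemma triple_points:
  "- a \<notin> period_lattice w" "2 * a \<notin> period_lattice w" "- a - a \<notin> period_lattice w"
proof -
  have "3 * a - a \<notin> period_lattice w" using a by (simp only: lattice_add_iff not_False_eq_True)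
  then show "2 * a \<notin> period_lattice w" by simp
  then have "- (2 * a) \<notin> period_lattice w" by (simp only: lattice_minus not_False_eq_True)
  then show "- a - a \<notin> period_lattice w" by simp
qed (use a in simp)

text \<open>Both follow from 2a = -a + 3a, periodicity and parity.\<close>

lemma triple_values:
  "weierstrass_p w (2 * a) = weierstrass_p w a"
  "k \<ge> 3 \<Longrightarrow> eis_full k w (2 * a) = (- 1) ^ k * eis_full k w a"
proof -
  show "weierstrass_p w (2 * a) = weierstrass_p w a"
    using weierstrass_p_period[OF w triple_points(1) a(2)] by (simp add: weierstrass_p_minus)
  show "eis_full k w (2 * a) = (- 1) ^ k * eis_full k w a" if "k \<ge> 3"
    using eis_full_period[OF w triple_points(1) a(2) that] by (simp add: eis_full_minus)
qed

text \<open>At z = -a the three arguments -a, 2a, -a of the zeta formula have equal \<wp>-values,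
  and their \<zeta>-values add up to -3 s with s the slope; so 9 s^2 = 3 \<wp>(a).\<close>

lemma flex_slope_square: "3 * flex_slope w a ^ 2 = weierstrass_p w a"
proof -
  have "(- weierstrass_zeta w a + weierstrass_zeta w (2 * a) - weierstrass_zeta w a) ^ 2 = 3 * weierstrass_p w a"
    using weierstrass_zeta_square[OF w a(1) triple_points(1,3)] weierstrass_zeta_minus[of w "2 * a"] weierstrass_p_minus[of w "2 * a"]
    by (simp add: weierstrass_zeta_minus weierstrass_p_minus triple_values)
  moreover have "- weierstrass_zeta w a + weierstrass_zeta w (2 * a) - weierstrass_zeta w a = - 3 * flex_slope w a"
    by (simp add: flex_slope_def)
  ultimately show ?thesis by (simp add: power_mult_distrib)
qed

text \<open>Second derivative of u^2 = \<wp>(z) + \<wp>(z - a) + \<wp>(a) at z = -a. There u'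
  vanishes because \<wp>(2a) = \<wp>(a), so only 2 u u'' survives on the left.\<close>

lemma flex_second_order: "eis_full 4 w a = 2 * flex_slope w a * eis_full 3 w a"
proof -
  define U where "U = - period_lattice w \<inter> (\<lambda>z. z - a) -` (- period_lattice w)"
  have U: "open U" unfolding U_def
    by (intro open_Int open_vimage open_compl_lattice(1)[OF w] continuous_intros)
  define u where "u z = weierstrass_zeta w z - weierstrass_zeta w (z - a) - weierstrass_zeta w a" for z
  define v where "v z = weierstrass_p w (z - a) - weierstrass_p w z" for z
  define E where "E k z = eis_full k w z + eis_full k w (z - a)" for k z
  have sh: "((\<lambda>z. f (z - a)) has_field_derivative D) (at z)" if "(f has_field_derivative D) (at (z - a))" for f D z
    using DERIV_shift[of f D z "- a"] that by simp
  have du: "(u has_field_derivative v z) (at z)" if "z \<in> U" for z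
  proof -
    have "(u has_field_derivative - weierstrass_p w z - - weierstrass_p w (z - a) - 0) (at z)"
      unfolding u_def using that by (intro DERIV_diff DERIV_const sh weierstrass_zeta_deriv[OF w]) (auto simp: U_def)
    then show ?thesis by (simp add: v_def)
  qed
  have dv: "(v has_field_derivative 2 * (eis_full 3 w z - eis_full 3 w (z - a))) (at z)" if "z \<in> U" for z
  proof -
    have "(v has_field_derivative - 2 * eis_full 3 w (z - a) - - 2 * eis_full 3 w z) (at z)"
      unfolding v_def using that by (intro DERIV_diff sh[of "weierstrass_p w"] weierstrass_p_deriv[OF w]) (auto simp: U_def)
    then show ?thesis by (simp add: algebra_simps)
  qed
  have dE: "(E 3 has_field_derivative - 3 * E 4 z) (at z)" if "z \<in> U" for z
  proof -
    have "(E 3 has_field_derivative - of_nat 3 * eis_full (Suc 3) w z + - of_nat 3 * eis_full (Suc 3) w (z - a)) (at z)"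
      unfolding E_def using that by (intro DERIV_add sh eis_full_deriv[OF w]) (auto simp: U_def)
    then show ?thesis by (simp add: E_def algebra_simps)
  qed
  have id1: "2 * u z * v z = - 2 * E 3 z" if z: "z \<in> U" for z
  proof -
    have "((\<lambda>z. u z ^ 2) has_field_derivative 2 * u z * v z) (at z)"
      using du[OF z] by (auto intro!: derivative_eq_intros)
    moreover have "((\<lambda>z. u z ^ 2) has_field_derivative - 2 * E 3 z) (at z)"
    proof (rule has_field_derivative_transform_within_open[OF _ U z])
      have "((\<lambda>z. weierstrass_p w z + weierstrass_p w (z - a) + weierstrass_p w a) has_field_derivative
          - 2 * eis_full 3 w z + - 2 * eis_full 3 w (z - a) + 0) (at z)"
        using z by (intro DERIV_add DERIV_const sh[of "weierstrass_p w"] weierstrass_p_deriv[OF w]) (auto simp: U_def)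
      then show "((\<lambda>z. weierstrass_p w z + weierstrass_p w (z - a) + weierstrass_p w a) has_field_derivative - 2 * E 3 z) (at z)"
        by (simp add: E_def algebra_simps)
    qed (use weierstrass_zeta_square[OF w a(1)] in \<open>auto simp: U_def u_def\<close>)
    ultimately show ?thesis by (rule DERIV_unique)
  qed
  have ma: "- a \<in> U" using triple_points by (simp add: U_def)
  have "((\<lambda>z. 2 * u z * v z) has_field_derivative
      2 * v (- a) * v (- a) + 2 * u (- a) * (2 * (eis_full 3 w (- a) - eis_full 3 w (- a - a)))) (at (- a))"
    using du[OF ma] dv[OF ma] by (auto intro!: derivative_eq_intros)
  moreover have "((\<lambda>z. 2 * u z * v z) has_field_derivative - 2 * (- 3 * E 4 (- a))) (at (- a))"
    by (rule has_field_derivative_transform_within_open[OF DERIV_cmult[OF dE[OF ma]] U ma]) (use id1 in auto)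
  ultimately have eq: "2 * v (- a) * v (- a) + 2 * u (- a) * (2 * (eis_full 3 w (- a) - eis_full 3 w (- a - a))) = 6 * E 4 (- a)"
    by (auto dest: DERIV_unique)
  have mm: "- a - a = - (2 * a)" by simp
  have vals: "v (- a) = 0" "u (- a) = - 3 * flex_slope w a" "E 4 (- a) = 2 * eis_full 4 w a"
    "eis_full 3 w (- a) - eis_full 3 w (- a - a) = - 2 * eis_full 3 w a"
    unfolding v_def u_def E_def mm
    by (simp_all add: weierstrass_p_minus weierstrass_zeta_minus eis_full_minus triple_values flex_slope_def)
  show ?thesis using eq unfolding vals by (simp add: mult.assoc)
qed

text \<open>The values \<wp>(a) = 3 s^2 and \<wp>''(a) = 12 s G turn the two differential equations
  at \<open>a\<close> into formulas for g_2 and g_3. With a_1 = 6 s and a_3 = 2 G the last line is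
  the discriminant a_3^3 (a_1^3 - 27 a_3) of the curve y^2 + a_1 x y + a_3 y = x^3.\<close>

lemma flex_invariants:
  defines "s \<equiv> flex_slope w a" and "G \<equiv> eis_full 3 w a"
  shows "60 * lattice_sum 4 w 0 = 108 * s ^ 4 - 24 * s * G"
    and "140 * lattice_sum 6 w 0 = - 216 * s ^ 6 + 72 * s ^ 3 * G - 4 * G ^ 2"
    and "discriminant w = 216 * G ^ 3 * (8 * s ^ 3 - 2 * G)"
proof -
  have x: "weierstrass_p w a = 3 * s ^ 2" using flex_slope_square by (simp add: s_def)
  show 1: "60 * lattice_sum 4 w 0 = 108 * s ^ 4 - 24 * s * G"
  proof -
    have "5 * lattice_sum 4 w 0 = (3 * s ^ 2) ^ 2 - 2 * s * G"
      using weierstrass_p_second_order[OF w a(1)] flex_second_order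
      unfolding x s_def[symmetric] G_def[symmetric] by (simp add: algebra_simps)
    then have "12 * (5 * lattice_sum 4 w 0) = 12 * ((3 * s ^ 2) ^ 2 - 2 * s * G)" by simp
    then show ?thesis by (simp add: power_mult_distrib algebra_simps)
  qed
  show 2: "140 * lattice_sum 6 w 0 = - 216 * s ^ 6 + 72 * s ^ 3 * G - 4 * G ^ 2"
  proof -
    have "140 * lattice_sum 6 w 0 = 4 * (3 * s ^ 2) ^ 3 - (108 * s ^ 4 - 24 * s * G) * (3 * s ^ 2) - 4 * G ^ 2"
      using weierstrass_p_cubic[OF w a(1)] unfolding x 1 G_def[symmetric] by (simp only:) simp
    then show ?thesis by (simp add: algebra_simps eval_nat_numeral)
  qed
  show "discriminant w = 216 * G ^ 3 * (8 * s ^ 3 - 2 * G)"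
    unfolding discriminant_def 1 2 by (simp add: algebra_simps eval_nat_numeral)
qed

end

subsection \<open>Behaviour at the cusps\<close>

abbreviation at_i_inf :: "complex filter" where
  "at_i_inf \<equiv> filtercomap Im at_top"

lemma eventually_at_i_inf: "eventually P at_i_inf \<longleftrightarrow> (\<exists>T. \<forall>\<tau>. Im \<tau> \<ge> T \<longrightarrow> P \<tau>)"
  unfolding eventually_filtercomap eventually_at_top_linorder by blast

lemma eventually_at_i_infI: "(\<And>\<tau>. Im \<tau> \<ge> T \<Longrightarrow> P \<tau>) \<Longrightarrow> eventually P at_i_inf"
  unfolding eventually_at_i_inf by blast

lemma at_i_inf_neq_bot [simp]: "at_i_inf \<noteq> bot"
proof
  assume "at_i_inf = bot"
  then have "eventually (\<lambda>_. False) at_i_inf" by simp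
  then obtain T where "\<And>\<tau>. Im \<tau> \<ge> T \<Longrightarrow> False" unfolding eventually_at_i_inf by blast
  from this[of "\<i> * of_real T"] show False by simp
qed

lemma eventually_upper_half_plane: "\<forall>\<^sub>F \<tau> in at_i_inf. \<tau> \<in> upper_half_plane"
  by (rule eventually_at_i_infI[of 1]) (auto simp: upper_half_plane_def)

lemma open_upper_half_plane [simp]: "open upper_half_plane"
  unfolding upper_half_plane_def by (rule open_halfspace_Im_gt)

text \<open>Boundedness passes to sums and products without control of limits, and for a periodic
  holomorphic function it is as good as holomorphy at the cusp, by the removable singularity
  theorem.\<close>

definition bounded_at_i_inf :: "(complex \<Rightarrow> complex) \<Rightarrow> bool" where
  "bounded_at_i_inf f \<longleftrightarrow> (\<exists>B. \<forall>\<^sub>F \<tau> in at_i_inf. norm (f \<tau>) \<le> B)"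

lemma bounded_at_i_inf_tendsto:
  assumes "(f \<longlongrightarrow> c) at_i_inf" shows "bounded_at_i_inf f"
proof -
  have "\<forall>\<^sub>F \<tau> in at_i_inf. dist (f \<tau>) c < 1" using tendstoD[OF assms] by simp
  then have "\<forall>\<^sub>F \<tau> in at_i_inf. norm (f \<tau>) \<le> norm c + 1"
  proof eventually_elim
    case (elim \<tau>)
    then show ?case using norm_triangle_ineq2[of "f \<tau>" c] by (simp add: dist_norm)
  qed
  then show ?thesis by (auto simp: bounded_at_i_inf_def)
qed

lemma bounded_at_i_inf_const [simp, intro]: "bounded_at_i_inf (\<lambda>_. c)"
  unfolding bounded_at_i_inf_def by (rule exI[of _ "norm c"]) simp

lemma bounded_at_i_inf_add [intro]:
  assumes "bounded_at_i_inf f" "bounded_at_i_inf g" shows "bounded_at_i_inf (\<lambda>\<tau>. f \<tau> + g \<tau>)"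
proof -
  obtain B C where "\<forall>\<^sub>F \<tau> in at_i_inf. norm (f \<tau>) \<le> B" "\<forall>\<^sub>F \<tau> in at_i_inf. norm (g \<tau>) \<le> C"
    using assms by (auto simp: bounded_at_i_inf_def)
  then have "\<forall>\<^sub>F \<tau> in at_i_inf. norm (f \<tau> + g \<tau>) \<le> B + C"
    by eventually_elim (meson add_mono norm_triangle_ineq order_trans)
  then show ?thesis by (auto simp: bounded_at_i_inf_def)
qed

lemma bounded_at_i_inf_mult [intro]:
  assumes "bounded_at_i_inf f" "bounded_at_i_inf g" shows "bounded_at_i_inf (\<lambda>\<tau>. f \<tau> * g \<tau>)"
proof -
  obtain B C where "\<forall>\<^sub>F \<tau> in at_i_inf. norm (f \<tau>) \<le> B" "\<forall>\<^sub>F \<tau> in at_i_inf. norm (g \<tau>) \<le> C"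
    using assms by (auto simp: bounded_at_i_inf_def)
  then have "\<forall>\<^sub>F \<tau> in at_i_inf. norm (f \<tau> * g \<tau>) \<le> B * C"
  proof eventually_elim
    case (elim \<tau>)
    then show ?case by (simp add: norm_mult mult_mono')
  qed
  then show ?thesis by (auto simp: bounded_at_i_inf_def)
qed

lemma bounded_at_i_inf_power [intro]:
  "bounded_at_i_inf f \<Longrightarrow> bounded_at_i_inf (\<lambda>\<tau>. f \<tau> ^ n)"
  by (induction n) auto

lemma bounded_at_i_inf_cong:
  assumes "\<And>\<tau>. \<tau> \<in> upper_half_plane \<Longrightarrow> f \<tau> = g \<tau>" "bounded_at_i_inf f"
  shows "bounded_at_i_inf g"
proof -
  obtain B where "\<forall>\<^sub>F \<tau> in at_i_inf. norm (f \<tau>) \<le> B" using assms(2) by (auto simp: bounded_at_i_inf_def)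
  with eventually_upper_half_plane have "\<forall>\<^sub>F \<tau> in at_i_inf. norm (g \<tau>) \<le> B"
    by eventually_elim (simp add: assms(1))
  then show ?thesis by (auto simp: bounded_at_i_inf_def)
qed

lemma filterlim_translate_at_i_inf: "filterlim (\<lambda>\<tau>. \<tau> + of_int j) at_i_inf at_i_inf"
  unfolding filterlim_iff
proof (intro allI impI)
  fix P assume "eventually P at_i_inf"
  then obtain T where "\<And>\<tau>. Im \<tau> \<ge> T \<Longrightarrow> P \<tau>" unfolding eventually_at_i_inf by blast
  then show "\<forall>\<^sub>F \<tau> in at_i_inf. P (\<tau> + of_int j)" by (intro eventually_at_i_infI[of T]) simp
qed

lemma bounded_at_i_inf_translate:
  assumes "bounded_at_i_inf f" shows "bounded_at_i_inf (\<lambda>\<tau>. f (\<tau> + of_int j))"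
proof -
  obtain B where "\<forall>\<^sub>F \<tau> in at_i_inf. norm (f \<tau>) \<le> B" using assms by (auto simp: bounded_at_i_inf_def)
  then have "\<forall>\<^sub>F \<tau> in at_i_inf. norm (f (\<tau> + of_int j)) \<le> B"
    using filterlim_translate_at_i_inf[of j] unfolding filterlim_iff by blast
  then show ?thesis by (auto simp: bounded_at_i_inf_def)
qed

lemma periodic_int:
  fixes f :: "complex \<Rightarrow> complex"
  assumes "\<And>\<tau>. \<tau> \<in> upper_half_plane \<Longrightarrow> f (\<tau> + of_nat N) = f \<tau>" "\<tau> \<in> upper_half_plane"
  shows "f (\<tau> + of_nat N * of_int m) = f \<tau>"
proof (induction m rule: int_induct[of _ 0])
  case (step1 i)
  have "\<tau> + of_nat N * of_int i \<in> upper_half_plane" using assms(2) by (simp add: upper_half_plane_def)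
  from assms(1)[OF this] step1 show ?case by (simp add: algebra_simps)
next
  case (step2 i)
  have "\<tau> + of_nat N * of_int (i - 1) \<in> upper_half_plane" using assms(2) by (simp add: upper_half_plane_def)
  from assms(1)[OF this] step2 show ?case by (simp add: algebra_simps)
qed simp

text \<open>Periodicity makes f(N log q / (2 \<pi> \<i>)) independent of the branch of the
  logarithm; boundedness makes q = 0 a removable singularity.\<close>

lemma holomorphic_at_infinityI:
  assumes N: "N > 0" and hol: "f holomorphic_on upper_half_plane"
    and per: "\<And>\<tau>. \<tau> \<in> upper_half_plane \<Longrightarrow> f (\<tau> + of_nat N) = f \<tau>"
    and bdd: "bounded_at_i_inf f"
  shows "holomorphic_at_infinity N f"
proof -
  define T where "T l = of_nat N * l / (2 * of_real pi * \<i>)" for l :: complex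
  have ImT: "Im (T l) = - (of_nat N * Re l / (2 * pi))" for l
    by (simp add: T_def Im_divide power2_eq_square field_simps)
  have TH: "T l \<in> upper_half_plane" if "norm (exp l) < 1" for l
  proof -
    have "Re l < 0" using that by simp
    then show ?thesis using N by (simp add: upper_half_plane_def ImT divide_simps mult_pos_neg)
  qed
  define h where "h q = f (T (Ln q))" for q
  have h_exp: "h (exp l) = f (T l)" if "norm (exp l) < 1" for l
  proof -
    have "exp (Ln (exp l)) = exp l" by simp
    then obtain n :: int where "Ln (exp l) = l + 2 * of_int n * pi * \<i>"
      unfolding exp_eq by auto
    then have "T (Ln (exp l)) = T l + of_nat N * of_int n" using N by (simp add: T_def field_simps)
    then show ?thesis using periodic_int[of f N "T l" n] per TH[OF that] by (simp add: h_def)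
  qed
  have "h holomorphic_on ball 0 1 - {0}"
  proof (subst holomorphic_on_open, simp add: open_Diff, intro ballI)
    fix p :: complex assume p: "p \<in> ball 0 1 - {0}"
    then have p0: "p \<noteq> 0" by simp
    define U where "U = ball p (norm p) \<inter> ball 0 1"
    \<comment> \<open>A branch of the logarithm near \<open>p\<close> that avoids the cut of
      \<open>Ln\<close>: on \<open>U\<close> the quotient q/p stays in the right half plane.\<close>
    define l where "l q = Ln p + Ln (q / p)" for q
    have nR: "q / p \<notin> \<real>\<^sub>\<le>\<^sub>0" if "q \<in> U" for q
    proof
      assume "q / p \<in> \<real>\<^sub>\<le>\<^sub>0"
      then have "Re (q / p) \<le> 0" by (auto simp: complex_nonpos_Reals_iff)
      then have "1 \<le> norm (1 - q / p)" using complex_Re_le_cmod[of "1 - q / p"] by simp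
      moreover have "norm (1 - q / p) < 1"
      proof -
        have "1 - q / p = (p - q) / p" using p0 by (simp add: diff_divide_distrib)
        then show ?thesis using that p0 by (simp add: U_def dist_norm norm_divide)
      qed
      ultimately show False by simp
    qed
    have lexp: "exp (l q) = q" if "q \<in> U" for q
    proof -
      have "q / p \<noteq> 0" using nR[OF that] by auto
      then show ?thesis using p0 by (simp add: l_def exp_add)
    qed
    have "(\<lambda>q. f (T (l q))) holomorphic_on U"
    proof (rule holomorphic_on_compose_gen[of "\<lambda>q. T (l q)" _ f, unfolded o_def, OF _ hol])
      show "(\<lambda>q. T (l q)) holomorphic_on U"
        unfolding T_def l_def by (intro holomorphic_intros) (use nR p0 in auto)
      show "(\<lambda>q. T (l q)) ` U \<subseteq> upper_half_plane"
      proof safe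
        fix q assume q: "q \<in> U"
        then have "norm (exp (l q)) < 1" by (simp only: lexp) (simp add: U_def)
        then show "T (l q) \<in> upper_half_plane" by (rule TH)
      qed
    qed
    then have "h holomorphic_on U"
    proof (rule holomorphic_transform)
      fix q assume q: "q \<in> U"
      then have "norm (exp (l q)) < 1" by (simp only: lexp) (simp add: U_def)
      from h_exp[OF this] show "f (T (l q)) = h q" using lexp[OF q] by simp
    qed
    moreover have "p \<in> U" "open U" using p by (auto simp: U_def)
    ultimately show "\<exists>f'. (h has_field_derivative f') (at p)"
      unfolding holomorphic_on_open[OF \<open>open U\<close>] by blast
  qed
  moreover have "\<exists>B. \<forall>\<^sub>F q in at 0. norm (h q) \<le> B"
  proof -
    obtain B S where B: "\<And>\<tau>. Im \<tau> \<ge> S \<Longrightarrow> norm (f \<tau>) \<le> B"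
      using bdd unfolding bounded_at_i_inf_def eventually_at_i_inf by blast
    have "\<forall>\<^sub>F q in at 0. q \<in> ball (0::complex) (exp (- (2 * pi * \<bar>S\<bar> / N))) - {0}"
      by (intro eventually_at_in_open) auto
    then have "\<forall>\<^sub>F q in at 0. norm (h q) \<le> B"
    proof eventually_elim
      case (elim q)
      then have "ln (norm q) < ln (exp (- (2 * pi * \<bar>S\<bar> / N)))"
        by (subst ln_less_cancel_iff) auto
      then have "2 * pi * \<bar>S\<bar> \<le> - (of_nat N * ln (norm q))" using N by (simp add: field_simps)
      then have "\<bar>S\<bar> \<le> - (of_nat N * ln (norm q)) / (2 * pi)" by (simp add: field_simps)
      moreover have "Re (Ln q) = ln (norm q)" using elim by simp
      ultimately have "S \<le> Im (T (Ln q))" unfolding ImT by simp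
      then show ?case unfolding h_def by (rule B)
    qed
    then show ?thesis by blast
  qed
  ultimately obtain g where g: "g holomorphic_on ball 0 1" "\<And>q. q \<in> ball 0 1 - {0} \<Longrightarrow> g q = h q"
    using holomorphic_on_extend_bounded[of h "ball 0 1" 0] by auto
  show ?thesis unfolding holomorphic_at_infinity_def
  proof (intro exI conjI ballI)
    fix \<tau> assume \<tau>: "\<tau> \<in> upper_half_plane"
    define l where "l = 2 * of_real pi * \<i> * \<tau> / of_nat N"
    have l: "norm (exp l) < 1" using \<tau> N by (simp add: l_def upper_half_plane_def Re_divide power2_eq_square field_simps)
    have "g (exp l) = f (T l)" using g(2)[of "exp l"] h_exp[OF l] l by simp
    also have "T l = \<tau>" using N by (simp add: T_def l_def)
    finally show "f \<tau> = g (exp (2 * of_real pi * \<i> * \<tau> / of_nat N))" by (simp add: l_def)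
  qed (rule g(1))
qed

lemma norm_q_exp: "norm (exp (2 * of_real pi * \<i> * \<tau> / of_nat N)) = exp (- (2 * pi * Im \<tau> / of_nat N))"
  by (cases "N = 0") (simp_all add: Re_divide power2_eq_square field_simps)

lemma q_exp_tendsto: "N > 0 \<Longrightarrow> ((\<lambda>\<tau>. exp (2 * of_real pi * \<i> * \<tau> / of_nat N)) \<longlongrightarrow> 0) at_i_inf"
proof -
  assume N: "N > 0"
  have "((\<lambda>y::real. exp (- (2 * pi * y / of_nat N))) \<longlongrightarrow> 0) at_top"
    using N by real_asymp
  then have "((\<lambda>\<tau>. exp (- (2 * pi * Im \<tau> / of_nat N))) \<longlongrightarrow> 0) at_i_inf"
    by (rule filterlim_compose) (rule filterlim_filtercomap)
  then show ?thesis by (subst tendsto_norm_zero_iff[symmetric]) (simp only: norm_q_exp)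
qed

lemma holomorphic_at_infinityD:
  assumes N: "N > 0" and f: "holomorphic_at_infinity N f"
  obtains h where "h holomorphic_on ball 0 1"
    "\<And>\<tau>. \<tau> \<in> upper_half_plane \<Longrightarrow> f \<tau> = h (exp (2 * of_real pi * \<i> * \<tau> / of_nat N))"
    "(f \<longlongrightarrow> h 0) at_i_inf" "\<And>\<tau>. \<tau> \<in> upper_half_plane \<Longrightarrow> f (\<tau> + of_nat N) = f \<tau>"
proof -
  obtain h where h: "h holomorphic_on ball 0 1"
    "\<And>\<tau>. \<tau> \<in> upper_half_plane \<Longrightarrow> f \<tau> = h (exp (2 * of_real pi * \<i> * \<tau> / of_nat N))"
    using f unfolding holomorphic_at_infinity_def by blast
  have "isCont h 0" using holomorphic_on_imp_continuous_on[OF h(1)] by (simp add: continuous_on_eq_continuous_at)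
  then have "((\<lambda>\<tau>. h (exp (2 * of_real pi * \<i> * \<tau> / of_nat N))) \<longlongrightarrow> h 0) at_i_inf"
    by (rule isCont_tendsto_compose[OF _ q_exp_tendsto[OF N]])
  then have "(f \<longlongrightarrow> h 0) at_i_inf"
    by (rule Lim_transform_eventually) (use eventually_upper_half_plane in \<open>eventually_elim, simp add: h(2)\<close>)
  moreover have "f (\<tau> + of_nat N) = f \<tau>" if "\<tau> \<in> upper_half_plane" for \<tau>
  proof -
    have "\<tau> + of_nat N \<in> upper_half_plane" using that by (simp add: upper_half_plane_def)
    moreover have "2 * of_real pi * \<i> * (\<tau> + of_nat N) / of_nat N = 2 * of_real pi * \<i> * \<tau> / of_nat N + 2 * of_real pi * \<i>"
      using N by (simp add: field_simps)
    ultimately show ?thesis using h(2) that by (simp add: exp_add)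
  qed
  ultimately show ?thesis using h by (intro that[of h])
qed

subsection \<open>Change of basis\<close>

definition mat2 :: "int \<Rightarrow> int \<Rightarrow> int \<Rightarrow> int \<Rightarrow> int ^ 2 ^ 2" where
  "mat2 a b c d = vector [vector [a, b], vector [c, d]]"

lemma mat2_nth [simp]:
  "mat2 a b c d $ 1 $ 1 = a" "mat2 a b c d $ 1 $ 2 = b" "mat2 a b c d $ 2 $ 1 = c" "mat2 a b c d $ 2 $ 2 = d"
  by (simp_all add: mat2_def)

lemma mat2_collapse: "A = mat2 (A $ 1 $ 1) (A $ 1 $ 2) (A $ 2 $ 1) (A $ 2 $ 2)"
  by (simp add: vec_eq_iff forall_2)

lemma mat2_SL2Z: "mat2 a b c d \<in> SL2Z \<longleftrightarrow> a * d - b * c = 1"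
  by (simp add: SL2Z_def det_2)

lemma mat2_Gamma1:
  "mat2 a b c d \<in> Gamma1 N \<longleftrightarrow> a * d - b * c = 1 \<and> [a = 1] (mod int N) \<and> [d = 1] (mod int N) \<and> [c = 0] (mod int N)"
  by (simp add: Gamma1_def mat2_SL2Z)

definition change_basis :: "int ^ 2 ^ 2 \<Rightarrow> complex \<times> complex \<Rightarrow> complex \<times> complex" where
  "change_basis A w = (of_int (A $ 2 $ 1) * snd w + of_int (A $ 2 $ 2) * fst w,
                       of_int (A $ 1 $ 1) * snd w + of_int (A $ 1 $ 2) * fst w)"

text \<open>One weight of the identification in the theorem. In this form the slash operator becomes
  a change of basis, with no automorphy factor.\<close>

definition homogenize :: "int \<Rightarrow> (complex \<Rightarrow> complex) \<Rightarrow> complex \<times> complex \<Rightarrow> complex" where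
  "homogenize k f w = fst w powi (- k) * f (snd w / fst w)"

lemma slash_eq_homogenize: "slash k f A \<tau> = homogenize k f (change_basis A (1, \<tau>))"
  by (simp add: slash_def homogenize_def change_basis_def)

lemma oriented_basis_fst: "w \<in> oriented_bases \<Longrightarrow> fst w \<noteq> 0"
  by (auto simp: oriented_bases_def case_prod_beta)

lemma oriented_basis_quotient: "w \<in> oriented_bases \<Longrightarrow> snd w / fst w \<in> upper_half_plane"
  by (auto simp: oriented_bases_def upper_half_plane_def case_prod_beta)

lemma oriented_basis_scale: "w \<in> oriented_bases \<Longrightarrow> c \<noteq> 0 \<Longrightarrow> (c * fst w, c * snd w) \<in> oriented_bases"
  by (auto simp: oriented_bases_def case_prod_beta)

lemma oriented_basis_1 [simp]: "(1, \<tau>) \<in> oriented_bases \<longleftrightarrow> \<tau> \<in> upper_half_plane"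
  by (simp add: oriented_bases_def upper_half_plane_def)

lemma Im_minus_inverse: "Im (- 1 / \<tau>) = Im \<tau> / norm \<tau> ^ 2"
  by (simp add: Im_divide cmod_power2)

lemma minus_inverse_upper_half_plane: "\<tau> \<in> upper_half_plane \<Longrightarrow> - 1 / \<tau> \<in> upper_half_plane"
proof -
  assume "\<tau> \<in> upper_half_plane"
  then have "Im \<tau> / norm \<tau> ^ 2 > 0" by (auto simp: upper_half_plane_def intro!: divide_pos_pos)
  then show ?thesis unfolding upper_half_plane_def mem_Collect_eq Im_minus_inverse .
qed

lemma oriented_basis_S [simp]: "(\<tau>, - 1) \<in> oriented_bases \<longleftrightarrow> \<tau> \<in> upper_half_plane"
proof -
  have "Im (- 1 / \<tau>) > 0 \<longleftrightarrow> Im \<tau> > 0"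
    unfolding Im_minus_inverse by (cases "\<tau> = 0") (simp_all add: zero_less_divide_iff)
  then show ?thesis by (simp add: oriented_bases_def upper_half_plane_def)
qed

lemma change_basis_oriented:
  assumes A: "A \<in> SL2Z" and w: "w \<in> oriented_bases"
  shows "change_basis A w \<in> oriented_bases"
proof -
  define a b c d where "a = A $ 1 $ 1" "b = A $ 1 $ 2" "c = A $ 2 $ 1" "d = A $ 2 $ 2"
  note defs = this
  have det: "a * d - b * c = 1" using A by (simp add: SL2Z_def det_2 defs)
  define t where "t = snd w / fst w"
  have t: "Im t > 0" and w0: "fst w \<noteq> 0"
    using w by (auto simp: oriented_bases_def t_def case_prod_beta)
  define p where "p = of_int c * t + of_int d"
  define r where "r = of_int a * t + of_int b"
  have p0: "p \<noteq> 0"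
  proof
    assume p: "p = 0"
    then have "Im p = 0" by simp
    then have "c = 0" using t by (simp add: p_def)
    with p have "d = 0" by (simp add: p_def)
    with \<open>c = 0\<close> det show False by simp
  qed
  have "change_basis A w = (fst w * p, fst w * r)"
    using w0 by (simp add: change_basis_def defs p_def r_def t_def field_simps)
  moreover have "Im (r / p) > 0"
  proof -
    have "Im r * Re p - Re r * Im p = of_int (a * d - b * c) * Im t"
      by (simp add: p_def r_def algebra_simps)
    then have "Im (r / p) = Im t / norm p ^ 2"
      by (simp add: Im_divide cmod_power2 det)
    then show ?thesis using t p0 by simp
  qed
  ultimately show ?thesis using w0 by (simp add: oriented_bases_def)
qed

lemma change_basis_lattice:
  assumes A: "A \<in> SL2Z"
  shows "period_lattice (change_basis A w) = period_lattice w"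
proof
  define a b c d where "a = A $ 1 $ 1" "b = A $ 1 $ 2" "c = A $ 2 $ 1" "d = A $ 2 $ 2"
  note defs = this
  have det: "of_int a * of_int d - of_int b * of_int c = (1::complex)"
    using A by (simp add: SL2Z_def det_2 defs flip: of_int_mult of_int_diff)
  define w' where "w' = change_basis A w"
  have w': "fst w' = of_int c * snd w + of_int d * fst w" "snd w' = of_int a * snd w + of_int b * fst w"
    by (simp_all add: w'_def change_basis_def defs)
  have sub: "period_lattice v \<subseteq> period_lattice u" if "fst v \<in> period_lattice u" "snd v \<in> period_lattice u" for u v
    using that by (auto simp: period_lattice_def[of v] intro!: lattice_add lattice_multiple)
  show "period_lattice (change_basis A w) \<subseteq> period_lattice w"
    by (rule sub) (auto simp: change_basis_def intro!: lattice_add lattice_multiple)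
  have "fst w = of_int a * fst w' - of_int c * snd w'" "snd w = of_int d * snd w' - of_int b * fst w'"
  proof -
    have "of_int a * fst w' - of_int c * snd w' = (of_int a * of_int d - of_int b * of_int c) * fst w"
      unfolding w' by (simp add: algebra_simps)
    then show "fst w = of_int a * fst w' - of_int c * snd w'" by (simp add: det)
    have "of_int d * snd w' - of_int b * fst w' = (of_int a * of_int d - of_int b * of_int c) * snd w"
      unfolding w' by (simp add: algebra_simps)
    then show "snd w = of_int d * snd w' - of_int b * fst w'" by (simp add: det)
  qed
  then show "period_lattice w \<subseteq> period_lattice (change_basis A w)"
    unfolding w'_def[symmetric] by (intro sub) (auto intro!: lattice_diff lattice_multiple)
qed

lemma homogenize_scale:
  assumes "c \<noteq> 0"
  shows "homogenize k f (c * fst w, c * snd w) = c powi (- k) * homogenize k f w"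
  using assms by (simp add: homogenize_def power_int_mult_distrib)

definition Gamma1_invariant :: "nat \<Rightarrow> int \<Rightarrow> (complex \<Rightarrow> complex) \<Rightarrow> bool" where
  "Gamma1_invariant N k f \<longleftrightarrow> (\<forall>A\<in>Gamma1 N. \<forall>\<tau>\<in>upper_half_plane. slash k f A \<tau> = f \<tau>)"

text \<open>The slash by the inversion (0 -1; 1 0), which carries infinity to the cusp 0. For
  functions of bases it amounts to evaluation at (\<tau>, -1).\<close>

definition at_zero :: "int \<Rightarrow> (complex \<Rightarrow> complex) \<Rightarrow> complex \<Rightarrow> complex" where
  "at_zero k f \<tau> = \<tau> powi (- k) * f (- 1 / \<tau>)"

lemma at_zero_eq_homogenize: "at_zero k f \<tau> = homogenize k f (\<tau>, - 1)"
  by (simp add: at_zero_def homogenize_def)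

lemma homogenize_Gamma1:
  assumes f: "Gamma1_invariant N k f" and A: "A \<in> Gamma1 N" and w: "w \<in> oriented_bases"
  shows "homogenize k f (change_basis A w) = homogenize k f w"
proof -
  define v :: "complex \<times> complex" where "v = (1, snd w / fst w)"
  have w0: "fst w \<noteq> 0" using w by (rule oriented_basis_fst)
  have "w = (fst w * fst v, fst w * snd v)" using w0 by (simp add: v_def prod_eq_iff)
  moreover have "change_basis A (fst w * fst v, fst w * snd v) = (fst w * fst (change_basis A v), fst w * snd (change_basis A v))"
    by (simp add: change_basis_def algebra_simps)
  ultimately have "homogenize k f (change_basis A w) = fst w powi (- k) * homogenize k f (change_basis A v)"
    using homogenize_scale[OF w0] by metis
  also have "homogenize k f (change_basis A v) = f (snd w / fst w)"
    using f A oriented_basis_quotient[OF w] by (simp add: Gamma1_invariant_def v_def slash_eq_homogenize[symmetric])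
  finally show ?thesis by (simp add: homogenize_def)
qed

lemma change_basis_uminus:
  "change_basis (mat2 (- a) (- b) (- c) (- d)) w = (- 1 * fst (change_basis (mat2 a b c d) w), - 1 * snd (change_basis (mat2 a b c d) w))"
  by (simp add: change_basis_def)

text \<open>For N \<le> 3 every residue prime to N is 1 or -1. So if N divides the entry c, then A
  or -A lies in \<open>Gamma1 N\<close>; otherwise A is, up to sign, an element of
  \<open>Gamma1 N\<close> times the inversion times a translation. Thus infinity and 0 represent all
  cusps.\<close>

lemma cusp_dichotomy:
  assumes N: "N \<in> {1, 2, 3}" and f: "Gamma1_invariant N k f" and A: "A \<in> SL2Z"
  obtains \<epsilon> where "\<epsilon> = 1 \<or> \<epsilon> = (- 1) powi k" "\<And>\<tau>. \<tau> \<in> upper_half_plane \<Longrightarrow> slash k f A \<tau> = \<epsilon> * f \<tau>"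
  | \<epsilon> and j :: int where "\<epsilon> = 1 \<or> \<epsilon> = (- 1) powi k"
      "\<And>\<tau>. \<tau> \<in> upper_half_plane \<Longrightarrow> slash k f A \<tau> = \<epsilon> * at_zero k f (\<tau> + of_int j)"
proof -
  define a b c d where "a = A $ 1 $ 1" "b = A $ 1 $ 2" "c = A $ 2 $ 1" "d = A $ 2 $ 2"
  note defs = this
  have det: "a * d - b * c = 1" using A by (simp add: SL2Z_def det_2 defs)
  have Aeq: "A = mat2 a b c d" unfolding defs by (rule mat2_collapse)
  have unit: "[x = 1] (mod int N) \<or> [- x = 1] (mod int N)" if "\<not> int N dvd x \<or> N = 1" for x
  proof -
    consider "N = 1" | "N = 2" | "N = 3" using N by blast
    then show ?thesis using that by cases (auto simp: cong_def; presburger)+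
  qed
  have pm: "\<exists>\<epsilon>. (\<epsilon> = 1 \<or> \<epsilon> = (- 1) powi k) \<and> (\<forall>w\<in>oriented_bases. homogenize k f (change_basis (mat2 x y z t) w) = \<epsilon> * homogenize k f w)"
    if det': "x * t - y * z = 1" and z: "int N dvd z" for x y z t
  proof -
    have xt: "[x * t = 1] (mod int N)"
      using det' z unfolding cong_iff_dvd_diff by (metis add_diff_cancel_left' diff_add_cancel dvd_minus_iff dvd_mult minus_diff_eq)
    have tN: "\<not> int N dvd t \<or> N = 1"
    proof (rule ccontr)
      assume "\<not> ?thesis"
      then have "int N dvd x * t" "N \<noteq> 1" by auto
      with xt have "int N dvd 1" by (metis cong_dvd_iff)
      with \<open>N \<noteq> 1\<close> show False by simp
    qed
    have c0: "[z = 0] (mod int N)" "[- z = 0] (mod int N)" using z by (auto simp: cong_0_iff)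
    show ?thesis
      using unit[OF tN]
    proof
      assume t: "[t = 1] (mod int N)"
      have "[x = 1] (mod int N)" using xt t by (metis cong_scalar_left cong_trans cong_sym mult.right_neutral)
      then have "mat2 x y z t \<in> Gamma1 N" using det' t c0 by (simp add: mat2_Gamma1)
      from homogenize_Gamma1[OF f this] show ?thesis by (intro exI[of _ 1]) simp
    next
      assume t: "[- t = 1] (mod int N)"
      have "[(- x) * (- t) = 1] (mod int N)" using xt by simp
      then have "[- x = 1] (mod int N)" using t by (metis cong_scalar_left cong_trans cong_sym mult.right_neutral)
      then have G: "mat2 (- x) (- y) (- z) (- t) \<in> Gamma1 N" using det' t c0 by (simp add: mat2_Gamma1)
      show ?thesis
      proof (intro exI[of _ "(- 1) powi k"] conjI ballI)
        fix w assume w: "w \<in> oriented_bases"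
        have "homogenize k f (change_basis (mat2 x y z t) w) =
            (- 1) powi (- k) * homogenize k f (change_basis (mat2 (- x) (- y) (- z) (- t)) w)"
          using homogenize_scale[of "-1" k f "change_basis (mat2 (- x) (- y) (- z) (- t)) w"]
            change_basis_uminus[of "- x" "- y" "- z" "- t" w] by simp
        also have "\<dots> = (- 1) powi (- k) * homogenize k f w"
          using homogenize_Gamma1[OF f G w] by simp
        also have "(- 1) powi (- k) = ((- 1) powi k :: complex)"
          by (simp add: power_int_minus flip: power_int_inverse)
        finally show "homogenize k f (change_basis (mat2 x y z t) w) = (- 1) powi k * homogenize k f w" .
      qed simp
    qed
  qed
  show ?thesis
  proof (cases "int N dvd c")
    case True
    from pm[OF det True] obtain \<epsilon> where e: "\<epsilon> = 1 \<or> \<epsilon> = (- 1) powi k"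
      "\<And>w. w \<in> oriented_bases \<Longrightarrow> homogenize k f (change_basis A w) = \<epsilon> * homogenize k f w"
      unfolding Aeq by blast
    show ?thesis
      by (rule that(1)[OF e(1)]) (simp add: slash_eq_homogenize e(2), simp add: homogenize_def)
  next
    case False
    \<comment> \<open>As c^2 = 1 mod N, the entry d - j c = d (1 - c^2) is divisible by N;
      \<open>j\<close> is the translation to be split off.\<close>
    define j where "j = c * d"
    have "[c = 1] (mod int N) \<or> [- c = 1] (mod int N)" using unit[of c] False by blast
    then have cc: "[c * c = 1] (mod int N)"
      using cong_mult[of c 1 "int N" c 1] cong_mult[of "- c" 1 "int N" "- c" 1] by auto
    have z: "int N dvd - (d - j * c)"
    proof -
      have "[d * (c * c) = d * 1] (mod int N)" using cc by (rule cong_scalar_left)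
      then have "int N dvd d * (c * c) - d" by (simp add: cong_iff_dvd_diff)
      then show ?thesis by (simp add: j_def algebra_simps)
    qed
    have det': "- (b - j * a) * c - a * - (d - j * c) = 1" using det by (simp add: algebra_simps)
    from pm[OF det' z] obtain \<epsilon> where e: "\<epsilon> = 1 \<or> \<epsilon> = (- 1) powi k"
      "\<And>w. w \<in> oriented_bases \<Longrightarrow>
        homogenize k f (change_basis (mat2 (- (b - j * a)) a (- (d - j * c)) c) w) = \<epsilon> * homogenize k f w"
      by blast
    show ?thesis
    proof (rule that(2)[OF e(1), of j])
      fix \<tau> assume \<tau>: "\<tau> \<in> upper_half_plane"
      then have "(\<tau> + of_int j, - 1) \<in> oriented_bases" by (simp add: upper_half_plane_def)
      moreover have "change_basis (mat2 (- (b - j * a)) a (- (d - j * c)) c) (\<tau> + of_int j, - 1) = change_basis A (1, \<tau>)"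
        unfolding Aeq by (simp add: change_basis_def algebra_simps)
      ultimately show "slash k f A \<tau> = \<epsilon> * at_zero k f (\<tau> + of_int j)"
        using e(2)[of "(\<tau> + of_int j, - 1)"] by (simp only: slash_eq_homogenize at_zero_eq_homogenize)
    qed
  qed
qed

subsection \<open>Spaces of modular forms\<close>

lemma homogenize_mult:
  "fst w \<noteq> 0 \<Longrightarrow> homogenize (k + l) (\<lambda>\<tau>. f \<tau> * g \<tau>) w = homogenize k f w * homogenize l g w"
proof -
  assume w: "fst w \<noteq> 0"
  have "fst w powi - (k + l) = fst w powi (- k) * fst w powi (- l)"
    using w power_int_add[of "fst w" "- k" "- l"] by (simp add: algebra_simps)
  then show ?thesis by (simp add: homogenize_def)
qed

lemma homogenize_add:
  "homogenize k (\<lambda>\<tau>. f \<tau> + g \<tau>) w = homogenize k f w + homogenize k g w"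
  by (simp add: homogenize_def algebra_simps)

lemma homogenize_divide:
  "fst w \<noteq> 0 \<Longrightarrow> homogenize (k - l) (\<lambda>\<tau>. f \<tau> / g \<tau>) w = homogenize k f w / homogenize l g w"
proof -
  assume w: "fst w \<noteq> 0"
  have "fst w powi - (k - l) = fst w powi (- k) / fst w powi (- l)"
    using w power_int_diff[of "fst w" "- k" "- l"] by (simp add: algebra_simps)
  then show ?thesis by (simp add: homogenize_def)
qed

text \<open>The working criterion for modular forms: two bounds replace the condition on all
  slashes, by \<open>cusp_dichotomy\<close>.\<close>

definition modular_at_cusps :: "nat \<Rightarrow> int \<Rightarrow> (complex \<Rightarrow> complex) \<Rightarrow> bool" where
  "modular_at_cusps N k f \<longleftrightarrow> f holomorphic_on upper_half_plane \<and> Gamma1_invariant N k f \<and>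
     bounded_at_i_inf f \<and> bounded_at_i_inf (at_zero k f)"

lemma at_zero_holomorphic:
  assumes "f holomorphic_on upper_half_plane"
  shows "at_zero k f holomorphic_on upper_half_plane"
proof -
  have ne: "\<tau> \<noteq> 0" if "\<tau> \<in> upper_half_plane" for \<tau> using that by (auto simp: upper_half_plane_def)
  have "(\<lambda>\<tau>. - 1 / \<tau>) holomorphic_on upper_half_plane"
    by (intro holomorphic_intros) (use ne in auto)
  then have "(\<lambda>\<tau>. f (- 1 / \<tau>)) holomorphic_on upper_half_plane"
    by (rule holomorphic_on_compose_gen[unfolded o_def, OF _ assms])
       (use minus_inverse_upper_half_plane in auto)
  then show ?thesis unfolding at_zero_def
    by (intro holomorphic_intros) (use ne in auto)
qed

text \<open>The translations (1 j; 0 1) lie in \<open>Gamma1 N\<close> for every j, whereas at the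
  cusp 0 the translation by N corresponds to (1 0; -N 1).\<close>

lemma Gamma1_invariant_period:
  assumes f: "Gamma1_invariant N k f" and \<tau>: "\<tau> \<in> upper_half_plane"
  shows "f (\<tau> + of_int j) = f \<tau>"
    and "at_zero k f (\<tau> + of_nat N) = at_zero k f \<tau>"
proof -
  have "mat2 1 j 0 1 \<in> Gamma1 N" by (simp add: mat2_Gamma1)
  from homogenize_Gamma1[OF f this, of "(1, \<tau>)"] \<tau> show "f (\<tau> + of_int j) = f \<tau>"
    by (simp add: change_basis_def homogenize_def)
  have "mat2 1 0 (- int N) 1 \<in> Gamma1 N" by (simp add: mat2_Gamma1 cong_0_iff)
  from homogenize_Gamma1[OF f this, of "(\<tau>, - 1)"] \<tau> show "at_zero k f (\<tau> + of_nat N) = at_zero k f \<tau>"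
    by (simp add: change_basis_def at_zero_eq_homogenize add.commute)
qed

context
  fixes N :: nat
  assumes N: "N \<in> {1, 2, 3}"
begin

lemma N_pos: "N > 0" using N by auto

lemma modular_at_cusps_imp:
  assumes f: "modular_at_cusps N k f" and "\<And>\<tau>. \<tau> \<notin> upper_half_plane \<Longrightarrow> f \<tau> = 0"
  shows "f \<in> modular_forms N k"
proof -
  have hol: "f holomorphic_on upper_half_plane" and inv: "Gamma1_invariant N k f"
    and bdd: "bounded_at_i_inf f" and bdd0: "bounded_at_i_inf (at_zero k f)"
    using f by (auto simp: modular_at_cusps_def)
  have "holomorphic_at_infinity N (slash k f A)" if A: "A \<in> SL2Z" for A
  proof (rule cusp_dichotomy[OF N inv A])
    fix \<epsilon> assume e: "\<And>\<tau>. \<tau> \<in> upper_half_plane \<Longrightarrow> slash k f A \<tau> = \<epsilon> * f \<tau>"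
    show ?thesis
    proof (rule holomorphic_at_infinityI[OF N_pos])
      have "(\<lambda>\<tau>. \<epsilon> * f \<tau>) holomorphic_on upper_half_plane" by (intro holomorphic_intros hol)
      then show "slash k f A holomorphic_on upper_half_plane" by (rule holomorphic_transform) (simp add: e)
      have "bounded_at_i_inf (\<lambda>\<tau>. \<epsilon> * f \<tau>)" by (intro bounded_at_i_inf_mult bdd bounded_at_i_inf_const)
      then show "bounded_at_i_inf (slash k f A)" by (rule bounded_at_i_inf_cong[rotated]) (simp add: e)
      fix \<tau> assume t: "\<tau> \<in> upper_half_plane"
      then have "\<tau> + of_nat N \<in> upper_half_plane" by (simp add: upper_half_plane_def)
      then show "slash k f A (\<tau> + of_nat N) = slash k f A \<tau>"
        using t e Gamma1_invariant_period(1)[OF inv t, of "int N"] by simp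
    qed
  next
    fix \<epsilon> and j :: int
    assume e: "\<And>\<tau>. \<tau> \<in> upper_half_plane \<Longrightarrow> slash k f A \<tau> = \<epsilon> * at_zero k f (\<tau> + of_int j)"
    show ?thesis
    proof (rule holomorphic_at_infinityI[OF N_pos])
      have "(\<lambda>\<tau>. at_zero k f (\<tau> + of_int j)) holomorphic_on upper_half_plane"
        by (rule holomorphic_on_compose_gen[of "\<lambda>\<tau>. \<tau> + of_int j" _ "at_zero k f", unfolded o_def, OF _ at_zero_holomorphic[OF hol]])
           (auto intro!: holomorphic_intros simp: upper_half_plane_def)
      then have "(\<lambda>\<tau>. \<epsilon> * at_zero k f (\<tau> + of_int j)) holomorphic_on upper_half_plane"
        by (intro holomorphic_intros)
      then show "slash k f A holomorphic_on upper_half_plane" by (rule holomorphic_transform) (simp add: e)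
      have "bounded_at_i_inf (\<lambda>\<tau>. \<epsilon> * at_zero k f (\<tau> + of_int j))"
        by (rule bounded_at_i_inf_mult[OF bounded_at_i_inf_const bounded_at_i_inf_translate[OF bdd0]])
      then show "bounded_at_i_inf (slash k f A)" by (rule bounded_at_i_inf_cong[rotated]) (simp add: e)
      fix \<tau> assume t: "\<tau> \<in> upper_half_plane"
      then have "\<tau> + of_nat N \<in> upper_half_plane" "\<tau> + of_int j \<in> upper_half_plane" by (simp_all add: upper_half_plane_def)
      then show "slash k f A (\<tau> + of_nat N) = slash k f A \<tau>"
        using t e Gamma1_invariant_period(2)[OF inv, of "\<tau> + of_int j"] by (simp add: algebra_simps)
    qed
  qed
  with hol inv assms(2) show ?thesis by (auto simp: modular_forms_def Gamma1_invariant_def)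
qed

text \<open>The definition gives expansions of period N at every cusp; at infinity invariance
  improves this to period 1. This matters because the order of vanishing at infinity is measured in
  exp(2 \<pi> \<i> \<tau>).\<close>

lemma modular_forms_imp:
  assumes f: "f \<in> modular_forms N k"
  shows "modular_at_cusps N k f" "holomorphic_at_infinity 1 f" "holomorphic_at_infinity N (at_zero k f)"
    and "\<tau> \<notin> upper_half_plane \<Longrightarrow> f \<tau> = 0"
proof -
  have hol: "f holomorphic_on upper_half_plane" and inv: "Gamma1_invariant N k f"
    and cusp: "\<And>A. A \<in> SL2Z \<Longrightarrow> holomorphic_at_infinity N (slash k f A)"
    and off: "\<tau> \<notin> upper_half_plane \<Longrightarrow> f \<tau> = 0" for \<tau>
    using f by (auto simp: modular_forms_def Gamma1_invariant_def)
  have "slash k f (mat2 1 0 0 1) = f" "slash k f (mat2 0 (- 1) 1 0) = at_zero k f"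
    by (auto simp: slash_def at_zero_def)
  then have 1: "holomorphic_at_infinity N f" and 2: "holomorphic_at_infinity N (at_zero k f)"
    using cusp[of "mat2 1 0 0 1"] cusp[of "mat2 0 (- 1) 1 0"] by (auto simp: mat2_SL2Z)
  have "bounded_at_i_inf f"
    by (rule holomorphic_at_infinityD[OF N_pos 1]) (rule bounded_at_i_inf_tendsto)
  moreover have "bounded_at_i_inf (at_zero k f)"
    by (rule holomorphic_at_infinityD[OF N_pos 2]) (rule bounded_at_i_inf_tendsto)
  ultimately show "modular_at_cusps N k f" "holomorphic_at_infinity 1 f"
    using hol inv Gamma1_invariant_period(1)[OF inv, of _ 1]
    by (auto simp: modular_at_cusps_def intro!: holomorphic_at_infinityI)
  show "holomorphic_at_infinity N (at_zero k f)" by (rule 2)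
  show "\<tau> \<notin> upper_half_plane \<Longrightarrow> f \<tau> = 0" by (rule off)
qed

lemma modular_forms_limits:
  assumes f: "f \<in> modular_forms N k"
  obtains a b where "(f \<longlongrightarrow> a) at_i_inf" "(at_zero k f \<longlongrightarrow> b) at_i_inf"
  using holomorphic_at_infinityD[OF _ modular_forms_imp(2)[OF f]] holomorphic_at_infinityD[OF N_pos modular_forms_imp(3)[OF f]]
  by (metis zero_less_one)

lemma zero_modular_form: "(\<lambda>_. 0) \<in> modular_forms N k"
  by (rule modular_at_cusps_imp) (auto simp: modular_at_cusps_def Gamma1_invariant_def slash_def at_zero_def[abs_def])

lemma at_zero_mult:
  "\<tau> \<noteq> 0 \<Longrightarrow> at_zero (k + l) (\<lambda>\<tau>. f \<tau> * g \<tau>) \<tau> = at_zero k f \<tau> * at_zero l g \<tau>"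
  by (simp add: at_zero_eq_homogenize homogenize_mult)

lemma at_zero_add: "at_zero k (\<lambda>\<tau>. f \<tau> + g \<tau>) = (\<lambda>\<tau>. at_zero k f \<tau> + at_zero k g \<tau>)"
  by (simp add: at_zero_def fun_eq_iff algebra_simps)

lemma at_zero_cmult: "at_zero k (\<lambda>\<tau>. c * f \<tau>) = (\<lambda>\<tau>. c * at_zero k f \<tau>)"
  by (simp add: at_zero_def fun_eq_iff algebra_simps)

lemma slash_mult:
  assumes "A \<in> SL2Z" "\<tau> \<in> upper_half_plane"
  shows "slash (k + l) (\<lambda>\<tau>. f \<tau> * g \<tau>) A \<tau> = slash k f A \<tau> * slash l g A \<tau>"
    and "slash (k - l) (\<lambda>\<tau>. f \<tau> / g \<tau>) A \<tau> = slash k f A \<tau> / slash l g A \<tau>"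
  using oriented_basis_fst[OF change_basis_oriented[OF assms(1), of "(1, \<tau>)"]] assms(2)
  by (simp_all add: slash_eq_homogenize homogenize_mult homogenize_divide)

lemma Gamma1_SL2Z: "A \<in> Gamma1 N \<Longrightarrow> A \<in> SL2Z"
  by (simp add: Gamma1_def)

lemma modular_forms_add:
  assumes f: "f \<in> modular_forms N k" and g: "g \<in> modular_forms N k"
  shows "(\<lambda>\<tau>. f \<tau> + g \<tau>) \<in> modular_forms N k"
  using modular_forms_imp(1,4)[OF f] modular_forms_imp(1,4)[OF g]
  by (intro modular_at_cusps_imp)
     (auto simp: modular_at_cusps_def Gamma1_invariant_def at_zero_add slash_eq_homogenize homogenize_add intro!: holomorphic_intros)

lemma modular_forms_mult:
  assumes f: "f \<in> modular_forms N k" and g: "g \<in> modular_forms N l"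
  shows "(\<lambda>\<tau>. f \<tau> * g \<tau>) \<in> modular_forms N (k + l)"
proof (rule modular_at_cusps_imp)
  have "bounded_at_i_inf (\<lambda>\<tau>. at_zero k f \<tau> * at_zero l g \<tau>)"
    using modular_forms_imp(1)[OF f] modular_forms_imp(1)[OF g] by (auto simp: modular_at_cusps_def)
  then have "bounded_at_i_inf (at_zero (k + l) (\<lambda>\<tau>. f \<tau> * g \<tau>))"
  proof (rule bounded_at_i_inf_cong[rotated])
    fix \<tau> assume "\<tau> \<in> upper_half_plane"
    then have "\<tau> \<noteq> 0" by (auto simp: upper_half_plane_def)
    then show "at_zero k f \<tau> * at_zero l g \<tau> = at_zero (k + l) (\<lambda>\<tau>. f \<tau> * g \<tau>) \<tau>" by (simp add: at_zero_mult)
  qed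
  then show "modular_at_cusps N (k + l) (\<lambda>\<tau>. f \<tau> * g \<tau>)"
    using modular_forms_imp(1)[OF f] modular_forms_imp(1)[OF g]
    by (auto simp: modular_at_cusps_def Gamma1_invariant_def slash_mult Gamma1_SL2Z intro!: holomorphic_intros)
qed (use modular_forms_imp(4)[OF f] in auto)

lemma modular_forms_cmult:
  assumes f: "f \<in> modular_forms N k"
  shows "(\<lambda>\<tau>. c * f \<tau>) \<in> modular_forms N k"
  using modular_forms_imp(1,4)[OF f]
  by (intro modular_at_cusps_imp)
     (auto simp: modular_at_cusps_def Gamma1_invariant_def at_zero_cmult slash_def intro!: holomorphic_intros)

lemma modular_forms_diff:
  assumes f: "f \<in> modular_forms N k" and g: "g \<in> modular_forms N k"
  shows "(\<lambda>\<tau>. f \<tau> - g \<tau>) \<in> modular_forms N k"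
  using modular_forms_add[OF f modular_forms_cmult[OF g, of "- 1"]] by simp

lemma one_modular_form: "(\<lambda>\<tau>. if \<tau> \<in> upper_half_plane then 1 else 0) \<in> modular_forms N 0"
proof (rule modular_at_cusps_imp)
  define f :: "complex \<Rightarrow> complex" where "f \<tau> = (if \<tau> \<in> upper_half_plane then 1 else 0)" for \<tau>
  have "Gamma1_invariant N 0 f" unfolding Gamma1_invariant_def
  proof (intro ballI)
    fix A \<tau> assume "A \<in> Gamma1 N" "\<tau> \<in> upper_half_plane"
    then have "change_basis A (1, \<tau>) \<in> oriented_bases" by (intro change_basis_oriented Gamma1_SL2Z) auto
    from oriented_basis_quotient[OF this] show "slash 0 f A \<tau> = f \<tau>" using \<open>\<tau> \<in> _\<close>
      by (simp add: slash_eq_homogenize homogenize_def f_def)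
  qed
  moreover have "f holomorphic_on upper_half_plane"
    by (rule holomorphic_transform[of "\<lambda>_. 1"]) (auto simp: f_def)
  moreover have "bounded_at_i_inf f"
    by (rule bounded_at_i_inf_cong[of "\<lambda>_. 1"]) (auto simp: f_def)
  moreover have "bounded_at_i_inf (at_zero 0 f)"
    by (rule bounded_at_i_inf_cong[of "\<lambda>_. 1"])
       (use minus_inverse_upper_half_plane in \<open>auto simp: f_def at_zero_def\<close>)
  ultimately show "modular_at_cusps N 0 f" by (simp add: modular_at_cusps_def)
qed auto

lemma modular_forms_power:
  assumes f: "f \<in> modular_forms N k" and n: "n > 0"
  shows "(\<lambda>\<tau>. f \<tau> ^ n) \<in> modular_forms N (int n * k)"
  using n
proof (induction n rule: nat_induct_non_zero)
  case (Suc n)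
  from modular_forms_mult[OF f Suc.IH] show ?case by (simp add: algebra_simps)
qed (use f in simp)

end

text \<open>A shortest nonzero vector v of the lattice of (1, \<tau>) is primitive, so it extends to
  a basis (v, u); then \<sigma> = u/v satisfies |\<sigma> + n| \<ge> 1 for every integer n.\<close>

lemma reduction_to_fundamental_domain:
  assumes \<tau>: "\<tau> \<in> upper_half_plane"
  obtains A \<sigma> where "A \<in> SL2Z" "Im \<sigma> \<ge> 1 / 2"
    "\<And>k f. homogenize k f (change_basis A (1, \<sigma>)) = slash k f A \<sigma>"
    "snd (change_basis A (1, \<sigma>)) / fst (change_basis A (1, \<sigma>)) = \<tau>"
proof -
  define w where "w = (1 :: complex, \<tau>)"
  have w: "w \<in> oriented_bases" using \<tau> by (simp add: w_def)
  have cl: "closed (period_lattice w - {0})" by (rule closed_lattice_subset[OF w]) auto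
  have ne: "period_lattice w - {0} \<noteq> {}" using lattice_basis(1)[of w] by (auto simp: w_def)
  obtain v where v0: "v \<in> period_lattice w - {0}"
    "\<And>y. y \<in> period_lattice w - {0} \<Longrightarrow> dist 0 v \<le> dist 0 y"
    using distance_attains_inf[OF cl ne, of 0] by blast
  then have v: "v \<in> period_lattice w - {0}"
    "\<And>y. y \<in> period_lattice w - {0} \<Longrightarrow> norm v \<le> norm y" by (auto simp: dist_norm)
  obtain d c :: int where dc: "v = of_int d * fst w + of_int c * snd w"
    using v(1) unfolding period_lattice_def by auto
  have "gcd c d = 1"
  proof -
    define g where "g = gcd c d"
    have g: "g > 0" using v(1) dc unfolding g_def by (cases "c = 0 \<and> d = 0") (auto simp: zero_less_iff_neq_zero)
    obtain c' d' where cd: "c = g * c'" "d = g * d'" unfolding g_def by (meson dvd_def gcd_dvd1 gcd_dvd2)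
    define v' where "v' = of_int d' * fst w + of_int c' * snd w"
    have vv: "v = of_int g * v'" by (simp add: dc cd v'_def algebra_simps)
    have "v' \<in> period_lattice w" unfolding v'_def period_lattice_def by blast
    moreover have "v' \<noteq> 0" using v(1) vv by auto
    ultimately have "norm v \<le> norm v'" "norm v' > 0" using v(2) by auto
    moreover have "norm v = real_of_int g * norm v'" using g by (simp add: vv norm_mult)
    ultimately have "real_of_int g \<le> 1" by simp
    with g show ?thesis unfolding g_def[symmetric] by simp
  qed
  then obtain a b :: int where ab: "a * d - b * c = 1"
  proof -
    obtain x y where "x * c + y * d = gcd c d" using bezout_int by blast
    then have "y * d - (- x) * c = 1" using \<open>gcd c d = 1\<close> by simp
    then show ?thesis by (rule that)
  qed
  define B where "B = mat2 a b c d"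
  have B: "B \<in> SL2Z" using ab by (simp add: B_def mat2_SL2Z)
  define u where "u = of_int a * \<tau> + of_int b"
  have vw: "v = of_int c * \<tau> + of_int d" by (simp add: dc w_def)
  have cb: "change_basis B w = (v, u)" by (simp add: change_basis_def B_def u_def vw w_def)
  define \<sigma> where "\<sigma> = u / v"
  have sH: "Im \<sigma> > 0" using oriented_basis_quotient[OF change_basis_oriented[OF B w]] unfolding cb
    by (simp add: upper_half_plane_def \<sigma>_def)
  \<comment> \<open>Rounding puts the real part of \<sigma> + n into [-1/2, 1/2], so that (Im
    \<sigma>)^2 \<ge> 3/4; the weaker bound 1/2 is enough.\<close>
  have "Im \<sigma> \<ge> 1 / 2"
  proof -
    define n where "n = - round (Re \<sigma>)"
    have re: "\<bar>Re (\<sigma> + of_int n)\<bar> \<le> 1 / 2"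
      using of_int_round_abs_le[of "Re \<sigma>"] by (simp add: n_def abs_minus_commute)
    have uL: "u + of_int n * v \<in> period_lattice w"
    proof -
      have "u \<in> period_lattice w" "v \<in> period_lattice w"
        using lattice_basis[of "(v, u)"] change_basis_lattice[OF B, of w] unfolding cb by simp_all
      then show ?thesis by (intro lattice_add lattice_multiple)
    qed
    have "u + of_int n * v = v * (\<sigma> + of_int n)" using v(1) by (simp add: \<sigma>_def field_simps)
    moreover have "\<sigma> + of_int n \<noteq> 0"
    proof
      assume "\<sigma> + of_int n = 0"
      then have "Im (\<sigma> + of_int n) = 0" by simp
      with sH show False by simp
    qed
    ultimately have "norm v \<le> norm v * norm (\<sigma> + of_int n)"
      using v(2)[of "u + of_int n * v"] uL v(1) by (auto simp: norm_mult)
    then have "1 \<le> norm (\<sigma> + of_int n)" using v(1) by simp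
    then have "1 \<le> norm (\<sigma> + of_int n) ^ 2" by (simp add: one_le_power)
    also have "\<dots> = Re (\<sigma> + of_int n) ^ 2 + Im \<sigma> ^ 2" by (simp add: cmod_power2)
    also have "Re (\<sigma> + of_int n) ^ 2 \<le> (1 / 2) ^ 2" using re by (metis abs_ge_zero power2_abs power_mono)
    finally have "(1 / 2) ^ 2 \<le> Im \<sigma> ^ 2" by (simp add: power2_eq_square)
    then show ?thesis using sH by (simp add: power2_le_iff_abs_le)
  qed
  \<comment> \<open>The inverse of \<open>B\<close>, which leads from \<sigma> back to
    \<tau>.\<close>
  define A where "A = mat2 d (- b) (- c) a"
  have A: "A \<in> SL2Z" using ab by (simp add: A_def mat2_SL2Z algebra_simps)
  have "fst (change_basis A (1, \<sigma>)) = 1 / v"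
  proof -
    have "v * fst (change_basis A (1, \<sigma>)) = of_int (a * d - b * c)"
      using v(1) by (simp add: change_basis_def A_def \<sigma>_def field_simps) (simp add: u_def vw algebra_simps)
    then show ?thesis using v(1) ab by (simp add: field_simps)
  qed
  moreover have "snd (change_basis A (1, \<sigma>)) = \<tau> / v"
  proof -
    have "v * snd (change_basis A (1, \<sigma>)) = of_int (a * d - b * c) * \<tau>"
      using v(1) by (simp add: change_basis_def A_def \<sigma>_def field_simps) (simp add: u_def vw algebra_simps)
    then show ?thesis using v(1) ab by (simp add: field_simps)
  qed
  ultimately have "snd (change_basis A (1, \<sigma>)) / fst (change_basis A (1, \<sigma>)) = \<tau>" using v(1) by simp
  with A \<open>Im \<sigma> \<ge> 1 / 2\<close> show ?thesis by (intro that[of A \<sigma>]) (auto simp: slash_eq_homogenize)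
qed

subsection \<open>The structure of the ring of modular forms\<close>

lemma q_exp_surj:
  assumes "N > 0" "q \<in> ball 0 1 - {0}"
  obtains \<tau> where "\<tau> \<in> upper_half_plane" "q = exp (2 * of_real pi * \<i> * \<tau> / of_nat N)"
proof -
  define \<tau> where "\<tau> = of_nat N * Ln q / (2 * of_real pi * \<i>)"
  have q: "exp (2 * of_real pi * \<i> * \<tau> / of_nat N) = q" using assms by (simp add: \<tau>_def)
  have "Im \<tau> = - (of_nat N * ln (norm q) / (2 * pi))"
    using assms(2) by (simp add: \<tau>_def Im_divide power2_eq_square field_simps)
  moreover have "of_nat N * ln (norm q) / (2 * pi) < 0"
    using assms by (intro divide_neg_pos mult_pos_neg) auto
  ultimately have "\<tau> \<in> upper_half_plane" by (simp add: upper_half_plane_def)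
  with q show ?thesis by (intro that[of \<tau>]) auto
qed

text \<open>Maximum modulus principle on the q-disc. The centre q = 0 stands for the cusp and is no
  value of the exponential, so it needs a bound of its own.\<close>

lemma q_expansion_constant:
  assumes N: "N > 0" and h: "h holomorphic_on ball 0 1" and p: "p \<in> ball 0 1"
    and max: "\<And>\<tau>. \<tau> \<in> upper_half_plane \<Longrightarrow> norm (h (exp (2 * of_real pi * \<i> * \<tau> / of_nat N))) \<le> norm (h p)"
    and "norm (h 0) \<le> norm (h p)"
  shows "q \<in> ball 0 1 \<Longrightarrow> h q = h p"
proof -
  have "h constant_on ball 0 1"
  proof (rule maximum_modulus_principle[OF h open_ball _ open_ball subset_refl p])
    fix q :: complex assume "q \<in> ball 0 1"
    then show "norm (h q) \<le> norm (h p)"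
      using q_exp_surj[OF N, of q] max assms(5) by (cases "q = 0") (force, blast)
  qed auto
  then show "q \<in> ball 0 1 \<Longrightarrow> h q = h p" using p by (auto simp: constant_on_def)
qed

context
  fixes N :: nat
  assumes N: "N \<in> {1, 2, 3}"
begin

text \<open>By reduction and the dichotomy, every value of \<open>f\<close> is taken by one of the
  two q-expansions on the compact disc |q| \<le> exp(-\<pi>/N); in weight 0 the sign is always 1.
  Hence one expansion attains the global bound inside the unit disc and is constant.\<close>

theorem modular_forms_weight_0:
  assumes f: "f \<in> modular_forms N 0"
  obtains c where "\<And>\<tau>. \<tau> \<in> upper_half_plane \<Longrightarrow> f \<tau> = c"
proof -
  have Np: "N > 0" using N by auto
  have inv: "Gamma1_invariant N 0 f" using modular_forms_imp(1)[OF N f] by (simp add: modular_at_cusps_def)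
  obtain h0 where h0: "h0 holomorphic_on ball 0 1"
    "\<And>\<tau>. \<tau> \<in> upper_half_plane \<Longrightarrow> f \<tau> = h0 (exp (2 * of_real pi * \<i> * \<tau> / of_nat 1))"
    using holomorphic_at_infinityD[OF _ modular_forms_imp(2)[OF N f]] by (metis zero_less_one)
  obtain h1 where h1: "h1 holomorphic_on ball 0 1"
    "\<And>\<tau>. \<tau> \<in> upper_half_plane \<Longrightarrow> at_zero 0 f \<tau> = h1 (exp (2 * of_real pi * \<i> * \<tau> / of_nat N))"
    using holomorphic_at_infinityD[OF Np modular_forms_imp(3)[OF N f]] by metis
  define r where "r = exp (- (pi / N))"
  have r: "0 < r" "r < 1" using Np by (auto simp: r_def)
  define K where "K = cball (0::complex) r"
  have K: "compact K" "K \<noteq> {}" "K \<subseteq> ball 0 1" "0 \<in> K" using r by (auto simp: K_def)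
  have range: "\<exists>x\<in>K. f \<tau> = h0 x \<or> f \<tau> = h1 x" if t: "\<tau> \<in> upper_half_plane" for \<tau>
  proof -
    obtain A \<sigma> where A: "A \<in> SL2Z" "Im \<sigma> \<ge> 1 / 2"
      "\<And>k f. homogenize k f (change_basis A (1, \<sigma>)) = slash k f A \<sigma>"
      "snd (change_basis A (1, \<sigma>)) / fst (change_basis A (1, \<sigma>)) = \<tau>"
      using reduction_to_fundamental_domain[OF t] by blast
    have s: "\<sigma> \<in> upper_half_plane" using A(2) by (auto simp: upper_half_plane_def)
    have fs: "f \<tau> = slash 0 f A \<sigma>" using A(4) unfolding A(3)[symmetric] by (simp add: homogenize_def)
    have inK: "exp (2 * of_real pi * \<i> * \<sigma>' / of_nat M) \<in> K" if "Im \<sigma>' = Im \<sigma>" "M > 0" "M \<le> N" for \<sigma>' M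
    proof -
      have "pi / N \<le> pi / M" using that by (simp add: frac_le)
      also have "\<dots> \<le> 2 * pi * Im \<sigma>' / M" using that A(2) by (intro divide_right_mono) auto
      finally show ?thesis unfolding K_def mem_cball dist_0_norm norm_q_exp by (simp add: r_def)
    qed
    show ?thesis
    proof (rule cusp_dichotomy[OF N inv A(1)])
      fix \<epsilon> :: complex assume "\<epsilon> = 1 \<or> \<epsilon> = (- 1) powi 0"
        "\<And>\<tau>. \<tau> \<in> upper_half_plane \<Longrightarrow> slash 0 f A \<tau> = \<epsilon> * f \<tau>"
      then have "f \<tau> = h0 (exp (2 * of_real pi * \<i> * \<sigma> / of_nat 1))" using fs s h0(2)[OF s] by auto
      then show ?thesis using inK[of \<sigma> 1] Np by auto
    next
      fix \<epsilon> :: complex and j :: int assume "\<epsilon> = 1 \<or> \<epsilon> = (- 1) powi 0"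
        "\<And>\<tau>. \<tau> \<in> upper_half_plane \<Longrightarrow> slash 0 f A \<tau> = \<epsilon> * at_zero 0 f (\<tau> + of_int j)"
      then have "f \<tau> = h1 (exp (2 * of_real pi * \<i> * (\<sigma> + of_int j) / of_nat N))"
        using fs s h1(2)[of "\<sigma> + of_int j"] by (auto simp: upper_half_plane_def)
      then show ?thesis using inK[of "\<sigma> + of_int j" N] Np by auto
    qed
  qed
  have c: "continuous_on K (\<lambda>x. norm (h0 x))" "continuous_on K (\<lambda>x. norm (h1 x))"
    using h0(1) h1(1) K(3) by (auto intro!: continuous_intros intro: continuous_on_subset holomorphic_on_imp_continuous_on)
  obtain p0 where p0: "p0 \<in> K" "\<And>x. x \<in> K \<Longrightarrow> norm (h0 x) \<le> norm (h0 p0)"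
    using continuous_attains_sup[OF K(1,2) c(1)] by blast
  obtain p1 where p1: "p1 \<in> K" "\<And>x. x \<in> K \<Longrightarrow> norm (h1 x) \<le> norm (h1 p1)"
    using continuous_attains_sup[OF K(1,2) c(2)] by blast
  have bound: "norm (f \<tau>) \<le> max (norm (h0 p0)) (norm (h1 p1))" if "\<tau> \<in> upper_half_plane" for \<tau>
    using range[OF that] p0(2) p1(2) by (metis max.coboundedI1 max.coboundedI2)
  show ?thesis
  proof (cases "norm (h1 p1) \<le> norm (h0 p0)")
    case True
    have "h0 q = h0 p0" if "q \<in> ball 0 1" for q
    proof (rule q_expansion_constant[of 1, OF _ h0(1) _ _ _ that])
      show "norm (h0 (exp (2 * of_real pi * \<i> * \<tau> / of_nat 1))) \<le> norm (h0 p0)" if "\<tau> \<in> upper_half_plane" for \<tau>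
        using bound[OF that] h0(2)[OF that] True by simp
    qed (use p0 K in auto)
    moreover have "exp (2 * of_real pi * \<i> * \<tau> / of_nat 1) \<in> ball 0 1" if "\<tau> \<in> upper_half_plane" for \<tau>
      using that unfolding mem_ball dist_0_norm norm_q_exp by (simp add: upper_half_plane_def)
    ultimately show ?thesis using h0(2) by (intro that[of "h0 p0"]) metis
  next
    case False
    have "h1 q = h1 p1" if "q \<in> ball 0 1" for q
    proof (rule q_expansion_constant[of N, OF Np h1(1) _ _ _ that])
      show "norm (h1 (exp (2 * of_real pi * \<i> * \<tau> / of_nat N))) \<le> norm (h1 p1)" if "\<tau> \<in> upper_half_plane" for \<tau>
        using bound[OF minus_inverse_upper_half_plane[OF that]] h1(2)[OF that] False by (simp add: at_zero_def)
    qed (use p1 K in auto)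
    moreover have "exp (2 * of_real pi * \<i> * \<tau> / of_nat N) \<in> ball 0 1" if "\<tau> \<in> upper_half_plane" for \<tau>
      using that Np unfolding mem_ball dist_0_norm norm_q_exp by (simp add: upper_half_plane_def)
    ultimately have c: "at_zero 0 f \<tau> = h1 p1" if "\<tau> \<in> upper_half_plane" for \<tau>
      using h1(2)[OF that] that by metis
    have "f \<tau> = h1 p1" if "\<tau> \<in> upper_half_plane" for \<tau>
      using c[OF minus_inverse_upper_half_plane[OF that]] by (simp add: at_zero_def)
    then show ?thesis by (rule that)
  qed
qed

end

text \<open>The lower bound says that the zero of \<open>D\<close> at \<open>\<infinity>\<close> is simple, so that every form that
  vanishes at \<open>\<infinity>\<close> is divisible by \<open>D\<close>.\<close>

definition cusp_divisor :: "nat \<Rightarrow> nat \<Rightarrow> (complex \<Rightarrow> complex) \<Rightarrow> bool" where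
  "cusp_divisor N m D \<longleftrightarrow> m > 0 \<and> D \<in> modular_forms N (int m) \<and> (\<forall>\<tau>\<in>upper_half_plane. D \<tau> \<noteq> 0) \<and>
     (D \<longlongrightarrow> 0) at_i_inf \<and>
     (\<exists>c>0. \<forall>\<^sub>F \<tau> in at_i_inf. c * exp (- (2 * pi * Im \<tau>)) \<le> norm (D \<tau>)) \<and>
     (N = 1 \<or> (\<exists>b. b \<noteq> 0 \<and> (at_zero (int m) D \<longlongrightarrow> b) at_i_inf))"

context
  fixes N m :: nat and D :: "complex \<Rightarrow> complex"
  assumes N: "N \<in> {1, 2, 3}" and D: "cusp_divisor N m D"
begin

lemma cusp_divisor_facts:
  "m > 0" "D \<in> modular_forms N (int m)" "\<tau> \<in> upper_half_plane \<Longrightarrow> D \<tau> \<noteq> 0" "(D \<longlongrightarrow> 0) at_i_inf"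
  using D by (auto simp: cusp_divisor_def)

text \<open>At infinity \<open>f\<close> is h(q) with h(0) = 0 and q = exp(2 \<pi> \<i> \<tau>), so
  h(q)/q stays bounded near 0.\<close>

lemma vanishing_at_infinity_bound:
  assumes f: "f \<in> modular_forms N k" and lim: "(f \<longlongrightarrow> 0) at_i_inf"
  obtains C where "\<forall>\<^sub>F \<tau> in at_i_inf. norm (f \<tau>) \<le> C * exp (- (2 * pi * Im \<tau>))"
proof -
  obtain h where h: "h holomorphic_on ball 0 1"
    "\<And>\<tau>. \<tau> \<in> upper_half_plane \<Longrightarrow> f \<tau> = h (exp (2 * of_real pi * \<i> * \<tau> / of_nat 1))"
    "(f \<longlongrightarrow> h 0) at_i_inf"
    using holomorphic_at_infinityD[OF _ modular_forms_imp(2)[OF N f]] by (metis zero_less_one)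
  have h0: "h 0 = 0" using tendsto_unique[OF at_i_inf_neq_bot h(3) lim] .
  have "(h has_field_derivative deriv h 0) (at 0)"
    by (rule holomorphic_derivI[OF h(1)]) auto
  then have "((\<lambda>q. h q / q) \<longlongrightarrow> deriv h 0) (at 0)" using h0 by (simp add: has_field_derivative_iff)
  then have "\<forall>\<^sub>F q in at 0. dist (h q / q) (deriv h 0) < 1" by (rule tendstoD) simp
  then obtain d where d: "d > 0" "\<And>q. q \<noteq> 0 \<Longrightarrow> norm q < d \<Longrightarrow> dist (h q / q) (deriv h 0) < 1"
    by (auto simp: eventually_at dist_norm)
  define C where "C = norm (deriv h 0) + 1"
  have hq: "norm (h q) \<le> C * norm q" if "q \<noteq> 0" "norm q < d" for q
  proof -
    have "norm (h q / q) \<le> C"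
      using d(2)[OF that] norm_triangle_ineq2[of "h q / q" "deriv h 0"] by (simp add: C_def dist_norm)
    then show ?thesis using that by (simp add: norm_divide divide_simps)
  qed
  have "\<forall>\<^sub>F \<tau> in at_i_inf. dist (exp (2 * of_real pi * \<i> * \<tau> / of_nat 1)) 0 < d"
    by (rule tendstoD[OF q_exp_tendsto]) (use d in auto)
  then have "\<forall>\<^sub>F \<tau> in at_i_inf. norm (f \<tau>) \<le> C * exp (- (2 * pi * Im \<tau>))"
    using eventually_upper_half_plane
  proof eventually_elim
    case (elim \<tau>)
    then show ?case using hq[of "exp (2 * of_real pi * \<i> * \<tau> / of_nat 1)"] h(2)[of \<tau>] norm_q_exp[of \<tau> 1] by simp
  qed
  then show ?thesis by (rule that)
qed

text \<open>At infinity \<open>f\<close> is O(q) while |D| \<ge> c |q|; at the cusp 0 the divisor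
  has a nonzero limit. In level 1 the inversion belongs to the group, and the bound at 0 follows
  from the one at infinity.\<close>

lemma divide_by_cusp_divisor:
  assumes f: "f \<in> modular_forms N k" and lim: "(f \<longlongrightarrow> 0) at_i_inf"
  shows "(\<lambda>\<tau>. f \<tau> / D \<tau>) \<in> modular_forms N (k - int m)"
proof (rule modular_at_cusps_imp[OF N])
  note mf = modular_forms_imp(1)[OF N f] modular_forms_imp(1)[OF N cusp_divisor_facts(2)]
  have inf: "bounded_at_i_inf (\<lambda>\<tau>. f \<tau> / D \<tau>)"
  proof -
    obtain C where C: "\<forall>\<^sub>F \<tau> in at_i_inf. norm (f \<tau>) \<le> C * exp (- (2 * pi * Im \<tau>))"
      using vanishing_at_infinity_bound[OF f lim] by blast
    obtain c where c: "c > 0" "\<forall>\<^sub>F \<tau> in at_i_inf. c * exp (- (2 * pi * Im \<tau>)) \<le> norm (D \<tau>)"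
      using D by (auto simp: cusp_divisor_def)
    from C c(2) have "\<forall>\<^sub>F \<tau> in at_i_inf. norm (f \<tau> / D \<tau>) \<le> C / c"
    proof eventually_elim
      case (elim \<tau>)
      have p: "0 < c * exp (- (2 * pi * Im \<tau>))" using c(1) by simp
      have "norm (f \<tau> / D \<tau>) \<le> (C * exp (- (2 * pi * Im \<tau>))) / (c * exp (- (2 * pi * Im \<tau>)))"
        unfolding norm_divide using elim p by (intro frac_le) (auto intro: order_trans[OF norm_ge_zero])
      then show ?case by simp
    qed
    then show ?thesis by (auto simp: bounded_at_i_inf_def)
  qed
  have inv: "Gamma1_invariant N (k - int m) (\<lambda>\<tau>. f \<tau> / D \<tau>)"
    using mf by (auto simp: modular_at_cusps_def Gamma1_invariant_def slash_mult[OF N] Gamma1_SL2Z[OF N])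
  have zero: "bounded_at_i_inf (at_zero (k - int m) (\<lambda>\<tau>. f \<tau> / D \<tau>))"
  proof (cases "N = 1")
    case True
    have "mat2 0 (- 1) 1 0 \<in> Gamma1 N" using True by (simp add: mat2_Gamma1 cong_def)
    then have "at_zero (k - int m) (\<lambda>\<tau>. f \<tau> / D \<tau>) \<tau> = f \<tau> / D \<tau>" if "\<tau> \<in> upper_half_plane" for \<tau>
      using inv that unfolding Gamma1_invariant_def by (force simp: slash_def at_zero_def)
    then show ?thesis by (intro bounded_at_i_inf_cong[OF _ inf]) auto
  next
    case False
    then obtain b where b: "b \<noteq> 0" "(at_zero (int m) D \<longlongrightarrow> b) at_i_inf"
      using D by (auto simp: cusp_divisor_def)
    have "bounded_at_i_inf (\<lambda>\<tau>. at_zero k f \<tau> * inverse (at_zero (int m) D \<tau>))"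
      using mf(1) b by (intro bounded_at_i_inf_mult bounded_at_i_inf_tendsto[OF tendsto_inverse[OF b(2)]])
        (auto simp: modular_at_cusps_def)
    then show ?thesis
    proof (rule bounded_at_i_inf_cong[rotated])
      fix \<tau> assume "\<tau> \<in> upper_half_plane"
      then have "\<tau> \<noteq> 0" by (auto simp: upper_half_plane_def)
      then have "at_zero (k - int m) (\<lambda>\<tau>. f \<tau> / D \<tau>) \<tau> = at_zero k f \<tau> / at_zero (int m) D \<tau>"
        by (simp add: at_zero_eq_homogenize homogenize_divide)
      then show "at_zero k f \<tau> * inverse (at_zero (int m) D \<tau>) = at_zero (k - int m) (\<lambda>\<tau>. f \<tau> / D \<tau>) \<tau>"
        by (simp only: divide_inverse)
    qed
  qed
  show "modular_at_cusps N (k - int m) (\<lambda>\<tau>. f \<tau> / D \<tau>)"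
    using mf inf inv zero cusp_divisor_facts(3) by (auto simp: modular_at_cusps_def intro!: holomorphic_intros)
qed (use modular_forms_imp(4)[OF N f] in auto)

text \<open>With n = -k the form f^m D^n has weight 0, so it is constant, and it vanishes at
  infinity together with \<open>D\<close>.\<close>

lemma modular_forms_negative_weight:
  assumes f: "f \<in> modular_forms N k" and k: "k < 0"
  shows "f \<tau> = 0"
proof (cases "\<tau> \<in> upper_half_plane")
  case True
  define n where "n = nat (- k)"
  have n: "n > 0" "int n = - k" using k by (auto simp: n_def)
  have "(\<lambda>\<tau>. f \<tau> ^ m * D \<tau> ^ n) \<in> modular_forms N (int m * k + int n * int m)"
    by (intro modular_forms_mult[OF N] modular_forms_power[OF N] f cusp_divisor_facts n)
  then have weight_0: "(\<lambda>\<tau>. f \<tau> ^ m * D \<tau> ^ n) \<in> modular_forms N 0" using n by simp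
  obtain c where c: "\<And>\<tau>. \<tau> \<in> upper_half_plane \<Longrightarrow> f \<tau> ^ m * D \<tau> ^ n = c"
    using modular_forms_weight_0[OF N weight_0] by blast
  obtain a where "(f \<longlongrightarrow> a) at_i_inf" using modular_forms_limits[OF N f] by blast
  then have "((\<lambda>\<tau>. f \<tau> ^ m * D \<tau> ^ n) \<longlongrightarrow> a ^ m * 0 ^ n) at_i_inf"
    by (intro tendsto_intros cusp_divisor_facts)
  moreover have "a ^ m * 0 ^ n = 0" using n by simp
  ultimately have "((\<lambda>\<tau>. f \<tau> ^ m * D \<tau> ^ n) \<longlongrightarrow> 0) at_i_inf" by (simp only:)
  then have "((\<lambda>_. c) \<longlongrightarrow> 0) at_i_inf"
    by (rule Lim_transform_eventually) (use eventually_upper_half_plane in \<open>eventually_elim, simp add: c\<close>)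
  from tendsto_unique[OF at_i_inf_neq_bot tendsto_const this] have "c = 0" .
  then show ?thesis using c[OF True] cusp_divisor_facts(3)[OF True] by simp
qed (use modular_forms_imp(4)[OF N f] in auto)

text \<open>Division by \<open>D\<close> leaves weight k - m. If that is negative, the quotient
  vanishes; if it is 0, then f = c D, and the nonzero limit of \<open>D\<close> at the cusp 0 gives
  c = 0.\<close>

lemma modular_form_unique:
  assumes f: "f \<in> modular_forms N k" and lim: "(f \<longlongrightarrow> 0) at_i_inf"
    and k: "k < int m \<or> k = int m \<and> N \<noteq> 1 \<and> (at_zero k f \<longlongrightarrow> 0) at_i_inf"
  shows "f \<tau> = 0"
proof (cases "\<tau> \<in> upper_half_plane")
  case True
  note quot = divide_by_cusp_divisor[OF f lim]
  show ?thesis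
  proof (cases "k < int m")
    case less: True
    then have "f \<tau> / D \<tau> = 0" using modular_forms_negative_weight[OF quot] by simp
    then show ?thesis using cusp_divisor_facts(3)[OF True] by simp
  next
    case False
    then have k': "k = int m" "N \<noteq> 1" "(at_zero k f \<longlongrightarrow> 0) at_i_inf" using k by auto
    have weight_0: "(\<lambda>\<tau>. f \<tau> / D \<tau>) \<in> modular_forms N 0" using quot k' by simp
    obtain c where c: "\<And>\<tau>. \<tau> \<in> upper_half_plane \<Longrightarrow> f \<tau> / D \<tau> = c"
      using modular_forms_weight_0[OF N weight_0] by blast
    then have fc: "f \<tau> = c * D \<tau>" if "\<tau> \<in> upper_half_plane" for \<tau>
      using c[OF that] cusp_divisor_facts(3)[OF that] by (simp add: field_simps)
    obtain b where b: "b \<noteq> 0" "(at_zero (int m) D \<longlongrightarrow> b) at_i_inf"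
      using D k' by (auto simp: cusp_divisor_def)
    have "((\<lambda>\<tau>. c * at_zero (int m) D \<tau>) \<longlongrightarrow> c * b) at_i_inf" by (intro tendsto_intros b)
    then have "(at_zero k f \<longlongrightarrow> c * b) at_i_inf"
      by (rule Lim_transform_eventually)
         (use eventually_upper_half_plane in \<open>eventually_elim, simp add: at_zero_def k' fc minus_inverse_upper_half_plane[simplified]\<close>)
    from tendsto_unique[OF at_i_inf_neq_bot this k'(3)] have "c * b = 0" .
    then show ?thesis using fc[OF True] b by simp
  qed
qed (use modular_forms_imp(4)[OF N f] in auto)

text \<open>Subtract the multiple of \<open>E\<close> with the same limit at infinity and divide by
  \<open>D\<close>; this is the induction step for the generation of the ring.\<close>

lemma modular_form_decompose:
  assumes f: "f \<in> modular_forms N k" and E: "E \<in> modular_forms N k" "(E \<longlongrightarrow> e) at_i_inf" "e \<noteq> 0"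
  obtains c g where "g \<in> modular_forms N (k - int m)" "\<And>\<tau>. f \<tau> = c * E \<tau> + D \<tau> * g \<tau>"
proof -
  obtain a where a: "(f \<longlongrightarrow> a) at_i_inf" using modular_forms_limits[OF N f] by blast
  define c where "c = a / e"
  have d: "(\<lambda>\<tau>. f \<tau> - c * E \<tau>) \<in> modular_forms N k"
    by (intro modular_forms_diff[OF N] modular_forms_cmult[OF N] f E)
  have "((\<lambda>\<tau>. f \<tau> - c * E \<tau>) \<longlongrightarrow> a - c * e) at_i_inf" by (intro tendsto_intros a E)
  then have "((\<lambda>\<tau>. f \<tau> - c * E \<tau>) \<longlongrightarrow> 0) at_i_inf" using E(3) by (simp add: c_def)
  from divide_by_cusp_divisor[OF d this] show ?thesis
  proof (rule that[of _ c])
    fix \<tau>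
    show "f \<tau> = c * E \<tau> + D \<tau> * ((f \<tau> - c * E \<tau>) / D \<tau>)"
      using cusp_divisor_facts(3)[of \<tau>] modular_forms_imp(4)[OF N f, of \<tau>] modular_forms_imp(4)[OF N E(1), of \<tau>]
      by (cases "\<tau> \<in> upper_half_plane") auto
  qed
qed

end

subsection \<open>Lattice sums as functions on the upper half plane\<close>

text \<open>The strips are unbounded above, so that one estimate serves both holomorphy and limits
  at infinity. The real part is kept bounded because |m + n \<tau>| has no lower bound by a multiple
  of |m| + |n| that is uniform in Re \<tau>.\<close>

definition strip_dominated :: "(int \<times> int) set \<Rightarrow> (int \<times> int \<Rightarrow> complex \<Rightarrow> complex) \<Rightarrow> bool" where
  "strip_dominated I f \<longleftrightarrow> (\<forall>R \<delta>. \<delta> > 0 \<longrightarrow> (\<exists>B. \<forall>p\<in>I. \<forall>\<tau>. \<bar>Re \<tau>\<bar> \<le> R \<longrightarrow> \<delta> \<le> Im \<tau> \<longrightarrow>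
     norm (f p \<tau>) \<le> B * cube_weight p))"

lemma summable_cube_weight_subset: "(\<lambda>p. B * cube_weight p) summable_on I"
  by (intro summable_on_cmult_right summable_on_subset_banach[OF summable_cube_weight]) auto

lemma strip_dominated_summable:
  assumes "strip_dominated I f" "\<tau> \<in> upper_half_plane"
  shows "(\<lambda>p. f p \<tau>) summable_on I"
proof -
  obtain B where B: "\<And>p. p \<in> I \<Longrightarrow> norm (f p \<tau>) \<le> B * cube_weight p"
    using assms unfolding strip_dominated_def upper_half_plane_def
    by (metis mem_Collect_eq order_refl)
  show ?thesis
    by (rule abs_summable_comparison[OF summable_cube_weight_subset[of 1 I], of _ B]) (use B in simp)
qed

lemma strip_dominated_holomorphic:
  assumes dom: "strip_dominated I f" and hol: "\<And>p. p \<in> I \<Longrightarrow> f p holomorphic_on upper_half_plane"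
  shows "(\<lambda>\<tau>. \<Sum>\<^sub>\<infinity>p\<in>I. f p \<tau>) holomorphic_on upper_half_plane"
  unfolding holomorphic_on_open[OF open_upper_half_plane]
proof
  fix t assume t: "t \<in> upper_half_plane"
  define r where "r = Im t / 2"
  have r: "r > 0" using t by (simp add: r_def upper_half_plane_def)
  have cb: "\<bar>Re x\<bar> \<le> norm t + r \<and> r \<le> Im x" if "x \<in> cball t r" for x
  proof -
    have "norm (t - x) \<le> r" using that by (simp add: dist_norm)
    then have 1: "\<bar>Re (t - x)\<bar> \<le> r" "\<bar>Im (t - x)\<bar> \<le> r"
      using abs_Re_le_cmod[of "t - x"] abs_Im_le_cmod[of "t - x"] by linarith+
    have "\<bar>Re t\<bar> \<le> norm t" by (rule abs_Re_le_cmod)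
    moreover have "Im t = 2 * r" by (simp add: r_def)
    ultimately show ?thesis using 1 by auto
  qed
  have sub: "cball t r \<subseteq> upper_half_plane" using cb r by (force simp: upper_half_plane_def)
  obtain B where B: "\<And>p \<tau>. p \<in> I \<Longrightarrow> \<bar>Re \<tau>\<bar> \<le> norm t + r \<Longrightarrow> r \<le> Im \<tau> \<Longrightarrow> norm (f p \<tau>) \<le> B * cube_weight p"
    using dom r unfolding strip_dominated_def by meson
  have "((\<lambda>x. \<Sum>\<^sub>\<infinity>i\<in>I. f i x) has_field_derivative (\<Sum>\<^sub>\<infinity>i\<in>I. deriv (f i) t)) (at t)"
  proof (rule has_field_derivative_infsum[of I t r])
    fix p x assume "p \<in> I" "x \<in> cball t r"
    then show "(f p has_field_derivative deriv (f p) x) (at x)"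
      using sub hol by (intro holomorphic_derivI[OF _ open_upper_half_plane]) auto
    show "norm (f p x) \<le> B * cube_weight p" using B cb \<open>p \<in> I\<close> \<open>x \<in> _\<close> by blast
  qed (use r summable_cube_weight_subset in auto)
  then show "\<exists>f'. ((\<lambda>\<tau>. \<Sum>\<^sub>\<infinity>p\<in>I. f p \<tau>) has_field_derivative f') (at t)" by blast
qed

lemma strip_dominated_limit:
  assumes dom: "strip_dominated I f" and lim: "\<And>p. p \<in> I \<Longrightarrow> (f p \<longlongrightarrow> g p) at_i_inf"
    and N: "N > 0" and per: "\<And>\<tau>. \<tau> \<in> upper_half_plane \<Longrightarrow> (\<Sum>\<^sub>\<infinity>p\<in>I. f p (\<tau> + of_nat N)) = (\<Sum>\<^sub>\<infinity>p\<in>I. f p \<tau>)"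
  shows "((\<lambda>\<tau>. \<Sum>\<^sub>\<infinity>p\<in>I. f p \<tau>) \<longlongrightarrow> (\<Sum>\<^sub>\<infinity>p\<in>I. g p)) at_i_inf"
proof -
  define S where "S \<tau> = (\<Sum>\<^sub>\<infinity>p\<in>I. f p \<tau>)" for \<tau>
  define F where "F = inf at_i_inf (principal {\<tau>. \<bar>Re \<tau>\<bar> \<le> real N})"
  obtain B where B: "\<And>p \<tau>. p \<in> I \<Longrightarrow> \<bar>Re \<tau>\<bar> \<le> real N \<Longrightarrow> 1 \<le> Im \<tau> \<Longrightarrow> norm (f p \<tau>) \<le> B * cube_weight p"
    using dom unfolding strip_dominated_def by (metis zero_less_one)
  have "(S \<longlongrightarrow> (\<Sum>\<^sub>\<infinity>p\<in>I. g p)) F"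
    unfolding S_def
  proof (rule tendsto_infsum_dominated[OF _ _ summable_cube_weight_subset[of B]])
    show "(f p \<longlongrightarrow> g p) F" if "p \<in> I" for p
      by (rule tendsto_mono[OF _ lim[OF that]]) (simp add: F_def)
    have "\<forall>\<^sub>F \<tau> in at_i_inf. 1 \<le> Im \<tau>" by (rule eventually_at_i_infI[of 1])
    then show "\<forall>\<^sub>F \<tau> in F. \<forall>p\<in>I. norm (f p \<tau>) \<le> B * cube_weight p"
      unfolding F_def eventually_inf_principal by eventually_elim (use B in auto)
  qed
  \<comment> \<open>A translation by a multiple of the period moves any \<tau> into the strip where
    the sum is dominated.\<close>
  moreover have "filterlim (\<lambda>\<tau>. \<tau> + of_nat N * of_int (- \<lfloor>Re \<tau> / N\<rfloor>)) F at_i_inf"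
    unfolding filterlim_iff
  proof (intro allI impI)
    fix P assume "eventually P F"
    then obtain T where T: "\<And>\<tau>. Im \<tau> \<ge> T \<Longrightarrow> \<bar>Re \<tau>\<bar> \<le> real N \<Longrightarrow> P \<tau>"
      unfolding F_def eventually_inf_principal eventually_at_i_inf by auto
    show "\<forall>\<^sub>F \<tau> in at_i_inf. P (\<tau> + of_nat N * of_int (- \<lfloor>Re \<tau> / N\<rfloor>))"
    proof (rule eventually_at_i_infI[of T], rule T)
      fix \<tau> :: complex assume "T \<le> Im \<tau>"
      then show "T \<le> Im (\<tau> + of_nat N * of_int (- \<lfloor>Re \<tau> / N\<rfloor>))" by simp
      have "Re (\<tau> + of_nat N * of_int (- \<lfloor>Re \<tau> / N\<rfloor>)) = real N * frac (Re \<tau> / N)"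
        using N by (simp add: frac_def algebra_simps)
      moreover have "0 \<le> frac (Re \<tau> / N)" "frac (Re \<tau> / N) \<le> 1" by (auto simp: frac_lt_1 less_imp_le)
      ultimately show "\<bar>Re (\<tau> + of_nat N * of_int (- \<lfloor>Re \<tau> / N\<rfloor>))\<bar> \<le> real N"
        by (simp add: mult_left_le)
    qed
  qed
  ultimately have "((\<lambda>\<tau>. S (\<tau> + of_nat N * of_int (- \<lfloor>Re \<tau> / N\<rfloor>))) \<longlongrightarrow> (\<Sum>\<^sub>\<infinity>p\<in>I. g p)) at_i_inf"
    by (rule filterlim_compose)
  then show ?thesis unfolding S_def[symmetric]
  proof (rule Lim_transform_eventually)
    show "\<forall>\<^sub>F \<tau> in at_i_inf. S (\<tau> + of_nat N * of_int (- \<lfloor>Re \<tau> / N\<rfloor>)) = S \<tau>"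
      using eventually_upper_half_plane
    proof eventually_elim
      case (elim \<tau>)
      show ?case by (rule periodic_int[of S N \<tau>]) (use per elim in \<open>auto simp: S_def\<close>)
    qed
  qed
qed

definition shift_term :: "real \<Rightarrow> real \<Rightarrow> nat \<Rightarrow> int \<times> int \<Rightarrow> complex \<Rightarrow> complex" where
  "shift_term r s k p \<tau> = 1 / (of_real (of_int (fst p) + r) + of_real (of_int (snd p) + s) * \<tau>) ^ k"

text \<open>The bound 1/3 is what points of order 2 and 3 guarantee: at least one coordinate is off
  the integers by 1/3 or more. It makes the constants below uniform over the index set.\<close>

definition shift_avoids :: "real \<Rightarrow> real \<Rightarrow> (int \<times> int) set \<Rightarrow> bool" where
  "shift_avoids r s I \<longleftrightarrow> \<bar>r\<bar> \<le> 1 \<and> \<bar>s\<bar> \<le> 1 \<and>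
     (\<forall>p\<in>I. 1 / 3 \<le> \<bar>of_int (fst p) + r\<bar> + \<bar>of_int (snd p) + s\<bar>)"

lemma shift_lower_bound:
  assumes "0 < \<delta>" "shift_avoids r s I"
  obtains c where "c > 0" "\<And>p \<tau>. p \<in> I \<Longrightarrow> \<bar>Re \<tau>\<bar> \<le> R \<Longrightarrow> \<delta> \<le> Im \<tau> \<Longrightarrow>
    c * (1 + \<bar>of_int (fst p)\<bar> + \<bar>of_int (snd p)\<bar>) \<le> norm (of_real (of_int (fst p) + r) + of_real (of_int (snd p) + s) * \<tau>)"
proof -
  define C where "C = 1 + (\<bar>R\<bar> + 1) / \<delta>"
  have C: "C > 0" using assms(1) by (simp add: C_def add_pos_nonneg)
  show ?thesis
  \<comment> \<open>The factor 10 comes from |m| + |n| \<le> |u| + |v| + 2 and 3 \<le> 9 (|u| +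
    |v|), which give 1 + |m| + |n| \<le> 10 (|u| + |v|).\<close>
  proof (rule that[of "1 / (10 * C)"])
    fix p \<tau> assume p: "p \<in> I" and t: "\<bar>Re \<tau>\<bar> \<le> R" "\<delta> \<le> Im \<tau>"
    define u v where "u = of_int (fst p) + r" and "v = of_int (snd p) + s"
    define n where "n = norm (of_real u + of_real v * \<tau>)"
    have "\<bar>v\<bar> * Im \<tau> \<le> n"
      using abs_Im_le_cmod[of "of_real u + of_real v * \<tau>"] t assms(1) by (simp add: abs_mult n_def)
    moreover have "\<bar>v\<bar> * \<delta> \<le> \<bar>v\<bar> * Im \<tau>" using t(2) by (intro mult_left_mono) auto
    ultimately have v: "\<bar>v\<bar> \<le> n / \<delta>" using assms(1) by (simp add: field_simps)
    have 2: "\<bar>u + v * Re \<tau>\<bar> \<le> n"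
      using abs_Re_le_cmod[of "of_real u + of_real v * \<tau>"] by (simp add: n_def)
    have "\<bar>u\<bar> \<le> \<bar>u + v * Re \<tau>\<bar> + \<bar>v\<bar> * \<bar>Re \<tau>\<bar>" by (simp flip: abs_mult)
    also have "\<bar>v\<bar> * \<bar>Re \<tau>\<bar> \<le> \<bar>v\<bar> * \<bar>R\<bar>" using t(1) by (intro mult_left_mono) auto
    finally have "\<bar>u\<bar> + \<bar>v\<bar> \<le> n + \<bar>v\<bar> * (\<bar>R\<bar> + 1)" using 2 by (simp add: algebra_simps)
    also have "\<bar>v\<bar> * (\<bar>R\<bar> + 1) \<le> n / \<delta> * (\<bar>R\<bar> + 1)" using v by (intro mult_right_mono) auto
    finally have uv: "\<bar>u\<bar> + \<bar>v\<bar> \<le> C * n" by (simp add: C_def algebra_simps add_divide_distrib)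
    have "1 / 3 \<le> \<bar>u\<bar> + \<bar>v\<bar>" "\<bar>r\<bar> \<le> 1" "\<bar>s\<bar> \<le> 1"
      using assms(2) p by (auto simp: shift_avoids_def u_def v_def)
    moreover have "\<bar>of_int (fst p)\<bar> \<le> \<bar>u\<bar> + \<bar>r\<bar>" "\<bar>of_int (snd p)\<bar> \<le> \<bar>v\<bar> + \<bar>s\<bar>" by (auto simp: u_def v_def)
    moreover have "1 + A + B \<le> 10 * (U + V)"
      if "1 / 3 \<le> U + V" "\<rho> \<le> 1" "\<sigma> \<le> 1" "A \<le> U + \<rho>" "B \<le> V + \<sigma>" for A B U V \<rho> \<sigma> :: real
      using that unfolding distrib_left by linarith
    ultimately have "1 + \<bar>of_int (fst p)\<bar> + \<bar>of_int (snd p)\<bar> \<le> 10 * (\<bar>u\<bar> + \<bar>v\<bar>)" by blast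
    also have "10 * (\<bar>u\<bar> + \<bar>v\<bar>) \<le> 10 * (C * n)" using uv by (intro mult_left_mono) auto
    finally have "1 + \<bar>of_int (fst p)\<bar> + \<bar>of_int (snd p)\<bar> \<le> 10 * C * n" by simp
    then show "1 / (10 * C) * (1 + \<bar>of_int (fst p)\<bar> + \<bar>of_int (snd p)\<bar>) \<le> norm (of_real (of_int (fst p) + r) + of_real (of_int (snd p) + s) * \<tau>)"
      using C by (simp add: n_def u_def v_def field_simps)
  qed (use C in simp)
qed

lemma cube_weight_pos: "cube_weight p > 0" "cube_weight p = 1 / (1 + \<bar>of_int (fst p)\<bar> + \<bar>of_int (snd p)\<bar>) ^ 3"
  by (auto simp: cube_weight_def case_prod_beta intro!: divide_pos_pos zero_less_power add_pos_nonneg)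

lemma shift_term_dominated:
  assumes av: "shift_avoids r s I" and k: "k \<ge> 3"
  shows "strip_dominated I (shift_term r s k)"
  unfolding strip_dominated_def
proof (intro allI impI)
  fix R \<delta> :: real assume d: "\<delta> > 0"
  obtain c where c: "c > 0" "\<And>p \<tau>. p \<in> I \<Longrightarrow> \<bar>Re \<tau>\<bar> \<le> R \<Longrightarrow> \<delta> \<le> Im \<tau> \<Longrightarrow>
    c * (1 + \<bar>of_int (fst p)\<bar> + \<bar>of_int (snd p)\<bar>) \<le> norm (of_real (of_int (fst p) + r) + of_real (of_int (snd p) + s) * \<tau>)"
    using shift_lower_bound[OF d av] by metis
  show "\<exists>B. \<forall>p\<in>I. \<forall>\<tau>. \<bar>Re \<tau>\<bar> \<le> R \<longrightarrow> \<delta> \<le> Im \<tau> \<longrightarrow> norm (shift_term r s k p \<tau>) \<le> B * cube_weight p"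
  proof (intro exI[of _ "1 / c ^ k"] ballI allI impI)
    fix p \<tau> assume p: "p \<in> I" "\<bar>Re \<tau>\<bar> \<le> R" "\<delta> \<le> Im \<tau>"
    define t where "t = 1 + \<bar>real_of_int (fst p)\<bar> + \<bar>real_of_int (snd p)\<bar>"
    define n where "n = norm (of_real (of_int (fst p) + r) + of_real (of_int (snd p) + s) * \<tau>)"
    have t: "t \<ge> 1" by (simp add: t_def)
    have cn: "c * t \<le> n" using c(2)[OF p] by (simp add: t_def n_def)
    have "(c * t) ^ k \<le> n ^ k" using cn c(1) t by (intro power_mono) auto
    then have "1 / n ^ k \<le> 1 / (c * t) ^ k" using c(1) t by (intro divide_left_mono mult_pos_pos) (auto intro!: zero_less_power less_le_trans[OF _ cn])
    also have "\<dots> = 1 / c ^ k * (1 / t ^ k)" by (simp add: power_mult_distrib)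
    also have "\<dots> \<le> 1 / c ^ k * (1 / t ^ 3)"
      using c(1) t k by (intro mult_left_mono divide_left_mono power_increasing) auto
    finally show "norm (shift_term r s k p \<tau>) \<le> 1 / c ^ k * cube_weight p"
      by (simp only: cube_weight_pos(2) t_def n_def shift_term_def norm_divide norm_one norm_power)
  qed
qed

text \<open>With equal \<open>s\<close> the two linear forms differ by the constant r' - r, so the
  difference of inverse squares gains one power and becomes cubic. With different \<open>s\<close>
  that numerator would grow with \<tau>.\<close>

lemma shift_difference_dominated:
  assumes av: "shift_avoids r s I" "shift_avoids r' s I"
  shows "strip_dominated I (\<lambda>p \<tau>. shift_term r s 2 p \<tau> - shift_term r' s 2 p \<tau>)"
  unfolding strip_dominated_def
proof (intro allI impI)
  fix R \<delta> :: real assume d: "\<delta> > 0"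
  obtain c1 where c1: "c1 > 0" "\<And>p \<tau>. p \<in> I \<Longrightarrow> \<bar>Re \<tau>\<bar> \<le> R \<Longrightarrow> \<delta> \<le> Im \<tau> \<Longrightarrow>
    c1 * (1 + \<bar>of_int (fst p)\<bar> + \<bar>of_int (snd p)\<bar>) \<le> norm (of_real (of_int (fst p) + r) + of_real (of_int (snd p) + s) * \<tau>)"
    using shift_lower_bound[OF d av(1)] by metis
  obtain c2 where c2: "c2 > 0" "\<And>p \<tau>. p \<in> I \<Longrightarrow> \<bar>Re \<tau>\<bar> \<le> R \<Longrightarrow> \<delta> \<le> Im \<tau> \<Longrightarrow>
    c2 * (1 + \<bar>of_int (fst p)\<bar> + \<bar>of_int (snd p)\<bar>) \<le> norm (of_real (of_int (fst p) + r') + of_real (of_int (snd p) + s) * \<tau>)"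
    using shift_lower_bound[OF d av(2)] by metis
  show "\<exists>B. \<forall>p\<in>I. \<forall>\<tau>. \<bar>Re \<tau>\<bar> \<le> R \<longrightarrow> \<delta> \<le> Im \<tau> \<longrightarrow>
      norm (shift_term r s 2 p \<tau> - shift_term r' s 2 p \<tau>) \<le> B * cube_weight p"
  proof (intro exI[of _ "\<bar>r' - r\<bar> * (1 / (c1 ^ 2 * c2) + 1 / (c1 * c2 ^ 2))"] ballI allI impI)
    fix p \<tau> assume p: "p \<in> I" "\<bar>Re \<tau>\<bar> \<le> R" "\<delta> \<le> Im \<tau>"
    define t where "t = 1 + \<bar>real_of_int (fst p)\<bar> + \<bar>real_of_int (snd p)\<bar>"
    define a where "a = of_real (of_int (fst p) + r) + of_real (of_int (snd p) + s) * \<tau>"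
    define b where "b = of_real (of_int (fst p) + r') + of_real (of_int (snd p) + s) * \<tau>"
    have t: "t \<ge> 1" by (simp add: t_def)
    have an: "c1 * t \<le> norm a" and bn: "c2 * t \<le> norm b" using c1(2)[OF p] c2(2)[OF p] by (simp_all add: t_def a_def b_def)
    have "0 < c1 * t" "0 < c2 * t" using c1 c2 t by auto
    with an bn have pos: "0 < norm a" "0 < norm b" by linarith+
    then have ne: "a \<noteq> 0" "b \<noteq> 0" by auto
    have ba: "b - a = of_real (r' - r)" by (simp add: a_def b_def)
    have "1 / a ^ 2 - 1 / b ^ 2 = (b - a) * (1 / (a ^ 2 * b) + 1 / (a * b ^ 2))"
      using ne by (simp add: field_simps) (simp add: eval_nat_numeral algebra_simps)
    then have "norm (1 / a ^ 2 - 1 / b ^ 2) = \<bar>r' - r\<bar> * norm (1 / (a ^ 2 * b) + 1 / (a * b ^ 2))"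
      unfolding ba by (simp only: norm_mult norm_of_real)
    also have "norm (1 / (a ^ 2 * b) + 1 / (a * b ^ 2)) \<le> 1 / (norm a ^ 2 * norm b) + 1 / (norm a * norm b ^ 2)"
      by (rule norm_triangle_mono) (simp_all add: norm_divide norm_mult norm_power)
    also have "\<dots> \<le> 1 / ((c1 * t) ^ 2 * (c2 * t)) + 1 / ((c1 * t) * (c2 * t) ^ 2)"
      using an bn c1(1) c2(1) t by (intro add_mono divide_left_mono mult_mono power_mono mult_pos_pos) (auto simp: ne)
    also have "\<dots> = (1 / (c1 ^ 2 * c2) + 1 / (c1 * c2 ^ 2)) * (1 / t ^ 3)"
      by (simp add: power2_eq_square power3_eq_cube field_simps add_divide_distrib)
    finally have "norm (1 / a ^ 2 - 1 / b ^ 2) \<le> \<bar>r' - r\<bar> * ((1 / (c1 ^ 2 * c2) + 1 / (c1 * c2 ^ 2)) * (1 / t ^ 3))"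
      by (simp add: mult_left_mono)
    then show "norm (shift_term r s 2 p \<tau> - shift_term r' s 2 p \<tau>) \<le> \<bar>r' - r\<bar> * (1 / (c1 ^ 2 * c2) + 1 / (c1 * c2 ^ 2)) * cube_weight p"
      by (simp only: cube_weight_pos(2) t_def a_def b_def shift_term_def mult.assoc)
  qed
qed

lemma shift_term_holomorphic:
  assumes "shift_avoids r s I" "p \<in> I"
  shows "shift_term r s k p holomorphic_on upper_half_plane"
proof -
  have "of_real (of_int (fst p) + r) + of_real (of_int (snd p) + s) * \<tau> \<noteq> (0::complex)" if t: "\<tau> \<in> upper_half_plane" for \<tau>
  proof
    assume 0: "of_real (of_int (fst p) + r) + of_real (of_int (snd p) + s) * \<tau> = (0::complex)"
    then have "Im (of_real (of_int (fst p) + r) + of_real (of_int (snd p) + s) * \<tau>) = 0" by simp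
    then have v: "of_int (snd p) + s = 0" using t by (simp add: upper_half_plane_def)
    with 0 have "complex_of_real (of_int (fst p) + r) = 0" by simp
    then have u: "of_int (fst p) + r = 0" by (simp only: of_real_eq_0_iff)
    show False using assms u v unfolding shift_avoids_def by force
  qed
  then show ?thesis unfolding shift_term_def by (intro holomorphic_intros) auto
qed

text \<open>Only the row whose coefficient of \<tau> vanishes survives at infinity; in the other
  rows the imaginary part of the denominator grows without bound.\<close>

lemma shift_term_limit:
  assumes "k > 0"
  shows "(shift_term r s k p \<longlongrightarrow> (if of_int (snd p) + s = 0 then 1 / of_real (of_int (fst p) + r) ^ k else 0)) at_i_inf"
proof (cases "of_int (snd p) + s = 0")
  case True
  then have "shift_term r s k p = (\<lambda>\<tau>. 1 / of_real (of_int (fst p) + r) ^ k)"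
    by (intro ext) (simp only: shift_term_def of_real_0 mult_zero_left add_0_right)
  with True show ?thesis by simp
next
  case False
  define v where "v = of_int (snd p) + s"
  have lim: "((\<lambda>y::real. 1 / (\<bar>v\<bar> * y) ^ k) \<longlongrightarrow> 0) at_top"
  proof -
    have "filterlim (\<lambda>y::real. \<bar>v\<bar> * y) at_top at_top"
      using False by (intro filterlim_tendsto_pos_mult_at_top[OF tendsto_const _ filterlim_ident]) (auto simp: v_def)
    from filterlim_pow_at_top[OF assms this] show ?thesis
      by (rule real_tendsto_divide_at_top[OF tendsto_const])
  qed
  have "((\<lambda>\<tau>. 1 / (\<bar>v\<bar> * Im \<tau>) ^ k) \<longlongrightarrow> 0) at_i_inf"
    by (rule filterlim_compose[OF lim filterlim_filtercomap])
  moreover have "\<forall>\<^sub>F \<tau> in at_i_inf. norm (shift_term r s k p \<tau>) \<le> 1 / (\<bar>v\<bar> * Im \<tau>) ^ k"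
  proof (rule eventually_at_i_infI[of 1])
    fix \<tau> :: complex assume t: "1 \<le> Im \<tau>"
    have "\<bar>v\<bar> * Im \<tau> \<le> norm (of_real (of_int (fst p) + r) + of_real v * \<tau>)"
      using abs_Im_le_cmod[of "of_real (of_int (fst p) + r) + of_real v * \<tau>"] t by (simp add: abs_mult)
    moreover have "0 < \<bar>v\<bar> * Im \<tau>" using False t by (auto simp: v_def)
    ultimately show "norm (shift_term r s k p \<tau>) \<le> 1 / (\<bar>v\<bar> * Im \<tau>) ^ k"
      by (simp add: shift_term_def norm_divide norm_power flip: v_def) (intro frac_le power_mono, auto)
  qed
  ultimately have "(shift_term r s k p \<longlongrightarrow> 0) at_i_inf" by (rule Lim_null_comparison[rotated])
  then show ?thesis using False by simp
qed

lemma lattice_sum_eq_shift: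
  assumes t: "\<tau> \<in> upper_half_plane" and a: "of_real r + of_real s * \<tau> \<noteq> 0"
  shows "lattice_sum k (1, \<tau>) (of_real r + of_real s * \<tau>) = (\<Sum>\<^sub>\<infinity>p\<in>UNIV. shift_term r s k p \<tau>)"
proof -
  have w: "(1, \<tau>) \<in> oriented_bases" using t by simp
  have "(\<Sum>\<^sub>\<infinity>p\<in>UNIV. shift_term r s k p \<tau>) = (\<Sum>\<^sub>\<infinity>p\<in>UNIV. 1 / (lattice_point (1, \<tau>) p + (of_real r + of_real s * \<tau>)) ^ k)"
    by (rule infsum_cong) (simp add: shift_term_def lattice_point_def algebra_simps)
  also have "\<dots> = (\<Sum>\<^sub>\<infinity>\<omega>\<in>period_lattice (1, \<tau>). 1 / (\<omega> + (of_real r + of_real s * \<tau>)) ^ k)"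
    by (rule infsum_reindex_bij_betw[OF lattice_point_bij(1)[OF w]])
  finally show ?thesis using a by (simp add: lattice_sum_def)
qed

lemma lattice_sum_0_eq_shift:
  assumes t: "\<tau> \<in> upper_half_plane"
  shows "lattice_sum k (1, \<tau>) 0 = (\<Sum>\<^sub>\<infinity>p\<in>UNIV - {(0, 0)}. shift_term 0 0 k p \<tau>)"
proof -
  have w: "(1, \<tau>) \<in> oriented_bases" using t by simp
  have "(\<Sum>\<^sub>\<infinity>p\<in>UNIV - {(0, 0)}. shift_term 0 0 k p \<tau>) = (\<Sum>\<^sub>\<infinity>p\<in>UNIV - {(0, 0)}. 1 / (lattice_point (1, \<tau>) p) ^ k)"
    by (rule infsum_cong) (simp add: shift_term_def lattice_point_def algebra_simps)
  also have "\<dots> = (\<Sum>\<^sub>\<infinity>\<omega>\<in>period_lattice (1, \<tau>) - {0}. 1 / \<omega> ^ k)"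
    by (rule infsum_reindex_bij_betw[OF lattice_point_bij(2)[OF w]])
  finally show ?thesis by (simp add: lattice_sum_def)
qed

lemma weierstrass_p_eq_shift:
  assumes t: "\<tau> \<in> upper_half_plane"
  shows "weierstrass_p (1, \<tau>) (of_real r) =
    1 / of_real r ^ 2 + (\<Sum>\<^sub>\<infinity>p\<in>UNIV - {(0, 0)}. shift_term r 0 2 p \<tau> - shift_term 0 0 2 p \<tau>)"
proof -
  have w: "(1, \<tau>) \<in> oriented_bases" using t by simp
  have "(\<Sum>\<^sub>\<infinity>p\<in>UNIV - {(0, 0)}. shift_term r 0 2 p \<tau> - shift_term 0 0 2 p \<tau>) =
      (\<Sum>\<^sub>\<infinity>p\<in>UNIV - {(0, 0)}. 1 / (of_real r - (- lattice_point (1, \<tau>) p)) ^ 2 - 1 / (- lattice_point (1, \<tau>) p) ^ 2)"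
  proof (rule infsum_cong)
    fix p
    have "shift_term r 0 2 p \<tau> = 1 / (of_real r + lattice_point (1, \<tau>) p) ^ 2"
      "shift_term 0 0 2 p \<tau> = 1 / (lattice_point (1, \<tau>) p) ^ 2"
      by (simp_all add: shift_term_def lattice_point_def add_ac)
    then show "shift_term r 0 2 p \<tau> - shift_term 0 0 2 p \<tau> =
      1 / (of_real r - (- lattice_point (1, \<tau>) p)) ^ 2 - 1 / (- lattice_point (1, \<tau>) p) ^ 2" by simp
  qed
  also have "\<dots> = (\<Sum>\<^sub>\<infinity>\<omega>\<in>period_lattice (1, \<tau>) - {0}. 1 / (of_real r - (- \<omega>)) ^ 2 - 1 / (- \<omega>) ^ 2)"
    by (rule infsum_reindex_bij_betw[OF lattice_point_bij(2)[OF w]])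
  also have "\<dots> = (\<Sum>\<^sub>\<infinity>\<omega>\<in>period_lattice (1, \<tau>) - {0}. 1 / (of_real r - \<omega>) ^ 2 - 1 / \<omega> ^ 2)"
    by (rule infsum_lattice_reflect(2))
  finally show ?thesis by (simp add: weierstrass_p_def)
qed

text \<open>The regularising terms 1/\<omega>^2 cancel between the two values, which leaves a sum
  over the whole lattice in a form that \<open>shift_difference_dominated\<close> covers.\<close>

lemma weierstrass_p_diff_eq_shift:
  assumes t: "\<tau> \<in> upper_half_plane" and a: "of_real r + of_real s * \<tau> \<notin> period_lattice (1, \<tau>)" "of_real r' + of_real s * \<tau> \<notin> period_lattice (1, \<tau>)"
  shows "weierstrass_p (1, \<tau>) (of_real r + of_real s * \<tau>) - weierstrass_p (1, \<tau>) (of_real r' + of_real s * \<tau>) =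
    (\<Sum>\<^sub>\<infinity>p\<in>UNIV. shift_term r s 2 p \<tau> - shift_term r' s 2 p \<tau>)"
proof -
  have w: "(1, \<tau>) \<in> oriented_bases" using t by simp
  define u v where "u = of_real r + of_real s * \<tau>" and "v = of_real r' + of_real s * \<tau>"
  define L where "L = period_lattice (1, \<tau>)"
  have uv: "u \<notin> L - {0}" "v \<notin> L - {0}" using a by (auto simp: u_def v_def L_def)
  have su: "(\<lambda>\<omega>. 1 / (u - \<omega>) ^ 2 - 1 / \<omega> ^ 2) summable_on (L - {0})"
    and sv: "(\<lambda>\<omega>. 1 / (v - \<omega>) ^ 2 - 1 / \<omega> ^ 2) summable_on (L - {0})"
    using wp_summable[OF w] uv by (simp_all add: L_def)
  have sd: "(\<lambda>\<omega>. 1 / (u - \<omega>) ^ 2 - 1 / (v - \<omega>) ^ 2) summable_on (L - {0})"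
    using summable_on_add[OF su summable_on_uminus[THEN iffD2, OF sv]] by simp
  have "wp_reg (1, \<tau>) u - wp_reg (1, \<tau>) v = (\<Sum>\<^sub>\<infinity>\<omega>\<in>L - {0}. 1 / (u - \<omega>) ^ 2 - 1 / (v - \<omega>) ^ 2)"
  proof -
    have "(\<Sum>\<^sub>\<infinity>\<omega>\<in>L - {0}. (1 / (u - \<omega>) ^ 2 - 1 / \<omega> ^ 2) + - (1 / (v - \<omega>) ^ 2 - 1 / \<omega> ^ 2)) =
        wp_reg (1, \<tau>) u + (\<Sum>\<^sub>\<infinity>\<omega>\<in>L - {0}. - (1 / (v - \<omega>) ^ 2 - 1 / \<omega> ^ 2))"
      unfolding wp_reg_def L_def[symmetric] by (rule infsum_add[OF su summable_on_uminus[THEN iffD2, OF sv]])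
    also have "(\<Sum>\<^sub>\<infinity>\<omega>\<in>L - {0}. - (1 / (v - \<omega>) ^ 2 - 1 / \<omega> ^ 2)) = - wp_reg (1, \<tau>) v"
      unfolding wp_reg_def L_def[symmetric] by (rule infsum_uminus)
    finally show ?thesis by simp
  qed
  then have "weierstrass_p (1, \<tau>) u - weierstrass_p (1, \<tau>) v = (\<Sum>\<^sub>\<infinity>\<omega>\<in>insert 0 (L - {0}). 1 / (u - \<omega>) ^ 2 - 1 / (v - \<omega>) ^ 2)"
    by (subst infsum_insert[OF sd]) (simp_all add: weierstrass_p_eq)
  also have "insert 0 (L - {0}) = L" by (auto simp: L_def)
  also have "(\<Sum>\<^sub>\<infinity>\<omega>\<in>L. 1 / (u - \<omega>) ^ 2 - 1 / (v - \<omega>) ^ 2) = (\<Sum>\<^sub>\<infinity>\<omega>\<in>L. 1 / (u - (- \<omega>)) ^ 2 - 1 / (v - (- \<omega>)) ^ 2)"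
    unfolding L_def by (rule infsum_lattice_reflect(1)[symmetric])
  also have "\<dots> = (\<Sum>\<^sub>\<infinity>p\<in>UNIV. 1 / (u - (- lattice_point (1, \<tau>) p)) ^ 2 - 1 / (v - (- lattice_point (1, \<tau>) p)) ^ 2)"
    unfolding L_def by (rule infsum_reindex_bij_betw[OF lattice_point_bij(1)[OF w], symmetric])
  also have "\<dots> = (\<Sum>\<^sub>\<infinity>p\<in>UNIV. shift_term r s 2 p \<tau> - shift_term r' s 2 p \<tau>)"
    by (rule infsum_cong) (simp add: u_def v_def shift_term_def lattice_point_def algebra_simps)
  finally show ?thesis by (simp add: u_def v_def)
qed

lemma abs_int_shift_ge: "r \<in> {1 / 3, 1 / 2} \<Longrightarrow> 1 / 3 \<le> \<bar>real_of_int m + r\<bar>"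
proof -
  assume r: "r \<in> {1 / 3, 1 / 2}"
  show ?thesis
  proof (cases "m \<ge> 0")
    case False
    then have "real_of_int m \<le> - 1" by linarith
    then show ?thesis using r by auto
  qed (use r in auto)
qed

lemma shift_avoids_cases:
  "shift_avoids 0 0 (UNIV - {(0, 0)})"
  "r \<in> {1 / 3, 1 / 2} \<Longrightarrow> shift_avoids r 0 I"
  "s \<in> {1 / 3, 1 / 2} \<Longrightarrow> \<bar>r\<bar> \<le> 1 \<Longrightarrow> shift_avoids r s I"
proof -
  show "shift_avoids 0 0 (UNIV - {(0, 0)})" unfolding shift_avoids_def
  proof (intro conjI ballI)
    fix p :: "int \<times> int" assume "p \<in> UNIV - {(0, 0)}"
    then have "1 \<le> \<bar>fst p\<bar> + \<bar>snd p\<bar>" by (cases p) auto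
    then have "1 \<le> real_of_int (\<bar>fst p\<bar> + \<bar>snd p\<bar>)" by linarith
    then show "1 / 3 \<le> \<bar>real_of_int (fst p) + 0\<bar> + \<bar>real_of_int (snd p) + 0\<bar>" by simp
  qed auto
  show "shift_avoids r 0 I" if r: "r \<in> {1 / 3, 1 / 2}"
    using abs_int_shift_ge[OF r] r unfolding shift_avoids_def by (auto intro: add_increasing2)
  show "shift_avoids r s I" if s: "s \<in> {1 / 3, 1 / 2}" and "\<bar>r\<bar> \<le> 1"
    using abs_int_shift_ge[OF s] that unfolding shift_avoids_def by (auto intro: add_increasing)
qed

subsection \<open>Sums over the integers\<close>

lemma infsum_nat_eq_suminf:
  fixes f :: "nat \<Rightarrow> complex"
  shows "f summable_on UNIV \<Longrightarrow> (\<Sum>\<^sub>\<infinity>n. f n) = (\<Sum>n. f n)"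
  using has_sum_imp_sums[OF has_sum_infsum] sums_unique by metis

lemma infsum_int_split:
  fixes f :: "int \<Rightarrow> complex"
  assumes f: "f summable_on UNIV"
  shows "(\<Sum>\<^sub>\<infinity>m. f m) = (\<Sum>n. f (int n)) + (\<Sum>n. f (- int n - 1))"
    and "summable (\<lambda>n. f (int n))" "summable (\<lambda>n. f (- int n - 1))"
proof -
  have U: "UNIV = range int \<union> range (\<lambda>n. - int n - 1)"
  proof (intro equalityI subsetI)
    fix m :: int
    show "m \<in> range int \<union> range (\<lambda>n. - int n - 1)"
    proof (cases "m \<ge> 0")
      case True
      then have "m = int (nat m)" by simp
      then show ?thesis by blast
    next
      case False
      then have "m = - int (nat (- m - 1)) - 1" by simp
      then show ?thesis by blast
    qed
  qed auto
  have inj: "inj int" "inj (\<lambda>n. - int n - 1)" by (auto simp: inj_def)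
  have s: "f summable_on range int" "f summable_on range (\<lambda>n. - int n - 1)"
    using summable_on_subset_banach[OF f] by auto
  then have s': "(\<lambda>n. f (int n)) summable_on UNIV" "(\<lambda>n. f (- int n - 1)) summable_on UNIV"
    using summable_on_reindex[OF inj(1), of f] summable_on_reindex[OF inj(2), of f] by (auto simp: o_def)
  have "(\<Sum>\<^sub>\<infinity>m. f m) = infsum f (range int) + infsum f (range (\<lambda>n. - int n - 1))"
    by (subst U, rule infsum_Un_disjoint[OF s]) auto
  also have "infsum f (range int) = (\<Sum>\<^sub>\<infinity>n. f (int n))" using infsum_reindex[OF inj(1), of f] by (simp add: o_def)
  also have "infsum f (range (\<lambda>n. - int n - 1)) = (\<Sum>\<^sub>\<infinity>n. f (- int n - 1))" using infsum_reindex[OF inj(2), of f] by (simp add: o_def)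
  finally show "(\<Sum>\<^sub>\<infinity>m. f m) = (\<Sum>n. f (int n)) + (\<Sum>n. f (- int n - 1))"
    using s' by (simp add: infsum_nat_eq_suminf)
  show "summable (\<lambda>n. f (int n))" "summable (\<lambda>n. f (- int n - 1))"
    using s' by (auto intro: summable_on_imp_summable)
qed

text \<open>Logarithmic derivative of the reflection formula of the Gamma function, differentiated
  once more. It evaluates the sum of 1/(z + m)^2 over all integers m, split into its two
  halves.\<close>

lemma trigamma_reflection:
  fixes z :: complex
  assumes z: "z \<notin> \<int>"
  shows "Polygamma 1 z + Polygamma 1 (1 - z) = of_real pi ^ 2 / sin (of_real pi * z) ^ 2"
proof -
  have z': "1 - z \<notin> \<int>" "z \<notin> \<int>" if "z \<notin> \<int>" for z :: complex
    using that by (auto simp: Ints_def) (metis Ints_1 Ints_diff Ints_of_int Ints_def diff_diff_eq2 add_diff_cancel_left' rangeI of_int_1 of_int_diff)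
  have np: "z \<notin> \<int>\<^sub>\<le>\<^sub>0" "1 - z \<notin> \<int>\<^sub>\<le>\<^sub>0" if "z \<notin> \<int>" for z :: complex
    using z'[OF that] nonpos_Ints_Int by blast+
  have sin: "sin (of_real pi * z) \<noteq> 0" if "z \<notin> \<int>" for z :: complex
  proof
    assume "sin (of_real pi * z) = 0"
    then obtain n :: int where "of_real pi * z = of_real (of_int n * pi)" unfolding sin_eq_0 by blast
    then have "z = of_int n" by (simp add: mult.commute)
    with that show False by auto
  qed
  have op: "open (- \<int> :: complex set)" by (simp add: open_Compl closed_Ints)
  have digamma: "Digamma z - Digamma (1 - z) = - of_real pi * cos (of_real pi * z) / sin (of_real pi * z)"
    if z: "z \<notin> \<int>" for z :: complex
  proof -
    have "((\<lambda>z. Gamma z * Gamma (1 - z)) has_field_derivative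
        Gamma z * Digamma z * Gamma (1 - z) + Gamma z * (- (Gamma (1 - z) * Digamma (1 - z)))) (at z)"
      by (rule derivative_eq_intros refl | use np[OF z] in simp)+
    moreover have "((\<lambda>z. Gamma z * Gamma (1 - z)) has_field_derivative
        - (of_real pi * (cos (of_real pi * z) * of_real pi)) / (sin (of_real pi * z) * sin (of_real pi * z))) (at z)"
      unfolding Gamma_reflection_complex
      by (rule derivative_eq_intros refl | use sin[OF z] in simp)+
    ultimately have "Gamma z * Gamma (1 - z) * (Digamma z - Digamma (1 - z)) =
        - (of_real pi * (cos (of_real pi * z) * of_real pi)) / (sin (of_real pi * z) * sin (of_real pi * z))"
      using DERIV_unique by (fastforce simp: algebra_simps)
    then have eq: "of_real pi / sin (of_real pi * z) * (Digamma z - Digamma (1 - z)) =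
        - (of_real pi * (cos (of_real pi * z) * of_real pi)) / (sin (of_real pi * z) * sin (of_real pi * z))"
      unfolding Gamma_reflection_complex .
    have "Digamma z - Digamma (1 - z) = sin (of_real pi * z) / of_real pi * (of_real pi / sin (of_real pi * z) * (Digamma z - Digamma (1 - z)))"
      using sin[OF z] by simp
    also have "\<dots> = - of_real pi * cos (of_real pi * z) / sin (of_real pi * z)"
      unfolding eq using sin[OF z] by simp
    finally show ?thesis .
  qed
  have "((\<lambda>z. Digamma z - Digamma (1 - z)) has_field_derivative Polygamma 1 z + Polygamma 1 (1 - z)) (at z)"
    by (rule derivative_eq_intros refl | use np[OF z] in simp)+
  moreover have "((\<lambda>z. Digamma z - Digamma (1 - z)) has_field_derivative of_real pi ^ 2 / sin (of_real pi * z) ^ 2) (at z)"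
  proof (rule has_field_derivative_transform_within_open[OF _ op])
    have "((\<lambda>z. - of_real pi * cot (of_real pi * z)) has_field_derivative
        - of_real pi * (- inverse (sin (of_real pi * z) ^ 2) * of_real pi)) (at z)"
      using DERIV_cmult[OF DERIV_chain2[OF DERIV_cot[OF sin[OF z]] DERIV_cmult_Id], of "- of_real pi"] by simp
    then show "((\<lambda>z. - of_real pi * cos (of_real pi * z) / sin (of_real pi * z)) has_field_derivative of_real pi ^ 2 / sin (of_real pi * z) ^ 2) (at z)"
      by (simp add: cot_def divide_inverse power2_eq_square mult_ac)
  qed (use z digamma in auto)
  ultimately show ?thesis by (rule DERIV_unique)
qed

lemma trigamma_eq: "Polygamma 1 (z :: complex) = (\<Sum>n. 1 / (z + of_nat n) ^ 2)"
  by (simp add: Polygamma_def divide_inverse numeral_2_eq_2)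

lemma trigamma_summable:
  assumes "(z :: complex) \<noteq> 0" shows "summable (\<lambda>n. 1 / (z + of_nat n) ^ 2)"
  using Polygamma_converges'[OF assms, of 2] by (simp add: divide_inverse)

text \<open>The difference of two translates of \<open>\<Sum> 1 / (z + m)\<^sup>2 = \<pi>\<^sup>2 / sin\<^sup>2 (\<pi> z)\<close>, in terms of
  \<open>U = exp (2 \<pi> \<i> z)\<close>.\<close>

lemma infsum_int_inverse_square_diff:
  fixes z :: complex
  assumes z: "2 * z \<notin> \<int>"
    and s: "(\<lambda>m::int. 1 / (of_int m + z) ^ 2 - 1 / (of_int m + z + 1 / 2) ^ 2) summable_on UNIV"
  defines "U \<equiv> exp (2 * of_real pi * \<i> * z)"
  shows "(\<Sum>\<^sub>\<infinity>m::int. 1 / (of_int m + z) ^ 2 - 1 / (of_int m + z + 1 / 2) ^ 2) =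
    - 8 * of_real pi ^ 2 * U * (1 + U ^ 2) / (1 - U ^ 2) ^ 2"
proof -
  have z1: "z \<notin> \<int>" "z + 1 / 2 \<notin> \<int>"
  proof -
    show "z \<notin> \<int>" using z by (metis Ints_mult Ints_numeral)
    show "z + 1 / 2 \<notin> \<int>"
    proof
      assume "z + 1 / 2 \<in> \<int>"
      then have "2 * (z + 1 / 2) - 1 \<in> \<int>" by (intro Ints_diff Ints_mult) auto
      then show False using z by simp
    qed
  qed
  have one: "(\<Sum>n. 1 / (of_int (int n) + y) ^ 2) + (\<Sum>n. 1 / (of_int (- int n - 1) + y) ^ 2) = of_real pi ^ 2 / sin (of_real pi * y) ^ 2"
    and sm: "summable (\<lambda>n. 1 / (of_int (int n) + y) ^ 2)" "summable (\<lambda>n. 1 / (of_int (- int n - 1) + y) ^ 2)"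
    if y: "y \<notin> \<int>" for y :: complex
  proof -
    have y0: "y \<noteq> 0" "1 - y \<noteq> 0" using y by auto
    have e: "(of_int (- int n - 1) + y) ^ 2 = (1 - y + of_nat n) ^ 2" for n
      by (simp add: power2_eq_square algebra_simps)
    have e': "of_int (int n) + y = y + of_nat n" for n by simp
    show "summable (\<lambda>n. 1 / (of_int (int n) + y) ^ 2)" "summable (\<lambda>n. 1 / (of_int (- int n - 1) + y) ^ 2)"
      unfolding e e' using trigamma_summable y0 by blast+
    show "(\<Sum>n. 1 / (of_int (int n) + y) ^ 2) + (\<Sum>n. 1 / (of_int (- int n - 1) + y) ^ 2) = of_real pi ^ 2 / sin (of_real pi * y) ^ 2"
      unfolding e e' by (rule trigamma_reflection[OF y, unfolded trigamma_eq])
  qed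
  define c where "c = sin (of_real pi * z)"
  have "(\<Sum>\<^sub>\<infinity>m::int. 1 / (of_int m + z) ^ 2 - 1 / (of_int m + z + 1 / 2) ^ 2) =
      of_real pi ^ 2 / sin (of_real pi * z) ^ 2 - of_real pi ^ 2 / sin (of_real pi * (z + 1 / 2)) ^ 2"
  proof -
    have "(\<Sum>n. 1 / (of_int (int n) + z) ^ 2 - 1 / (of_int (int n) + z + 1 / 2) ^ 2) =
        (\<Sum>n. 1 / (of_int (int n) + z) ^ 2) - (\<Sum>n. 1 / (of_int (int n) + (z + 1 / 2)) ^ 2)"
      using suminf_diff[OF sm(1)[OF z1(1)] sm(1)[OF z1(2)]] by (simp only: add.assoc)
    moreover have "(\<Sum>n. 1 / (of_int (- int n - 1) + z) ^ 2 - 1 / (of_int (- int n - 1) + z + 1 / 2) ^ 2) =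
        (\<Sum>n. 1 / (of_int (- int n - 1) + z) ^ 2) - (\<Sum>n. 1 / (of_int (- int n - 1) + (z + 1 / 2)) ^ 2)"
      using suminf_diff[OF sm(2)[OF z1(1)] sm(2)[OF z1(2)]] by (simp only: add.assoc)
    ultimately show ?thesis
      unfolding one[OF z1(1), symmetric] one[OF z1(2), symmetric] infsum_int_split(1)[OF s]
      by (simp only: add_diff_add)
  qed
  also have "sin (of_real pi * (z + 1 / 2)) = cos (of_real pi * z)"
  proof -
    have "of_real pi * (z + 1 / 2) = of_real pi * z + of_real pi / 2" by (simp add: algebra_simps)
    then show ?thesis using cos_sin_eq[of "- (of_real pi * z)"] by (simp add: add.commute)
  qed
  also have "of_real pi ^ 2 / sin (of_real pi * z) ^ 2 - of_real pi ^ 2 / cos (of_real pi * z) ^ 2 =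
      - 8 * of_real pi ^ 2 * U * (1 + U ^ 2) / (1 - U ^ 2) ^ 2"
  proof -
    define E where "E = exp (\<i> * (of_real pi * z))"
    have E0: "E \<noteq> 0" by (simp add: E_def)
    have U: "U = E ^ 2" by (simp add: U_def E_def exp_of_nat_mult[symmetric] algebra_simps flip: exp_double)
    have Em: "exp (- (\<i> * (of_real pi * z))) = 1 / E" by (simp add: E_def exp_minus divide_inverse)
    have sn: "sin (of_real pi * z) = (E - 1 / E) / (2 * \<i>)" and cs: "cos (of_real pi * z) = (E + 1 / E) / 2"
      by (simp_all add: sin_exp_eq cos_exp_eq Em E_def[symmetric])
    have "U \<noteq> 1"
    proof
      assume "U = 1"
      then obtain n :: int where "2 * of_real pi * \<i> * z = 2 * of_int n * of_real pi * \<i>"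
        using exp_eq_1 unfolding U_def by (auto simp: complex_eq_iff)
      then show False using z1(1) by simp
    qed
    moreover have "U \<noteq> - 1"
    proof
      assume "U = - 1"
      then have "exp (2 * of_real pi * \<i> * (z + 1 / 2)) = 1"
        by (simp add: U_def exp_add ring_distribs)
      then obtain n :: int where "2 * of_real pi * \<i> * (z + 1 / 2) = 2 * of_int n * of_real pi * \<i>"
        using exp_eq_1 by (auto simp: complex_eq_iff)
      then show False using z1(2) by simp
    qed
    ultimately have ne: "E ^ 2 - 1 \<noteq> 0" "E ^ 2 + 1 \<noteq> 0"
      unfolding U by (simp, metis eq_neg_iff_add_eq_0)
    have s2: "sin (of_real pi * z) ^ 2 = - ((E ^ 2 - 1) ^ 2) / (4 * E ^ 2)" and c2: "cos (of_real pi * z) ^ 2 = (E ^ 2 + 1) ^ 2 / (4 * E ^ 2)"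
      unfolding sn cs using E0 by (simp_all add: power_divide power_mult_distrib field_simps power2_eq_square)
    define A B where "A = E ^ 2 - 1" and "B = E ^ 2 + 1"
    have AB: "A \<noteq> 0" "B \<noteq> 0" "E ^ 2 \<noteq> 0" using ne E0 by (simp_all add: A_def B_def)
    have "of_real pi ^ 2 / (- (A ^ 2) / (4 * E ^ 2)) - of_real pi ^ 2 / (B ^ 2 / (4 * E ^ 2)) =
        - 4 * of_real pi ^ 2 * E ^ 2 * ((A ^ 2 + B ^ 2) / (A ^ 2 * B ^ 2))"
      using AB by (simp add: divide_simps) (simp add: algebra_simps)
    also have "A ^ 2 + B ^ 2 = 2 * (1 + (E ^ 2) ^ 2)"
      by (simp add: A_def B_def power2_eq_square algebra_simps)
    also have "A ^ 2 * B ^ 2 = (- (A * B)) ^ 2" by (simp add: power_mult_distrib)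
    finally have main: "of_real pi ^ 2 / (- (A ^ 2) / (4 * E ^ 2)) - of_real pi ^ 2 / (B ^ 2 / (4 * E ^ 2)) =
        - 4 * of_real pi ^ 2 * E ^ 2 * (2 * (1 + (E ^ 2) ^ 2) / (- (A * B)) ^ 2)" .
    have d: "1 - (E ^ 2) ^ 2 = - (A * B)" by (simp add: A_def B_def algebra_simps power2_eq_square)
    show ?thesis unfolding s2 c2 U d A_def[symmetric] B_def[symmetric] main by simp
  qed
  finally show ?thesis .
qed

subsection \<open>Limits at the cusps\<close>

lemma lattice_functions_cong:
  assumes "period_lattice w = period_lattice w'"
  shows "weierstrass_p w = weierstrass_p w'" "weierstrass_zeta w = weierstrass_zeta w'" "lattice_sum k w = lattice_sum k w'"
  using assms by (auto simp: fun_eq_iff weierstrass_p_def weierstrass_zeta_def lattice_sum_def)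

lemma period_lattice_translate: "period_lattice (1, \<tau> + of_int j) = period_lattice (1, \<tau>)"
proof -
  have "mat2 1 j 0 1 \<in> SL2Z" by (simp add: mat2_SL2Z)
  from change_basis_lattice[OF this, of "(1, \<tau>)"] show ?thesis by (simp add: change_basis_def)
qed

lemma period_lattice_S: "period_lattice (\<tau>, - 1) = period_lattice (1, \<tau>)"
proof -
  have "mat2 0 (- 1) 1 0 \<in> SL2Z" by (simp add: mat2_SL2Z)
  from change_basis_lattice[OF this, of "(1, \<tau>)"] show ?thesis by (simp add: change_basis_def)
qed

lemma period_lattice_translate': "period_lattice (1, \<tau> + of_nat j) = period_lattice (1, \<tau>)"
  using period_lattice_translate[of \<tau> "int j"] by simp

lemma real_multiple_notin_lattice:
  assumes "\<tau> \<in> upper_half_plane" "s \<in> {1 / 3, 1 / 2}"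
  shows "of_real r + of_real s * \<tau> \<notin> period_lattice (1, \<tau>)" "of_real s \<notin> period_lattice (1, \<tau>)"
proof -
  have frac: "real_of_int n \<noteq> s" for n
  proof
    assume "real_of_int n = s"
    with assms(2) have "real_of_int (3 * n) = of_int 1 \<or> real_of_int (2 * n) = of_int 1" by auto
    then have "3 * n = 1 \<or> 2 * n = 1" by (simp only: of_int_eq_iff)
    then show False by presburger
  qed
  show "of_real r + of_real s * \<tau> \<notin> period_lattice (1, \<tau>)"
  proof
    assume "of_real r + of_real s * \<tau> \<in> period_lattice (1, \<tau>)"
    then obtain m n :: int where "of_real r + of_real s * \<tau> = of_int m + of_int n * \<tau>"
      by (auto simp: period_lattice_def)
    then have "Im (of_real r + of_real s * \<tau>) = Im (of_int m + of_int n * \<tau>)" by simp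
    then show False using assms(1) frac[of n] by (simp add: upper_half_plane_def)
  qed
  show "of_real s \<notin> period_lattice (1, \<tau>)"
  proof
    assume "of_real s \<in> period_lattice (1, \<tau>)"
    then obtain m n :: int where eq: "of_real s = of_int m + of_int n * \<tau>"
      by (auto simp: period_lattice_def)
    then have "Im (of_real s :: complex) = Im (of_int m + of_int n * \<tau>)" by simp
    then have "n = 0" using assms(1) by (simp add: upper_half_plane_def)
    with eq have "Re (of_real s :: complex) = Re (of_int m :: complex)" by simp
    then show False using frac[of m] by simp
  qed
qed

lemma infsum_first_row:
  fixes f :: "int \<Rightarrow> complex"
  shows "(\<Sum>\<^sub>\<infinity>p. if snd p = (0::int) then f (fst p) else 0) = (\<Sum>\<^sub>\<infinity>m. f m)"
proof -
  have "(\<Sum>\<^sub>\<infinity>p. if snd p = (0::int) then f (fst p) else 0) = (\<Sum>\<^sub>\<infinity>p\<in>range (\<lambda>m. (m, 0::int)). f (fst p))"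
    by (rule infsum_cong_neutral) auto
  also have "\<dots> = (\<Sum>\<^sub>\<infinity>m. f m)" by (subst infsum_reindex) (auto simp: inj_def o_def)
  finally show ?thesis .
qed

text \<open>Existence of the limit is enough here; the values in weights 4 and 6 are found
  algebraically from the half-period values.\<close>

lemma lattice_sum_0_limit:
  assumes k: "k \<ge> 3"
  obtains c where "((\<lambda>\<tau>. lattice_sum k (1, \<tau>) 0) \<longlongrightarrow> c) at_i_inf"
proof -
  define S where "S \<tau> = (\<Sum>\<^sub>\<infinity>p\<in>UNIV - {(0, 0)}. shift_term 0 0 k p \<tau>)" for \<tau>
  have eq: "lattice_sum k (1, \<tau>) 0 = S \<tau>" if "\<tau> \<in> upper_half_plane" for \<tau>
    using lattice_sum_0_eq_shift[OF that] by (simp add: S_def)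
  have "(S \<longlongrightarrow> (\<Sum>\<^sub>\<infinity>p\<in>UNIV - {(0, 0)}. if of_int (snd p) + 0 = (0::real) then 1 / of_real (of_int (fst p) + 0) ^ k else 0)) at_i_inf"
    unfolding S_def
  proof (rule strip_dominated_limit[of _ _ _ 1])
    fix \<tau> assume t: "\<tau> \<in> upper_half_plane"
    then have t1: "\<tau> + of_nat 1 \<in> upper_half_plane" by (simp add: upper_half_plane_def)
    have "S (\<tau> + of_nat 1) = S \<tau>"
      using eq[OF t] eq[OF t1] lattice_functions_cong(3)[OF period_lattice_translate'[of \<tau> 1]] by metis
    then show "(\<Sum>\<^sub>\<infinity>p\<in>UNIV - {(0, 0)}. shift_term 0 0 k p (\<tau> + of_nat 1)) = (\<Sum>\<^sub>\<infinity>p\<in>UNIV - {(0, 0)}. shift_term 0 0 k p \<tau>)"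
      by (simp add: S_def)
  next
    show "(shift_term 0 0 k p \<longlongrightarrow> (if of_int (snd p) + 0 = (0::real) then 1 / of_real (of_int (fst p) + 0) ^ k else 0)) at_i_inf" for p
      by (rule shift_term_limit) (use k in auto)
  qed (use k in \<open>auto intro!: shift_term_dominated shift_avoids_cases(1)\<close>)
  then show ?thesis
    by (rule that[OF Lim_transform_eventually])
       (use eventually_upper_half_plane in \<open>eventually_elim, simp add: eq\<close>)
qed

lemma lattice_sum_real_limit:
  assumes k: "k \<ge> 3" and r: "r \<in> {1 / 3, 1 / 2}"
  shows "((\<lambda>\<tau>. lattice_sum k (1, \<tau>) (of_real r)) \<longlongrightarrow> (\<Sum>\<^sub>\<infinity>m::int. 1 / of_real (of_int m + r) ^ k)) at_i_inf"
proof -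
  define S where "S \<tau> = (\<Sum>\<^sub>\<infinity>p\<in>UNIV. shift_term r 0 k p \<tau>)" for \<tau>
  have eq: "lattice_sum k (1, \<tau>) (of_real r) = S \<tau>" if "\<tau> \<in> upper_half_plane" for \<tau>
    using lattice_sum_eq_shift[OF that, of r 0 k] r by (auto simp: S_def)
  have "(S \<longlongrightarrow> (\<Sum>\<^sub>\<infinity>p\<in>UNIV. if of_int (snd p) + 0 = (0::real) then 1 / of_real (of_int (fst p) + r) ^ k else 0)) at_i_inf"
    unfolding S_def
  proof (rule strip_dominated_limit[of _ _ _ 1])
    fix \<tau> assume t: "\<tau> \<in> upper_half_plane"
    then have t1: "\<tau> + of_nat 1 \<in> upper_half_plane" by (simp add: upper_half_plane_def)
    have "S (\<tau> + of_nat 1) = S \<tau>"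
      using eq[OF t] eq[OF t1] lattice_functions_cong(3)[OF period_lattice_translate'[of \<tau> 1]] by metis
    then show "(\<Sum>\<^sub>\<infinity>p\<in>UNIV. shift_term r 0 k p (\<tau> + of_nat 1)) = (\<Sum>\<^sub>\<infinity>p\<in>UNIV. shift_term r 0 k p \<tau>)"
      by (simp add: S_def)
  next
    show "(shift_term r 0 k p \<longlongrightarrow> (if of_int (snd p) + 0 = (0::real) then 1 / of_real (of_int (fst p) + r) ^ k else 0)) at_i_inf" for p
      by (rule shift_term_limit) (use k in auto)
  qed (use k r in \<open>auto intro!: shift_term_dominated shift_avoids_cases(2)\<close>)
  then have "(S \<longlongrightarrow> (\<Sum>\<^sub>\<infinity>m::int. 1 / of_real (of_int m + r) ^ k)) at_i_inf"
    by (simp add: infsum_first_row[of "\<lambda>m. 1 / of_real (of_int m + r) ^ k"] del: of_real_add)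
  then show ?thesis
    by (rule Lim_transform_eventually) (use eventually_upper_half_plane in \<open>eventually_elim, simp add: eq\<close>)
qed

text \<open>At the cusp 0 the torsion point becomes \<tau>/N. The coefficient n + 1/N of \<tau>
  never vanishes, so no row survives; the period in \<tau> is N here.\<close>

lemma lattice_sum_tau_limit:
  assumes k: "k \<ge> 3" and N: "N \<in> {2, 3}"
  shows "((\<lambda>\<tau>. lattice_sum k (1, \<tau>) (\<tau> / of_nat N)) \<longlongrightarrow> 0) at_i_inf"
proof -
  define s where "s = 1 / real N"
  have s: "s \<in> {1 / 3, 1 / 2}" using N by (auto simp: s_def)
  have st: "of_real s * \<tau> = \<tau> / of_nat N" for \<tau> :: complex by (simp add: s_def)
  define S where "S \<tau> = (\<Sum>\<^sub>\<infinity>p\<in>UNIV. shift_term 0 s k p \<tau>)" for \<tau>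
  have notin: "\<tau> / of_nat N \<notin> period_lattice (1, \<tau>)" if "\<tau> \<in> upper_half_plane" for \<tau>
    using real_multiple_notin_lattice(1)[OF that s, of 0] by (simp add: st)
  have eq: "lattice_sum k (1, \<tau>) (\<tau> / of_nat N) = S \<tau>" if "\<tau> \<in> upper_half_plane" for \<tau>
  proof -
    have "\<tau> / of_nat N \<noteq> 0" using notin[OF that] zero_in_lattice[of "(1, \<tau>)"] by metis
    then show ?thesis using lattice_sum_eq_shift[OF that, of 0 s k] by (simp add: S_def st)
  qed
  have "(S \<longlongrightarrow> (\<Sum>\<^sub>\<infinity>p\<in>UNIV. if of_int (snd p) + s = 0 then 1 / of_real (of_int (fst p) + 0) ^ k else 0)) at_i_inf"
    unfolding S_def
  proof (rule strip_dominated_limit[of _ _ _ N])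
    fix \<tau> assume t: "\<tau> \<in> upper_half_plane"
    then have t1: "\<tau> + of_nat N \<in> upper_half_plane" and w: "(1, \<tau>) \<in> oriented_bases" by (simp_all add: upper_half_plane_def)
    have "lattice_sum k (1, \<tau> + of_nat N) ((\<tau> + of_nat N) / of_nat N) = lattice_sum k (1, \<tau>) (\<tau> / of_nat N + 1)"
      using N lattice_functions_cong(3)[OF period_lattice_translate'[of \<tau> N]] by (auto simp: add_divide_distrib)
    also have "\<dots> = lattice_sum k (1, \<tau>) (\<tau> / of_nat N)"
      using eis_full_period[OF w notin[OF t] _ k, of 1] notin[OF t] lattice_basis(1)[of "(1, \<tau>)"] k
      by (simp add: lattice_sum_eq_eis_full[OF w])
    finally have "S (\<tau> + of_nat N) = S \<tau>" using eq[OF t] eq[OF t1] by simp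
    then show "(\<Sum>\<^sub>\<infinity>p\<in>UNIV. shift_term 0 s k p (\<tau> + of_nat N)) = (\<Sum>\<^sub>\<infinity>p\<in>UNIV. shift_term 0 s k p \<tau>)"
      by (simp add: S_def)
  next
    show "(shift_term 0 s k p \<longlongrightarrow> (if of_int (snd p) + s = 0 then 1 / of_real (of_int (fst p) + 0) ^ k else 0)) at_i_inf" for p
      by (rule shift_term_limit) (use k in auto)
  qed (use k s N in \<open>auto intro!: shift_term_dominated shift_avoids_cases(3)\<close>)
  moreover have "of_int n + s \<noteq> 0" for n using abs_int_shift_ge[OF s, of n] by auto
  ultimately have "(S \<longlongrightarrow> 0) at_i_inf" by simp
  then show ?thesis
    by (rule Lim_transform_eventually) (use eventually_upper_half_plane in \<open>eventually_elim, simp add: eq\<close>)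
qed

text \<open>In the next formula the summand for \<open>m = 0\<close> is \<open>1 / r\<^sup>2\<close>, because \<open>1 / 0 = 0\<close>.\<close>

lemma weierstrass_p_real_limit:
  assumes r: "r \<in> {1 / 3, 1 / 2}"
  shows "((\<lambda>\<tau>. weierstrass_p (1, \<tau>) (of_real r)) \<longlongrightarrow>
      (\<Sum>\<^sub>\<infinity>m::int. 1 / of_real (of_int m + r) ^ 2 - 1 / of_int m ^ 2)) at_i_inf"
    and "(\<lambda>m::int. 1 / of_real (of_int m + r) ^ 2 - 1 / of_int m ^ 2 :: complex) summable_on UNIV"
proof -
  define f where "f p \<tau> = shift_term r 0 2 p \<tau> - shift_term 0 0 2 p \<tau>" for p \<tau>
  define g :: "int \<times> int \<Rightarrow> complex" where
    "g p = (if snd p = 0 then 1 / of_real (of_int (fst p) + r) ^ 2 - 1 / of_int (fst p) ^ 2 else 0)" for p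
  define S where "S \<tau> = (\<Sum>\<^sub>\<infinity>p\<in>UNIV - {(0, 0)}. f p \<tau>)" for \<tau>
  have eq: "weierstrass_p (1, \<tau>) (of_real r) = 1 / of_real r ^ 2 + S \<tau>" if "\<tau> \<in> upper_half_plane" for \<tau>
    using weierstrass_p_eq_shift[OF that, of r] by (simp add: S_def f_def)
  have dom: "strip_dominated (UNIV - {(0, 0)}) f" unfolding f_def
    by (intro shift_difference_dominated shift_avoids_cases r)
  have lim: "(f p \<longlongrightarrow> g p) at_i_inf" for p
  proof -
    have "(f p \<longlongrightarrow> (if of_int (snd p) + 0 = (0::real) then 1 / of_real (of_int (fst p) + r) ^ 2 else 0) -
        (if of_int (snd p) + 0 = (0::real) then 1 / of_real (of_int (fst p) + 0) ^ 2 else 0)) at_i_inf"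
      unfolding f_def by (intro tendsto_diff shift_term_limit) auto
    then show ?thesis by (simp add: g_def split: if_splits)
  qed
  have "(S \<longlongrightarrow> (\<Sum>\<^sub>\<infinity>p\<in>UNIV - {(0, 0)}. g p)) at_i_inf"
    unfolding S_def
  proof (rule strip_dominated_limit[OF dom lim, of 1])
    fix \<tau> assume t: "\<tau> \<in> upper_half_plane"
    then have t1: "\<tau> + of_nat 1 \<in> upper_half_plane" by (simp add: upper_half_plane_def)
    have "S (\<tau> + of_nat 1) = S \<tau>"
      using eq[OF t] eq[OF t1] lattice_functions_cong(1)[OF period_lattice_translate'[of \<tau> 1]] by (metis add_left_cancel)
    then show "(\<Sum>\<^sub>\<infinity>p\<in>UNIV - {(0, 0)}. f p (\<tau> + of_nat 1)) = (\<Sum>\<^sub>\<infinity>p\<in>UNIV - {(0, 0)}. f p \<tau>)"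
      by (simp add: S_def)
  qed auto
  then have "((\<lambda>\<tau>. 1 / of_real r ^ 2 + S \<tau>) \<longlongrightarrow> 1 / of_real r ^ 2 + (\<Sum>\<^sub>\<infinity>p\<in>UNIV - {(0, 0)}. g p)) at_i_inf"
    by (intro tendsto_intros)
  then have lim1: "((\<lambda>\<tau>. weierstrass_p (1, \<tau>) (of_real r)) \<longlongrightarrow> 1 / of_real r ^ 2 + (\<Sum>\<^sub>\<infinity>p\<in>UNIV - {(0, 0)}. g p)) at_i_inf"
    by (rule Lim_transform_eventually) (use eventually_upper_half_plane in \<open>eventually_elim, simp add: eq\<close>)
  obtain B where B: "\<And>p \<tau>. p \<in> UNIV - {(0, 0)} \<Longrightarrow> \<bar>Re \<tau>\<bar> \<le> 0 \<Longrightarrow> 1 \<le> Im \<tau> \<Longrightarrow> norm (f p \<tau>) \<le> B * cube_weight p"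
    using dom unfolding strip_dominated_def by (metis zero_less_one)
  have gs: "g summable_on UNIV - {(0, 0)}"
  proof (rule abs_summable_comparison[OF summable_cube_weight_subset[of 1 "UNIV - {(0, 0)}"], of _ B])
    fix p :: "int \<times> int" assume p: "p \<in> UNIV - {(0, 0)}"
    show "norm (g p) \<le> B * (1 * cube_weight p)"
    proof (cases "snd p = 0")
      case True
      \<comment> \<open>On the row of index 0 the summand does not depend on \<tau>, so the bound at
        \<tau> = \<i> also dominates the limit \<open>g\<close>.\<close>
      then have "g p = f p \<i>" by (simp add: g_def f_def shift_term_def)
      then show ?thesis using B[OF p, of \<i>] by simp
    next
      case False
      have "norm (f p \<i>) \<le> B * cube_weight p" using B[OF p, of \<i>] by simp
      then have "0 \<le> B * cube_weight p" by (rule order_trans[OF norm_ge_zero])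
      then show ?thesis using False by (simp add: g_def)
    qed
  qed
  have ins: "insert (0, 0) (UNIV - {(0, 0)}) = (UNIV :: (int \<times> int) set)" by auto
  have gU: "g summable_on UNIV" using gs summable_on_insert_iff[of g "(0, 0)" "UNIV - {(0, 0)}"] ins by simp
  have "infsum g UNIV = g (0, 0) + infsum g (UNIV - {(0, 0)})"
    using infsum_insert[OF gs, of "(0, 0)"] ins by simp
  then have "1 / of_real r ^ 2 + infsum g (UNIV - {(0, 0)}) = infsum g UNIV" by (simp add: g_def)
  also have "\<dots> = (\<Sum>\<^sub>\<infinity>m::int. 1 / of_real (of_int m + r) ^ 2 - 1 / of_int m ^ 2)"
    unfolding g_def by (rule infsum_first_row)
  finally show "((\<lambda>\<tau>. weierstrass_p (1, \<tau>) (of_real r)) \<longlongrightarrow>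
      (\<Sum>\<^sub>\<infinity>m::int. 1 / of_real (of_int m + r) ^ 2 - 1 / of_int m ^ 2)) at_i_inf"
    using lim1 by simp
  have "g summable_on range (\<lambda>m. (m, 0))" using gU by (rule summable_on_subset_banach) auto
  then show "(\<lambda>m::int. 1 / of_real (of_int m + r) ^ 2 - 1 / of_int m ^ 2 :: complex) summable_on UNIV"
    by (subst (asm) summable_on_reindex) (auto simp: inj_def o_def g_def)
qed

text \<open>The surviving row is the sum of (m + 1/2)^(-2) - m^(-2), in which the subtracted term is
  0 for m = 0. Each half of the integers contributes \<pi>^2/2 - \<pi>^2/6, by the trigamma value at
  1/2 and Euler's sum.\<close>

lemma half_value_1_limit: "((\<lambda>\<tau>. half_value_1 (1, \<tau>)) \<longlongrightarrow> 2 * of_real pi ^ 2 / 3) at_i_inf"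
proof -
  define f :: "int \<Rightarrow> complex" where "f m = 1 / of_real (of_int m + 1 / 2) ^ 2 - 1 / of_int m ^ 2" for m
  have s: "f summable_on UNIV" using weierstrass_p_real_limit(2)[of "1 / 2"] by (simp add: f_def[abs_def])
  have sq: "(\<lambda>n. 1 / (of_nat n + 1) ^ 2) sums (of_real pi ^ 2 / 6 :: complex)"
  proof -
    have "(\<lambda>n. complex_of_real (1 / real ((n + 1) ^ 2))) sums of_real (pi ^ 2 / 6)"
      using inverse_squares_sums by (simp only: sums_of_real_iff)
    then show ?thesis by (simp add: add.commute)
  qed
  have tri: "(\<lambda>n. 1 / (1 / 2 + of_nat n) ^ 2) sums (of_real pi ^ 2 / 2 :: complex)"
  proof -
    have "Polygamma 1 (1 / 2 :: complex) + Polygamma 1 (1 - 1 / 2) = of_real pi ^ 2 / sin (of_real pi * (1 / 2)) ^ 2"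
      by (rule trigamma_reflection) (use fraction_not_in_Ints[where 'a = complex, of 2 1] in simp)
    moreover have "sin (of_real pi * (1 / 2) :: complex) = 1"
      using cos_sin_eq[of "0 :: complex"] by simp
    ultimately have P: "Polygamma 1 (1 / 2 :: complex) = of_real pi ^ 2 / 2" by (simp add: field_simps)
    have "(\<lambda>n. 1 / (1 / 2 + of_nat n) ^ 2) sums (\<Sum>n. 1 / (1 / 2 + of_nat n) ^ 2 :: complex)"
      by (rule summable_sums[OF trigamma_summable]) simp
    then show ?thesis by (simp only: P[unfolded trigamma_eq])
  qed
  have sq0: "(\<lambda>n. 1 / (of_nat n) ^ 2) sums (of_real pi ^ 2 / 6 :: complex)"
    using sums_Suc[of "\<lambda>n. 1 / (of_nat n) ^ 2 :: complex" "of_real pi ^ 2 / 6"] sq by (simp add: add.commute)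
  have "(\<lambda>n. f (int n)) sums (of_real pi ^ 2 / 2 - of_real pi ^ 2 / 6)"
    using sums_diff[OF tri sq0] by (simp add: f_def add.commute)
  moreover have "(\<lambda>n. f (- int n - 1)) sums (of_real pi ^ 2 / 2 - of_real pi ^ 2 / 6)"
  proof -
    have "f (- int n - 1) = 1 / (1 / 2 + of_nat n) ^ 2 - 1 / (of_nat n + 1) ^ 2" for n
    proof -
      have "complex_of_real (of_int (- int n - 1) + 1 / 2) = - (1 / 2 + of_nat n)" "(of_int (- int n - 1) :: complex) = - (of_nat n + 1)"
        by (simp_all add: algebra_simps)
      then show ?thesis by (simp only: f_def power2_minus)
    qed
    then show ?thesis using sums_diff[OF tri sq] by simp
  qed
  ultimately have "(\<Sum>\<^sub>\<infinity>m. f m) = 2 * (of_real pi ^ 2 / 2 - of_real pi ^ 2 / 6)"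
    using infsum_int_split(1)[OF s] by (simp add: sums_iff)
  also have "\<dots> = 2 * of_real pi ^ 2 / 3" by simp
  finally have v: "(\<Sum>\<^sub>\<infinity>m. f m) = 2 * of_real pi ^ 2 / 3" .
  have "((\<lambda>\<tau>. weierstrass_p (1, \<tau>) (of_real (1 / 2))) \<longlongrightarrow> (\<Sum>\<^sub>\<infinity>m. f m)) at_i_inf"
    unfolding f_def by (rule weierstrass_p_real_limit(1)) simp
  then show ?thesis unfolding v by (simp add: half_value_1_def)
qed

text \<open>Only the sign is extracted: the terms of index n and -n-1 combine to (n + 1/3)^(-3) - (n
  + 2/3)^(-3) > 0. The value comes later from algebraic relations, which leave just this sign
  open.\<close>

lemma lattice_sum_3_limit:
  obtains d :: real where "d > 0" "((\<lambda>\<tau>. lattice_sum 3 (1, \<tau>) (1 / 3)) \<longlongrightarrow> of_real d) at_i_inf"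
proof -
  define f :: "int \<Rightarrow> complex" where "f m = 1 / of_real (of_int m + 1 / 3) ^ 3" for m
  have s: "f summable_on UNIV"
  proof -
    have "(\<lambda>p. shift_term (1 / 3) 0 3 p \<i>) summable_on UNIV"
      by (intro strip_dominated_summable[of UNIV "shift_term (1 / 3) 0 3"] shift_term_dominated shift_avoids_cases) (auto simp: upper_half_plane_def)
    then have "(\<lambda>p. shift_term (1 / 3) 0 3 p \<i>) summable_on range (\<lambda>m. (m, 0))"
      by (rule summable_on_subset_banach) auto
    then show ?thesis
      by (subst (asm) summable_on_reindex) (auto simp: inj_def o_def f_def[abs_def] shift_term_def)
  qed
  define g where "g n = 1 / (real n + 1 / 3) ^ 3 - 1 / (real n + 2 / 3) ^ 3" for n
  have "f (int n) + f (- int n - 1) = of_real (g n)" for n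
  proof -
    have fr: "f m = of_real (1 / (of_int m + 1 / 3) ^ 3)" for m by (simp add: f_def)
    have neg: "1 / y ^ 3 = - (1 / x ^ 3)" if "y = - x" for x y :: real using that by (simp add: power3_eq_cube)
    have "real_of_int (- int n - 1) + 1 / 3 = - (real n + 2 / 3)" by simp
    from neg[OF this] have "1 / (real_of_int (- int n - 1) + 1 / 3) ^ 3 = - (1 / (real n + 2 / 3) ^ 3)" .
    then have "1 / (of_int (int n) + 1 / 3) ^ 3 + 1 / (real_of_int (- int n - 1) + 1 / 3) ^ 3 = g n"
      by (simp add: g_def)
    then show ?thesis unfolding fr by (simp only: of_real_add[symmetric])
  qed
  then have sums: "(\<lambda>n. complex_of_real (g n)) sums infsum f UNIV"
    using sums_add[OF summable_sums[OF infsum_int_split(2)[OF s]] summable_sums[OF infsum_int_split(3)[OF s]]]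
    unfolding infsum_int_split(1)[OF s] by simp
  then have "summable g" using sums_summable summable_of_real_iff by (metis (no_types, lifting) summable_complex_of_real)
  have gp: "g n > 0" for n
    unfolding g_def by (simp add: frac_less2 power_strict_mono)
  have "infsum f UNIV = of_real (suminf g)"
    using sums \<open>summable g\<close> by (metis sums_iff suminf_of_real)
  moreover have "suminf g > 0" using suminf_pos[OF \<open>summable g\<close>] gp by blast
  moreover have "((\<lambda>\<tau>. lattice_sum 3 (1, \<tau>) (1 / 3)) \<longlongrightarrow> infsum f UNIV) at_i_inf"
    using lattice_sum_real_limit[of 3 "1 / 3"] by (simp add: f_def[abs_def])
  ultimately show ?thesis by (intro that[of "suminf g"]) auto
qed

text \<open>The source of all simple zeros at infinity. Summing over m first turns row n into
  T(exp(2 \<pi> \<i> (n + 1/2) \<tau>)); the rows n and -n-1 agree, and the two rows of lowest order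
  contribute twice -8 \<pi>^2 exp(\<pi> \<i> \<tau>).\<close>

lemma half_value_diff_limit:
  "((\<lambda>\<tau>. (half_value_2 (1, \<tau>) - half_value_3 (1, \<tau>)) / exp (of_real pi * \<i> * \<tau>)) \<longlongrightarrow> - 16 * of_real pi ^ 2) at_i_inf"
proof -
  define Q where "Q \<tau> = exp (of_real pi * \<i> * \<tau>)" for \<tau>
  define T where "T (V :: complex) = - 8 * of_real pi ^ 2 * V * (1 + V ^ 2) / (1 - V ^ 2) ^ 2" for V
  define f where "f n \<tau> = - 16 * of_real pi ^ 2 * Q \<tau> ^ (2 * n) * (1 + (Q \<tau> ^ (2 * n + 1)) ^ 2) / (1 - (Q \<tau> ^ (2 * n + 1)) ^ 2) ^ 2" for n \<tau>
  have diff: "(half_value_2 (1, \<tau>) - half_value_3 (1, \<tau>)) / Q \<tau> = (\<Sum>n. f n \<tau>)" if t: "\<tau> \<in> upper_half_plane" for \<tau>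
  proof -
    define F where "F p = shift_term 0 (1 / 2) 2 p \<tau> - shift_term (1 / 2) (1 / 2) 2 p \<tau>" for p
    define S where "S = half_value_2 (1, \<tau>) - half_value_3 (1, \<tau>)"
    have S: "S = (\<Sum>\<^sub>\<infinity>p. F p)"
      using weierstrass_p_diff_eq_shift[OF t, of 0 "1 / 2" "1 / 2"] real_multiple_notin_lattice(1)[OF t, of "1 / 2" 0]
        real_multiple_notin_lattice(1)[OF t, of "1 / 2" "1 / 2"]
      by (simp add: S_def F_def half_value_2_def half_value_3_def add_divide_distrib)
    have Fs: "F summable_on UNIV" unfolding F_def
      by (intro strip_dominated_summable[of UNIV "\<lambda>p \<tau>. shift_term 0 (1 / 2) 2 p \<tau> - shift_term (1 / 2) (1 / 2) 2 p \<tau>"]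
        shift_difference_dominated shift_avoids_cases t) auto
    then have "(F has_sum S) (UNIV \<times> UNIV)" unfolding S by simp
    then have sw: "((\<lambda>(n, m). F (m, n)) has_sum S) (UNIV \<times> UNIV)" by (subst (asm) has_sum_swap)
    define g where "g n = T (exp (2 * of_real pi * \<i> * (of_real (of_int n + 1 / 2) * \<tau>)))" for n :: int
    have inner: "((\<lambda>m. (case (n, m) of (n, m) \<Rightarrow> F (m, n))) has_sum g n) UNIV" for n
    proof -
      define z where "z = of_real (of_int n + 1 / 2) * \<tau>"
      have z: "2 * z \<notin> \<int>"
      proof
        assume "2 * z \<in> \<int>"
        then obtain k where "2 * z = of_int k" by (elim Ints_cases)
        then have "Im (2 * z) = Im (of_int k)" by (simp only:)
        then have "real_of_int (2 * n + 1) = of_int 0" using t by (simp add: z_def upper_half_plane_def)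
        then have "2 * n + 1 = 0" by (simp only: of_int_eq_iff)
        then show False by presburger
      qed
      have Fz: "F (m, n) = 1 / (of_int m + z) ^ 2 - 1 / (of_int m + z + 1 / 2) ^ 2" for m
        by (simp add: F_def shift_term_def z_def algebra_simps)
      have "(\<lambda>m. F (m, n)) summable_on UNIV"
        by (rule summable_on_SigmaD1[of "\<lambda>n m. F (m, n)" UNIV "\<lambda>_. UNIV"]) (use has_sum_imp_summable[OF sw] in auto)
      then have "((\<lambda>m. F (m, n)) has_sum (\<Sum>\<^sub>\<infinity>m. F (m, n))) UNIV" by simp
      moreover have "(\<Sum>\<^sub>\<infinity>m. F (m, n)) = g n"
        using infsum_int_inverse_square_diff[OF z] \<open>(\<lambda>m. F (m, n)) summable_on UNIV\<close>
        by (simp add: Fz g_def T_def z_def)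
      ultimately show ?thesis by simp
    qed
    have gS: "(g has_sum S) UNIV" by (rule has_sum_SigmaD[OF sw]) (use inner in auto)
    \<comment> \<open>Identifies row -n-1 with row n. If V^2 = 1, both sides are 0 because division
      by 0 gives 0.\<close>
    have Tinv: "T (1 / V) = T V" if "V \<noteq> 0" for V
    proof (cases "V ^ 2 = 1")
      case True
      then show ?thesis by (simp add: T_def power_one_over)
    next
      case False
      then have "1 - V ^ 2 \<noteq> 0" "V ^ 2 - 1 \<noteq> 0" by auto
      have "1 - (1 / V) ^ 2 = (V ^ 2 - 1) / V ^ 2" "1 + (1 / V) ^ 2 = (1 + V ^ 2) / V ^ 2"
        using that by (simp_all add: power_divide diff_divide_distrib add_divide_distrib)
      then have "T (1 / V) = - 8 * of_real pi ^ 2 * ((1 / V) * ((1 + V ^ 2) / V ^ 2) / ((V ^ 2 - 1) / V ^ 2) ^ 2)"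
        by (simp add: T_def)
      also have "(1 / V) * ((1 + V ^ 2) / V ^ 2) / ((V ^ 2 - 1) / V ^ 2) ^ 2 = V * (1 + V ^ 2) / (V ^ 2 - 1) ^ 2"
        using that \<open>V ^ 2 - 1 \<noteq> 0\<close> by (simp add: field_simps power_divide) (simp add: eval_nat_numeral algebra_simps)
      also have "(V ^ 2 - 1) ^ 2 = (1 - V ^ 2) ^ 2" by (rule power2_commute)
      finally show ?thesis by (simp add: T_def)
    qed
    have Q0: "Q \<tau> \<noteq> 0" by (simp add: Q_def)
    have g1: "g (int n) = T (Q \<tau> ^ (2 * n + 1))" for n
    proof -
      have "2 * of_real pi * \<i> * (of_real (of_int (int n) + 1 / 2) * \<tau>) = of_nat (2 * n + 1) * (of_real pi * \<i> * \<tau>)"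
        by (simp add: algebra_simps)
      then show ?thesis by (simp only: g_def Q_def exp_of_nat_mult)
    qed
    have g2: "g (- int n - 1) = T (Q \<tau> ^ (2 * n + 1))" for n
    proof -
      have "2 * of_real pi * \<i> * (of_real (of_int (- int n - 1) + 1 / 2) * \<tau>) = - (of_nat (2 * n + 1) * (of_real pi * \<i> * \<tau>))"
        by (simp add: algebra_simps)
      then have "g (- int n - 1) = T (1 / Q \<tau> ^ (2 * n + 1))"
        by (simp only: g_def Q_def exp_minus exp_of_nat_mult divide_inverse mult_1_left)
      then show ?thesis using Tinv[of "Q \<tau> ^ (2 * n + 1)"] Q0 by simp
    qed
    have gs: "g summable_on UNIV" using gS by (rule has_sum_imp_summable)
    have "(\<lambda>n. g (int n) + g (- int n - 1)) sums S"
      using sums_add[OF summable_sums[OF infsum_int_split(2)[OF gs]] summable_sums[OF infsum_int_split(3)[OF gs]]]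
        infsum_int_split(1)[OF gs] infsumI[OF gS] by simp
    then have "(\<lambda>n. (T (Q \<tau> ^ (2 * n + 1)) + T (Q \<tau> ^ (2 * n + 1))) / Q \<tau>) sums (S / Q \<tau>)"
      unfolding g1 g2 by (rule sums_divide)
    moreover have "(T (Q \<tau> ^ (2 * n + 1)) + T (Q \<tau> ^ (2 * n + 1))) / Q \<tau> = f n \<tau>" for n
      using Q0 by (simp add: T_def f_def)
    ultimately show ?thesis by (simp add: S_def sums_iff)
  qed
  have Qlim: "(Q \<longlongrightarrow> 0) at_i_inf"
    using q_exp_tendsto[of 2] by (simp add: Q_def[abs_def] mult.assoc)
  \<comment> \<open>Valid once |Q| < 1/2: then |1 + V| \<le> 2, |1 - V| \<ge> 1/2 and |Q|^(2 n)
    \<le> 4^(-n), with V the square of Q^(2 n + 1).\<close>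
  define M where "M n = 16 * pi ^ 2 * 2 / (1 / 2) ^ 2 * (1 / 4 :: real) ^ n" for n
  have Ms: "M summable_on UNIV" unfolding M_def
    by (intro summable_on_cmult_right summable_nonneg_imp_summable_on summable_geometric) auto
  have small: "\<forall>\<^sub>F \<tau> in at_i_inf. norm (Q \<tau>) < 1 / 2"
    using tendstoD[OF Qlim, of "1 / 2"] by (simp add: dist_norm)
  have bound: "\<forall>\<^sub>F \<tau> in at_i_inf. \<forall>n\<in>UNIV. norm (f n \<tau>) \<le> M n"
    using small
  proof eventually_elim
    case (elim \<tau>)
    show ?case
    proof
      fix n
      define V where "V = (Q \<tau> ^ (2 * n + 1)) ^ 2"
      have "norm V \<le> 1 / 2"
      proof -
        have e: "(2 * n + 1) * 2 = Suc (4 * n + 1)" by simp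
        have "norm V = norm (Q \<tau>) * norm (Q \<tau>) ^ (4 * n + 1)"
          by (simp only: V_def norm_power norm_mult power_mult[symmetric] e power_Suc)
        also have "\<dots> \<le> 1 / 2 * 1"
          using elim by (intro mult_mono power_le_one) auto
        finally show ?thesis by simp
      qed
      then have "norm (1 + V) \<le> 2" "1 / 2 \<le> norm (1 - V)"
        using norm_triangle_ineq[of 1 V] norm_triangle_ineq2[of 1 V] by auto
      then have "norm (1 + V) \<le> 2" "(1 / 2) ^ 2 \<le> norm (1 - V) ^ 2" by (auto intro: power_mono)
      moreover have "norm (Q \<tau>) ^ 2 \<le> 1 / 4"
        using power_mono[of "norm (Q \<tau>)" "1 / 2" 2] elim by (simp add: power_divide)
      then have "norm (Q \<tau>) ^ (2 * n) \<le> (1 / 4) ^ n"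
        unfolding power_mult by (intro power_mono) auto
      ultimately have "16 * pi ^ 2 * norm (Q \<tau>) ^ (2 * n) * norm (1 + V) / norm (1 - V) ^ 2 \<le> 16 * pi ^ 2 * (1 / 4) ^ n * 2 / (1 / 2) ^ 2"
        by (intro frac_le mult_mono) auto
      then show "norm (f n \<tau>) \<le> M n"
        by (simp add: f_def M_def V_def norm_mult norm_divide norm_power mult_ac)
    qed
  qed
  have lim_f: "(f n \<longlongrightarrow> (if n = 0 then - 16 * of_real pi ^ 2 else 0)) at_i_inf" for n
  proof -
    have "(f n \<longlongrightarrow> - 16 * of_real pi ^ 2 * 0 ^ (2 * n) * (1 + (0 ^ (2 * n + 1)) ^ 2) / (1 - (0 ^ (2 * n + 1)) ^ 2) ^ 2) at_i_inf"
      unfolding f_def by (intro tendsto_intros Qlim) simp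
    moreover have "(0 :: complex) ^ (2 * n) = (if n = 0 then 1 else 0)" "(0 :: complex) ^ (2 * n + 1) = 0"
      by (simp_all add: power_0_left)
    ultimately show ?thesis by (cases "n = 0") simp_all
  qed
  have "((\<lambda>\<tau>. \<Sum>\<^sub>\<infinity>n. f n \<tau>) \<longlongrightarrow> (\<Sum>\<^sub>\<infinity>n. if n = (0::nat) then - 16 * of_real pi ^ 2 else 0)) at_i_inf"
    by (rule tendsto_infsum_dominated[OF lim_f bound Ms])
  also have "(\<Sum>\<^sub>\<infinity>n. if n = (0::nat) then - 16 * of_real pi ^ 2 else 0) = (- 16 * of_real pi ^ 2 :: complex)"
    by (rule infsumI, rule has_sum_finite_neutralI[of "{0}"]) auto
  finally show ?thesis unfolding Q_def[symmetric]
  proof (rule Lim_transform_eventually)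
    show "\<forall>\<^sub>F \<tau> in at_i_inf. (\<Sum>\<^sub>\<infinity>n. f n \<tau>) = (half_value_2 (1, \<tau>) - half_value_3 (1, \<tau>)) / Q \<tau>"
      using eventually_upper_half_plane bound
    proof eventually_elim
      case (elim \<tau>)
      have "(\<lambda>n. f n \<tau>) summable_on UNIV"
        by (rule abs_summable_comparison[OF Ms, of _ 1]) (use elim in auto)
      then show ?case using diff[OF elim(1)] by (simp add: infsum_nat_eq_suminf)
    qed
  qed
qed

subsection \<open>Modular functions of lattices\<close>

text \<open>Modular forms seen as functions of bases: homogeneity carries the weight, so that
  algebraic relations between Weierstrass functions apply directly. The basis (\<tau>, -1) spans the
  same lattice as (1, \<tau>) and represents the cusp 0.\<close>

definition lattice_modular :: "nat \<Rightarrow> int \<Rightarrow> (complex \<times> complex \<Rightarrow> complex) \<Rightarrow> bool" where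
  "lattice_modular N k F \<longleftrightarrow>
     (\<forall>c w. c \<noteq> 0 \<longrightarrow> w \<in> oriented_bases \<longrightarrow> F (c * fst w, c * snd w) = c powi (- k) * F w) \<and>
     (\<forall>A\<in>Gamma1 N. \<forall>w\<in>oriented_bases. F (change_basis A w) = F w) \<and>
     (\<lambda>\<tau>. F (1, \<tau>)) holomorphic_on upper_half_plane \<and>
     bounded_at_i_inf (\<lambda>\<tau>. F (1, \<tau>)) \<and> bounded_at_i_inf (\<lambda>\<tau>. F (\<tau>, - 1))"

lemma lattice_modularD:
  assumes "lattice_modular N k F"
  shows "c \<noteq> 0 \<Longrightarrow> w \<in> oriented_bases \<Longrightarrow> F (c * fst w, c * snd w) = c powi (- k) * F w"
    and "A \<in> Gamma1 N \<Longrightarrow> w \<in> oriented_bases \<Longrightarrow> F (change_basis A w) = F w"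
    and "(\<lambda>\<tau>. F (1, \<tau>)) holomorphic_on upper_half_plane"
    and "bounded_at_i_inf (\<lambda>\<tau>. F (1, \<tau>))" "bounded_at_i_inf (\<lambda>\<tau>. F (\<tau>, - 1))"
  using assms unfolding lattice_modular_def by (simp_all del: split_paired_All)

lemma lattice_modularI:
  assumes "\<And>c w. c \<noteq> 0 \<Longrightarrow> w \<in> oriented_bases \<Longrightarrow> F (c * fst w, c * snd w) = c powi (- k) * F w"
    and "\<And>A w. A \<in> Gamma1 N \<Longrightarrow> w \<in> oriented_bases \<Longrightarrow> F (change_basis A w) = F w"
    and "(\<lambda>\<tau>. F (1, \<tau>)) holomorphic_on upper_half_plane"
    and "bounded_at_i_inf (\<lambda>\<tau>. F (1, \<tau>))" "bounded_at_i_inf (\<lambda>\<tau>. F (\<tau>, - 1))"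
  shows "lattice_modular N k F"
  using assms unfolding lattice_modular_def by blast

definition dehomogenize :: "(complex \<times> complex \<Rightarrow> complex) \<Rightarrow> complex \<Rightarrow> complex" where
  "dehomogenize F \<tau> = (if \<tau> \<in> upper_half_plane then F (1, \<tau>) else 0)"

lemma lattice_modular_homogenize:
  assumes "lattice_modular N k F" "w \<in> oriented_bases"
  shows "homogenize k (dehomogenize F) w = F w"
proof -
  have w0: "fst w \<noteq> 0" using assms(2) by (rule oriented_basis_fst)
  have o: "(1, snd w / fst w) \<in> oriented_bases" using oriented_basis_quotient[OF assms(2)] by simp
  have "F (fst w * 1, fst w * (snd w / fst w)) = fst w powi (- k) * F (1, snd w / fst w)"
    using lattice_modularD(1)[OF assms(1) w0 o] by (simp only: fst_conv snd_conv)
  then show ?thesis using w0 oriented_basis_quotient[OF assms(2)] by (simp add: homogenize_def dehomogenize_def)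
qed

lemma lattice_modular_at_zero:
  assumes "lattice_modular N k F" "\<tau> \<in> upper_half_plane"
  shows "at_zero k (dehomogenize F) \<tau> = F (\<tau>, - 1)"
  using lattice_modular_homogenize[OF assms(1), of "(\<tau>, - 1)"] assms(2) by (simp add: at_zero_eq_homogenize)

lemma lattice_modular_form:
  assumes N: "N \<in> {1, 2, 3}" and F: "lattice_modular N k F"
  shows "dehomogenize F \<in> modular_forms N k"
proof (rule modular_at_cusps_imp[OF N])
  have "Gamma1_invariant N k (dehomogenize F)" unfolding Gamma1_invariant_def
  proof (intro ballI)
    fix A \<tau> assume A: "A \<in> Gamma1 N" and t: "\<tau> \<in> upper_half_plane"
    then have w: "(1, \<tau>) \<in> oriented_bases" "change_basis A (1, \<tau>) \<in> oriented_bases"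
      by (auto intro!: change_basis_oriented Gamma1_SL2Z[OF N])
    have "slash k (dehomogenize F) A \<tau> = F (change_basis A (1, \<tau>))"
      using lattice_modular_homogenize[OF F w(2)] by (simp add: slash_eq_homogenize)
    also have "\<dots> = F (1, \<tau>)" by (rule lattice_modularD(2)[OF F A w(1)])
    finally show "slash k (dehomogenize F) A \<tau> = dehomogenize F \<tau>" using t by (simp add: dehomogenize_def)
  qed
  moreover have "dehomogenize F holomorphic_on upper_half_plane"
    by (rule holomorphic_transform[of "\<lambda>\<tau>. F (1, \<tau>)"]) (use lattice_modularD(3,4)[OF F] in \<open>auto simp: dehomogenize_def\<close>)
  moreover have "bounded_at_i_inf (dehomogenize F)"
    by (rule bounded_at_i_inf_cong[of "\<lambda>\<tau>. F (1, \<tau>)"]) (use lattice_modularD(3,4)[OF F] in \<open>auto simp: dehomogenize_def\<close>)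
  moreover have "bounded_at_i_inf (at_zero k (dehomogenize F))"
    by (rule bounded_at_i_inf_cong[of "\<lambda>\<tau>. F (\<tau>, - 1)"])
       (use lattice_modularD(5)[OF F] lattice_modular_at_zero[OF F] in auto)
  ultimately show "modular_at_cusps N k (dehomogenize F)" by (simp add: modular_at_cusps_def)
qed (simp add: dehomogenize_def)

lemma lattice_modular_const: "lattice_modular N 0 (\<lambda>_. c)"
  by (rule lattice_modularI) auto

lemma lattice_modular_add:
  assumes F: "lattice_modular N k F" and G: "lattice_modular N k G"
  shows "lattice_modular N k (\<lambda>w. F w + G w)"
proof (rule lattice_modularI)
  show "F (c * fst w, c * snd w) + G (c * fst w, c * snd w) = c powi (- k) * (F w + G w)"
    if "c \<noteq> 0" "w \<in> oriented_bases" for c w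
    using lattice_modularD(1)[OF F that] lattice_modularD(1)[OF G that] by (simp only: distrib_left)
qed (use lattice_modularD[OF F] lattice_modularD[OF G] in \<open>auto intro!: holomorphic_intros bounded_at_i_inf_add\<close>)

lemma lattice_modular_mult:
  assumes "lattice_modular N k F" "lattice_modular N l G"
  shows "lattice_modular N (k + l) (\<lambda>w. F w * G w)"
proof -
  have "c powi (- (k + l)) = c powi (- k) * c powi (- l)" if "c \<noteq> 0" for c :: complex
    using that power_int_add[of c "- k" "- l"] by (simp add: algebra_simps)
  note scale = this
  show ?thesis
  proof (rule lattice_modularI)
    show "F (c * fst w, c * snd w) * G (c * fst w, c * snd w) = c powi (- (k + l)) * (F w * G w)"
      if "c \<noteq> 0" "w \<in> oriented_bases" for c w
      unfolding lattice_modularD(1)[OF assms(1) that] lattice_modularD(1)[OF assms(2) that] scale[OF that(1)] by (simp only: mult_ac)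
  qed (use lattice_modularD[OF assms(1)] lattice_modularD[OF assms(2)] in \<open>auto intro!: holomorphic_intros bounded_at_i_inf_mult\<close>)
qed

lemma lattice_modular_cmult:
  "lattice_modular N k F \<Longrightarrow> lattice_modular N k (\<lambda>w. c * F w)"
  using lattice_modular_mult[OF lattice_modular_const, of N k F c] by simp

lemma lattice_modular_diff:
  "lattice_modular N k F \<Longrightarrow> lattice_modular N k G \<Longrightarrow> lattice_modular N k (\<lambda>w. F w - G w)"
  using lattice_modular_add[of N k F "\<lambda>w. - 1 * G w"] lattice_modular_cmult[of N k G "- 1"] by simp

lemma lattice_modular_power:
  "lattice_modular N k F \<Longrightarrow> lattice_modular N (int n * k) (\<lambda>w. F w ^ n)"
proof (induction n)
  case 0
  then show ?case using lattice_modular_const[of N 1] by simp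
next
  case (Suc n)
  from lattice_modular_mult[OF Suc.prems Suc.IH[OF Suc.prems]] show ?case by (simp add: algebra_simps)
qed

lemma lattice_modular_cong:
  assumes F: "lattice_modular N k F" and eq: "\<And>w. w \<in> oriented_bases \<Longrightarrow> F w = G w"
  shows "lattice_modular N k G"
proof (rule lattice_modularI)
  show "G (c * fst w, c * snd w) = c powi (- k) * G w" if "c \<noteq> 0" "w \<in> oriented_bases" for c w
    using lattice_modularD(1)[OF F that] eq[OF that(2)] eq[OF oriented_basis_scale[OF that(2,1)]] by simp
  show "G (change_basis A w) = G w" if "A \<in> Gamma1 N" "w \<in> oriented_bases" for A w
  proof -
    have "change_basis A w \<in> oriented_bases" using that by (intro change_basis_oriented) (auto simp: Gamma1_def)
    then show ?thesis using lattice_modularD(2)[OF F that] eq[OF that(2)] eq[of "change_basis A w"] by simp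
  qed
  show "(\<lambda>\<tau>. G (1, \<tau>)) holomorphic_on upper_half_plane"
    by (rule holomorphic_transform[OF lattice_modularD(3)[OF F]]) (simp add: eq)
  show "bounded_at_i_inf (\<lambda>\<tau>. G (1, \<tau>))"
    by (rule bounded_at_i_inf_cong[OF _ lattice_modularD(4)[OF F]]) (simp add: eq)
  show "bounded_at_i_inf (\<lambda>\<tau>. G (\<tau>, - 1))"
    by (rule bounded_at_i_inf_cong[OF _ lattice_modularD(5)[OF F]]) (simp add: eq)
qed

subsection \<open>Homogeneity\<close>

lemma period_lattice_scale:
  assumes "c \<noteq> 0"
  shows "\<omega> \<in> period_lattice (c * fst w, c * snd w) \<longleftrightarrow> \<omega> / c \<in> period_lattice w"
proof
  assume "\<omega> \<in> period_lattice (c * fst w, c * snd w)"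
  then obtain m n :: int where "\<omega> = of_int m * (c * fst w) + of_int n * (c * snd w)" by (auto simp: period_lattice_def)
  then have "\<omega> / c = of_int m * fst w + of_int n * snd w" using assms by (simp add: field_simps)
  then show "\<omega> / c \<in> period_lattice w" unfolding period_lattice_def by blast
next
  assume "\<omega> / c \<in> period_lattice w"
  then obtain m n :: int where "\<omega> / c = of_int m * fst w + of_int n * snd w" by (auto simp: period_lattice_def)
  then have "\<omega> = of_int m * (c * fst w) + of_int n * (c * snd w)" using assms by (simp add: field_simps)
  then show "\<omega> \<in> period_lattice (c * fst w, c * snd w)" by (auto simp: period_lattice_def)
qed

lemma infsum_lattice_scale:
  assumes c: "c \<noteq> 0"
  shows "(\<Sum>\<^sub>\<infinity>\<omega>\<in>period_lattice (c * fst w, c * snd w). f \<omega>) = (\<Sum>\<^sub>\<infinity>\<omega>\<in>period_lattice w. f (c * \<omega>))"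
    and "(\<Sum>\<^sub>\<infinity>\<omega>\<in>period_lattice (c * fst w, c * snd w) - {0}. f \<omega>) = (\<Sum>\<^sub>\<infinity>\<omega>\<in>period_lattice w - {0}. f (c * \<omega>))"
  by (rule infsum_reindex_bij_witness[of _ "\<lambda>\<omega>. c * \<omega>" "\<lambda>\<omega>. \<omega> / c"];
      use c in \<open>simp add: period_lattice_scale\<close>)+

lemma lattice_sum_scale:
  assumes c: "c \<noteq> 0"
  shows "lattice_sum k (c * fst w, c * snd w) (c * a) = c powi (- int k) * lattice_sum k w a"
proof -
  have e: "1 / (c * \<omega>) ^ k = c powi (- int k) * (1 / \<omega> ^ k)" "1 / (c * \<omega> + c * a) ^ k = c powi (- int k) * (1 / (\<omega> + a) ^ k)" for \<omega>
    by (simp_all add: power_mult_distrib power_int_minus divide_inverse flip: distrib_left)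
  show ?thesis
    unfolding lattice_sum_def infsum_lattice_scale(1)[OF c] infsum_lattice_scale(2)[OF c] e infsum_cmult_right'
    using c by simp
qed

lemma weierstrass_p_scale:
  assumes c: "c \<noteq> 0"
  shows "weierstrass_p (c * fst w, c * snd w) (c * z) = c powi (- 2) * weierstrass_p w z"
proof -
  have p: "c powi (- 2) = 1 / c ^ 2" by (simp add: power_int_minus divide_inverse)
  have e: "1 / (c * z - c * \<omega>) ^ 2 - 1 / (c * \<omega>) ^ 2 = c powi (- 2) * (1 / (z - \<omega>) ^ 2 - 1 / \<omega> ^ 2)" for \<omega>
  proof -
    have "c * z - c * \<omega> = c * (z - \<omega>)" by (simp add: right_diff_distrib)
    then show ?thesis unfolding p by (simp only: power_mult_distrib) (simp add: right_diff_distrib)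
  qed
  show ?thesis
    unfolding weierstrass_p_def infsum_lattice_scale[OF c] e infsum_cmult_right'
    by (simp add: p power_mult_distrib distrib_left)
qed

lemma weierstrass_zeta_scale:
  assumes c: "c \<noteq> 0"
  shows "weierstrass_zeta (c * fst w, c * snd w) (c * z) = c powi (- 1) * weierstrass_zeta w z"
proof -
  have p: "c powi (- 1) = 1 / c" by (simp add: power_int_minus divide_inverse)
  have e: "1 / (c * z - c * \<omega>) + 1 / (c * \<omega>) + c * z / (c * \<omega>) ^ 2 = c powi (- 1) * (1 / (z - \<omega>) + 1 / \<omega> + z / \<omega> ^ 2)" for \<omega>
    unfolding p using c by (simp add: right_diff_distrib[symmetric] power2_eq_square distrib_left)
  show ?thesis
    unfolding weierstrass_zeta_def infsum_lattice_scale[OF c] e infsum_cmult_right' p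
    by (simp add: distrib_left)
qed

subsection \<open>Eisenstein series are modular\<close>

text \<open>Inside the modular group, \<open>Gamma1 N\<close> is the stabiliser of the point
  \<omega>_0/N modulo the lattice; this is why division values at that point are forms of level
  N.\<close>

lemma Gamma1_torsion_point:
  assumes "A \<in> Gamma1 N" "N > 0"
  obtains \<mu> where "\<mu> \<in> period_lattice w" "fst (change_basis A w) / of_nat N = fst w / of_nat N + \<mu>"
proof -
  have "[A $ 2 $ 2 = 1] (mod int N)" "[A $ 2 $ 1 = 0] (mod int N)" using assms(1) by (auto simp: Gamma1_def)
  then have "int N dvd A $ 2 $ 2 - 1" "int N dvd A $ 2 $ 1" by (simp_all add: cong_iff_dvd_diff)
  then obtain d c where dc: "A $ 2 $ 2 - 1 = int N * d" "A $ 2 $ 1 = int N * c" by (auto elim!: dvdE)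
  then have d: "A $ 2 $ 2 = 1 + int N * d" by simp
  have "fst (change_basis A w) / of_nat N = fst w / of_nat N + (of_int c * snd w + of_int d * fst w)"
    using assms(2) by (simp add: change_basis_def d dc(2) field_simps)
  moreover have "of_int c * snd w + of_int d * fst w \<in> period_lattice w"
    by (intro lattice_add lattice_multiple) auto
  ultimately show ?thesis by (intro that)
qed

lemma torsion_point_notin:
  assumes "w \<in> oriented_bases" "N \<in> {2, 3}"
  shows "fst w / of_nat N \<notin> period_lattice w"
  using lattice_coset_not_half[OF assms(1), of N 1 0] assms(2) by auto

lemma lattice_modular_sum_0:
  assumes N: "N > 0" and k: "k \<ge> 3"
  shows "lattice_modular N (int k) (\<lambda>w. lattice_sum k w 0)"
proof (rule lattice_modularI)
  fix c :: complex and w assume "c \<noteq> 0"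
  then show "lattice_sum k (c * fst w, c * snd w) 0 = c powi (- int k) * lattice_sum k w 0"
    using lattice_sum_scale[of c k w 0] by simp
next
  fix A w assume "A \<in> Gamma1 N"
  then have "A \<in> SL2Z" by (simp add: Gamma1_def)
  from lattice_functions_cong(3)[OF change_basis_lattice[OF this]]
  show "lattice_sum k (change_basis A w) 0 = lattice_sum k w 0" by metis
next
  have "(\<lambda>\<tau>. \<Sum>\<^sub>\<infinity>p\<in>UNIV - {(0, 0)}. shift_term 0 0 k p \<tau>) holomorphic_on upper_half_plane"
    by (intro strip_dominated_holomorphic shift_term_dominated k shift_avoids_cases(1) shift_term_holomorphic[OF shift_avoids_cases(1)])
  then show "(\<lambda>\<tau>. lattice_sum k (1, \<tau>) 0) holomorphic_on upper_half_plane"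
    by (rule holomorphic_transform) (simp add: lattice_sum_0_eq_shift)
  show b: "bounded_at_i_inf (\<lambda>\<tau>. lattice_sum k (1, \<tau>) 0)"
    using lattice_sum_0_limit[OF k] bounded_at_i_inf_tendsto by metis
  then show "bounded_at_i_inf (\<lambda>\<tau>. lattice_sum k (\<tau>, - 1) 0)"
    using lattice_functions_cong(3)[OF period_lattice_S] by simp
qed

lemma lattice_modular_sum_torsion:
  assumes N: "N \<in> {2, 3}" and k: "k \<ge> 3"
  shows "lattice_modular N (int k) (\<lambda>w. lattice_sum k w (fst w / of_nat N))"
proof (rule lattice_modularI)
  fix c :: complex and w assume "c \<noteq> 0"
  then show "lattice_sum k (c * fst w, c * snd w) (fst (c * fst w, c * snd w) / of_nat N) = c powi (- int k) * lattice_sum k w (fst w / of_nat N)"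
    using lattice_sum_scale[of c k w "fst w / of_nat N"] by simp
next
  fix A w assume A: "A \<in> Gamma1 N" and w: "w \<in> oriented_bases"
  then have "A \<in> SL2Z" by (simp add: Gamma1_def)
  then have 1: "lattice_sum k (change_basis A w) = lattice_sum k w" by (intro lattice_functions_cong change_basis_lattice)
  obtain \<mu> where \<mu>: "\<mu> \<in> period_lattice w" "fst (change_basis A w) / of_nat N = fst w / of_nat N + \<mu>"
    by (rule Gamma1_torsion_point[OF A]) (use N in auto)
  note notin = torsion_point_notin[OF w N]
  show "lattice_sum k (change_basis A w) (fst (change_basis A w) / of_nat N) = lattice_sum k w (fst w / of_nat N)"
    unfolding 1 \<mu>(2) using eis_full_period[OF w notin \<mu>(1) k] notin \<mu>(1) k by (simp add: lattice_sum_eq_eis_full[OF w])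
next
  define r where "r = 1 / real N"
  have r: "r \<in> {1 / 3, 1 / 2}" using N by (auto simp: r_def)
  have rc: "fst (1, \<tau>) / of_nat N = (of_real r :: complex)" for \<tau> :: complex by (simp add: r_def)
  have "(\<lambda>\<tau>. \<Sum>\<^sub>\<infinity>p\<in>UNIV. shift_term r 0 k p \<tau>) holomorphic_on upper_half_plane"
    by (intro strip_dominated_holomorphic shift_term_dominated k shift_avoids_cases(2)[OF r] shift_term_holomorphic[OF shift_avoids_cases(2)[OF r, of UNIV]]) auto
  then show "(\<lambda>\<tau>. lattice_sum k (1, \<tau>) (fst (1, \<tau>) / of_nat N)) holomorphic_on upper_half_plane"
  proof (rule holomorphic_transform)
    fix \<tau> assume "\<tau> \<in> upper_half_plane"
    from lattice_sum_eq_shift[OF this, of r 0 k] r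
    show "(\<Sum>\<^sub>\<infinity>p\<in>UNIV. shift_term r 0 k p \<tau>) = lattice_sum k (1, \<tau>) (fst (1, \<tau>) / of_nat N)" unfolding rc by auto
  qed
  show "bounded_at_i_inf (\<lambda>\<tau>. lattice_sum k (1, \<tau>) (fst (1, \<tau>) / of_nat N))"
    unfolding rc by (rule bounded_at_i_inf_tendsto[OF lattice_sum_real_limit[OF k r]])
  show "bounded_at_i_inf (\<lambda>\<tau>. lattice_sum k (\<tau>, - 1) (fst (\<tau>, - 1) / of_nat N))"
    using bounded_at_i_inf_tendsto[OF lattice_sum_tau_limit[OF k N]] lattice_functions_cong(3)[OF period_lattice_S] by simp
qed

text \<open>Used for \<wp>(\<tau>/N) at the cusp 0: the shift grows with \<tau>, which spoils
  domination of the series, but \<wp> satisfies a cubic whose coefficients are known to be bounded.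
  Where |x| > 1, the equation yields 4 |x| \<le> B + C.\<close>

lemma bounded_at_i_inf_cubic:
  assumes p: "bounded_at_i_inf p" and q: "bounded_at_i_inf q"
    and eq: "\<And>\<tau>. \<tau> \<in> upper_half_plane \<Longrightarrow> 4 * x \<tau> ^ 3 = p \<tau> * x \<tau> + q \<tau>"
  shows "bounded_at_i_inf x"
proof -
  obtain B C where "\<forall>\<^sub>F \<tau> in at_i_inf. norm (p \<tau>) \<le> B" "\<forall>\<^sub>F \<tau> in at_i_inf. norm (q \<tau>) \<le> C"
    using p q by (auto simp: bounded_at_i_inf_def)
  then have "\<forall>\<^sub>F \<tau> in at_i_inf. norm (x \<tau>) \<le> max 1 (B + C)"
    using eventually_upper_half_plane
  proof eventually_elim
    case (elim \<tau>)
    define n where "n = norm (x \<tau>)"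
    show ?case
    proof (cases "n \<le> 1")
      case False
      then have n: "n > 1" by simp
      have "4 * n ^ 3 = norm (p \<tau> * x \<tau> + q \<tau>)"
        using arg_cong[OF eq[OF elim(3)], of norm] by (simp add: n_def norm_mult norm_power)
      also have "\<dots> \<le> B * n + C"
        using norm_triangle_ineq[of "p \<tau> * x \<tau>" "q \<tau>"] elim mult_right_mono[OF elim(1), of n] by (simp add: norm_mult n_def)
      also have "B * n \<le> B * n ^ 2"
        using n order_trans[OF norm_ge_zero elim(1)] by (intro mult_left_mono self_le_power) auto
      also have "C \<le> C * n ^ 2"
        using n order_trans[OF norm_ge_zero elim(2)] mult_left_mono[of 1 "n ^ 2" C] by (simp add: one_le_power)
      finally have "(4 * n) * n ^ 2 \<le> (B + C) * n ^ 2" by (simp add: power2_eq_square power3_eq_cube algebra_simps)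
      then have "4 * n \<le> B + C" using n by (simp add: mult_le_cancel_right)
      then show ?thesis using n by (simp add: n_def)
    qed (simp add: n_def)
  qed
  then show ?thesis by (auto simp: bounded_at_i_inf_def)
qed

lemma bounded_at_i_inf_root:
  assumes "bounded_at_i_inf (\<lambda>\<tau>. 3 * s \<tau> ^ 2)" shows "bounded_at_i_inf s"
proof -
  obtain B where "\<forall>\<^sub>F \<tau> in at_i_inf. norm (3 * s \<tau> ^ 2) \<le> B"
    using assms by (auto simp: bounded_at_i_inf_def)
  then have "\<forall>\<^sub>F \<tau> in at_i_inf. norm (s \<tau>) \<le> max 1 B"
  proof eventually_elim
    case (elim \<tau>)
    show ?case
    proof (cases "norm (s \<tau>) \<le> 1")
      case False
      then have "norm (s \<tau>) \<le> norm (s \<tau>) ^ 2" by (intro self_le_power) auto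
      also have "\<dots> \<le> B"
      proof -
        have "3 * norm (s \<tau>) ^ 2 \<le> B" using elim by (simp add: norm_mult norm_power)
        moreover have "0 \<le> norm (s \<tau>) ^ 2" by simp
        ultimately show ?thesis by linarith
      qed
      finally show ?thesis by simp
    qed simp
  qed
  then show ?thesis by (auto simp: bounded_at_i_inf_def)
qed

lemma lattice_modular_weierstrass_p:
  assumes N: "N \<in> {2, 3}"
  shows "lattice_modular N 2 (\<lambda>w. weierstrass_p w (fst w / of_nat N))"
proof (rule lattice_modularI)
  fix c :: complex and w assume "c \<noteq> 0"
  then show "weierstrass_p (c * fst w, c * snd w) (fst (c * fst w, c * snd w) / of_nat N) = c powi (- 2) * weierstrass_p w (fst w / of_nat N)"
    using weierstrass_p_scale[of c w "fst w / of_nat N"] by simp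
next
  fix A w assume A: "A \<in> Gamma1 N" and w: "w \<in> oriented_bases"
  then have "A \<in> SL2Z" by (simp add: Gamma1_def)
  then have 1: "weierstrass_p (change_basis A w) = weierstrass_p w" by (intro lattice_functions_cong change_basis_lattice)
  obtain \<mu> where \<mu>: "\<mu> \<in> period_lattice w" "fst (change_basis A w) / of_nat N = fst w / of_nat N + \<mu>"
    by (rule Gamma1_torsion_point[OF A]) (use N in auto)
  show "weierstrass_p (change_basis A w) (fst (change_basis A w) / of_nat N) = weierstrass_p w (fst w / of_nat N)"
    unfolding 1 \<mu>(2) by (rule weierstrass_p_period[OF w torsion_point_notin[OF w N] \<mu>(1)])
next
  define r where "r = 1 / real N"
  have r: "r \<in> {1 / 3, 1 / 2}" using N by (auto simp: r_def)
  have rc: "fst (1, \<tau>) / of_nat N = (of_real r :: complex)" for \<tau> :: complex by (simp add: r_def)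
  have "(\<lambda>\<tau>. \<Sum>\<^sub>\<infinity>p\<in>UNIV - {(0, 0)}. shift_term r 0 2 p \<tau> - shift_term 0 0 2 p \<tau>) holomorphic_on upper_half_plane"
  proof (rule strip_dominated_holomorphic)
    show "strip_dominated (UNIV - {(0, 0)}) (\<lambda>p \<tau>. shift_term r 0 2 p \<tau> - shift_term 0 0 2 p \<tau>)"
      by (intro shift_difference_dominated shift_avoids_cases r)
    fix p :: "int \<times> int" assume p: "p \<in> UNIV - {(0, 0)}"
    show "(\<lambda>\<tau>. shift_term r 0 2 p \<tau> - shift_term 0 0 2 p \<tau>) holomorphic_on upper_half_plane"
      by (intro holomorphic_on_diff shift_term_holomorphic[OF shift_avoids_cases(2)[OF r] p] shift_term_holomorphic[OF shift_avoids_cases(1) p])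
  qed
  then have "(\<lambda>\<tau>. 1 / of_real r ^ 2 + (\<Sum>\<^sub>\<infinity>p\<in>UNIV - {(0, 0)}. shift_term r 0 2 p \<tau> - shift_term 0 0 2 p \<tau>)) holomorphic_on upper_half_plane"
    by (intro holomorphic_on_add holomorphic_on_const)
  then show "(\<lambda>\<tau>. weierstrass_p (1, \<tau>) (fst (1, \<tau>) / of_nat N)) holomorphic_on upper_half_plane"
    unfolding rc by (rule holomorphic_transform) (simp only: weierstrass_p_eq_shift)
  show "bounded_at_i_inf (\<lambda>\<tau>. weierstrass_p (1, \<tau>) (fst (1, \<tau>) / of_nat N))"
    unfolding rc by (rule bounded_at_i_inf_tendsto[OF weierstrass_p_real_limit(1)[OF r]])
  note S = lattice_functions_cong[OF period_lattice_S]
  have "bounded_at_i_inf (\<lambda>\<tau>. weierstrass_p (1, \<tau>) (\<tau> / of_nat N))"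
  proof (rule bounded_at_i_inf_cubic)
    show "bounded_at_i_inf (\<lambda>\<tau>. 60 * lattice_sum 4 (1, \<tau>) 0)"
      using lattice_modularD(4)[OF lattice_modular_sum_0[of 1 4]] by (intro bounded_at_i_inf_mult) auto
    show "bounded_at_i_inf (\<lambda>\<tau>. 140 * lattice_sum 6 (1, \<tau>) 0 + 4 * lattice_sum 3 (1, \<tau>) (\<tau> / of_nat N) ^ 2)"
      using lattice_modularD(4)[OF lattice_modular_sum_0[of 1 6]] bounded_at_i_inf_tendsto[OF lattice_sum_tau_limit[of 3, OF _ N]]
      by (intro bounded_at_i_inf_add bounded_at_i_inf_mult bounded_at_i_inf_power) auto
    fix \<tau> assume t: "\<tau> \<in> upper_half_plane"
    then have w: "(\<tau>, - 1) \<in> oriented_bases" "(1, \<tau>) \<in> oriented_bases" by simp_all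
    have a: "\<tau> / of_nat N \<notin> period_lattice (1, \<tau>)"
      using torsion_point_notin[OF w(1) N] by (simp add: period_lattice_S)
    show "4 * weierstrass_p (1, \<tau>) (\<tau> / of_nat N) ^ 3 = 60 * lattice_sum 4 (1, \<tau>) 0 * weierstrass_p (1, \<tau>) (\<tau> / of_nat N) +
        (140 * lattice_sum 6 (1, \<tau>) 0 + 4 * lattice_sum 3 (1, \<tau>) (\<tau> / of_nat N) ^ 2)"
      using weierstrass_p_cubic[OF w(2) a] lattice_sum_eq_eis_full[OF w(2) a, of 3] by simp
  qed
  then show "bounded_at_i_inf (\<lambda>\<tau>. weierstrass_p (\<tau>, - 1) (fst (\<tau>, - 1) / of_nat N))"
    by (simp add: S)
qed

section \<open>Level 3: the tangent slope and the cubic lattice sum at a point of order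
  three\<close>

definition torsion_slope :: "complex \<times> complex \<Rightarrow> complex" where
  "torsion_slope w = flex_slope w (fst w / 3)"

definition torsion_sum :: "complex \<times> complex \<Rightarrow> complex" where
  "torsion_sum w = lattice_sum 3 w (fst w / 3)"

lemma torsion_relations:
  assumes w: "w \<in> oriented_bases"
  shows "3 * torsion_slope w ^ 2 = weierstrass_p w (fst w / 3)"
    and "60 * lattice_sum 4 w 0 = 108 * torsion_slope w ^ 4 - 24 * torsion_slope w * torsion_sum w"
    and "140 * lattice_sum 6 w 0 = - 216 * torsion_slope w ^ 6 + 72 * torsion_slope w ^ 3 * torsion_sum w - 4 * torsion_sum w ^ 2"
    and "discriminant w = 216 * torsion_sum w ^ 3 * (8 * torsion_slope w ^ 3 - 2 * torsion_sum w)"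
    and "torsion_sum w \<noteq> 0"
proof -
  have a: "fst w / 3 \<notin> period_lattice w" "3 * (fst w / 3) \<in> period_lattice w"
    using torsion_point_notin[OF w, of 3] by auto
  have G: "eis_full 3 w (fst w / 3) = torsion_sum w"
    using lattice_sum_eq_eis_full[OF w a(1), of 3] by (simp add: torsion_sum_def)
  show "3 * torsion_slope w ^ 2 = weierstrass_p w (fst w / 3)"
    using flex_slope_square[OF w a] by (simp add: torsion_slope_def)
  note inv = flex_invariants[OF w a, unfolded G, folded torsion_slope_def]
  show "60 * lattice_sum 4 w 0 = 108 * torsion_slope w ^ 4 - 24 * torsion_slope w * torsion_sum w" by (rule inv(1))
  show "140 * lattice_sum 6 w 0 = - 216 * torsion_slope w ^ 6 + 72 * torsion_slope w ^ 3 * torsion_sum w - 4 * torsion_sum w ^ 2" by (rule inv(2))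
  show d: "discriminant w = 216 * torsion_sum w ^ 3 * (8 * torsion_slope w ^ 3 - 2 * torsion_sum w)" by (rule inv(3))
  \<comment> \<open>The sum divides the discriminant, which does not vanish.\<close>
  show "torsion_sum w \<noteq> 0" using discriminant_nonzero[OF w] unfolding d by auto
qed

lemma lattice_modular_torsion_sum: "lattice_modular 3 3 torsion_sum"
  using lattice_modular_sum_torsion[of 3 3] by (simp add: torsion_sum_def[abs_def])

text \<open>When the point a moves by a period, \<zeta>(a) gains c and \<zeta>(2a) gains 2 c, which
  cancel in 2 \<zeta>(a) - \<zeta>(2a). Holomorphy comes from solving 60 G_4 = 12 \<wp>(a)^2 - 24 s
  G for the slope s, where the sum G has no zeros, and boundedness from 3 s^2 = \<wp>(a).\<close>

lemma lattice_modular_torsion_slope: "lattice_modular 3 1 torsion_slope"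
proof (rule lattice_modularI)
  fix c :: complex and w :: "complex \<times> complex" assume c: "c \<noteq> 0"
  have e: "fst (c * fst w, c * snd w) / 3 = c * (fst w / 3)" "2 * (c * (fst w / 3)) = c * (2 * (fst w / 3))" by simp_all
  show "torsion_slope (c * fst w, c * snd w) = c powi (- 1) * torsion_slope w"
    unfolding torsion_slope_def flex_slope_def e weierstrass_zeta_scale[OF c]
    by (simp add: right_diff_distrib diff_divide_distrib)
next
  fix A w assume A: "A \<in> Gamma1 3" and w: "w \<in> oriented_bases"
  then have "A \<in> SL2Z" by (simp add: Gamma1_def)
  then have 1: "weierstrass_zeta (change_basis A w) = weierstrass_zeta w" by (intro lattice_functions_cong change_basis_lattice)
  obtain \<mu> where \<mu>: "\<mu> \<in> period_lattice w" "fst (change_basis A w) / of_nat 3 = fst w / of_nat 3 + \<mu>"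
    by (rule Gamma1_torsion_point[OF A]) auto
  define a where "a = fst w / 3"
  have a: "a \<notin> period_lattice w" "3 * a \<in> period_lattice w" using torsion_point_notin[OF w, of 3] by (auto simp: a_def)
  have a': "fst (change_basis A w) / 3 = a + \<mu>" using \<mu>(2) by (simp add: a_def)
  note a2 = triple_points(2)[OF w a]
  obtain c where c: "\<And>z. z \<notin> period_lattice w \<Longrightarrow> weierstrass_zeta w (z + \<mu>) = weierstrass_zeta w z + c"
    using weierstrass_zeta_period[OF w \<mu>(1)] by blast
  have "weierstrass_zeta w (2 * (a + \<mu>)) = weierstrass_zeta w ((2 * a + \<mu>) + \<mu>)" by (simp add: algebra_simps)
  also have "\<dots> = weierstrass_zeta w (2 * a) + 2 * c" using c[of "2 * a + \<mu>"] c[OF a2] a2 \<mu>(1) by simp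
  finally show "torsion_slope (change_basis A w) = torsion_slope w"
    unfolding torsion_slope_def flex_slope_def 1 a' a_def[symmetric] using c[OF a(1)] by simp
next
  have "(\<lambda>\<tau>. (12 * weierstrass_p (1, \<tau>) (fst (1, \<tau>) / of_nat 3) ^ 2 - 60 * lattice_sum 4 (1, \<tau>) 0) / (24 * torsion_sum (1, \<tau>))) holomorphic_on upper_half_plane"
    using lattice_modularD(3)[OF lattice_modular_weierstrass_p[of 3]] lattice_modularD(3)[OF lattice_modular_sum_0[of 3 4]]
      lattice_modularD(3)[OF lattice_modular_torsion_sum] torsion_relations(5)
    by (intro holomorphic_intros) auto
  then show "(\<lambda>\<tau>. torsion_slope (1, \<tau>)) holomorphic_on upper_half_plane"
  proof (rule holomorphic_transform)
    fix \<tau> assume "\<tau> \<in> upper_half_plane"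
    then have w: "(1, \<tau>) \<in> oriented_bases" by simp
    have "12 * weierstrass_p (1, \<tau>) (fst (1, \<tau>) / of_nat 3) ^ 2 - 60 * lattice_sum 4 (1, \<tau>) 0 = torsion_slope (1, \<tau>) * (24 * torsion_sum (1, \<tau>))"
    proof -
      have x: "weierstrass_p (1, \<tau>) (fst (1, \<tau>) / of_nat 3) = 3 * torsion_slope (1, \<tau>) ^ 2"
        using torsion_relations(1)[OF w] by simp
      show ?thesis unfolding x torsion_relations(2)[OF w] by (simp add: power_mult_distrib algebra_simps)
    qed
    then show "(12 * weierstrass_p (1, \<tau>) (fst (1, \<tau>) / of_nat 3) ^ 2 - 60 * lattice_sum 4 (1, \<tau>) 0) / (24 * torsion_sum (1, \<tau>)) = torsion_slope (1, \<tau>)"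
      using torsion_relations(5)[OF w] by simp
  qed
  have x: "bounded_at_i_inf (\<lambda>\<tau>. weierstrass_p (1, \<tau>) (fst (1, \<tau>) / 3))" "bounded_at_i_inf (\<lambda>\<tau>. weierstrass_p (\<tau>, - 1) (fst (\<tau>, - 1) / 3))"
    using lattice_modularD(4,5)[OF lattice_modular_weierstrass_p[of 3]] by simp_all
  show "bounded_at_i_inf (\<lambda>\<tau>. torsion_slope (1, \<tau>))"
    by (rule bounded_at_i_inf_root, rule bounded_at_i_inf_cong[OF _ x(1)]) (simp add: torsion_relations(1))
  show "bounded_at_i_inf (\<lambda>\<tau>. torsion_slope (\<tau>, - 1))"
    by (rule bounded_at_i_inf_root, rule bounded_at_i_inf_cong[OF _ x(2)]) (simp add: torsion_relations(1))
qed

subsection \<open>Values at the cusps\<close>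

lemma dehomogenize_tendsto:
  assumes "((\<lambda>\<tau>. F (1, \<tau>)) \<longlongrightarrow> a) at_i_inf"
  shows "(dehomogenize F \<longlongrightarrow> a) at_i_inf"
  by (rule Lim_transform_eventually[OF assms])
     (use eventually_upper_half_plane in \<open>eventually_elim, simp add: dehomogenize_def\<close>)

lemma at_zero_dehomogenize_tendsto:
  assumes F: "lattice_modular N k F" and lim: "((\<lambda>\<tau>. F (\<tau>, - 1)) \<longlongrightarrow> a) at_i_inf"
  shows "(at_zero k (dehomogenize F) \<longlongrightarrow> a) at_i_inf"
  by (rule Lim_transform_eventually[OF lim])
     (use eventually_upper_half_plane in \<open>eventually_elim, simp add: lattice_modular_at_zero[OF F]\<close>)

lemma lattice_modular_limits:
  assumes N: "N \<in> {1, 2, 3}" and F: "lattice_modular N k F"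
  obtains a b where "((\<lambda>\<tau>. F (1, \<tau>)) \<longlongrightarrow> a) at_i_inf" "((\<lambda>\<tau>. F (\<tau>, - 1)) \<longlongrightarrow> b) at_i_inf"
proof -
  obtain a b where ab: "(dehomogenize F \<longlongrightarrow> a) at_i_inf" "(at_zero k (dehomogenize F) \<longlongrightarrow> b) at_i_inf"
    using modular_forms_limits[OF N lattice_modular_form[OF N F]] by blast
  have "((\<lambda>\<tau>. F (1, \<tau>)) \<longlongrightarrow> a) at_i_inf"
    by (rule Lim_transform_eventually[OF ab(1)])
       (use eventually_upper_half_plane in \<open>eventually_elim, simp add: dehomogenize_def\<close>)
  moreover have "((\<lambda>\<tau>. F (\<tau>, - 1)) \<longlongrightarrow> b) at_i_inf"
    by (rule Lim_transform_eventually[OF ab(2)])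
       (use eventually_upper_half_plane in \<open>eventually_elim, simp add: lattice_modular_at_zero[OF F]\<close>)
  ultimately show ?thesis by (rule that)
qed

lemma simple_zero_at_i_inf:
  assumes "((\<lambda>\<tau>. f \<tau> / exp (2 * of_real pi * \<i> * \<tau>)) \<longlongrightarrow> a) at_i_inf" "a \<noteq> 0"
  shows "(f \<longlongrightarrow> 0) at_i_inf"
    and "\<exists>c>0. \<forall>\<^sub>F \<tau> in at_i_inf. c * exp (- (2 * pi * Im \<tau>)) \<le> norm (f \<tau>)"
proof -
  have "((\<lambda>\<tau>. f \<tau> / exp (2 * of_real pi * \<i> * \<tau>) * exp (2 * of_real pi * \<i> * \<tau>)) \<longlongrightarrow> a * 0) at_i_inf"
    using q_exp_tendsto[of 1] by (intro tendsto_mult assms) simp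
  then show "(f \<longlongrightarrow> 0) at_i_inf" by simp
  have "((\<lambda>\<tau>. norm (f \<tau> / exp (2 * of_real pi * \<i> * \<tau>))) \<longlongrightarrow> norm a) at_i_inf"
    by (intro tendsto_intros assms)
  moreover have "norm a / 2 < norm a" using assms(2) by simp
  ultimately have "\<forall>\<^sub>F \<tau> in at_i_inf. norm a / 2 < norm (f \<tau> / exp (2 * of_real pi * \<i> * \<tau>))"
    by (rule order_tendstoD)
  then have "\<forall>\<^sub>F \<tau> in at_i_inf. norm a / 2 * exp (- (2 * pi * Im \<tau>)) \<le> norm (f \<tau>)"
  proof eventually_elim
    case (elim \<tau>)
    then show ?case using norm_q_exp[of \<tau> 1] by (simp add: norm_divide field_simps)
  qed
  then show "\<exists>c>0. \<forall>\<^sub>F \<tau> in at_i_inf. c * exp (- (2 * pi * Im \<tau>)) \<le> norm (f \<tau>)"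
    using assms(2) by (intro exI[of _ "norm a / 2"]) auto
qed

lemma cusp_divisor_dehomogenize:
  assumes N: "N \<in> {1, 2, 3}" and m: "m > 0" and F: "lattice_modular N (int m) F"
    and nz: "\<And>w. w \<in> oriented_bases \<Longrightarrow> F w \<noteq> 0"
    and lim: "((\<lambda>\<tau>. F (1, \<tau>) / exp (2 * of_real pi * \<i> * \<tau>)) \<longlongrightarrow> a) at_i_inf" "a \<noteq> 0"
    and zero: "N = 1 \<or> (((\<lambda>\<tau>. F (\<tau>, - 1)) \<longlongrightarrow> b) at_i_inf \<and> b \<noteq> 0)"
  shows "cusp_divisor N m (dehomogenize F)"
proof -
  have "((\<lambda>\<tau>. dehomogenize F \<tau> / exp (2 * of_real pi * \<i> * \<tau>)) \<longlongrightarrow> a) at_i_inf"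
    by (rule Lim_transform_eventually[OF lim(1)])
       (use eventually_upper_half_plane in \<open>eventually_elim, simp add: dehomogenize_def\<close>)
  note s = simple_zero_at_i_inf[OF this lim(2)]
  have "N = 1 \<or> (\<exists>b. b \<noteq> 0 \<and> (at_zero (int m) (dehomogenize F) \<longlongrightarrow> b) at_i_inf)"
    using zero at_zero_dehomogenize_tendsto[OF F] by blast
  moreover have "dehomogenize F \<tau> \<noteq> 0" if "\<tau> \<in> upper_half_plane" for \<tau>
    using nz[of "(1, \<tau>)"] that by (simp add: dehomogenize_def)
  ultimately show ?thesis unfolding cusp_divisor_def
    using m lattice_modular_form[OF N F] s by blast
qed

text \<open>Since e1 + e2 + e3 = 0 and e2 - e3 tends to 0, both e2 and e3 tend to minus half the
  limit of e1. The limits of g_2 and g_3 follow by expressing them in the half-period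
  values.\<close>

lemma half_value_limits:
  "((\<lambda>\<tau>. half_value_2 (1, \<tau>)) \<longlongrightarrow> - (of_real pi ^ 2 / 3)) at_i_inf"
  "((\<lambda>\<tau>. half_value_3 (1, \<tau>)) \<longlongrightarrow> - (of_real pi ^ 2 / 3)) at_i_inf"
  "((\<lambda>\<tau>. 60 * lattice_sum 4 (1, \<tau>) 0) \<longlongrightarrow> 4 * of_real pi ^ 4 / 3) at_i_inf"
  "((\<lambda>\<tau>. 140 * lattice_sum 6 (1, \<tau>) 0) \<longlongrightarrow> 8 * of_real pi ^ 6 / 27) at_i_inf"
proof -
  define d where "d \<tau> = half_value_2 (1, \<tau>) - half_value_3 (1, \<tau>)" for \<tau>
  have "((\<lambda>\<tau>. d \<tau> / exp (of_real pi * \<i> * \<tau>) * exp (of_real pi * \<i> * \<tau>)) \<longlongrightarrow> - 16 * of_real pi ^ 2 * 0) at_i_inf"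
    using q_exp_tendsto[of 2] half_value_diff_limit unfolding d_def by (intro tendsto_mult) (auto simp: mult.assoc)
  then have d: "(d \<longlongrightarrow> 0) at_i_inf" by simp
  have "((\<lambda>\<tau>. (- half_value_1 (1, \<tau>) + d \<tau>) / 2) \<longlongrightarrow> (- (2 * of_real pi ^ 2 / 3) + 0) / 2) at_i_inf"
    by (intro tendsto_intros d half_value_1_limit) auto
  moreover have "\<forall>\<^sub>F \<tau> in at_i_inf. (- half_value_1 (1, \<tau>) + d \<tau>) / 2 = half_value_2 (1, \<tau>)"
    using eventually_upper_half_plane
  proof eventually_elim
    case (elim \<tau>)
    have "half_value_1 (1, \<tau>) = - half_value_2 (1, \<tau>) - half_value_3 (1, \<tau>)"
      using half_value_vieta(1)[of "(1, \<tau>)"] elim by (simp add: eq_neg_iff_add_eq_0 eq_diff_eq add_ac)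
    then show ?case by (simp add: d_def)
  qed
  ultimately have "((\<lambda>\<tau>. half_value_2 (1, \<tau>)) \<longlongrightarrow> (- (2 * of_real pi ^ 2 / 3) + 0) / 2) at_i_inf"
    by (rule Lim_transform_eventually)
  then show 2: "((\<lambda>\<tau>. half_value_2 (1, \<tau>)) \<longlongrightarrow> - (of_real pi ^ 2 / 3)) at_i_inf" by simp
  have "((\<lambda>\<tau>. half_value_2 (1, \<tau>) - d \<tau>) \<longlongrightarrow> - (of_real pi ^ 2 / 3) - 0) at_i_inf"
    by (intro tendsto_intros 2 d)
  then show 3: "((\<lambda>\<tau>. half_value_3 (1, \<tau>)) \<longlongrightarrow> - (of_real pi ^ 2 / 3)) at_i_inf" by (simp add: d_def)
  have "((\<lambda>\<tau>. d \<tau> ^ 2 + 3 * half_value_1 (1, \<tau>) ^ 2) \<longlongrightarrow> 0 ^ 2 + 3 * (2 * of_real pi ^ 2 / 3) ^ 2) at_i_inf"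
    by (intro tendsto_intros d half_value_1_limit)
  moreover have "\<forall>\<^sub>F \<tau> in at_i_inf. d \<tau> ^ 2 + 3 * half_value_1 (1, \<tau>) ^ 2 = 60 * lattice_sum 4 (1, \<tau>) 0"
    using eventually_upper_half_plane
  proof eventually_elim
    case (elim \<tau>)
    then show ?case using half_value_square_diff[of "(1, \<tau>)"] by (simp add: d_def)
  qed
  ultimately have "((\<lambda>\<tau>. 60 * lattice_sum 4 (1, \<tau>) 0) \<longlongrightarrow> 0 ^ 2 + 3 * (2 * of_real pi ^ 2 / 3) ^ 2) at_i_inf"
    by (rule Lim_transform_eventually)
  then show "((\<lambda>\<tau>. 60 * lattice_sum 4 (1, \<tau>) 0) \<longlongrightarrow> 4 * of_real pi ^ 4 / 3) at_i_inf"
    by (simp add: power_mult_distrib power_divide)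
  have "((\<lambda>\<tau>. 4 * half_value_1 (1, \<tau>) * half_value_2 (1, \<tau>) * half_value_3 (1, \<tau>)) \<longlongrightarrow>
      4 * (2 * of_real pi ^ 2 / 3) * (- (of_real pi ^ 2 / 3)) * (- (of_real pi ^ 2 / 3))) at_i_inf"
    by (intro tendsto_intros 2 3 half_value_1_limit)
  moreover have "\<forall>\<^sub>F \<tau> in at_i_inf. 4 * half_value_1 (1, \<tau>) * half_value_2 (1, \<tau>) * half_value_3 (1, \<tau>) = 140 * lattice_sum 6 (1, \<tau>) 0"
    using eventually_upper_half_plane
  proof eventually_elim
    case (elim \<tau>)
    then show ?case using half_value_vieta(3)[of "(1, \<tau>)"] by simp
  qed
  ultimately have "((\<lambda>\<tau>. 140 * lattice_sum 6 (1, \<tau>) 0) \<longlongrightarrow>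
      4 * (2 * of_real pi ^ 2 / 3) * (- (of_real pi ^ 2 / 3)) * (- (of_real pi ^ 2 / 3))) at_i_inf"
    by (rule Lim_transform_eventually)
  moreover have "4 * (2 * of_real pi ^ 2 / 3) * (- (of_real pi ^ 2 / 3)) * (- (of_real pi ^ 2 / 3)) = 8 * (of_real pi :: complex) ^ 6 / 27"
    by (simp add: power2_eq_square eval_nat_numeral)
  ultimately show "((\<lambda>\<tau>. 140 * lattice_sum 6 (1, \<tau>) 0) \<longlongrightarrow> 8 * of_real pi ^ 6 / 27) at_i_inf" by (simp only:)
qed

lemma half_value_diff_square_limit:
  "((\<lambda>\<tau>. (half_value_2 (1, \<tau>) - half_value_3 (1, \<tau>)) ^ 2 / exp (2 * of_real pi * \<i> * \<tau>)) \<longlongrightarrow> 256 * of_real pi ^ 4) at_i_inf"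
proof -
  have "exp (2 * of_real pi * \<i> * \<tau>) = exp (of_real pi * \<i> * \<tau>) ^ 2" for \<tau> by (simp add: mult_ac flip: exp_double)
  then show ?thesis using tendsto_power[OF half_value_diff_limit, of 2] by (simp add: power_divide power_mult_distrib)
qed

text \<open>Here e1 - e2 and e1 - e3 tend to \<pi>^2, which leaves the constant 16 \<pi>^8 times the
  limit 256 \<pi>^4 of the squared difference over q.\<close>

lemma discriminant_limit:
  "((\<lambda>\<tau>. discriminant (1, \<tau>) / exp (2 * of_real pi * \<i> * \<tau>)) \<longlongrightarrow> 4096 * of_real pi ^ 12) at_i_inf"
proof -
  have "((\<lambda>\<tau>. 16 * (half_value_1 (1, \<tau>) - half_value_2 (1, \<tau>)) ^ 2 * (half_value_1 (1, \<tau>) - half_value_3 (1, \<tau>)) ^ 2 *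
      ((half_value_2 (1, \<tau>) - half_value_3 (1, \<tau>)) ^ 2 / exp (2 * of_real pi * \<i> * \<tau>))) \<longlongrightarrow>
      16 * (2 * of_real pi ^ 2 / 3 - (- (of_real pi ^ 2 / 3))) ^ 2 * (2 * of_real pi ^ 2 / 3 - (- (of_real pi ^ 2 / 3))) ^ 2 *
      (256 * of_real pi ^ 4)) at_i_inf"
    by (intro tendsto_intros half_value_1_limit half_value_limits half_value_diff_square_limit)
  moreover have "16 * (2 * of_real pi ^ 2 / 3 - (- (of_real pi ^ 2 / 3))) ^ 2 * (2 * of_real pi ^ 2 / 3 - (- (of_real pi ^ 2 / 3))) ^ 2 *
      (256 * of_real pi ^ 4) = 4096 * (of_real pi :: complex) ^ 12"
    by (simp add: field_simps eval_nat_numeral)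
  ultimately have "((\<lambda>\<tau>. 16 * (half_value_1 (1, \<tau>) - half_value_2 (1, \<tau>)) ^ 2 * (half_value_1 (1, \<tau>) - half_value_3 (1, \<tau>)) ^ 2 *
      ((half_value_2 (1, \<tau>) - half_value_3 (1, \<tau>)) ^ 2 / exp (2 * of_real pi * \<i> * \<tau>))) \<longlongrightarrow> 4096 * of_real pi ^ 12) at_i_inf" by (simp only:)
  then show ?thesis
    by (rule Lim_transform_eventually)
       (use eventually_upper_half_plane in \<open>eventually_elim, simp add: discriminant_eq power_mult_distrib\<close>)
qed

lemma lattice_modular_discriminant: "lattice_modular 1 12 discriminant"
proof -
  have 4: "lattice_modular 1 4 (\<lambda>w. 60 * lattice_sum 4 w 0)" and 6: "lattice_modular 1 6 (\<lambda>w. 140 * lattice_sum 6 w 0)"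
    using lattice_modular_sum_0[of 1 4] lattice_modular_sum_0[of 1 6] by (auto intro: lattice_modular_cmult)
  from lattice_modular_power[OF 4, of 3] lattice_modular_cmult[OF lattice_modular_power[OF 6, of 2], of 27]
  have "lattice_modular 1 12 (\<lambda>w. (60 * lattice_sum 4 w 0) ^ 3 - 27 * (140 * lattice_sum 6 w 0) ^ 2)"
    by (intro lattice_modular_diff) simp_all
  then show ?thesis by (simp add: discriminant_def[abs_def])
qed

lemma cusp_divisor_1: "cusp_divisor 1 12 (dehomogenize discriminant)"
  by (rule cusp_divisor_dehomogenize[OF _ _ _ _ discriminant_limit])
     (use lattice_modular_discriminant discriminant_nonzero in auto)

definition half_form :: "complex \<times> complex \<Rightarrow> complex" where
  "half_form w = 60 * lattice_sum 4 w 0 - 3 * half_value_1 w ^ 2"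

lemma lattice_modular_half_value: "lattice_modular 2 2 half_value_1"
  using lattice_modular_weierstrass_p[of 2] by (simp add: half_value_1_def[abs_def])

lemma lattice_modular_half_form: "lattice_modular 2 4 half_form"
proof -
  from lattice_modular_cmult[OF lattice_modular_power[OF lattice_modular_half_value, of 2], of 3]
    lattice_modular_cmult[OF lattice_modular_sum_0[of 2 4], of 60]
  have "lattice_modular 2 4 (\<lambda>w. 60 * lattice_sum 4 w 0 - 3 * half_value_1 w ^ 2)"
    by (intro lattice_modular_diff) simp_all
  then show ?thesis by (simp add: half_form_def[abs_def])
qed

lemma half_value_S: "half_value_1 (\<tau>, - 1) = half_value_2 (1, \<tau>)"
  by (simp add: half_value_1_def half_value_2_def lattice_functions_cong[OF period_lattice_S])

lemma half_form_limits:
  "((\<lambda>\<tau>. half_form (1, \<tau>) / exp (2 * of_real pi * \<i> * \<tau>)) \<longlongrightarrow> 256 * of_real pi ^ 4) at_i_inf"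
  "((\<lambda>\<tau>. half_form (\<tau>, - 1)) \<longlongrightarrow> of_real pi ^ 4) at_i_inf"
proof -
  show "((\<lambda>\<tau>. half_form (1, \<tau>) / exp (2 * of_real pi * \<i> * \<tau>)) \<longlongrightarrow> 256 * of_real pi ^ 4) at_i_inf"
    by (rule Lim_transform_eventually[OF half_value_diff_square_limit])
       (use eventually_upper_half_plane in \<open>eventually_elim, simp add: half_value_square_diff half_form_def\<close>)
  have "((\<lambda>\<tau>. 60 * lattice_sum 4 (1, \<tau>) 0 - 3 * half_value_2 (1, \<tau>) ^ 2) \<longlongrightarrow> 4 * of_real pi ^ 4 / 3 - 3 * (- (of_real pi ^ 2 / 3)) ^ 2) at_i_inf"
    by (intro tendsto_intros half_value_limits)
  moreover have "4 * of_real pi ^ 4 / 3 - 3 * (- (of_real pi ^ 2 / 3)) ^ 2 = (of_real pi :: complex) ^ 4"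
    by (simp add: power_divide)
  moreover have "(\<lambda>\<tau>. half_form (\<tau>, - 1)) = (\<lambda>\<tau>. 60 * lattice_sum 4 (1, \<tau>) 0 - 3 * half_value_2 (1, \<tau>) ^ 2)"
    by (simp add: fun_eq_iff half_form_def half_value_S lattice_functions_cong[OF period_lattice_S])
  ultimately show "((\<lambda>\<tau>. half_form (\<tau>, - 1)) \<longlongrightarrow> of_real pi ^ 4) at_i_inf" by (simp only:)
qed

lemma cusp_divisor_2: "cusp_divisor 2 4 (dehomogenize half_form)"
proof (rule cusp_divisor_dehomogenize[OF _ _ _ _ half_form_limits(1)])
  show "half_form w \<noteq> 0" if "w \<in> oriented_bases" for w
    using half_values_distinct(3)[OF that] unfolding half_form_def half_value_square_diff[OF that, symmetric] by simp
qed (use lattice_modular_half_form half_form_limits(2) in auto)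

definition torsion_form :: "complex \<times> complex \<Rightarrow> complex" where
  "torsion_form w = 8 * torsion_slope w ^ 3 - 2 * torsion_sum w"

lemma lattice_modular_torsion_form: "lattice_modular 3 3 torsion_form"
proof -
  from lattice_modular_cmult[OF lattice_modular_power[OF lattice_modular_torsion_slope, of 3], of 8]
    lattice_modular_cmult[OF lattice_modular_torsion_sum, of 2]
  have "lattice_modular 3 3 (\<lambda>w. 8 * torsion_slope w ^ 3 - 2 * torsion_sum w)"
    by (intro lattice_modular_diff) simp_all
  then show ?thesis by (simp add: torsion_form_def[abs_def])
qed

text \<open>Dividing the discriminant by 216 G^3 shows that \<open>torsion_form\<close> vanishes at
  infinity, so d = 4 S^3 for the limits d of the sum and S of the slope. The limits of g_2 and g_3
  then give S^4 and S^6, hence S^2 = \<pi>^2/3, and d > 0 selects the sign.\<close>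

lemma torsion_limits_infinity:
  "((\<lambda>\<tau>. torsion_slope (1, \<tau>)) \<longlongrightarrow> of_real (pi / sqrt 3)) at_i_inf"
  "((\<lambda>\<tau>. torsion_sum (1, \<tau>)) \<longlongrightarrow> 4 * of_real (pi / sqrt 3) ^ 3) at_i_inf"
  "\<exists>a. a \<noteq> 0 \<and> ((\<lambda>\<tau>. torsion_form (1, \<tau>) / exp (2 * of_real pi * \<i> * \<tau>)) \<longlongrightarrow> a) at_i_inf"
proof -
  obtain S where S: "((\<lambda>\<tau>. torsion_slope (1, \<tau>)) \<longlongrightarrow> S) at_i_inf"
    using lattice_modular_limits[OF _ lattice_modular_torsion_slope] by (metis insertCI)
  obtain d :: real where d: "d > 0" "((\<lambda>\<tau>. torsion_sum (1, \<tau>)) \<longlongrightarrow> of_real d) at_i_inf"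
    using lattice_sum_3_limit by (auto simp: torsion_sum_def)
  have "((\<lambda>\<tau>. discriminant (1, \<tau>) / exp (2 * of_real pi * \<i> * \<tau>) / (216 * torsion_sum (1, \<tau>) ^ 3)) \<longlongrightarrow>
      4096 * of_real pi ^ 12 / (216 * of_real d ^ 3)) at_i_inf"
    using d(1) by (intro tendsto_intros discriminant_limit d(2)) auto
  then have f: "((\<lambda>\<tau>. torsion_form (1, \<tau>) / exp (2 * of_real pi * \<i> * \<tau>)) \<longlongrightarrow>
      4096 * of_real pi ^ 12 / (216 * of_real d ^ 3)) at_i_inf"
    by (rule Lim_transform_eventually)
       (use eventually_upper_half_plane in \<open>eventually_elim, simp add: torsion_relations torsion_form_def\<close>)
  moreover have a: "4096 * of_real pi ^ 12 / (216 * of_real d ^ 3) \<noteq> (0 :: complex)" using d(1) by simp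
  ultimately show "\<exists>a. a \<noteq> 0 \<and> ((\<lambda>\<tau>. torsion_form (1, \<tau>) / exp (2 * of_real pi * \<i> * \<tau>)) \<longlongrightarrow> a) at_i_inf" by blast
  have "((\<lambda>\<tau>. torsion_form (1, \<tau>)) \<longlongrightarrow> 8 * S ^ 3 - 2 * of_real d) at_i_inf"
    unfolding torsion_form_def by (intro tendsto_intros S d(2))
  from tendsto_unique[OF at_i_inf_neq_bot this simple_zero_at_i_inf(1)[OF f a]]
  have dS: "of_real d = 4 * S ^ 3" by simp
  have "((\<lambda>\<tau>. 108 * torsion_slope (1, \<tau>) ^ 4 - 24 * torsion_slope (1, \<tau>) * torsion_sum (1, \<tau>)) \<longlongrightarrow> 108 * S ^ 4 - 24 * S * of_real d) at_i_inf"
    by (intro tendsto_intros S d(2))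
  then have "((\<lambda>\<tau>. 60 * lattice_sum 4 (1, \<tau>) 0) \<longlongrightarrow> 108 * S ^ 4 - 24 * S * of_real d) at_i_inf"
    by (rule Lim_transform_eventually) (use eventually_upper_half_plane in \<open>eventually_elim, simp add: torsion_relations(2)\<close>)
  from tendsto_unique[OF at_i_inf_neq_bot this half_value_limits(3)]
  have S4: "S ^ 4 = of_real pi ^ 4 / 9" unfolding dS by (simp add: eval_nat_numeral field_simps)
  have "((\<lambda>\<tau>. - 216 * torsion_slope (1, \<tau>) ^ 6 + 72 * torsion_slope (1, \<tau>) ^ 3 * torsion_sum (1, \<tau>) - 4 * torsion_sum (1, \<tau>) ^ 2) \<longlongrightarrow>
      - 216 * S ^ 6 + 72 * S ^ 3 * of_real d - 4 * of_real d ^ 2) at_i_inf"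
    by (intro tendsto_intros S d(2))
  then have "((\<lambda>\<tau>. 140 * lattice_sum 6 (1, \<tau>) 0) \<longlongrightarrow> - 216 * S ^ 6 + 72 * S ^ 3 * of_real d - 4 * of_real d ^ 2) at_i_inf"
    by (rule Lim_transform_eventually) (use eventually_upper_half_plane in \<open>eventually_elim, simp add: torsion_relations(3)\<close>)
  from tendsto_unique[OF at_i_inf_neq_bot this half_value_limits(4)]
  have S6: "S ^ 6 = of_real pi ^ 6 / 27" unfolding dS by (simp add: eval_nat_numeral field_simps)
  have "S ^ 2 = S ^ 6 / S ^ 4" using S4 by (auto simp: eval_nat_numeral)
  then have S2: "S ^ 2 = of_real pi ^ 2 / 3" unfolding S4 S6 by (simp add: eval_nat_numeral)
  also have "\<dots> = of_real (pi / sqrt 3) ^ 2" by (simp add: power_divide flip: of_real_power)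
  finally have "S = of_real (pi / sqrt 3) \<or> S = - of_real (pi / sqrt 3)" by (simp only: power2_eq_iff)
  moreover have False if "S = - of_real (pi / sqrt 3)"
  proof -
    have "of_real d = (of_real (- 4 * (pi / sqrt 3) ^ 3) :: complex)" unfolding dS that by simp
    then have "d = - 4 * (pi / sqrt 3) ^ 3" by (simp only: of_real_eq_iff)
    moreover have "(pi / sqrt 3) ^ 3 > 0" by simp
    ultimately show False using d(1) by linarith
  qed
  ultimately have S1: "S = of_real (pi / sqrt 3)" by blast
  show "((\<lambda>\<tau>. torsion_slope (1, \<tau>)) \<longlongrightarrow> of_real (pi / sqrt 3)) at_i_inf" using S unfolding S1 .
  show "((\<lambda>\<tau>. torsion_sum (1, \<tau>)) \<longlongrightarrow> 4 * of_real (pi / sqrt 3) ^ 3) at_i_inf" using d(2) unfolding dS S1 .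
qed

text \<open>The invariants only determine the limit of \<open>torsion_slope\<close> at the cusp \<open>0\<close> up to sign. The
  sign follows from the positivity of \<open>torsion_slope\<close> on the imaginary axis, where the lattice is
  stable under conjugation.\<close>

context
  fixes t :: real
  assumes t: "t > 0"
begin

lemma cnj_lattice: "bij_betw cnj (period_lattice (1, \<i> * of_real t) - {0}) (period_lattice (1, \<i> * of_real t) - {0})"
proof (rule bij_betwI[of _ _ _ cnj])
  have "cnj z \<in> period_lattice (1, \<i> * of_real t)" if z: "z \<in> period_lattice (1, \<i> * of_real t)" for z
  proof -
    obtain m n where "z = of_int m * 1 + of_int n * (\<i> * of_real t)" using z by (auto simp: period_lattice_def)
    then have "cnj z = of_int m * 1 + of_int (- n) * (\<i> * of_real t)" by simp
    then show ?thesis unfolding period_lattice_def fst_conv snd_conv by blast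
  qed
  then show "cnj \<in> period_lattice (1, \<i> * of_real t) - {0} \<rightarrow> period_lattice (1, \<i> * of_real t) - {0}"
    "cnj \<in> period_lattice (1, \<i> * of_real t) - {0} \<rightarrow> period_lattice (1, \<i> * of_real t) - {0}" by auto
qed auto

lemma weierstrass_functions_cnj:
  "cnj (weierstrass_zeta (1, \<i> * of_real t) z) = weierstrass_zeta (1, \<i> * of_real t) (cnj z)"
  "cnj (weierstrass_p (1, \<i> * of_real t) z) = weierstrass_p (1, \<i> * of_real t) (cnj z)"
proof -
  show "cnj (weierstrass_zeta (1, \<i> * of_real t) z) = weierstrass_zeta (1, \<i> * of_real t) (cnj z)"
    unfolding weierstrass_zeta_def complex_cnj_add
    by (subst infsum_reindex_bij_betw[OF cnj_lattice, symmetric], subst infsum_cnj[symmetric]) simp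
  show "cnj (weierstrass_p (1, \<i> * of_real t) z) = weierstrass_p (1, \<i> * of_real t) (cnj z)"
    unfolding weierstrass_p_def complex_cnj_add
    by (subst infsum_reindex_bij_betw[OF cnj_lattice, symmetric], subst infsum_cnj[symmetric]) simp
qed

text \<open>Stability of the lattice under conjugation makes the slope, e1 and e2 real. A slope 0
  would give g_2 = 0, but g_2 = 3 (e1 + e2)^2 + (e1 - e2)^2 > 0.\<close>

lemma torsion_slope_imaginary_axis:
  "torsion_slope (1, \<i> * of_real t) \<in> \<real>" "torsion_slope (1, \<i> * of_real t) \<noteq> 0"
proof -
  let ?w = "(1, \<i> * of_real t)"
  have w: "?w \<in> oriented_bases" using t by (simp add: upper_half_plane_def)
  show "torsion_slope ?w \<in> \<real>"
    unfolding Reals_cnj_iff by (simp add: torsion_slope_def flex_slope_def weierstrass_functions_cnj)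
  have "half_value_1 ?w \<in> \<real>"
    unfolding Reals_cnj_iff by (simp add: half_value_1_def weierstrass_functions_cnj)
  moreover have "half_value_2 ?w \<in> \<real>"
    using weierstrass_p_minus[of ?w "\<i> * of_real t / 2"]
    unfolding Reals_cnj_iff by (simp add: half_value_2_def weierstrass_functions_cnj)
  ultimately obtain x y where xy: "half_value_1 ?w = of_real x" "half_value_2 ?w = of_real y"
    by (auto elim!: Reals_cases)
  have ne: "x \<noteq> y" using half_values_distinct(1)[OF w] xy by auto
  have 3: "half_value_3 ?w = - of_real x - of_real y"
    using half_value_vieta(1)[OF w] unfolding xy by (simp add: eq_neg_iff_add_eq_0 eq_diff_eq add_ac)
  have "60 * lattice_sum 4 ?w 0 = of_real (4 * (x ^ 2 + x * y + y ^ 2))"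
    unfolding half_value_vieta(2)[OF w] xy 3 by (simp add: algebra_simps power2_eq_square)
  moreover have "4 * (x ^ 2 + x * y + y ^ 2) = 3 * (x + y) ^ 2 + (x - y) ^ 2"
    by (simp add: algebra_simps power2_eq_square)
  moreover have "3 * (x + y) ^ 2 + (x - y) ^ 2 > 0" using ne by (intro add_nonneg_pos) auto
  ultimately have "60 * lattice_sum 4 ?w 0 \<noteq> 0" by (metis less_irrefl of_real_eq_0_iff)
  then show "torsion_slope ?w \<noteq> 0" using torsion_relations(2)[OF w] by auto
qed

end

text \<open>The slope is real on the imaginary axis, has no zero there and a positive limit at
  infinity; the intermediate value theorem excludes any other sign.\<close>

lemma torsion_slope_imaginary_axis_pos:
  assumes t: "t > 0" shows "Re (torsion_slope (1, \<i> * of_real t)) > 0"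
proof (rule ccontr)
  assume neg: "\<not> Re (torsion_slope (1, \<i> * of_real t)) > 0"
  have "((\<lambda>\<tau>. Re (torsion_slope (1, \<tau>))) \<longlongrightarrow> Re (of_real (pi / sqrt 3))) at_i_inf"
    by (intro tendsto_intros torsion_limits_infinity)
  then have "\<forall>\<^sub>F \<tau> in at_i_inf. Re (torsion_slope (1, \<tau>)) > 0" by (rule order_tendstoD) simp
  then obtain T where T: "\<And>\<tau>. Im \<tau> \<ge> T \<Longrightarrow> Re (torsion_slope (1, \<tau>)) > 0"
    unfolding eventually_at_i_inf by blast
  define u where "u = max t T"
  have u: "t \<le> u" "Re (torsion_slope (1, \<i> * of_real u)) > 0" using T[of "\<i> * of_real u"] by (auto simp: u_def)
  have "continuous_on upper_half_plane (\<lambda>\<tau>. torsion_slope (1, \<tau>))"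
    using lattice_modularD(3)[OF lattice_modular_torsion_slope] by (rule holomorphic_on_imp_continuous_on)
  moreover have "continuous_on {t..u} (\<lambda>x. \<i> * of_real x)" by (intro continuous_intros)
  moreover have "(\<lambda>x. \<i> * of_real x) ` {t..u} \<subseteq> upper_half_plane" using t by (auto simp: upper_half_plane_def)
  ultimately have "continuous_on {t..u} (\<lambda>x. torsion_slope (1, \<i> * of_real x))"
    by (rule continuous_on_compose2)
  then have "continuous_on {t..u} (\<lambda>x. Re (torsion_slope (1, \<i> * of_real x)))" by (rule continuous_on_Re)
  from IVT'[of "\<lambda>x. Re (torsion_slope (1, \<i> * of_real x))", OF _ _ u(1) this, of 0]
  obtain x where x: "t \<le> x" "Re (torsion_slope (1, \<i> * of_real x)) = 0" using neg u by auto
  have "x > 0" using t x by simp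
  from torsion_slope_imaginary_axis[OF this] x(2) show False by (auto elim!: Reals_cases)
qed

text \<open>Here the sum tends to 0, so g_2 and g_3 give S^4 = \<pi>^4/81 and S^6 = -\<pi>^6/729,
  hence S^2 = -\<pi>^2/9. The sign is read off on the imaginary axis, where by homogeneity the slope
  at (\<i> u, -1) is -\<i>/u times the slope at (1, \<i>/u).\<close>

lemma torsion_limits_zero:
  "((\<lambda>\<tau>. torsion_slope (\<tau>, - 1)) \<longlongrightarrow> - \<i> * of_real pi / 3) at_i_inf"
  "((\<lambda>\<tau>. torsion_sum (\<tau>, - 1)) \<longlongrightarrow> 0) at_i_inf"
proof -
  show G: "((\<lambda>\<tau>. torsion_sum (\<tau>, - 1)) \<longlongrightarrow> 0) at_i_inf"
    using lattice_sum_tau_limit[of 3 3] by (simp add: torsion_sum_def lattice_functions_cong[OF period_lattice_S])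
  obtain S where S: "((\<lambda>\<tau>. torsion_slope (\<tau>, - 1)) \<longlongrightarrow> S) at_i_inf"
    using lattice_modular_limits[OF _ lattice_modular_torsion_slope] by (metis insertCI)
  note cong = lattice_functions_cong[OF period_lattice_S]
  have "((\<lambda>\<tau>. 108 * torsion_slope (\<tau>, - 1) ^ 4 - 24 * torsion_slope (\<tau>, - 1) * torsion_sum (\<tau>, - 1)) \<longlongrightarrow> 108 * S ^ 4 - 24 * S * 0) at_i_inf"
    by (intro tendsto_intros S G)
  then have "((\<lambda>\<tau>. 60 * lattice_sum 4 (1, \<tau>) 0) \<longlongrightarrow> 108 * S ^ 4 - 24 * S * 0) at_i_inf"
    by (rule Lim_transform_eventually)
       (use eventually_upper_half_plane in \<open>eventually_elim, simp add: torsion_relations(2)[symmetric] cong\<close>)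
  from tendsto_unique[OF at_i_inf_neq_bot this half_value_limits(3)]
  have S4: "S ^ 4 = of_real pi ^ 4 / 81" by (simp add: eval_nat_numeral field_simps)
  have "((\<lambda>\<tau>. - 216 * torsion_slope (\<tau>, - 1) ^ 6 + 72 * torsion_slope (\<tau>, - 1) ^ 3 * torsion_sum (\<tau>, - 1) - 4 * torsion_sum (\<tau>, - 1) ^ 2) \<longlongrightarrow>
      - 216 * S ^ 6 + 72 * S ^ 3 * 0 - 4 * 0 ^ 2) at_i_inf"
    by (intro tendsto_intros S G)
  then have "((\<lambda>\<tau>. 140 * lattice_sum 6 (1, \<tau>) 0) \<longlongrightarrow> - 216 * S ^ 6 + 72 * S ^ 3 * 0 - 4 * 0 ^ 2) at_i_inf"
  proof (rule Lim_transform_eventually)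
    show "\<forall>\<^sub>F \<tau> in at_i_inf. - 216 * torsion_slope (\<tau>, - 1) ^ 6 + 72 * torsion_slope (\<tau>, - 1) ^ 3 * torsion_sum (\<tau>, - 1) -
        4 * torsion_sum (\<tau>, - 1) ^ 2 = 140 * lattice_sum 6 (1, \<tau>) 0"
      using eventually_upper_half_plane
    proof eventually_elim
      case (elim \<tau>)
      then have "(\<tau>, - 1) \<in> oriented_bases" by simp
      from torsion_relations(3)[OF this] show ?case unfolding cong by (rule sym)
    qed
  qed
  from tendsto_unique[OF at_i_inf_neq_bot this half_value_limits(4)]
  have S6: "- (S ^ 6) = of_real pi ^ 6 / 729" by (simp add: eval_nat_numeral field_simps)
  have "S ^ 2 = S ^ 6 / S ^ 4" using S4 by (auto simp: eval_nat_numeral)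
  also have "S ^ 6 = - (of_real pi ^ 6 / 729)" using S6 by (metis minus_minus)
  also have "- (of_real pi ^ 6 / 729) / S ^ 4 = - (of_real pi ^ 2 / 9)"
    unfolding S4 by (simp add: eval_nat_numeral)
  also have "\<dots> = (- \<i> * of_real pi / 3) ^ 2" by (simp add: power_divide power_mult_distrib)
  finally have "S = - \<i> * of_real pi / 3 \<or> S = - (- \<i> * of_real pi / 3)" by (simp only: power2_eq_iff)
  moreover have False if "S = - (- \<i> * of_real pi / 3)"
  proof -
    have "((\<lambda>\<tau>. Im (torsion_slope (\<tau>, - 1))) \<longlongrightarrow> Im S) at_i_inf" by (intro tendsto_intros S)
    then have "\<forall>\<^sub>F \<tau> in at_i_inf. Im (torsion_slope (\<tau>, - 1)) > 0" by (rule order_tendstoD) (simp add: that)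
    then obtain T where T: "\<And>\<tau>. Im \<tau> \<ge> T \<Longrightarrow> Im (torsion_slope (\<tau>, - 1)) > 0"
      unfolding eventually_at_i_inf by blast
    define u where "u = max 1 T"
    define y where "y = \<i> * of_real u"
    have u: "u > 0" "Im (torsion_slope (y, - 1)) > 0" using T[of y] by (auto simp: u_def y_def)
    have iu: "- 1 / y = \<i> * of_real (1 / u)" "\<i> * of_real (1 / u) \<in> upper_half_plane"
      using u(1) by (simp_all add: y_def upper_half_plane_def field_simps)
    have "torsion_slope (y, - 1) = at_zero 1 (dehomogenize torsion_slope) y"
      using u(1) by (intro lattice_modular_at_zero[OF lattice_modular_torsion_slope, symmetric])
        (simp add: y_def upper_half_plane_def)
    also have "\<dots> = 1 / y * torsion_slope (1, \<i> * of_real (1 / u))"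
      unfolding at_zero_def dehomogenize_def iu(1) using iu(2) by (simp add: power_int_minus divide_inverse)
    also have "1 / y = - (- 1 / y)" by simp
    also have "\<dots> = - \<i> / of_real u" unfolding iu(1) by simp
    finally have "Im (torsion_slope (y, - 1)) = - Re (torsion_slope (1, \<i> * of_real (1 / u))) / u"
      by (simp add: Im_divide_of_real)
    moreover have "Re (torsion_slope (1, \<i> * of_real (1 / u))) > 0"
      by (rule torsion_slope_imaginary_axis_pos) (use u in simp)
    ultimately show False using u by (simp add: divide_less_0_iff)
  qed
  ultimately show "((\<lambda>\<tau>. torsion_slope (\<tau>, - 1)) \<longlongrightarrow> - \<i> * of_real pi / 3) at_i_inf" using S by blast
qed

lemma cusp_divisor_3: "cusp_divisor 3 3 (dehomogenize torsion_form)"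
proof -
  obtain a where a: "a \<noteq> 0" "((\<lambda>\<tau>. torsion_form (1, \<tau>) / exp (2 * of_real pi * \<i> * \<tau>)) \<longlongrightarrow> a) at_i_inf"
    using torsion_limits_infinity(3) by blast
  have "((\<lambda>\<tau>. torsion_form (\<tau>, - 1)) \<longlongrightarrow> 8 * (- \<i> * of_real pi / 3) ^ 3 - 2 * 0) at_i_inf"
    unfolding torsion_form_def by (intro tendsto_intros torsion_limits_zero)
  then show ?thesis
  proof (intro cusp_divisor_dehomogenize[OF _ _ _ _ a(2,1)] disjI2 conjI)
    show "torsion_form w \<noteq> 0" if "w \<in> oriented_bases" for w
      using torsion_relations(4)[OF that] discriminant_nonzero[OF that] by (auto simp: torsion_form_def)
  qed (use lattice_modular_torsion_form in auto)
qed

subsection \<open>Forms determined by their values at the cusps\<close>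

text \<open>Two candidates differ by a form that vanishes at infinity, hence by \<open>D\<close>
  times a form of weight k - m. A negative weight makes it vanish, and for k = m the value at the
  cusp 0 excludes a multiple of \<open>D\<close>.\<close>

lemma the_modular_form:
  assumes N: "N \<in> {1, 2, 3}" and D: "cusp_divisor N m D" and F: "lattice_modular N k F"
    and a: "((\<lambda>\<tau>. F (1, \<tau>)) \<longlongrightarrow> a) at_i_inf"
  shows "k < int m \<Longrightarrow> (THE f. f \<in> modular_forms N k \<and> value_at_infinity f a) = dehomogenize F"
    and "k \<le> int m \<Longrightarrow> N \<noteq> 1 \<Longrightarrow> ((\<lambda>\<tau>. F (\<tau>, - 1)) \<longlongrightarrow> b) at_i_inf \<Longrightarrow>
      (THE f. f \<in> modular_forms N k \<and> value_at_infinity f a \<and> value_at_zero k f b) = dehomogenize F"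
proof -
  note mf = lattice_modular_form[OF N F]
  note inf = dehomogenize_tendsto[OF a]
  have eq: "f = dehomogenize F"
    if f: "f \<in> modular_forms N k" "(f \<longlongrightarrow> a) at_i_inf"
      and *: "k < int m \<or> k = int m \<and> N \<noteq> 1 \<and> ((\<lambda>\<tau>. at_zero k f \<tau> - at_zero k (dehomogenize F) \<tau>) \<longlongrightarrow> 0) at_i_inf" for f
  proof
    fix \<tau>
    have "((\<lambda>\<tau>. f \<tau> - dehomogenize F \<tau>) \<longlongrightarrow> a - a) at_i_inf" by (intro tendsto_intros f inf)
    moreover have "at_zero k (\<lambda>\<tau>. f \<tau> - dehomogenize F \<tau>) = (\<lambda>\<tau>. at_zero k f \<tau> - at_zero k (dehomogenize F) \<tau>)"
      by (simp add: at_zero_def fun_eq_iff right_diff_distrib)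
    ultimately have "f \<tau> - dehomogenize F \<tau> = 0"
      using * by (intro modular_form_unique[OF N D modular_forms_diff[OF N f(1) mf]]) simp_all
    then show "f \<tau> = dehomogenize F \<tau>" by simp
  qed
  show "(THE f. f \<in> modular_forms N k \<and> value_at_infinity f a) = dehomogenize F" if "k < int m"
  proof (rule the_equality)
    show "dehomogenize F \<in> modular_forms N k \<and> value_at_infinity (dehomogenize F) a"
      using mf inf by (simp add: value_at_infinity_def)
    fix f assume "f \<in> modular_forms N k \<and> value_at_infinity f a"
    then have "f \<in> modular_forms N k" "(f \<longlongrightarrow> a) at_i_inf" by (simp_all add: value_at_infinity_def)
    from eq[OF this disjI1[OF that]] show "f = dehomogenize F" .
  qed
  show "(THE f. f \<in> modular_forms N k \<and> value_at_infinity f a \<and> value_at_zero k f b) = dehomogenize F"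
    if k: "k \<le> int m" "N \<noteq> 1" and b: "((\<lambda>\<tau>. F (\<tau>, - 1)) \<longlongrightarrow> b) at_i_inf"
  proof (rule the_equality)
    note zero = at_zero_dehomogenize_tendsto[OF F b]
    then show "dehomogenize F \<in> modular_forms N k \<and> value_at_infinity (dehomogenize F) a \<and> value_at_zero k (dehomogenize F) b"
      using mf inf by (simp add: value_at_infinity_def value_at_zero_def at_zero_def[abs_def])
    fix f assume f: "f \<in> modular_forms N k \<and> value_at_infinity f a \<and> value_at_zero k f b"
    then have "(at_zero k f \<longlongrightarrow> b) at_i_inf" by (simp add: value_at_zero_def at_zero_def[abs_def])
    from tendsto_diff[OF this zero] k
    have "k < int m \<or> k = int m \<and> N \<noteq> 1 \<and> ((\<lambda>\<tau>. at_zero k f \<tau> - at_zero k (dehomogenize F) \<tau>) \<longlongrightarrow> 0) at_i_inf"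
      by (cases "k = int m") simp_all
    moreover have "f \<in> modular_forms N k" "(f \<longlongrightarrow> a) at_i_inf" using f by (simp_all add: value_at_infinity_def)
    ultimately show "f = dehomogenize F" by (intro eq)
  qed
qed

text \<open>The scalars are the reciprocals of the limits at infinity: 4 \<pi>^4/3, 8 \<pi>^6/27, 2
  \<pi>^2/3, \<pi>/sqrt 3 and, for the last form, 2 S^3 - 4 S^3 = -2 \<pi>^3/(3 sqrt 3). The fourth
  form vanishes at infinity and is normalised at 0, where \<open>half_form\<close> tends to \<pi>^4
  and the value 1/256 is prescribed.\<close>

lemma lattice_modular_cusp_forms:
  "lattice_modular 1 4 (\<lambda>w. 3 / (4 * of_real pi ^ 4) * (60 * lattice_sum 4 w 0))"
  "lattice_modular 1 6 (\<lambda>w. 27 / (8 * of_real pi ^ 6) * (140 * lattice_sum 6 w 0))"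
  "lattice_modular 2 2 (\<lambda>w. 3 / (2 * of_real pi ^ 2) * half_value_1 w)"
  "lattice_modular 2 4 (\<lambda>w. 1 / (256 * of_real pi ^ 4) * half_form w)"
  "lattice_modular 3 1 (\<lambda>w. of_real (sqrt 3 / pi) * torsion_slope w)"
  "lattice_modular 3 3 (\<lambda>w. of_real (- (3 * sqrt 3) / (2 * pi ^ 3)) * (2 * torsion_slope w ^ 3 - torsion_sum w))"
  using lattice_modular_sum_0[of 1 4] lattice_modular_sum_0[of 1 6] lattice_modular_power[OF lattice_modular_torsion_slope, of 3]
  by (intro lattice_modular_cmult lattice_modular_diff lattice_modular_half_value lattice_modular_half_form
    lattice_modular_torsion_slope lattice_modular_torsion_sum; simp)+

lemma cusp_forms_eq:
  "e4 = dehomogenize (\<lambda>w. 3 / (4 * of_real pi ^ 4) * (60 * lattice_sum 4 w 0))"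
  "e6 = dehomogenize (\<lambda>w. 27 / (8 * of_real pi ^ 6) * (140 * lattice_sum 6 w 0))"
  "alpha2 = dehomogenize (\<lambda>w. 3 / (2 * of_real pi ^ 2) * half_value_1 w)"
  "beta4 = dehomogenize (\<lambda>w. 1 / (256 * of_real pi ^ 4) * half_form w)"
  "alpha1 = dehomogenize (\<lambda>w. of_real (sqrt 3 / pi) * torsion_slope w)"
  "beta3 = dehomogenize (\<lambda>w. of_real (- (3 * sqrt 3) / (2 * pi ^ 3)) * (2 * torsion_slope w ^ 3 - torsion_sum w))"
proof -
  note forms = lattice_modular_cusp_forms
  have "((\<lambda>\<tau>. 3 / (4 * of_real pi ^ 4) * (60 * lattice_sum 4 (1, \<tau>) 0)) \<longlongrightarrow> 3 / (4 * of_real pi ^ 4) * (4 * of_real pi ^ 4 / 3)) at_i_inf"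
    by (intro tendsto_intros half_value_limits)
  then show "e4 = dehomogenize (\<lambda>w. 3 / (4 * of_real pi ^ 4) * (60 * lattice_sum 4 w 0))"
    unfolding e4_def by (intro the_modular_form(1)[OF _ cusp_divisor_1 forms(1)]) simp_all
  have "((\<lambda>\<tau>. 27 / (8 * of_real pi ^ 6) * (140 * lattice_sum 6 (1, \<tau>) 0)) \<longlongrightarrow> 27 / (8 * of_real pi ^ 6) * (8 * of_real pi ^ 6 / 27)) at_i_inf"
    by (intro tendsto_intros half_value_limits)
  then show "e6 = dehomogenize (\<lambda>w. 27 / (8 * of_real pi ^ 6) * (140 * lattice_sum 6 w 0))"
    unfolding e6_def by (intro the_modular_form(1)[OF _ cusp_divisor_1 forms(2)]) simp_all
  have "((\<lambda>\<tau>. 3 / (2 * of_real pi ^ 2) * half_value_1 (1, \<tau>)) \<longlongrightarrow> 3 / (2 * of_real pi ^ 2) * (2 * of_real pi ^ 2 / 3)) at_i_inf"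
    "((\<lambda>\<tau>. 3 / (2 * of_real pi ^ 2) * half_value_1 (\<tau>, - 1)) \<longlongrightarrow> 3 / (2 * of_real pi ^ 2) * (- (of_real pi ^ 2 / 3))) at_i_inf"
    unfolding half_value_S by (intro tendsto_intros half_value_1_limit half_value_limits)+
  then show "alpha2 = dehomogenize (\<lambda>w. 3 / (2 * of_real pi ^ 2) * half_value_1 w)"
    unfolding alpha2_def by (intro the_modular_form(2)[OF _ cusp_divisor_2 forms(3)]) simp_all
  have h0: "((\<lambda>\<tau>. half_form (1, \<tau>)) \<longlongrightarrow> 0) at_i_inf"
    by (rule simple_zero_at_i_inf[OF half_form_limits(1)]) simp
  have "((\<lambda>\<tau>. 1 / (256 * of_real pi ^ 4) * half_form (1, \<tau>)) \<longlongrightarrow> 1 / (256 * of_real pi ^ 4) * 0) at_i_inf"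
    "((\<lambda>\<tau>. 1 / (256 * of_real pi ^ 4) * half_form (\<tau>, - 1)) \<longlongrightarrow> 1 / (256 * of_real pi ^ 4) * of_real pi ^ 4) at_i_inf"
    by (intro tendsto_intros h0 half_form_limits)+
  then show "beta4 = dehomogenize (\<lambda>w. 1 / (256 * of_real pi ^ 4) * half_form w)"
    unfolding beta4_def by (intro the_modular_form(2)[OF _ cusp_divisor_2 forms(4)]) simp_all
  have sq: "of_real (sqrt 3) * of_real (sqrt 3) = (3 :: complex)" by (simp flip: of_real_mult)
  have "((\<lambda>\<tau>. of_real (sqrt 3 / pi) * torsion_slope (1, \<tau>)) \<longlongrightarrow> of_real (sqrt 3 / pi) * of_real (pi / sqrt 3)) at_i_inf"
    "((\<lambda>\<tau>. of_real (sqrt 3 / pi) * torsion_slope (\<tau>, - 1)) \<longlongrightarrow> of_real (sqrt 3 / pi) * (- \<i> * of_real pi / 3)) at_i_inf"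
    by (intro tendsto_intros torsion_limits_infinity torsion_limits_zero)+
  moreover have "of_real (sqrt 3 / pi) * (- \<i> * of_real pi / 3) = - \<i> / of_real (sqrt 3)"
    using sq by (simp add: field_simps)
  ultimately show "alpha1 = dehomogenize (\<lambda>w. of_real (sqrt 3 / pi) * torsion_slope w)"
    unfolding alpha1_def by (intro the_modular_form(2)[OF _ cusp_divisor_3 forms(5)]) simp_all
  let ?c = "of_real (- (3 * sqrt 3) / (2 * pi ^ 3)) :: complex"
  have "((\<lambda>\<tau>. ?c * (2 * torsion_slope (1, \<tau>) ^ 3 - torsion_sum (1, \<tau>))) \<longlongrightarrow>
      ?c * (2 * of_real (pi / sqrt 3) ^ 3 - 4 * of_real (pi / sqrt 3) ^ 3)) at_i_inf"
    by (intro tendsto_intros torsion_limits_infinity)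
  moreover have "?c * (2 * of_real (pi / sqrt 3) ^ 3 - 4 * of_real (pi / sqrt 3) ^ 3) = 1"
    using sq by (simp add: power3_eq_cube field_simps)
  moreover have "((\<lambda>\<tau>. ?c * (2 * torsion_slope (\<tau>, - 1) ^ 3 - torsion_sum (\<tau>, - 1))) \<longlongrightarrow>
      ?c * (2 * (- \<i> * of_real pi / 3) ^ 3 - 0)) at_i_inf"
    by (intro tendsto_intros torsion_limits_zero)
  moreover have "?c * (2 * (- \<i> * of_real pi / 3) ^ 3 - 0) = - \<i> / (3 * of_real (sqrt 3))"
    using sq by (simp add: power3_eq_cube field_simps)
  ultimately show "beta3 = dehomogenize (\<lambda>w. ?c * (2 * torsion_slope w ^ 3 - torsion_sum w))"
    unfolding beta3_def by (intro the_modular_form(2)[OF _ cusp_divisor_3 forms(6)]) simp_all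
qed

subsection \<open>Generators\<close>

lemma on_oriented_bases_algebra:
  shows on_oriented_bases_const: "on_oriented_bases (\<lambda>_. c) \<in> generated_algebra S"
    and on_oriented_bases_add: "on_oriented_bases F \<in> generated_algebra S \<Longrightarrow> on_oriented_bases G \<in> generated_algebra S \<Longrightarrow>
      on_oriented_bases (\<lambda>w. F w + G w) \<in> generated_algebra S"
    and on_oriented_bases_mult: "on_oriented_bases F \<in> generated_algebra S \<Longrightarrow> on_oriented_bases G \<in> generated_algebra S \<Longrightarrow>
      on_oriented_bases (\<lambda>w. F w * G w) \<in> generated_algebra S"
proof -
  show "on_oriented_bases (\<lambda>_. c) \<in> generated_algebra S" by (rule generated_algebra.const)
  have "on_oriented_bases (\<lambda>w. F w + G w) = (\<lambda>w. on_oriented_bases F w + on_oriented_bases G w)"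
    "on_oriented_bases (\<lambda>w. F w * G w) = (\<lambda>w. on_oriented_bases F w * on_oriented_bases G w)"
    by (auto simp: on_oriented_bases_def)
  then show "on_oriented_bases F \<in> generated_algebra S \<Longrightarrow> on_oriented_bases G \<in> generated_algebra S \<Longrightarrow>
      on_oriented_bases (\<lambda>w. F w + G w) \<in> generated_algebra S"
    "on_oriented_bases F \<in> generated_algebra S \<Longrightarrow> on_oriented_bases G \<in> generated_algebra S \<Longrightarrow>
      on_oriented_bases (\<lambda>w. F w * G w) \<in> generated_algebra S"
    by (simp_all add: generated_algebra.add generated_algebra.mult)
qed

lemma on_oriented_bases_cmult:
  "on_oriented_bases F \<in> generated_algebra S \<Longrightarrow> on_oriented_bases (\<lambda>w. c * F w) \<in> generated_algebra S"
  using on_oriented_bases_mult[OF on_oriented_bases_const] .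

lemma on_oriented_bases_diff:
  "on_oriented_bases F \<in> generated_algebra S \<Longrightarrow> on_oriented_bases G \<in> generated_algebra S \<Longrightarrow>
    on_oriented_bases (\<lambda>w. F w - G w) \<in> generated_algebra S"
  using on_oriented_bases_add[of F S "\<lambda>w. - 1 * G w"] on_oriented_bases_cmult[of G S "- 1"] by simp

lemma on_oriented_bases_power:
  "on_oriented_bases F \<in> generated_algebra S \<Longrightarrow> on_oriented_bases (\<lambda>w. F w ^ n) \<in> generated_algebra S"
  by (induction n) (auto intro: on_oriented_bases_const on_oriented_bases_mult)

lemma on_oriented_bases_cong:
  "(\<And>w. w \<in> oriented_bases \<Longrightarrow> F w = G w) \<Longrightarrow> on_oriented_bases F = on_oriented_bases G"
  by (auto simp: on_oriented_bases_def)

lemma modular_forms_generated: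
  assumes N: "N \<in> {1, 2, 3}" and m: "cusp_divisor N m (dehomogenize D)" and D: "lattice_modular N (int m) D"
    and DS: "on_oriented_bases D \<in> generated_algebra S"
    and E: "\<And>k. (\<forall>f\<in>modular_forms N (int k). \<forall>\<tau>. f \<tau> = 0) \<or>
      (\<exists>F e. lattice_modular N (int k) F \<and> on_oriented_bases F \<in> generated_algebra S \<and>
        ((\<lambda>\<tau>. F (1, \<tau>)) \<longlongrightarrow> e) at_i_inf \<and> e \<noteq> 0)"
  shows "f \<in> modular_forms N k \<Longrightarrow> on_oriented_bases (homogenize k f) \<in> generated_algebra S"
proof (induction "nat k" arbitrary: k f rule: less_induct)
  case less
  have zero: "on_oriented_bases (homogenize k f) \<in> generated_algebra S" if "\<And>\<tau>. f \<tau> = 0"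
    using on_oriented_bases_const[of 0 S] that by (simp add: homogenize_def[abs_def])
  show ?case
  proof (cases "k < 0")
    case True
    then show ?thesis using zero modular_forms_negative_weight[OF N m less.prems] by blast
  next
    case False
    define n where "n = nat k"
    have k: "k = int n" using False by (simp add: n_def)
    from E[of n] show ?thesis
    proof (elim disjE exE conjE)
      assume "\<forall>f\<in>modular_forms N (int n). \<forall>\<tau>. f \<tau> = 0"
      then show ?thesis using zero less.prems k by blast
    next
      fix F e assume F: "lattice_modular N (int n) F" and FS: "on_oriented_bases F \<in> generated_algebra S"
        and e: "((\<lambda>\<tau>. F (1, \<tau>)) \<longlongrightarrow> e) at_i_inf" "e \<noteq> 0"
      obtain c g where g: "g \<in> modular_forms N (k - int m)" "\<And>\<tau>. f \<tau> = c * dehomogenize F \<tau> + dehomogenize D \<tau> * g \<tau>"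
        using modular_form_decompose[OF N m less.prems lattice_modular_form[OF N F, folded k] dehomogenize_tendsto[OF e(1)] e(2)] by blast
      have m0: "m > 0" using m by (simp add: cusp_divisor_def)
      have gS: "on_oriented_bases (homogenize (k - int m) g) \<in> generated_algebra S"
      \<comment> \<open>For k = 0 the measure cannot drop, because \<open>nat\<close> sends negative
        weights to 0 as well; there the cofactor vanishes by its negative weight.\<close>
      proof (cases "k = 0")
        case True
        then have "g \<tau> = 0" for \<tau> using modular_forms_negative_weight[OF N m g(1)] m0 by simp
        then show ?thesis using on_oriented_bases_const[of 0 S] by (simp add: homogenize_def[abs_def])
      next
        case False
        then have "nat (k - int m) < nat k" using m0 k by simp
        from less.hyps[OF this g(1)] show ?thesis .
      qed
      have eq: "homogenize k f w = c * F w + D w * homogenize (k - int m) g w" if w: "w \<in> oriented_bases" for w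
      proof -
        have "f = (\<lambda>\<tau>. c * dehomogenize F \<tau> + dehomogenize D \<tau> * g \<tau>)" using g(2) by blast
        then have "homogenize k f w = homogenize k (\<lambda>\<tau>. c * dehomogenize F \<tau>) w + homogenize (int m + (k - int m)) (\<lambda>\<tau>. dehomogenize D \<tau> * g \<tau>) w"
          by (simp add: homogenize_add)
        also have "homogenize k (\<lambda>\<tau>. c * dehomogenize F \<tau>) w = c * homogenize (int n) (dehomogenize F) w"
          by (simp add: homogenize_def k)
        finally show ?thesis
          by (simp only: homogenize_mult[OF oriented_basis_fst[OF w]] lattice_modular_homogenize[OF F w] lattice_modular_homogenize[OF D w])
      qed
      have "on_oriented_bases (\<lambda>w. c * F w + D w * homogenize (k - int m) g w) \<in> generated_algebra S"
        by (intro on_oriented_bases_add on_oriented_bases_mult on_oriented_bases_cmult FS DS gS)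
      then show ?thesis using on_oriented_bases_cong[OF eq] by simp
    qed
  qed
qed

text \<open>For N \<le> 2 the matrix -1 belongs to \<open>Gamma1 N\<close> and acts by
  (-1)^k.\<close>

lemma modular_forms_odd_weight:
  assumes N: "N \<in> {1, 2}" and f: "f \<in> modular_forms N k" and k: "odd k"
  shows "f \<tau> = 0"
proof (cases "\<tau> \<in> upper_half_plane")
  case True
  have "mat2 (- 1) 0 0 (- 1) \<in> Gamma1 N" using N by (auto simp: mat2_Gamma1 cong_def)
  then have "slash k f (mat2 (- 1) 0 0 (- 1)) \<tau> = f \<tau>" using f True by (simp add: modular_forms_def)
  moreover have "slash k f (mat2 (- 1) 0 0 (- 1)) \<tau> = - f \<tau>"
    using k by (simp add: slash_def power_int_minus_left)
  ultimately show ?thesis by simp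
next
  case False
  then show ?thesis using f by (simp add: modular_forms_def)
qed

text \<open>The inversion fixes \<i> and multiplies the value there by \<i>^(-k).\<close>

lemma modular_forms_1_at_i:
  assumes f: "f \<in> modular_forms 1 k" and k: "\<i> powi (- k) = - 1"
  shows "f \<i> = 0"
proof -
  have "mat2 0 (- 1) 1 0 \<in> Gamma1 1" by (simp add: mat2_Gamma1)
  then have "slash k f (mat2 0 (- 1) 1 0) \<i> = f \<i>" using f by (simp add: modular_forms_def upper_half_plane_def)
  then show ?thesis using k by (simp add: slash_def)
qed

text \<open>Weight 2 is not reached by monomials in G_4 and G_6. The square of \<open>f\<close> has
  weight 4, hence equals c g_2, as the cofactor of the discriminant has weight -8. At \<i> both
  \<open>f\<close> and g_3 vanish, so g_2 does not, the discriminant being nonzero; thus c =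
  0.\<close>

lemma modular_forms_1_weight_2:
  assumes f: "f \<in> modular_forms 1 2"
  shows "f \<tau> = 0"
proof -
  let ?E = "\<lambda>w. 60 * lattice_sum 4 w 0"
  have N: "(1 :: nat) \<in> {1, 2, 3}" by simp
  have E: "lattice_modular 1 4 ?E" and E6: "lattice_modular 1 6 (\<lambda>w. 140 * lattice_sum 6 w 0)"
    using lattice_modular_sum_0[of 1 4] lattice_modular_sum_0[of 1 6] by (auto intro: lattice_modular_cmult)
  have f2: "(\<lambda>\<tau>. f \<tau> ^ 2) \<in> modular_forms 1 4" using modular_forms_power[OF N f, of 2] by simp
  have ne: "4 * of_real pi ^ 4 / 3 \<noteq> (0 :: complex)" by simp
  obtain c g where g: "g \<in> modular_forms 1 (4 - int 12)" "\<And>\<tau>. f \<tau> ^ 2 = c * dehomogenize ?E \<tau> + dehomogenize discriminant \<tau> * g \<tau>"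
    using modular_form_decompose[OF N cusp_divisor_1 f2 lattice_modular_form[OF N E] dehomogenize_tendsto[OF half_value_limits(3)] ne] by blast
  have fE: "f \<tau> ^ 2 = c * dehomogenize ?E \<tau>" for \<tau>
    using modular_forms_negative_weight[OF N cusp_divisor_1 g(1)] g(2) by simp
  have i: "\<i> \<in> upper_half_plane" by (simp add: upper_half_plane_def)
  have "f \<i> = 0" by (rule modular_forms_1_at_i[OF f]) (simp add: power_int_minus)
  moreover have "dehomogenize ?E \<i> \<noteq> 0"
  proof
    assume "dehomogenize ?E \<i> = 0"
    then have "60 * lattice_sum 4 (1, \<i>) 0 = 0" using i by (simp add: dehomogenize_def)
    moreover have "dehomogenize (\<lambda>w. 140 * lattice_sum 6 w 0) \<i> = 0"
      by (rule modular_forms_1_at_i[OF lattice_modular_form[OF N E6]]) (simp add: power_int_minus eval_nat_numeral)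
    then have "140 * lattice_sum 6 (1, \<i>) 0 = 0" using i by (simp add: dehomogenize_def)
    ultimately have "discriminant (1, \<i>) = 0" unfolding discriminant_def by (simp only:) simp
    then show False using discriminant_nonzero[of "(1, \<i>)"] i by simp
  qed
  ultimately have "c = 0" using fE[of \<i>] by simp
  then show ?thesis using fE[of \<tau>] by simp
qed

lemma modular_forms_1_generated:
  assumes "on_oriented_bases (\<lambda>w. lattice_sum 4 w 0) \<in> generated_algebra S" "on_oriented_bases (\<lambda>w. lattice_sum 6 w 0) \<in> generated_algebra S"
  shows "f \<in> modular_forms 1 k \<Longrightarrow> on_oriented_bases (homogenize k f) \<in> generated_algebra S"
proof (rule modular_forms_generated[OF _ cusp_divisor_1])
  let ?E = "\<lambda>w. 60 * lattice_sum 4 w 0" and ?F = "\<lambda>w. 140 * lattice_sum 6 w 0"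
  have gen: "on_oriented_bases ?E \<in> generated_algebra S" "on_oriented_bases ?F \<in> generated_algebra S"
    by (intro on_oriented_bases_cmult assms)+
  have E: "lattice_modular 1 4 ?E" and F: "lattice_modular 1 6 ?F"
    using lattice_modular_sum_0[of 1 4] lattice_modular_sum_0[of 1 6] by (auto intro: lattice_modular_cmult)
  show "on_oriented_bases discriminant \<in> generated_algebra S"
    unfolding discriminant_def[abs_def] by (intro on_oriented_bases_diff on_oriented_bases_cmult on_oriented_bases_power gen)
  fix k :: nat
  have mono: "\<exists>F e. lattice_modular 1 (int k) F \<and> on_oriented_bases F \<in> generated_algebra S \<and>
      ((\<lambda>\<tau>. F (1, \<tau>)) \<longlongrightarrow> e) at_i_inf \<and> e \<noteq> 0" if k: "k = 4 * a + 6 * b" for a b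
  proof (intro exI conjI)
    show "lattice_modular 1 (int k) (\<lambda>w. ?E w ^ a * ?F w ^ b)"
      using lattice_modular_mult[OF lattice_modular_power[OF E, of a] lattice_modular_power[OF F, of b]] k by (simp add: mult.commute)
    show "on_oriented_bases (\<lambda>w. ?E w ^ a * ?F w ^ b) \<in> generated_algebra S"
      by (intro on_oriented_bases_mult on_oriented_bases_power gen)
    show "((\<lambda>\<tau>. ?E (1, \<tau>) ^ a * ?F (1, \<tau>) ^ b) \<longlongrightarrow> (4 * of_real pi ^ 4 / 3) ^ a * (8 * of_real pi ^ 6 / 27) ^ b) at_i_inf"
      by (intro tendsto_intros half_value_limits)
  qed auto
  \<comment> \<open>Even weights other than 2 are 4 a or 4 a + 6.\<close>
  consider "odd k" | "k = 2" | a where "k = 4 * a + 6 * 0" | a where "k = 4 * a + 6 * 1"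
  proof (cases "even k")
    case True
    then obtain j where j: "k = 2 * j" by blast
    show ?thesis
    proof (cases "even j")
      case True
      then obtain a where "j = 2 * a" by blast
      then show ?thesis using j that(3)[of a] by simp
    next
      case False
      then obtain a where a: "j = 2 * a + 1" by (rule oddE)
      show ?thesis
      proof (cases a)
        case (Suc b)
        then show ?thesis using j a that(4)[of b] by simp
      qed (use j a that(2) in simp)
    qed
  qed (use that(1) in blast)
  then show "(\<forall>f\<in>modular_forms 1 (int k). \<forall>\<tau>. f \<tau> = 0) \<or>
      (\<exists>F e. lattice_modular 1 (int k) F \<and> on_oriented_bases F \<in> generated_algebra S \<and>
        ((\<lambda>\<tau>. F (1, \<tau>)) \<longlongrightarrow> e) at_i_inf \<and> e \<noteq> 0)"
  proof cases
    case 1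
    then show ?thesis using modular_forms_odd_weight[of 1 _ "int k"] by auto
  next
    case 2
    then show ?thesis using modular_forms_1_weight_2 by auto
  next
    case 3
    from mono[OF this] show ?thesis by blast
  next
    case 4
    from mono[OF this] show ?thesis by blast
  qed
qed (use lattice_modular_discriminant in auto)

lemma modular_forms_2_generated:
  assumes "on_oriented_bases half_value_1 \<in> generated_algebra S" "on_oriented_bases half_form \<in> generated_algebra S"
  shows "f \<in> modular_forms 2 k \<Longrightarrow> on_oriented_bases (homogenize k f) \<in> generated_algebra S"
proof (rule modular_forms_generated[OF _ cusp_divisor_2 _ assms(2)])
  fix k :: nat
  show "(\<forall>f\<in>modular_forms 2 (int k). \<forall>\<tau>. f \<tau> = 0) \<or>
      (\<exists>F e. lattice_modular 2 (int k) F \<and> on_oriented_bases F \<in> generated_algebra S \<and>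
        ((\<lambda>\<tau>. F (1, \<tau>)) \<longlongrightarrow> e) at_i_inf \<and> e \<noteq> 0)"
  proof (cases "even k")
    case True
    then obtain j where j: "k = 2 * j" by blast
    have "\<exists>F e. lattice_modular 2 (int k) F \<and> on_oriented_bases F \<in> generated_algebra S \<and>
        ((\<lambda>\<tau>. F (1, \<tau>)) \<longlongrightarrow> e) at_i_inf \<and> e \<noteq> 0"
    proof (intro exI conjI)
      show "lattice_modular 2 (int k) (\<lambda>w. half_value_1 w ^ j)"
        using lattice_modular_power[OF lattice_modular_half_value, of j] j by (simp add: mult.commute)
      show "((\<lambda>\<tau>. half_value_1 (1, \<tau>) ^ j) \<longlongrightarrow> (2 * of_real pi ^ 2 / 3) ^ j) at_i_inf"
        by (intro tendsto_intros half_value_1_limit)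
    qed (use assms(1) in \<open>auto intro: on_oriented_bases_power\<close>)
    then show ?thesis by blast
  next
    case False
    then show ?thesis using modular_forms_odd_weight[of 2 _ "int k"] by auto
  qed
qed (use lattice_modular_half_form in auto)

lemma modular_forms_3_generated:
  assumes "on_oriented_bases torsion_slope \<in> generated_algebra S" "on_oriented_bases torsion_form \<in> generated_algebra S"
  shows "f \<in> modular_forms 3 k \<Longrightarrow> on_oriented_bases (homogenize k f) \<in> generated_algebra S"
proof (rule modular_forms_generated[OF _ cusp_divisor_3 _ assms(2)])
  fix k :: nat
  have "\<exists>F e. lattice_modular 3 (int k) F \<and> on_oriented_bases F \<in> generated_algebra S \<and>
      ((\<lambda>\<tau>. F (1, \<tau>)) \<longlongrightarrow> e) at_i_inf \<and> e \<noteq> 0"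
  proof (intro exI conjI)
    show "lattice_modular 3 (int k) (\<lambda>w. torsion_slope w ^ k)"
      using lattice_modular_power[OF lattice_modular_torsion_slope, of k] by simp
    show "((\<lambda>\<tau>. torsion_slope (1, \<tau>) ^ k) \<longlongrightarrow> of_real (pi / sqrt 3) ^ k) at_i_inf"
      by (intro tendsto_intros torsion_limits_infinity)
  qed (use assms(1) in \<open>auto intro: on_oriented_bases_power\<close>)
  then show "(\<forall>f\<in>modular_forms 3 (int k). \<forall>\<tau>. f \<tau> = 0) \<or>
      (\<exists>F e. lattice_modular 3 (int k) F \<and> on_oriented_bases F \<in> generated_algebra S \<and>
        ((\<lambda>\<tau>. F (1, \<tau>)) \<longlongrightarrow> e) at_i_inf \<and> e \<noteq> 0)" by blast
qed (use lattice_modular_torsion_form in auto)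

subsection \<open>Laurent coefficients\<close>

text \<open>One family E_k for \<zeta>, \<wp> and the sums of higher order, with E_k' = -k E_(k+1)
  throughout, so that all Taylor coefficients have the same shape.\<close>

definition eis_func :: "nat \<Rightarrow> complex \<times> complex \<Rightarrow> complex \<Rightarrow> complex" where
  "eis_func k w = (if k = 1 then weierstrass_zeta w else if k = 2 then weierstrass_p w else eis_full k w)"

definition eis_func_reg :: "nat \<Rightarrow> complex \<times> complex \<Rightarrow> complex \<Rightarrow> complex" where
  "eis_func_reg k w = (if k = 1 then zeta_reg w else if k = 2 then wp_reg w else eis_reg k w)"

text \<open>The value at 0 of the regular part. For k \<le> 2 the regularising terms make it 0, and
  the lattice sum would not converge absolutely.\<close>

definition eis_value :: "nat \<Rightarrow> complex \<times> complex \<Rightarrow> complex" where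
  "eis_value k w = (if k \<le> 2 then 0 else lattice_sum k w 0)"

text \<open>The binomial coefficient of -k over n, produced by n-fold differentiation down the tower
  E_k' = -k E_(k+1).\<close>

definition taylor_factor :: "nat \<Rightarrow> nat \<Rightarrow> complex" where
  "taylor_factor k n = (- 1) ^ n * pochhammer (of_nat k) n / fact n"

lemma taylor_factor_simps [simp]:
  "taylor_factor k 0 = 1" "taylor_factor 2 2 = 3" "taylor_factor 2 4 = 5"
  "taylor_factor (Suc 0) (Suc 0) = - 1" "taylor_factor (Suc 0) 2 = 1" "taylor_factor (Suc 0) 3 = - 1"
  by (simp_all add: taylor_factor_def eval_nat_numeral pochhammer_Suc)

lemma eis_func_eq: "k \<ge> 1 \<Longrightarrow> eis_func k w z = 1 / z ^ k + eis_func_reg k w z"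
  by (simp add: eis_func_def eis_func_reg_def weierstrass_zeta_eq weierstrass_p_eq eis_full_def)

lemma eis_func_minus: "k \<ge> 1 \<Longrightarrow> eis_func k w (- z) = (- 1) ^ k * eis_func k w z"
  by (simp add: eis_func_def weierstrass_zeta_minus weierstrass_p_minus eis_full_minus)

lemma eis_func_reg_0: "k \<ge> 1 \<Longrightarrow> eis_func_reg k w 0 = eis_value k w"
  by (auto simp: eis_func_reg_def eis_value_def eis_reg_0)

context
  fixes w :: "complex \<times> complex"
  assumes w: "w \<in> oriented_bases"
begin

lemma eis_func_reg_deriv:
  assumes "k \<ge> 1" "z \<notin> period_lattice w - {0}"
  shows "(eis_func_reg k w has_field_derivative - of_nat k * eis_func_reg (Suc k) w z) (at z)"
proof -
  consider "k = 1" | "k = 2" | "k \<ge> 3" using assms(1) by linarith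
  then show ?thesis
  proof cases
    case 1
    then show ?thesis using zeta_reg_deriv[OF w assms(2)] by (simp add: eis_func_reg_def)
  next
    case 2
    then show ?thesis using wp_reg_deriv(1)[OF w assms(2)] by (simp add: eis_func_reg_def)
  next
    case 3
    then show ?thesis using eis_reg_deriv(1)[OF w assms(2) 3] by (simp add: eis_func_reg_def)
  qed
qed

lemma eis_func_deriv:
  assumes "k \<ge> 1" "z \<notin> period_lattice w"
  shows "(eis_func k w has_field_derivative - of_nat k * eis_func (Suc k) w z) (at z)"
proof -
  consider "k = 1" | "k = 2" | "k \<ge> 3" using assms(1) by linarith
  then show ?thesis
  proof cases
    case 1
    then show ?thesis using weierstrass_zeta_deriv[OF w assms(2)] by (simp add: eis_func_def)
  next
    case 2
    then show ?thesis using weierstrass_p_deriv[OF w assms(2)] by (simp add: eis_func_def)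
  next
    case 3
    then show ?thesis using eis_full_deriv[OF w assms(2) 3] by (simp add: eis_func_def)
  qed
qed

lemma eis_func_period:
  "k \<ge> 2 \<Longrightarrow> z \<notin> period_lattice w \<Longrightarrow> \<mu> \<in> period_lattice w \<Longrightarrow> eis_func k w (z + \<mu>) = eis_func k w z"
  using weierstrass_p_period[OF w, of z \<mu>] eis_full_period[OF w, of z \<mu> k] by (auto simp: eis_func_def)

end

section \<open>Laurent expansions of X and Y at the origin\<close>

definition has_laurent_coeffs :: "(complex \<Rightarrow> complex) \<Rightarrow> (int \<Rightarrow> complex) \<Rightarrow> bool" where
  "has_laurent_coeffs f a \<longleftrightarrow> (\<exists>F. f has_laurent_expansion F \<and> fls_nth F = a)"

lemma has_laurent_coeffsD: "has_laurent_coeffs f a \<Longrightarrow> fls_nth (laurent_expansion f 0) n = a n"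
  unfolding has_laurent_coeffs_def using laurent_expansion_0_eqI by metis

lemma has_laurent_coeffs_add:
  assumes "has_laurent_coeffs f a" "has_laurent_coeffs g b"
  shows "has_laurent_coeffs (\<lambda>z. f z + g z) (\<lambda>n. a n + b n)"
proof -
  obtain F G where "f has_laurent_expansion F" "fls_nth F = a" "g has_laurent_expansion G" "fls_nth G = b"
    using assms by (auto simp: has_laurent_coeffs_def)
  then show ?thesis unfolding has_laurent_coeffs_def
    by (intro exI[of _ "F + G"] conjI has_laurent_expansion_add) auto
qed

lemma has_laurent_coeffs_cmult:
  assumes "has_laurent_coeffs f a"
  shows "has_laurent_coeffs (\<lambda>z. c * f z) (\<lambda>n. c * a n)"
proof -
  obtain F where "f has_laurent_expansion F" "fls_nth F = a"
    using assms by (auto simp: has_laurent_coeffs_def)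
  then show ?thesis unfolding has_laurent_coeffs_def
    by (intro exI[of _ "fls_const c * F"] conjI has_laurent_expansion_cmult_left) auto
qed

lemma has_laurent_coeffs_const: "has_laurent_coeffs (\<lambda>_. c) (\<lambda>n. if n = 0 then c else 0)"
  unfolding has_laurent_coeffs_def by (intro exI[of _ "fls_const c"]) auto

lemma has_laurent_coeffs_inverse_power: "has_laurent_coeffs (\<lambda>z. 1 / z ^ k) (\<lambda>n. if n = - int k then 1 else 0)"
proof -
  have "(\<lambda>z. z powi (- int k)) has_laurent_expansion fls_X_intpow (- int k)" by (rule has_laurent_expansion_fps_X_power_int)
  then show ?thesis unfolding has_laurent_coeffs_def
    by (intro exI[of _ "fls_X_intpow (- int k)"]) (auto simp: power_int_minus divide_inverse fun_eq_iff)
qed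

lemma has_laurent_coeffs_cong:
  assumes "has_laurent_coeffs f a" "\<forall>\<^sub>F z in at 0. f z = g z"
  shows "has_laurent_coeffs g a"
  using assms has_laurent_expansion_cong[OF assms(2) refl] unfolding has_laurent_coeffs_def by blast

text \<open>Differentiation only raises the index and contributes minus the old index as a factor,
  so the Taylor coefficients of \<open>E k\<close> at 0 are multiples of values of the tower
  itself.\<close>

lemma has_laurent_coeffs_tower:
  assumes S: "open S" "0 \<in> S"
    and E: "\<And>k z. k \<ge> 1 \<Longrightarrow> z \<in> S \<Longrightarrow> (E k has_field_derivative - of_nat k * E (Suc k) z) (at z)" and k: "k \<ge> 1"
  shows "has_laurent_coeffs (E k) (\<lambda>n. if n < 0 then 0 else taylor_factor k (nat n) * E (k + nat n) 0)"
proof -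
  define F where "F j z = (- 1) ^ j * pochhammer (of_nat k) j * E (k + j) z" for j z
  have F: "(F j has_field_derivative F (Suc j) z) (at z)" if "z \<in> S" for j z
  proof -
    have "((\<lambda>z. (- 1) ^ j * pochhammer (of_nat k) j * E (k + j) z) has_field_derivative
        (- 1) ^ j * pochhammer (of_nat k) j * (- of_nat (k + j) * E (Suc (k + j)) z)) (at z)"
      using k that by (intro DERIV_cmult E) auto
    moreover have "(- 1) ^ j * pochhammer (of_nat k) j * (- of_nat (k + j) * E (Suc (k + j)) z) = F (Suc j) z"
      by (simp add: F_def pochhammer_Suc algebra_simps)
    ultimately show ?thesis by (simp add: F_def[abs_def])
  qed
  have F0: "F 0 = E k" by (simp add: F_def fun_eq_iff)
  have "E k holomorphic_on S" unfolding holomorphic_on_def field_differentiable_def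
    using E[OF k] has_field_derivative_at_within by blast
  then have "E k analytic_on {0}" using S by (auto simp: analytic_at)
  then have "E k has_laurent_expansion fps_to_fls (fps_expansion (E k) 0)"
    by (intro has_laurent_expansion_fps analytic_at_imp_has_fps_expansion_0)
  moreover have "fps_nth (fps_expansion (E k) 0) j = taylor_factor k j * E (k + j) 0" for j
    using higher_deriv_tower[where F = F and S = S and z = 0 and k = j, OF S(1) F S(2)] by (simp add: fps_expansion_def F0 F_def taylor_factor_def)
  ultimately show ?thesis unfolding has_laurent_coeffs_def
    by (intro exI[of _ "fps_to_fls (fps_expansion (E k) 0)"]) (auto simp: fun_eq_iff)
qed

definition coeff_origin :: "nat \<Rightarrow> complex \<times> complex \<Rightarrow> int \<Rightarrow> complex" where
  "coeff_origin k w n = (if n = - int k then 1 else 0) + (if n < 0 then 0 else taylor_factor k (nat n) * eis_value (k + nat n) w)"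

definition coeff_shift :: "nat \<Rightarrow> complex \<times> complex \<Rightarrow> complex \<Rightarrow> int \<Rightarrow> complex" where
  "coeff_shift k w a n = (if n < 0 then 0 else taylor_factor k (nat n) * eis_func (k + nat n) w (- a))"

lemma has_laurent_coeffs_eis_func:
  assumes w: "w \<in> oriented_bases" and k: "k \<ge> 1"
  shows "has_laurent_coeffs (eis_func k w) (coeff_origin k w)"
    and "a \<notin> period_lattice w \<Longrightarrow> has_laurent_coeffs (\<lambda>z. eis_func k w (z - a)) (coeff_shift k w a)"
proof -
  have "has_laurent_coeffs (eis_func_reg k w) (\<lambda>n. if n < 0 then 0 else taylor_factor k (nat n) * eis_func_reg (k + nat n) w 0)"
    by (rule has_laurent_coeffs_tower[OF open_compl_lattice(2)[OF w], where E = "\<lambda>k. eis_func_reg k w"])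
       (use eis_func_reg_deriv[OF w] k in auto)
  then have "has_laurent_coeffs (\<lambda>z. 1 / z ^ k + eis_func_reg k w z) (coeff_origin k w)"
    unfolding coeff_origin_def[abs_def] using k
    by (intro has_laurent_coeffs_add has_laurent_coeffs_inverse_power) (simp add: eis_func_reg_0 cong: if_cong)
  then show "has_laurent_coeffs (eis_func k w) (coeff_origin k w)" using k by (simp flip: eis_func_eq)
  assume a: "a \<notin> period_lattice w"
  then have "- a \<notin> period_lattice w" using lattice_minus[of "- a" w] by auto
  moreover have "open ((\<lambda>z. z - a) -` (- period_lattice w))"
    by (intro open_vimage open_compl_lattice[OF w] continuous_intros)
  moreover have "((\<lambda>z. eis_func k w (z - a)) has_field_derivative - of_nat k * eis_func (Suc k) w (z - a)) (at z)"
    if "k \<ge> 1" "z \<in> (\<lambda>z. z - a) -` (- period_lattice w)" for k z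
  proof -
    have "((\<lambda>z. z - a) has_field_derivative 1) (at z)" by (auto intro!: derivative_eq_intros)
    moreover have "(eis_func k w has_field_derivative - of_nat k * eis_func (Suc k) w (z - a)) (at (z - a))"
      using eis_func_deriv[OF w that(1), of "z - a"] that(2) by simp
    ultimately have "((\<lambda>z. eis_func k w (z - a)) has_field_derivative - of_nat k * eis_func (Suc k) w (z - a) * 1) (at z)"
      by (intro DERIV_chain2[where g = "\<lambda>z. z - a"])
    then show ?thesis by simp
  qed
  ultimately have "has_laurent_coeffs (\<lambda>z. eis_func k w (z - a)) (\<lambda>n. if n < 0 then 0 else taylor_factor k (nat n) * eis_func (k + nat n) w (0 - a))"
    using k by (intro has_laurent_coeffs_tower[where E = "\<lambda>k z. eis_func k w (z - a)"]) auto
  then show "has_laurent_coeffs (\<lambda>z. eis_func k w (z - a)) (coeff_shift k w a)"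
    unfolding coeff_shift_def[abs_def] diff_0 .
qed

lemma eis_XY_coeffs:
  assumes w: "w \<in> oriented_bases"
  shows "has_laurent_coeffs (eis_X 3 w) (\<lambda>n. 1 / 4 * coeff_origin 2 w n)"
    "has_laurent_coeffs (eis_Y 3 w) (\<lambda>n. - 1 / 4 * coeff_origin 3 w n)"
    "has_laurent_coeffs (eis_X 4 w) (\<lambda>n. (if n = 0 then - 1 / 2 * weierstrass_zeta w (fst w / 2) else 0) +
      1 / 2 * coeff_origin 1 w n + - 1 / 2 * coeff_shift 1 w (fst w / 2) n)"
    "has_laurent_coeffs (eis_Y 4 w) (\<lambda>n. - 1 / 4 * coeff_origin 2 w n + 1 / 4 * coeff_shift 2 w (fst w / 2) n)"
    "has_laurent_coeffs (eis_X 6 w) (\<lambda>n. (if n = 0 then - 1 / 6 * weierstrass_zeta w (fst w / 3) - 1 / 6 * weierstrass_zeta w (2 * fst w / 3) else 0) +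
      1 / 2 * coeff_origin 1 w n + - 1 / 2 * coeff_shift 1 w (fst w / 3) n)"
    "has_laurent_coeffs (eis_Y 6 w) (\<lambda>n. (if n = 0 then 1 / 2 * weierstrass_zeta w (fst w / 3) + 1 / 2 * weierstrass_zeta w (2 * fst w / 3) else 0) +
      - 1 / 2 * coeff_origin 1 w n + - 1 / 2 * coeff_shift 1 w (fst w / 3) n + 1 * coeff_shift 1 w (2 * fst w / 3) n)"
proof -
  have a: "fst w / 2 \<notin> period_lattice w" "fst w / 3 \<notin> period_lattice w" "2 * fst w / 3 \<notin> period_lattice w"
    using torsion_point_notin[OF w, of 2] torsion_point_notin[OF w, of 3] triple_points(2)[OF w, of "fst w / 3"] by simp_all
  note c = has_laurent_coeffs_const has_laurent_coeffs_add has_laurent_coeffs_cmult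
  note E = has_laurent_coeffs_eis_func[OF w]
  have E1: "weierstrass_zeta w = eis_func 1 w" "weierstrass_p w = eis_func 2 w" by (simp_all add: eis_func_def)
  have "has_laurent_coeffs (\<lambda>z. 1 / 4 * eis_func 2 w z) (\<lambda>n. 1 / 4 * coeff_origin 2 w n)"
    by (intro c E) simp
  then show "has_laurent_coeffs (eis_X 3 w) (\<lambda>n. 1 / 4 * coeff_origin 2 w n)"
    by (simp add: eis_X_def[abs_def] Let_def E1)
  have "has_laurent_coeffs (\<lambda>z. - 1 / 4 * eis_func 3 w z) (\<lambda>n. - 1 / 4 * coeff_origin 3 w n)"
    by (intro c E) simp
  \<comment> \<open>Here Y is \<wp>'/8 = -E_3/4. The equation is shown off the lattice, which
    suffices since the coefficients depend only on a punctured neighbourhood of 0.\<close>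
  moreover have "- 1 / 4 * eis_func 3 w z = eis_Y 3 w z" if "z \<notin> period_lattice w" for z
    using DERIV_imp_deriv[OF weierstrass_p_deriv[OF w that]] by (simp add: eis_Y_def eis_func_def)
  moreover have "\<forall>\<^sub>F z in at 0. z \<notin> period_lattice w"
  proof -
    have "\<forall>\<^sub>F z in at 0. z \<in> - (period_lattice w - {0})"
      by (rule eventually_at_in_open'[OF open_compl_lattice(2)[OF w]]) simp
    then show ?thesis using eventually_neq_at_within[of 0 0 UNIV] by eventually_elim auto
  qed
  ultimately show "has_laurent_coeffs (eis_Y 3 w) (\<lambda>n. - 1 / 4 * coeff_origin 3 w n)"
    by (elim has_laurent_coeffs_cong) (auto elim: eventually_mono)
  have "has_laurent_coeffs (\<lambda>z. - 1 / 2 * weierstrass_zeta w (fst w / 2) + 1 / 2 * eis_func 1 w z + - 1 / 2 * eis_func 1 w (z - fst w / 2))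
      (\<lambda>n. (if n = 0 then - 1 / 2 * weierstrass_zeta w (fst w / 2) else 0) + 1 / 2 * coeff_origin 1 w n + - 1 / 2 * coeff_shift 1 w (fst w / 2) n)"
    by (intro c E a) simp_all
  then show "has_laurent_coeffs (eis_X 4 w) (\<lambda>n. (if n = 0 then - 1 / 2 * weierstrass_zeta w (fst w / 2) else 0) +
      1 / 2 * coeff_origin 1 w n + - 1 / 2 * coeff_shift 1 w (fst w / 2) n)"
    by (simp add: eis_X_def[abs_def] Let_def E1)
  have "has_laurent_coeffs (\<lambda>z. - 1 / 4 * eis_func 2 w z + 1 / 4 * eis_func 2 w (z - fst w / 2))
      (\<lambda>n. - 1 / 4 * coeff_origin 2 w n + 1 / 4 * coeff_shift 2 w (fst w / 2) n)"
    by (intro c E a) simp_all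
  then show "has_laurent_coeffs (eis_Y 4 w) (\<lambda>n. - 1 / 4 * coeff_origin 2 w n + 1 / 4 * coeff_shift 2 w (fst w / 2) n)"
    by (simp add: eis_Y_def[abs_def] Let_def E1)
  have "has_laurent_coeffs (\<lambda>z. (- 1 / 6 * weierstrass_zeta w (fst w / 3) - 1 / 6 * weierstrass_zeta w (2 * fst w / 3)) + 1 / 2 * eis_func 1 w z + - 1 / 2 * eis_func 1 w (z - fst w / 3))
      (\<lambda>n. (if n = 0 then - 1 / 6 * weierstrass_zeta w (fst w / 3) - 1 / 6 * weierstrass_zeta w (2 * fst w / 3) else 0) +
      1 / 2 * coeff_origin 1 w n + - 1 / 2 * coeff_shift 1 w (fst w / 3) n)"
    by (intro c E a) simp_all
  then show "has_laurent_coeffs (eis_X 6 w) (\<lambda>n. (if n = 0 then - 1 / 6 * weierstrass_zeta w (fst w / 3) - 1 / 6 * weierstrass_zeta w (2 * fst w / 3) else 0) +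
      1 / 2 * coeff_origin 1 w n + - 1 / 2 * coeff_shift 1 w (fst w / 3) n)"
    by (simp add: eis_X_def[abs_def] Let_def E1)
  have "has_laurent_coeffs (\<lambda>z. (1 / 2 * weierstrass_zeta w (fst w / 3) + 1 / 2 * weierstrass_zeta w (2 * fst w / 3)) +
      - 1 / 2 * eis_func 1 w z + - 1 / 2 * eis_func 1 w (z - fst w / 3) + 1 * eis_func 1 w (z - 2 * fst w / 3))
      (\<lambda>n. (if n = 0 then 1 / 2 * weierstrass_zeta w (fst w / 3) + 1 / 2 * weierstrass_zeta w (2 * fst w / 3) else 0) +
      - 1 / 2 * coeff_origin 1 w n + - 1 / 2 * coeff_shift 1 w (fst w / 3) n + 1 * coeff_shift 1 w (2 * fst w / 3) n)"
    by (intro c E a) simp_all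
  then show "has_laurent_coeffs (eis_Y 6 w) (\<lambda>n. (if n = 0 then 1 / 2 * weierstrass_zeta w (fst w / 3) + 1 / 2 * weierstrass_zeta w (2 * fst w / 3) else 0) +
      - 1 / 2 * coeff_origin 1 w n + - 1 / 2 * coeff_shift 1 w (fst w / 3) n + 1 * coeff_shift 1 w (2 * fst w / 3) n)"
    by (simp add: eis_Y_def[abs_def] Let_def E1)
qed

text \<open>The minus sign comes from expanding E_k(z - \<omega>_0/N) at z = 0.\<close>

definition torsion_value :: "nat \<Rightarrow> nat \<Rightarrow> complex \<times> complex \<Rightarrow> complex" where
  "torsion_value N k w = eis_func k w (- (fst w / of_nat N))"

lemma lattice_modular_zero: "lattice_modular N k (\<lambda>_. 0)"
  using lattice_modular_const[of N 0] by (auto simp: lattice_modular_def)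

lemma lattice_modular_eis_value:
  assumes "N > 0" shows "lattice_modular N (int k) (eis_value k)"
proof (cases "k \<le> 2")
  case True
  then show ?thesis using lattice_modular_zero by (simp add: eis_value_def[abs_def])
next
  case False
  then show ?thesis using lattice_modular_sum_0[OF assms, of k] by (simp add: eis_value_def[abs_def])
qed

lemma torsion_value_eq:
  assumes "w \<in> oriented_bases" "N \<in> {2, 3}"
  shows "torsion_value N 1 w = - weierstrass_zeta w (fst w / of_nat N)"
    "torsion_value N 2 w = weierstrass_p w (fst w / of_nat N)"
    "k \<ge> 3 \<Longrightarrow> torsion_value N k w = (- 1) ^ k * lattice_sum k w (fst w / of_nat N)"
  using lattice_sum_eq_eis_full[OF assms(1) torsion_point_notin[OF assms]]
  by (auto simp: torsion_value_def eis_func_def weierstrass_zeta_minus weierstrass_p_minus eis_full_minus)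

lemma lattice_modular_torsion_value:
  assumes N: "N \<in> {2, 3}" and k: "k \<ge> 2"
  shows "lattice_modular N (int k) (torsion_value N k)"
proof (cases "k = 2")
  case True
  show ?thesis
    by (rule lattice_modular_cong[of N _ "\<lambda>w. weierstrass_p w (fst w / of_nat N)"])
       (use lattice_modular_weierstrass_p[OF N] torsion_value_eq(2)[OF _ N] True in auto)
next
  case False
  then have k3: "k \<ge> 3" using k by simp
  show ?thesis
    by (rule lattice_modular_cong[OF lattice_modular_cmult[OF lattice_modular_sum_torsion[OF N k3], of "(- 1) ^ k"]])
       (simp add: torsion_value_eq(3)[OF _ N k3])
qed

text \<open>Evaluating the quasi-period c of \<omega>_0 at -\<omega>_0/2 and -\<omega>_0/3 gives c =
  2 \<zeta>(\<omega>_0/2) and \<zeta>(2 \<omega>_0/3) = c - \<zeta>(\<omega>_0/3). This identifies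
  \<open>g_s 6\<close> with the slope.\<close>

lemma torsion_slope_eq:
  assumes w: "w \<in> oriented_bases"
  shows "torsion_slope w = (2 * weierstrass_zeta w (fst w / 3) - weierstrass_zeta w (2 * fst w / 3)) / 3"
    and "torsion_slope w = weierstrass_zeta w (fst w / 3) - 2 / 3 * weierstrass_zeta w (fst w / 2)"
proof -
  show 1: "torsion_slope w = (2 * weierstrass_zeta w (fst w / 3) - weierstrass_zeta w (2 * fst w / 3)) / 3"
    by (simp add: torsion_slope_def flex_slope_def)
  have \<mu>: "fst w \<in> period_lattice w" by simp
  obtain c where c: "\<And>z. z \<notin> period_lattice w \<Longrightarrow> weierstrass_zeta w (z + fst w) = weierstrass_zeta w z + c"
    using weierstrass_zeta_period[OF w \<mu>] by blast
  have a: "fst w / 3 \<notin> period_lattice w" "fst w / 2 \<notin> period_lattice w"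
    using torsion_point_notin[OF w, of 2] torsion_point_notin[OF w, of 3] by simp_all
  have "- (fst w / 2) \<notin> period_lattice w" "- (fst w / 3) \<notin> period_lattice w"
    using a lattice_minus[of "- (fst w / 2)" w] lattice_minus[of "- (fst w / 3)" w] by auto
  from this[THEN c] have cz: "c = 2 * weierstrass_zeta w (fst w / 2)"
    "weierstrass_zeta w (2 * fst w / 3) = - weierstrass_zeta w (fst w / 3) + c"
    by (simp_all add: weierstrass_zeta_minus eq_neg_iff_add_eq_0 add_ac)
  show "torsion_slope w = weierstrass_zeta w (fst w / 3) - 2 / 3 * weierstrass_zeta w (fst w / 2)"
    unfolding 1 cz(2) cz(1) by (simp add: field_simps)
qed

text \<open>As -2/3 = 1/3 - 1, the second torsion point in Y contributes the same division values up
  to sign. The case k = 1 is left out because \<zeta> is not periodic.\<close>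

lemma eis_func_minus_two_thirds:
  assumes w: "w \<in> oriented_bases" and k: "k \<ge> 2"
  shows "eis_func k w (- (2 * fst w / 3)) = (- 1) ^ k * torsion_value 3 k w"
proof -
  have a: "fst w / 3 \<notin> period_lattice w" using torsion_point_notin[OF w, of 3] by simp
  have \<mu>: "- fst w \<in> period_lattice w" using lattice_minus[of "fst w" w] by simp
  have "eis_func k w (- (2 * fst w / 3)) = eis_func k w (fst w / 3 + - fst w)" by simp
  also have "\<dots> = eis_func k w (fst w / 3)" by (rule eis_func_period[OF w k a \<mu>])
  also have "\<dots> = (- 1) ^ k * torsion_value 3 k w"
    using eis_func_minus[of k w "fst w / 3"] k by (simp add: torsion_value_def)
  finally show ?thesis .
qed

definition modular_coeff :: "nat \<Rightarrow> (complex \<times> complex \<Rightarrow> complex \<Rightarrow> complex) \<Rightarrow> int \<Rightarrow> bool" where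
  "modular_coeff N f n \<longleftrightarrow> (\<exists>k F. lattice_modular N k F \<and>
     (\<forall>w\<in>oriented_bases. fls_nth (laurent_expansion (f w) 0) n = F w))"

lemma modular_coeffI:
  assumes "lattice_modular N k F" "\<And>w. w \<in> oriented_bases \<Longrightarrow> fls_nth (laurent_expansion (f w) 0) n = F w"
  shows "modular_coeff N f n"
  using assms unfolding modular_coeff_def by blast

text \<open>A coefficient of order n \<ge> 0 combines terms of a single weight, n plus the pole
  order 1, 2 or 3 of the building block; polar coefficients are constants. Only the constant terms
  for \<open>eis_X 4\<close>, \<open>eis_X 6\<close> and \<open>eis_Y 6\<close> involve \<zeta>,
  which is not periodic, and need a separate check.\<close>

lemma eis_XY_nth_modular:
  assumes p: "p \<in> {3, 4, 6}"
  shows "modular_coeff (p div 2) (eis_X p) n \<and> modular_coeff (p div 2) (eis_Y p) n"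
proof -
  note coeff = eis_XY_coeffs[THEN has_laurent_coeffsD]
  have "modular_coeff 1 (eis_X 3) n \<and> modular_coeff 1 (eis_Y 3) n \<and> modular_coeff 2 (eis_X 4) n \<and>
    modular_coeff 2 (eis_Y 4) n \<and> modular_coeff 3 (eis_X 6) n \<and> modular_coeff 3 (eis_Y 6) n"
  proof (cases "n < 0")
    case True
    define u where "u k = (if n = - int k then 1 else 0 :: complex)" for k
    have c: "coeff_origin k w n = u k" "coeff_shift k w a n = 0" for k w a
      using True by (simp_all add: coeff_origin_def coeff_shift_def u_def)
    show ?thesis
    proof (intro conjI)
      show "modular_coeff 1 (eis_X 3) n" by (rule modular_coeffI[OF lattice_modular_const[of _ "1 / 4 * u 2"]]) (simp add: coeff(1) c)
      show "modular_coeff 1 (eis_Y 3) n" by (rule modular_coeffI[OF lattice_modular_const[of _ "- 1 / 4 * u 3"]]) (simp add: coeff(2) c)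
      show "modular_coeff 2 (eis_X 4) n" by (rule modular_coeffI[OF lattice_modular_const[of _ "1 / 2 * u 1"]]) (use True in \<open>simp add: coeff(3) c\<close>)
      show "modular_coeff 2 (eis_Y 4) n" by (rule modular_coeffI[OF lattice_modular_const[of _ "- 1 / 4 * u 2"]]) (simp add: coeff(4) c)
      show "modular_coeff 3 (eis_X 6) n" by (rule modular_coeffI[OF lattice_modular_const[of _ "1 / 2 * u 1"]]) (use True in \<open>simp add: coeff(5) c\<close>)
      show "modular_coeff 3 (eis_Y 6) n" by (rule modular_coeffI[OF lattice_modular_const[of _ "- 1 / 2 * u 1"]]) (use True in \<open>simp add: coeff(6) c\<close>)
    qed
  next
    case False
    define j where "j = nat n"
    have n: "n = int j" using False by (simp add: j_def)
    have origin: "coeff_origin k w (int j) = taylor_factor k j * eis_value (k + j) w" if "k > 0" for k w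
      using that by (simp add: coeff_origin_def)
    have shift: "coeff_shift k w (fst w / 2) (int j) = taylor_factor k j * torsion_value 2 (k + j) w"
      "coeff_shift k w (fst w / 3) (int j) = taylor_factor k j * torsion_value 3 (k + j) w" for k w
      by (simp_all add: coeff_shift_def torsion_value_def)
    have shift': "coeff_shift k w (2 * fst w / 3) (int j) = taylor_factor k j * ((- 1) ^ (k + j) * torsion_value 3 (k + j) w)"
      if "w \<in> oriented_bases" "k + j \<ge> 2" for k w
      using eis_func_minus_two_thirds[OF that] by (simp add: coeff_shift_def)
    note M = lattice_modular_cmult lattice_modular_diff lattice_modular_add lattice_modular_eis_value lattice_modular_torsion_value
    have X3: "modular_coeff 1 (eis_X 3) n"
    proof (rule modular_coeffI)
      show "lattice_modular 1 (int (2 + j)) (\<lambda>w. 1 / 4 * (taylor_factor 2 j * eis_value (2 + j) w))" by (intro M) simp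
    qed (simp add: coeff(1) n origin)
    have Y3: "modular_coeff 1 (eis_Y 3) n"
    proof (rule modular_coeffI)
      show "lattice_modular 1 (int (3 + j)) (\<lambda>w. - 1 / 4 * (taylor_factor 3 j * eis_value (3 + j) w))" by (intro M) simp
    qed (simp add: coeff(2) n origin)
    have Y4: "modular_coeff 2 (eis_Y 4) n"
    proof (rule modular_coeffI)
      show "lattice_modular 2 (int (2 + j)) (\<lambda>w. - 1 / 4 * (taylor_factor 2 j * eis_value (2 + j) w) + 1 / 4 * (taylor_factor 2 j * torsion_value 2 (2 + j) w))"
        by (intro M) simp_all
    qed (simp add: coeff(4) n origin shift)
    have "modular_coeff 2 (eis_X 4) n \<and> modular_coeff 3 (eis_X 6) n \<and> modular_coeff 3 (eis_Y 6) n"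
    proof (cases "j = 0")
      \<comment> \<open>In order 0 the added constants make up for the quasi-periods: the total is 0
        for p = 4, and for p = 6 it is s/2 in X and 3 s/2 in Y, with s the slope (2
        \<zeta>(\<omega>_0/3) - \<zeta>(2 \<omega>_0/3))/3.\<close>
      case True
      have [simp]: "eis_value (Suc 0) w = 0" for w by (simp add: eis_value_def)
      note at_0 = origin[of 1, unfolded True, simplified] shift[of 1, unfolded True, simplified]
      have two: "coeff_shift 1 w (2 * fst w / 3) 0 = - weierstrass_zeta w (2 * fst w / 3)" for w
        by (simp add: coeff_shift_def eis_func_def weierstrass_zeta_minus)
      note zero = at_0[simplified] two[simplified]
      show ?thesis
      proof (intro conjI)
        show "modular_coeff 2 (eis_X 4) n"
          by (rule modular_coeffI[OF lattice_modular_const[of _ 0]])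
            (use torsion_value_eq(1)[of _ 2] in \<open>simp add: coeff(3) n True zero\<close>)
        show "modular_coeff 3 (eis_X 6) n"
          by (rule modular_coeffI[OF lattice_modular_cmult[OF lattice_modular_torsion_slope, of "1 / 2"]])
            (use torsion_value_eq(1)[of _ 3] in \<open>simp add: coeff(5) n True zero torsion_slope_eq(1) field_simps\<close>)
        show "modular_coeff 3 (eis_Y 6) n"
        proof (rule modular_coeffI[OF lattice_modular_cmult[OF lattice_modular_torsion_slope, of "3 / 2"]])
          fix w assume w: "w \<in> oriented_bases"
          have "torsion_value 3 (Suc 0) w = - weierstrass_zeta w (fst w / 3)" using torsion_value_eq(1)[OF w, of 3] by simp
          then show "fls_nth (laurent_expansion (eis_Y 6 w) 0) n = 3 / 2 * torsion_slope w"
            unfolding coeff(6)[OF w] n True torsion_slope_eq(1)[OF w] by (simp add: zero diff_divide_distrib)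
        qed
      qed
    next
      case False
      then have j: "1 + j \<ge> 2" "int j \<noteq> 0" by simp_all
      show ?thesis
      proof (intro conjI)
        show "modular_coeff 2 (eis_X 4) n"
        proof (rule modular_coeffI)
          show "lattice_modular 2 (int (1 + j)) (\<lambda>w. 1 / 2 * (taylor_factor 1 j * eis_value (1 + j) w) + - 1 / 2 * (taylor_factor 1 j * torsion_value 2 (1 + j) w))"
            by (intro M j) simp_all
        qed (use j in \<open>simp add: coeff(3) n origin shift\<close>)
        show "modular_coeff 3 (eis_X 6) n"
        proof (rule modular_coeffI)
          show "lattice_modular 3 (int (1 + j)) (\<lambda>w. 1 / 2 * (taylor_factor 1 j * eis_value (1 + j) w) + - 1 / 2 * (taylor_factor 1 j * torsion_value 3 (1 + j) w))"
            by (intro M j) simp_all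
        qed (use j in \<open>simp add: coeff(5) n origin shift\<close>)
        show "modular_coeff 3 (eis_Y 6) n"
        proof (rule modular_coeffI)
          show "lattice_modular 3 (int (1 + j)) (\<lambda>w. - 1 / 2 * (taylor_factor 1 j * eis_value (1 + j) w) + - 1 / 2 * (taylor_factor 1 j * torsion_value 3 (1 + j) w) +
              taylor_factor 1 j * ((- 1) ^ (1 + j) * torsion_value 3 (1 + j) w))"
            by (intro M j) simp_all
        next
          fix w assume w: "w \<in> oriented_bases"
          show "fls_nth (laurent_expansion (eis_Y 6 w) 0) n = - 1 / 2 * (taylor_factor 1 j * eis_value (1 + j) w) + - 1 / 2 * (taylor_factor 1 j * torsion_value 3 (1 + j) w) +
              taylor_factor 1 j * ((- 1) ^ (1 + j) * torsion_value 3 (1 + j) w)"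
            unfolding coeff(6)[OF w] n shift origin[OF zero_less_one] shift'[OF w j(1)] using j by simp
        qed
      qed
    qed
    with X3 Y3 Y4 show ?thesis by blast
  qed
  with p show ?thesis by auto
qed

subsection \<open>The algebra of Eisenstein series\<close>

lemma generated_algebra_mono:
  assumes "S \<subseteq> generated_algebra T" shows "generated_algebra S \<subseteq> generated_algebra T"
proof
  fix F assume "F \<in> generated_algebra S"
  then show "F \<in> generated_algebra T" by induction (use assms in \<open>auto intro: generated_algebra.intros\<close>)
qed

lemma lattice_sum_4_half: "w \<in> oriented_bases \<Longrightarrow> lattice_sum 4 w (fst w / 2) = half_value_1 w ^ 2 - 5 * lattice_sum 4 w 0"
  using weierstrass_p_second_order half_basis_notin(1)[of w] lattice_sum_eq_eis_full[of w "fst w / 2" 4] by (simp add: half_value_1_def)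

lemma g_s_eq:
  "g_s 3 = on_oriented_bases (\<lambda>w. 15 / 4 * lattice_sum 4 w 0)"
  "g_s 4 = on_oriented_bases (\<lambda>w. 3 / 2 * half_value_1 w)"
  "g_s 6 = on_oriented_bases torsion_slope"
  by (auto simp: g_s_def Let_def half_value_1_def torsion_slope_eq(2) intro: on_oriented_bases_cong)

text \<open>For p = 4 the second order equation turns the lattice sum at \<omega>_0/2 into e1^2 - 5
  G_4; the coefficients then combine to 5/8 + 25/8 = 15/4 and 5/32 - 5/8 = -15/32.\<close>

lemma g_l_eq:
  "g_l 3 = on_oriented_bases (\<lambda>w. 35 / 16 * lattice_sum 6 w 0)"
  "g_l 4 = on_oriented_bases (\<lambda>w. 15 / 4 * lattice_sum 4 w 0 - 15 / 32 * half_value_1 w ^ 2)"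
  "g_l 6 = on_oriented_bases (\<lambda>w. 2 * torsion_slope w ^ 3 - torsion_sum w)"
proof -
  show "g_l 3 = on_oriented_bases (\<lambda>w. 35 / 16 * lattice_sum 6 w 0)"
    by (simp add: g_l_def)
  show "g_l 4 = on_oriented_bases (\<lambda>w. 15 / 4 * lattice_sum 4 w 0 - 15 / 32 * half_value_1 w ^ 2)"
    unfolding g_l_def
    by (rule on_oriented_bases_cong) (simp add: Let_def lattice_sum_4_half field_simps flip: half_value_1_def)
  show "g_l 6 = on_oriented_bases (\<lambda>w. 2 * torsion_slope w ^ 3 - torsion_sum w)"
    unfolding g_l_def g_s_eq
    by (rule on_oriented_bases_cong) (simp add: Let_def torsion_sum_def on_oriented_bases_def)
qed

lemma modular_forms_generators:
  assumes p: "p \<in> {3, 4, 6}" and f: "f \<in> modular_forms (p div 2) k"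
  shows "on_oriented_bases (homogenize k f) \<in> generated_algebra {g_s p, g_l p}"
proof -
  have gen: "g_s p \<in> generated_algebra {g_s p, g_l p}" "g_l p \<in> generated_algebra {g_s p, g_l p}"
    by (auto intro: generated_algebra.gen)
  from p consider "p = 3" | "p = 4" | "p = 6" by blast
  then show ?thesis
  proof cases
    case 1
    show ?thesis
    proof (rule modular_forms_1_generated)
      show "on_oriented_bases (\<lambda>w. lattice_sum 4 w 0) \<in> generated_algebra {g_s p, g_l p}"
        using on_oriented_bases_cmult[OF gen(1)[unfolded 1 g_s_eq], of "4 / 15"] by (simp add: 1 g_s_eq)
      show "on_oriented_bases (\<lambda>w. lattice_sum 6 w 0) \<in> generated_algebra {g_s p, g_l p}"
        using on_oriented_bases_cmult[OF gen(2)[unfolded 1 g_l_eq], of "16 / 35"] by (simp add: 1 g_l_eq)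
    qed (use f 1 in simp)
  next
    case 2
    show ?thesis
    proof (rule modular_forms_2_generated)
      show x: "on_oriented_bases half_value_1 \<in> generated_algebra {g_s p, g_l p}"
        using on_oriented_bases_cmult[OF gen(1)[unfolded 2 g_s_eq], of "2 / 3"] by (simp add: 2 g_s_eq)
      have y: "on_oriented_bases (\<lambda>w. 15 / 4 * lattice_sum 4 w 0 - 15 / 32 * half_value_1 w ^ 2) \<in> generated_algebra {g_s p, g_l p}"
        using gen(2) by (simp add: 2 g_l_eq)
      \<comment> \<open>Solves \<open>g_l\<close> for \<open>half_form\<close>: 16 times 15/4 is 60,
        and -15/2 + 9/2 = -3.\<close>
      have "on_oriented_bases (\<lambda>w. 16 * (15 / 4 * lattice_sum 4 w 0 - 15 / 32 * half_value_1 w ^ 2) + 9 / 2 * half_value_1 w ^ 2) \<in> generated_algebra {g_s p, g_l p}"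
        by (intro on_oriented_bases_add on_oriented_bases_cmult on_oriented_bases_power x y)
      then show "on_oriented_bases half_form \<in> generated_algebra {g_s p, g_l p}"
        by (simp add: half_form_def[abs_def] algebra_simps)
    qed (use f 2 in simp)
  next
    case 3
    show ?thesis
    proof (rule modular_forms_3_generated)
      show x: "on_oriented_bases torsion_slope \<in> generated_algebra {g_s p, g_l p}"
        using gen(1) by (simp add: 3 g_s_eq)
      have y: "on_oriented_bases (\<lambda>w. 2 * torsion_slope w ^ 3 - torsion_sum w) \<in> generated_algebra {g_s p, g_l p}"
        using gen(2) by (simp add: 3 g_l_eq)
      have "on_oriented_bases (\<lambda>w. 2 * (2 * torsion_slope w ^ 3 - torsion_sum w) + 4 * torsion_slope w ^ 3) \<in> generated_algebra {g_s p, g_l p}"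
        by (intro on_oriented_bases_add on_oriented_bases_cmult on_oriented_bases_power x y)
      then show "on_oriented_bases torsion_form \<in> generated_algebra {g_s p, g_l p}"
        by (simp add: torsion_form_def[abs_def] algebra_simps)
    qed (use f 3 in simp)
  qed
qed

lemma eisenstein_series_modular:
  assumes p: "p \<in> {3, 4, 6}" and F: "F \<in> eisenstein_series p"
  obtains k f where "f \<in> modular_forms (p div 2) k" "F = on_oriented_bases (homogenize k f)"
proof -
  have N: "p div 2 \<in> {1, 2, 3}" using p by auto
  obtain n where "F = on_oriented_bases (\<lambda>w. fls_nth (laurent_expansion (eis_X p w) 0) n) \<or>
      F = on_oriented_bases (\<lambda>w. fls_nth (laurent_expansion (eis_Y p w) 0) n)"
    using F by (auto simp: eisenstein_series_def)
  then obtain k G where G: "lattice_modular (p div 2) k G" "F = on_oriented_bases G"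
    using eis_XY_nth_modular[OF p, of n] unfolding modular_coeff_def
    by (metis (mono_tags, lifting) on_oriented_bases_cong)
  show ?thesis
  proof (rule that)
    show "dehomogenize G \<in> modular_forms (p div 2) k" by (rule lattice_modular_form[OF N G(1)])
    show "F = on_oriented_bases (homogenize k (dehomogenize G))"
      unfolding G(2) by (rule on_oriented_bases_cong) (simp add: lattice_modular_homogenize[OF G(1)])
  qed
qed

text \<open>Coefficients of X suffice: those of order 2 and 4 for p = 3, of order 1 and 3 for p = 4,
  and of order 0 and 2 for p = 6.\<close>

lemma generators_in_eisenstein_algebra:
  assumes p: "p \<in> {3, 4, 6}"
  shows "{g_s p, g_l p} \<subseteq> generated_algebra (eisenstein_series p)"
proof -
  have X: "on_oriented_bases (\<lambda>w. fls_nth (laurent_expansion (eis_X p w) 0) n) \<in> generated_algebra (eisenstein_series p)" for n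
    by (rule generated_algebra.gen) (auto simp: eisenstein_series_def)
  have X': "on_oriented_bases G \<in> generated_algebra (eisenstein_series p)"
    if "\<And>w. w \<in> oriented_bases \<Longrightarrow> fls_nth (laurent_expansion (eis_X p w) 0) n = G w" for n G
    using X[of n] on_oriented_bases_cong[OF that] by simp
  note coeff = eis_XY_coeffs[THEN has_laurent_coeffsD]
  note defs = coeff_origin_def coeff_shift_def eis_value_def
  from p consider "p = 3" | "p = 4" | "p = 6" by blast
  then show ?thesis
  proof cases
    case 1
    have "on_oriented_bases (\<lambda>w. 3 / 4 * lattice_sum 4 w 0) \<in> generated_algebra (eisenstein_series p)"
      by (rule X'[of 2]) (simp add: 1 coeff(1) defs)
    from on_oriented_bases_cmult[OF this, of 5]
    have s: "g_s p \<in> generated_algebra (eisenstein_series p)" by (simp add: 1 g_s_eq)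
    have "on_oriented_bases (\<lambda>w. 5 / 4 * lattice_sum 6 w 0) \<in> generated_algebra (eisenstein_series p)"
      by (rule X'[of 4]) (simp add: 1 coeff(1) defs)
    from on_oriented_bases_cmult[OF this, of "7 / 4"]
    have l: "g_l p \<in> generated_algebra (eisenstein_series p)" by (simp add: 1 g_l_eq)
    from s l show ?thesis by simp
  next
    case 2
    have t: "torsion_value 2 2 w = half_value_1 w" "torsion_value 2 4 w = half_value_1 w ^ 2 - 5 * lattice_sum 4 w 0"
      if "w \<in> oriented_bases" for w
      using torsion_value_eq(2,3)[OF that, of 2] lattice_sum_4_half[OF that] by (simp_all add: half_value_1_def)
    have x: "on_oriented_bases (\<lambda>w. 1 / 2 * half_value_1 w) \<in> generated_algebra (eisenstein_series p)"
      by (rule X'[of 1]) (use t(1) in \<open>simp add: 2 coeff(3) defs torsion_value_def numeral_2_eq_2\<close>)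
    from on_oriented_bases_cmult[OF this, of 3]
    have s: "g_s p \<in> generated_algebra (eisenstein_series p)" by (simp add: 2 g_s_eq)
    have y: "on_oriented_bases (\<lambda>w. 1 / 2 * (half_value_1 w ^ 2 - 6 * lattice_sum 4 w 0)) \<in> generated_algebra (eisenstein_series p)"
      by (rule X'[of 3]) (simp add: 2 coeff(3) defs t(2)[unfolded torsion_value_def, simplified] algebra_simps)
    \<comment> \<open>The factor -5/4 turns -3 G_4 into 15/4 G_4; the square corrects -5/8 e1^2 to
      -15/32 e1^2.\<close>
    have "on_oriented_bases (\<lambda>w. - 5 / 4 * (1 / 2 * (half_value_1 w ^ 2 - 6 * lattice_sum 4 w 0)) + 5 / 8 * (1 / 2 * half_value_1 w) ^ 2) \<in> generated_algebra (eisenstein_series p)"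
      by (intro on_oriented_bases_add on_oriented_bases_cmult on_oriented_bases_power x y)
    then have "g_l p \<in> generated_algebra (eisenstein_series p)"
      by (simp add: 2 g_l_eq power_divide algebra_simps)
    with s show ?thesis by simp
  next
    case 3
    have x: "on_oriented_bases (\<lambda>w. 1 / 2 * torsion_slope w) \<in> generated_algebra (eisenstein_series p)"
      by (rule X'[of 0])
        (simp add: 3 coeff(5) defs eis_func_def weierstrass_zeta_minus torsion_slope_eq(1) field_simps)
    from on_oriented_bases_cmult[OF this, of 2]
    have s: "g_s p \<in> generated_algebra (eisenstein_series p)" by (simp add: 3 g_s_eq)
    have t: "torsion_value 3 3 w = - torsion_sum w" if "w \<in> oriented_bases" for w
      using torsion_value_eq(3)[OF that, of 3 3] by (simp add: torsion_sum_def)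
    have y: "on_oriented_bases (\<lambda>w. 1 / 2 * torsion_sum w) \<in> generated_algebra (eisenstein_series p)"
      by (rule X'[of 2]) (use t in \<open>simp add: 3 coeff(5) defs torsion_value_def lattice_sum_odd numeral_3_eq_3\<close>)
    have "on_oriented_bases (\<lambda>w. 16 * (1 / 2 * torsion_slope w) ^ 3 - 2 * (1 / 2 * torsion_sum w)) \<in> generated_algebra (eisenstein_series p)"
      by (intro on_oriented_bases_diff on_oriented_bases_cmult on_oriented_bases_power x y)
    then have "g_l p \<in> generated_algebra (eisenstein_series p)"
      by (simp add: 3 g_l_eq power_divide)
    with s show ?thesis by simp
  qed
qed

subsection \<open>The isomorphism of graded rings\<close>

text \<open>Multiplied by a power of c, the sum is a polynomial with infinitely many zeros. It
  separates weights, because scaling a basis by c acts on weight k by c^(-k).\<close>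

lemma power_int_sum_eq_0:
  fixes a :: "int \<Rightarrow> complex"
  assumes K: "finite K" and zero: "\<And>c. c \<noteq> 0 \<Longrightarrow> (\<Sum>k\<in>K. c powi (- k) * a k) = 0" and k: "k \<in> K"
  shows "a k = 0"
proof -
  define m where "m = Max K"
  have m: "i \<le> m" if "i \<in> K" for i using K that by (simp add: m_def)
  define P where "P = (\<Sum>i\<in>K. monom (a i) (nat (m - i)))"
  have "poly P c = 0" if c: "c \<noteq> 0" for c
  proof -
    have "poly P c = (\<Sum>i\<in>K. c powi m * (c powi (- i) * a i))" unfolding P_def poly_sum
    proof (rule sum.cong[OF refl])
      fix i assume i: "i \<in> K"
      have "c ^ nat (m - i) = c powi (m - i)" using m[OF i] by (simp add: power_int_def)
      also have "\<dots> = c powi m * c powi (- i)" using c power_int_add[of c m "- i"] by simp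
      finally show "poly (monom (a i) (nat (m - i))) c = c powi m * (c powi (- i) * a i)" by (simp add: poly_monom)
    qed
    also have "\<dots> = 0" using zero[OF c] by (simp flip: sum_distrib_left)
    finally show ?thesis .
  qed
  then have "UNIV - {0} \<subseteq> {c. poly P c = 0}" by blast
  moreover have "infinite (UNIV - {0 :: complex})" using infinite_UNIV_char_0[where 'a = complex] by simp
  ultimately have "P = 0" using poly_roots_finite[of P] finite_subset by blast
  then have "0 = coeff P (nat (m - k))" by simp
  also have "\<dots> = (\<Sum>i\<in>K. if i = k then a i else 0)" unfolding P_def coeff_sum
    by (rule sum.cong[OF refl]) (use m k in \<open>auto simp: eq_nat_nat_iff\<close>)
  also have "\<dots> = a k" using K k by simp
  finally show ?thesis by simp
qed

definition weights :: "(int \<Rightarrow> complex \<Rightarrow> complex) \<Rightarrow> int set" where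
  "weights s = {k. s k \<noteq> (\<lambda>_. 0)}"

lemma modular_to_lattice_eq:
  assumes "finite K" "weights s \<subseteq> K" "w \<in> oriented_bases"
  shows "modular_to_lattice s w = (\<Sum>k\<in>K. homogenize k (s k) w)"
proof -
  have "modular_to_lattice s w = (\<Sum>k\<in>weights s. homogenize k (s k) w)"
    using assms(3) by (simp add: modular_to_lattice_def on_oriented_bases_def weights_def homogenize_def case_prod_beta)
  also have "\<dots> = (\<Sum>k\<in>K. homogenize k (s k) w)"
    using assms by (intro sum.mono_neutral_left) (auto simp: weights_def homogenize_def)
  finally show ?thesis .
qed

lemma modular_to_lattice_off: "w \<notin> oriented_bases \<Longrightarrow> modular_to_lattice s w = 0"
  by (simp add: modular_to_lattice_def on_oriented_bases_def)

lemma modular_to_lattice_scale: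
  assumes K: "finite K" "weights s \<subseteq> K" and w: "w \<in> oriented_bases" and c: "c \<noteq> 0"
  shows "modular_to_lattice s (c * fst w, c * snd w) = (\<Sum>k\<in>K. c powi (- k) * homogenize k (s k) w)"
  using modular_to_lattice_eq[OF K oriented_basis_scale[OF w c]] by (simp add: homogenize_scale[OF c])

lemma carrier_modular_forms_ring:
  "s \<in> carrier (modular_forms_ring N) \<longleftrightarrow> (\<forall>k. s k \<in> modular_forms N k) \<and> finite (weights s)"
  by (simp add: modular_forms_ring_def weights_def)

context
  fixes N :: nat
  assumes N: "N \<in> {1, 2, 3}"
begin

lemma modular_to_lattice_add:
  assumes s: "s \<in> carrier (modular_forms_ring N)" and t: "t \<in> carrier (modular_forms_ring N)"
  shows "s \<oplus>\<^bsub>modular_forms_ring N\<^esub> t \<in> carrier (modular_forms_ring N)"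
    and "modular_to_lattice (s \<oplus>\<^bsub>modular_forms_ring N\<^esub> t) = (\<lambda>w. modular_to_lattice s w + modular_to_lattice t w)"
proof -
  have add: "s \<oplus>\<^bsub>modular_forms_ring N\<^esub> t = (\<lambda>k \<tau>. s k \<tau> + t k \<tau>)" by (simp add: modular_forms_ring_def)
  have K: "finite (weights s \<union> weights t)" using s t by (simp add: carrier_modular_forms_ring)
  have sub: "weights (\<lambda>k \<tau>. s k \<tau> + t k \<tau>) \<subseteq> weights s \<union> weights t" by (auto simp: weights_def)
  show "s \<oplus>\<^bsub>modular_forms_ring N\<^esub> t \<in> carrier (modular_forms_ring N)"
    unfolding add using s t finite_subset[OF sub K] by (auto simp: carrier_modular_forms_ring intro: modular_forms_add[OF N])
  show "modular_to_lattice (s \<oplus>\<^bsub>modular_forms_ring N\<^esub> t) = (\<lambda>w. modular_to_lattice s w + modular_to_lattice t w)"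
  proof
    fix w show "modular_to_lattice (s \<oplus>\<^bsub>modular_forms_ring N\<^esub> t) w = modular_to_lattice s w + modular_to_lattice t w"
    proof (cases "w \<in> oriented_bases")
      case True
      show ?thesis unfolding add
        by (simp only: modular_to_lattice_eq[OF K sub True] modular_to_lattice_eq[OF K Un_upper1 True]
          modular_to_lattice_eq[OF K Un_upper2 True] homogenize_add sum.distrib)
    qed (simp add: modular_to_lattice_off)
  qed
qed

lemma modular_forms_sum:
  assumes "finite I" "\<And>i. i \<in> I \<Longrightarrow> f i \<in> modular_forms N k"
  shows "(\<lambda>\<tau>. \<Sum>i\<in>I. f i \<tau>) \<in> modular_forms N k"
  using assms by (induction I) (auto intro: zero_modular_form[OF N] modular_forms_add[OF N])

text \<open>The convolution is supported on the sumset \<open>K\<close> of the two sets of weights;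
  exchanging the sums and shifting the index by i recovers the product.\<close>

lemma modular_to_lattice_mult:
  assumes s: "s \<in> carrier (modular_forms_ring N)" and t: "t \<in> carrier (modular_forms_ring N)"
  shows "s \<otimes>\<^bsub>modular_forms_ring N\<^esub> t \<in> carrier (modular_forms_ring N)"
    and "modular_to_lattice (s \<otimes>\<^bsub>modular_forms_ring N\<^esub> t) = (\<lambda>w. modular_to_lattice s w * modular_to_lattice t w)"
proof -
  define p where "p = (\<lambda>k \<tau>. \<Sum>i\<in>weights s. s i \<tau> * t (k - i) \<tau>)"
  have mult: "s \<otimes>\<^bsub>modular_forms_ring N\<^esub> t = p" by (simp add: modular_forms_ring_def p_def weights_def)
  have fin: "finite (weights s)" "finite (weights t)" using s t by (simp_all add: carrier_modular_forms_ring)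
  define K where "K = (\<lambda>(i, j). i + j) ` (weights s \<times> weights t)"
  have K: "finite K" using fin by (simp add: K_def)
  have sub: "weights p \<subseteq> K"
  proof
    fix k assume "k \<in> weights p"
    then obtain \<tau> where "p k \<tau> \<noteq> 0" by (auto simp: weights_def fun_eq_iff)
    then obtain i where i: "i \<in> weights s" "s i \<tau> * t (k - i) \<tau> \<noteq> 0"
      unfolding p_def by (meson sum.neutral)
    then have "k - i \<in> weights t" by (auto simp: weights_def fun_eq_iff)
    then show "k \<in> K" using i(1) by (force simp: K_def intro: image_eqI[of _ _ "(i, k - i)"])
  qed
  have "p k \<in> modular_forms N k" for k
  proof -
    have "(\<lambda>\<tau>. s i \<tau> * t (k - i) \<tau>) \<in> modular_forms N k" for i
      using modular_forms_mult[OF N, of "s i" i "t (k - i)" "k - i"] s t by (simp add: carrier_modular_forms_ring)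
    then show ?thesis unfolding p_def by (intro modular_forms_sum fin)
  qed
  then show "s \<otimes>\<^bsub>modular_forms_ring N\<^esub> t \<in> carrier (modular_forms_ring N)"
    unfolding mult carrier_modular_forms_ring using finite_subset[OF sub K] by blast
  show "modular_to_lattice (s \<otimes>\<^bsub>modular_forms_ring N\<^esub> t) = (\<lambda>w. modular_to_lattice s w * modular_to_lattice t w)"
  proof
    fix w show "modular_to_lattice (s \<otimes>\<^bsub>modular_forms_ring N\<^esub> t) w = modular_to_lattice s w * modular_to_lattice t w"
    proof (cases "w \<in> oriented_bases")
      case True
      have hom: "homogenize k (p k) w = (\<Sum>i\<in>weights s. homogenize i (s i) w * homogenize (k - i) (t (k - i)) w)" for k
      proof -
        have "homogenize k (p k) w = (\<Sum>i\<in>weights s. homogenize (i + (k - i)) (\<lambda>\<tau>. s i \<tau> * t (k - i) \<tau>) w)"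
          by (simp add: homogenize_def p_def sum_distrib_left)
        then show ?thesis unfolding homogenize_mult[OF oriented_basis_fst[OF True]] .
      qed
      have shift: "(\<Sum>k\<in>K. homogenize (k - i) (t (k - i)) w) = modular_to_lattice t w" if i: "i \<in> weights s" for i
      proof -
        have "(\<Sum>k\<in>K. homogenize (k - i) (t (k - i)) w) = (\<Sum>j\<in>(\<lambda>k. k - i) ` K. homogenize j (t j) w)"
          by (subst sum.reindex) (auto simp: inj_on_def)
        also have "\<dots> = modular_to_lattice t w"
        proof (rule modular_to_lattice_eq[OF _ _ True, symmetric])
          show "weights t \<subseteq> (\<lambda>k. k - i) ` K"
          proof
            fix j assume "j \<in> weights t"
            then have "i + j \<in> K" using i by (force simp: K_def)
            then show "j \<in> (\<lambda>k. k - i) ` K" by (intro image_eqI[of _ _ "i + j"]) auto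
          qed
        qed (use K in simp)
        finally show ?thesis .
      qed
      have "modular_to_lattice p w = (\<Sum>i\<in>weights s. \<Sum>k\<in>K. homogenize i (s i) w * homogenize (k - i) (t (k - i)) w)"
        unfolding modular_to_lattice_eq[OF K sub True] hom by (rule sum.swap)
      also have "\<dots> = (\<Sum>i\<in>weights s. homogenize i (s i) w * modular_to_lattice t w)"
        by (intro sum.cong[OF refl]) (simp add: shift flip: sum_distrib_left)
      also have "\<dots> = modular_to_lattice s w * modular_to_lattice t w"
        unfolding modular_to_lattice_eq[OF fin(1) subset_refl True] by (simp add: sum_distrib_right)
      finally show ?thesis unfolding mult .
    qed (simp add: modular_to_lattice_off)
  qed
qed

lemma modular_to_lattice_single:
  assumes f: "f \<in> modular_forms N k"
  shows "(\<lambda>_ _. 0)(k := f) \<in> modular_forms_part N k"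
    and "modular_to_lattice ((\<lambda>_ _. 0)(k := f)) = on_oriented_bases (homogenize k f)"
proof -
  have sub: "weights ((\<lambda>_ _. 0)(k := f)) \<subseteq> {k}" by (auto simp: weights_def)
  show "(\<lambda>_ _. 0)(k := f) \<in> modular_forms_part N k"
    unfolding modular_forms_part_def mem_Collect_eq carrier_modular_forms_ring
    using f finite_subset[OF sub] zero_modular_form[OF N] by auto
  show "modular_to_lattice ((\<lambda>_ _. 0)(k := f)) = on_oriented_bases (homogenize k f)"
    using modular_to_lattice_eq[OF _ sub] by (auto simp: fun_eq_iff on_oriented_bases_def modular_to_lattice_off)
qed

lemma modular_to_lattice_one: "modular_to_lattice \<one>\<^bsub>modular_forms_ring N\<^esub> = on_oriented_bases (\<lambda>_. 1)"
proof -
  have one: "\<one>\<^bsub>modular_forms_ring N\<^esub> = (\<lambda>_ _. 0)(0 := \<lambda>\<tau>. if \<tau> \<in> upper_half_plane then 1 else 0)"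
    by (auto simp: modular_forms_ring_def fun_eq_iff)
  show ?thesis unfolding one modular_to_lattice_single(2)[OF one_modular_form[OF N]]
    by (rule on_oriented_bases_cong) (simp add: homogenize_def oriented_basis_quotient)
qed

lemma homogenize_eq_0_imp:
  assumes f: "f \<in> modular_forms N k" and zero: "\<And>\<tau>. \<tau> \<in> upper_half_plane \<Longrightarrow> homogenize k f (1, \<tau>) = 0"
  shows "f = (\<lambda>_. 0)"
proof
  fix \<tau> show "f \<tau> = 0"
    using zero[of \<tau>] modular_forms_imp(4)[OF N f, of \<tau>] by (cases "\<tau> \<in> upper_half_plane") (simp_all add: homogenize_def)
qed

text \<open>Scaling the basis turns equality of the images into a vanishing Laurent polynomial in c
  whose coefficients are the differences in each weight; a form is recovered from its values at the
  bases (1, \<tau>).\<close>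

lemma modular_to_lattice_inj: "inj_on modular_to_lattice (carrier (modular_forms_ring N))"
proof (rule inj_onI)
  fix s t assume s: "s \<in> carrier (modular_forms_ring N)" and t: "t \<in> carrier (modular_forms_ring N)"
    and eq: "modular_to_lattice s = modular_to_lattice t"
  define K where "K = weights s \<union> weights t"
  have K: "finite K" "weights s \<subseteq> K" "weights t \<subseteq> K" using s t by (auto simp: K_def carrier_modular_forms_ring)
  have "s k = t k" for k
  proof (cases "k \<in> K")
    case True
    have "(\<lambda>\<tau>. s k \<tau> - t k \<tau>) = (\<lambda>_. 0)"
    proof (rule homogenize_eq_0_imp)
      show "(\<lambda>\<tau>. s k \<tau> - t k \<tau>) \<in> modular_forms N k"
        using s t by (auto simp: carrier_modular_forms_ring intro: modular_forms_diff[OF N])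
      fix \<tau> assume "\<tau> \<in> upper_half_plane"
      then have w: "(1, \<tau>) \<in> oriented_bases" by simp
      have "homogenize k (s k) (1, \<tau>) - homogenize k (t k) (1, \<tau>) = 0"
      proof (rule power_int_sum_eq_0[OF K(1) _ True, where a = "\<lambda>k. homogenize k (s k) (1, \<tau>) - homogenize k (t k) (1, \<tau>)"])
        fix c :: complex assume c: "c \<noteq> 0"
        show "(\<Sum>k\<in>K. c powi (- k) * (homogenize k (s k) (1, \<tau>) - homogenize k (t k) (1, \<tau>))) = 0"
          using modular_to_lattice_scale[OF K(1,2) w c] modular_to_lattice_scale[OF K(1,3) w c] eq
          by (simp add: right_diff_distrib sum_subtractf)
      qed
      then show "homogenize k (\<lambda>\<tau>. s k \<tau> - t k \<tau>) (1, \<tau>) = 0" by (simp add: homogenize_def)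
    qed
    then show ?thesis by (simp add: fun_eq_iff)
  qed (auto simp: K_def weights_def)
  then show "s = t" by blast
qed

text \<open>The image has one expansion in powers of c by weights and another as a single power.
  Subtracting the value of the image at index k leaves a vanishing Laurent polynomial, so all other
  weights are zero.\<close>

lemma modular_to_lattice_homogeneous:
  assumes s: "s \<in> carrier (modular_forms_ring N)"
    and hom: "\<And>c w. c \<noteq> 0 \<Longrightarrow> w \<in> oriented_bases \<Longrightarrow>
      modular_to_lattice s (c * fst w, c * snd w) = c powi (- k) * modular_to_lattice s w"
  shows "s \<in> modular_forms_part N k"
proof -
  \<comment> \<open>The index \<open>k\<close> is included because it carries the subtracted value,
    even if \<open>s\<close> has no part of weight k.\<close>
  define K where "K = insert k (weights s)"
  have K: "finite K" "weights s \<subseteq> K" "k \<in> K" using s by (auto simp: K_def carrier_modular_forms_ring)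
  have "s i = (\<lambda>_. 0)" if i: "i \<noteq> k" for i
  proof (cases "i \<in> K")
    case True
    show ?thesis
    proof (rule homogenize_eq_0_imp)
      show "s i \<in> modular_forms N i" using s by (simp add: carrier_modular_forms_ring)
      fix \<tau> assume "\<tau> \<in> upper_half_plane"
      then have w: "(1, \<tau>) \<in> oriented_bases" by simp
      define a where "a j = homogenize j (s j) (1, \<tau>)" for j
      have "a i - (if i = k then modular_to_lattice s (1, \<tau>) else 0) = 0"
      proof (rule power_int_sum_eq_0[OF K(1) _ True, where a = "\<lambda>j. a j - (if j = k then modular_to_lattice s (1, \<tau>) else 0)"])
        fix c :: complex assume c: "c \<noteq> 0"
        have "(\<Sum>j\<in>K. c powi (- j) * a j) = c powi (- k) * modular_to_lattice s (1, \<tau>)"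
          using modular_to_lattice_scale[OF K(1,2) w c] hom[OF c w] by (simp add: a_def)
        also have "\<dots> = (\<Sum>j\<in>K. c powi (- j) * (if j = k then modular_to_lattice s (1, \<tau>) else 0))"
          using K(1,3) by (simp add: if_distrib cong: if_cong)
        finally show "(\<Sum>j\<in>K. c powi (- j) * (a j - (if j = k then modular_to_lattice s (1, \<tau>) else 0))) = 0"
          by (simp add: right_diff_distrib sum_subtractf)
      qed
      then show "homogenize i (s i) (1, \<tau>) = 0" using i by (simp add: a_def)
    qed
  qed (auto simp: K_def weights_def)
  then show ?thesis using s by (simp add: modular_forms_part_def)
qed

end

context
  fixes p :: nat
  assumes p: "p \<in> {3, 4, 6}"
begin

lemma p_div_2: "p div 2 \<in> {1, 2, 3}"
  using p by auto

text \<open>One inclusion is explicit in low coefficients of X. For the other, a coefficient of any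
  order is a modular form, and such a form is a polynomial in the generators.\<close>

lemma eisenstein_series_generators: "generated_algebra {g_s p, g_l p} = generated_algebra (eisenstein_series p)"
proof
  show "generated_algebra {g_s p, g_l p} \<subseteq> generated_algebra (eisenstein_series p)"
    by (intro generated_algebra_mono generators_in_eisenstein_algebra p)
  show "generated_algebra (eisenstein_series p) \<subseteq> generated_algebra {g_s p, g_l p}"
  proof (rule generated_algebra_mono, rule subsetI)
    fix F assume "F \<in> eisenstein_series p"
    then show "F \<in> generated_algebra {g_s p, g_l p}"
      by (rule eisenstein_series_modular[OF p]) (simp add: modular_forms_generators[OF p])
  qed
qed

text \<open>Forms land in the algebra because they are polynomials in the generators; conversely the
  image contains the Eisenstein series and the constants and is closed under sums and
  products.\<close>

lemma modular_to_lattice_image: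
  "modular_to_lattice ` carrier (modular_forms_ring (p div 2)) = generated_algebra (eisenstein_series p)"
proof
  show "modular_to_lattice ` carrier (modular_forms_ring (p div 2)) \<subseteq> generated_algebra (eisenstein_series p)"
  proof (rule image_subsetI)
    fix s assume s: "s \<in> carrier (modular_forms_ring (p div 2))"
    then have fin: "finite (weights s)" by (simp add: carrier_modular_forms_ring)
    have "on_oriented_bases (\<lambda>w. \<Sum>k\<in>K. homogenize k (s k) w) \<in> generated_algebra {g_s p, g_l p}" if "finite K" for K
      using that
    proof (induction K)
      case empty
      then show ?case using on_oriented_bases_const[of 0] by simp
    next
      case (insert k K)
      have "s k \<in> modular_forms (p div 2) k" using s by (simp add: carrier_modular_forms_ring)
      from on_oriented_bases_add[OF modular_forms_generators[OF p this] insert.IH] insert.hyps show ?case by simp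
    qed
    moreover have "modular_to_lattice s = on_oriented_bases (\<lambda>w. \<Sum>k\<in>weights s. homogenize k (s k) w)"
      using modular_to_lattice_eq[OF fin subset_refl] by (auto simp: fun_eq_iff on_oriented_bases_def modular_to_lattice_off)
    ultimately show "modular_to_lattice s \<in> generated_algebra (eisenstein_series p)"
      using fin by (simp add: eisenstein_series_generators)
  qed
  have single: "on_oriented_bases (homogenize k f) \<in> modular_to_lattice ` carrier (modular_forms_ring (p div 2))"
    if "f \<in> modular_forms (p div 2) k" for k f
    unfolding modular_to_lattice_single(2)[OF p_div_2 that, symmetric]
    using modular_to_lattice_single(1)[OF p_div_2 that] unfolding modular_forms_part_def by blast
  show "generated_algebra (eisenstein_series p) \<subseteq> modular_to_lattice ` carrier (modular_forms_ring (p div 2))"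
  proof
    fix F assume "F \<in> generated_algebra (eisenstein_series p)"
    then show "F \<in> modular_to_lattice ` carrier (modular_forms_ring (p div 2))"
    proof induction
      case (gen F)
      then show ?case by (rule eisenstein_series_modular[OF p]) (simp add: single)
    next
      case (const c)
      have "on_oriented_bases (homogenize 0 (dehomogenize (\<lambda>_. c))) = on_oriented_bases (\<lambda>_. c)"
        by (rule on_oriented_bases_cong) (rule lattice_modular_homogenize[OF lattice_modular_const])
      then show ?case using single[OF lattice_modular_form[OF p_div_2 lattice_modular_const, of c]] by simp
    next
      case (add F G)
      then obtain s t where st: "s \<in> carrier (modular_forms_ring (p div 2))" "F = modular_to_lattice s"
        "t \<in> carrier (modular_forms_ring (p div 2))" "G = modular_to_lattice t" by blast
      show ?case
        using imageI[OF modular_to_lattice_add(1)[OF p_div_2 st(1,3)], of modular_to_lattice]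
        unfolding modular_to_lattice_add(2)[OF p_div_2 st(1,3)] st(2,4) .
    next
      case (mult F G)
      then obtain s t where st: "s \<in> carrier (modular_forms_ring (p div 2))" "F = modular_to_lattice s"
        "t \<in> carrier (modular_forms_ring (p div 2))" "G = modular_to_lattice t" by blast
      show ?case
        using imageI[OF modular_to_lattice_mult(1)[OF p_div_2 st(1,3)], of modular_to_lattice]
        unfolding modular_to_lattice_mult(2)[OF p_div_2 st(1,3)] st(2,4) .
    qed
  qed
qed

lemma modular_to_lattice_graded_ring_iso:
  "graded_ring_iso (modular_forms_ring (p div 2)) (modular_forms_part (p div 2))
     (eisenstein_ring p) (eisenstein_part p) modular_to_lattice"
  unfolding graded_ring_iso_def
proof (intro conjI allI)
  have "modular_to_lattice \<in> ring_hom (modular_forms_ring (p div 2)) (eisenstein_ring p)"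
    using modular_to_lattice_image modular_to_lattice_mult(2)[OF p_div_2] modular_to_lattice_add(2)[OF p_div_2] modular_to_lattice_one[OF p_div_2]
    by (auto simp: ring_hom_def eisenstein_ring_def)
  moreover have "bij_betw modular_to_lattice (carrier (modular_forms_ring (p div 2))) (carrier (eisenstein_ring p))"
    using modular_to_lattice_inj[OF p_div_2] modular_to_lattice_image by (simp add: bij_betw_def eisenstein_ring_def)
  ultimately show "modular_to_lattice \<in> ring_iso (modular_forms_ring (p div 2)) (eisenstein_ring p)"
    by (simp add: ring_iso_def)
  fix k
  show "modular_to_lattice ` modular_forms_part (p div 2) k = eisenstein_part p k"
  proof
    show "modular_to_lattice ` modular_forms_part (p div 2) k \<subseteq> eisenstein_part p k"
    proof (rule image_subsetI)
      fix s assume "s \<in> modular_forms_part (p div 2) k"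
      then have s: "s \<in> carrier (modular_forms_ring (p div 2))" "weights s \<subseteq> {k}"
        by (auto simp: modular_forms_part_def weights_def)
      have K: "finite {k}" by simp
      have "modular_to_lattice s (c * \<omega>0, c * \<omega>1) = c powi (- k) * modular_to_lattice s (\<omega>0, \<omega>1)"
        if "c \<noteq> 0" "(\<omega>0, \<omega>1) \<in> oriented_bases" for c \<omega>0 \<omega>1
        using modular_to_lattice_scale[OF K s(2) that(2,1)] modular_to_lattice_eq[OF K s(2) that(2)] by simp
      then show "modular_to_lattice s \<in> eisenstein_part p k"
        using modular_to_lattice_image s(1) by (auto simp: eisenstein_part_def eisenstein_ring_def)
    qed
    show "eisenstein_part p k \<subseteq> modular_to_lattice ` modular_forms_part (p div 2) k"
    proof
      fix F assume F: "F \<in> eisenstein_part p k"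
      then have "F \<in> generated_algebra (eisenstein_series p)" by (simp add: eisenstein_part_def eisenstein_ring_def)
      then obtain s where s: "s \<in> carrier (modular_forms_ring (p div 2))" "F = modular_to_lattice s"
        unfolding modular_to_lattice_image[symmetric] by blast
      have "s \<in> modular_forms_part (p div 2) k"
        by (rule modular_to_lattice_homogeneous[OF p_div_2 s(1)])
           (use F in \<open>auto simp: eisenstein_part_def s(2) case_prod_beta\<close>)
      then show "F \<in> modular_to_lattice ` modular_forms_part (p div 2) k" using s(2) by blast
    qed
  qed
qed

end

theorem theorem10p1:
  fixes p N :: nat
  assumes "p \<in> {3, 4, 6}" and "N = p div 2"
  shows
    "graded_ring_iso (modular_forms_ring N) (modular_forms_part N)
       (eisenstein_ring p) (eisenstein_part p) modular_to_lattice
     \<and> generated_algebra {g_s p, g_l p} = carrier (eisenstein_ring p)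
     \<and> (p = 3 \<longrightarrow> (\<forall>\<omega>0 \<omega>1. (\<omega>0, \<omega>1) \<in> oriented_bases \<longrightarrow>
          g_s p (\<omega>0, \<omega>1) = 1 / (2 ^ 2 * 3) * of_real pi ^ 4 * e4 (\<omega>1 / \<omega>0) * \<omega>0 powi (-4)
        \<and> g_l p (\<omega>0, \<omega>1) = 1 / (2 ^ 3 * 3 ^ 3) * of_real pi ^ 6 * e6 (\<omega>1 / \<omega>0) * \<omega>0 powi (-6)))
     \<and> (p = 4 \<longrightarrow> (\<forall>\<omega>0 \<omega>1. (\<omega>0, \<omega>1) \<in> oriented_bases \<longrightarrow>
          g_s p (\<omega>0, \<omega>1) = of_real pi ^ 2 * alpha2 (\<omega>1 / \<omega>0) * \<omega>0 powi (-2)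
        \<and> g_l p (\<omega>0, \<omega>1) = 2 ^ 4 * of_real pi ^ 4 * beta4 (\<omega>1 / \<omega>0) * \<omega>0 powi (-4)
            - 1 / 2 ^ 3 * of_real pi ^ 4 * (alpha2 (\<omega>1 / \<omega>0) * \<omega>0 powi (-2)) ^ 2))
     \<and> (p = 6 \<longrightarrow> (\<forall>\<omega>0 \<omega>1. (\<omega>0, \<omega>1) \<in> oriented_bases \<longrightarrow>
          g_s p (\<omega>0, \<omega>1) = 1 / of_real (sqrt 3) * of_real pi * alpha1 (\<omega>1 / \<omega>0) * \<omega>0 powi (-1)
        \<and> g_l p (\<omega>0, \<omega>1) = - 2 / (3 * of_real (sqrt 3)) * of_real pi ^ 3
            * beta3 (\<omega>1 / \<omega>0) * \<omega>0 powi (-3)))"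
proof (intro conjI impI allI)
  show "graded_ring_iso (modular_forms_ring N) (modular_forms_part N)
      (eisenstein_ring p) (eisenstein_part p) modular_to_lattice"
    unfolding assms(2) by (rule modular_to_lattice_graded_ring_iso[OF assms(1)])
  show "generated_algebra {g_s p, g_l p} = carrier (eisenstein_ring p)"
    using eisenstein_series_generators[OF assms(1)] by (simp add: eisenstein_ring_def)
  fix \<omega>0 \<omega>1 assume w: "(\<omega>0, \<omega>1) \<in> oriented_bases"
  have val: "dehomogenize F (\<omega>1 / \<omega>0) * \<omega>0 powi (- k) = F (\<omega>0, \<omega>1)" if "lattice_modular n k F" for n k F
    using lattice_modular_homogenize[OF that w] by (simp add: homogenize_def mult.commute)
  \<comment> \<open>Rewrites the six forms, with their powers of \<omega>_0, as functions of bases;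
    what remains is a comparison of scalars.\<close>
  note forms = lattice_modular_cusp_forms[THEN val, folded cusp_forms_eq]
  have sq: "of_real (sqrt 3) * of_real (sqrt 3) = (3 :: complex)" by (simp flip: of_real_mult)
  show "g_s p (\<omega>0, \<omega>1) = 1 / (2 ^ 2 * 3) * of_real pi ^ 4 * e4 (\<omega>1 / \<omega>0) * \<omega>0 powi (-4)" if "p = 3"
    unfolding that g_s_eq mult.assoc forms using w by (simp add: on_oriented_bases_def)
  show "g_l p (\<omega>0, \<omega>1) = 1 / (2 ^ 3 * 3 ^ 3) * of_real pi ^ 6 * e6 (\<omega>1 / \<omega>0) * \<omega>0 powi (-6)" if "p = 3"
    unfolding that g_l_eq mult.assoc forms using w by (simp add: on_oriented_bases_def)
  show "g_s p (\<omega>0, \<omega>1) = of_real pi ^ 2 * alpha2 (\<omega>1 / \<omega>0) * \<omega>0 powi (-2)" if "p = 4"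
    unfolding that g_s_eq mult.assoc forms using w by (simp add: on_oriented_bases_def)
  \<comment> \<open>In terms of G_4 and e1 the right-hand side is \<open>half_form\<close>/16 - 9/32
    e1^2 = 15/4 G_4 - 15/32 e1^2.\<close>
  show "g_l p (\<omega>0, \<omega>1) = 2 ^ 4 * of_real pi ^ 4 * beta4 (\<omega>1 / \<omega>0) * \<omega>0 powi (-4)
            - 1 / 2 ^ 3 * of_real pi ^ 4 * (alpha2 (\<omega>1 / \<omega>0) * \<omega>0 powi (-2)) ^ 2" if "p = 4"
    unfolding that g_l_eq mult.assoc forms using w
    by (simp add: on_oriented_bases_def half_form_def power_mult_distrib power_divide field_simps)
  show "g_s p (\<omega>0, \<omega>1) = 1 / of_real (sqrt 3) * of_real pi * alpha1 (\<omega>1 / \<omega>0) * \<omega>0 powi (-1)" if "p = 6"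
    unfolding that g_s_eq mult.assoc forms using w by (simp add: on_oriented_bases_def)
  show "g_l p (\<omega>0, \<omega>1) = - 2 / (3 * of_real (sqrt 3)) * of_real pi ^ 3
            * beta3 (\<omega>1 / \<omega>0) * \<omega>0 powi (-3)" if "p = 6"
    unfolding that g_l_eq mult.assoc forms using w by (simp add: on_oriented_bases_def)
qed

end
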